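(* For every integer $\ell \ge 4$ and every $\tau > 0$ there exist constants $\alpha,\beta \in (0,1)$ and $A, n_0 > 0$ (where $\alpha,\beta,A$ depend only on $\ell$) such that for all $n \ge n_0$ the following holds for the high-girth triple-process on $[n]$ (with parameter $\ell$). With probability at least $1 - n^{-\tau} > 0$, for all $0 \le i \le m_0 := \bigl\lceil (1-n^{-\beta}) n^2/6 \bigr\rceil$, writing $t = i/n^2$, we have $|Q(i)| > 0$ and \begin{align*} |Q(i)| &= \hat q(t) \pm p^{-A} n^{\alpha} (p n^2),\\ |Y_{uv}(i)| &= \hat y(t) \pm p^{-A} n^{\alpha} \quad \text{for all } uv \in E(i),\\ |W_{uvw,F,k}(i)| &= \hat w_{F,k}(t) \pm p^{-A} n^{\alpha} (p^2 n)^{e_F - (2+k)} \quad \text{for all } uvw \in Q(i),\ F \in \mathfrak F,\ 0 \le k \le e_F - 2, \end{align*} where $p = p(t)$ and $x = a \pm b$ means $a - b \le x \le a + b$.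
   Context: Fix $\ell \ge 4$. For a $3$-uniform hypergraph $F$ let $v_F$, $e_F$ denote its numbers of vertices and triples. Let $\mathfrak F^+$ be the collection (up to isomorphism) of all $3$-uniform hypergraphs $F$ with $4 \le v_F \le \ell$ and $e_F = v_F - 2$ that contain no subhypergraph $J \subsetneq F$ with $v_J \ge 4$ and $e_J = v_J - 2$; let $\mathfrak F$ be the subcollection of those $F \in \mathfrak F^+$ with $v_F \ge 6$. High-girth triple-process: $\mathcal H_0$ is the empty $3$-uniform hypergraph on vertex set $[n]$. A triple $xyz$ is available at step $i$ if it intersects every triple of $\mathcal H_i$ in at most one vertex and $\mathcal H_i + xyz$ contains no copy of any hypergraph in $\mathfrak F$. The triple $e_{i+1}$ is chosen uniformly at random among triples available at step $i$ and $\mathcal H_{i+1} := \mathcal H_i + e_{i+1}$; the process stops at the first $\mathcal H_m$ with no available triples. Let $Q(i)$ be the set of triples available at step $i$; $E(i)$ the set of pairs in $\binom{[n]}{2}$ not contained in any triple of $\mathcal H_i$; for $uv \in E(i)$, $Y_{uv}(i) := \{ z \in [n]\setminus\{u,v\} : uvz \in Q(i)\}$. For $F \in \mathfrak F$, let $\mathbf F_F$ be the set of all copies of $F$ in the complete $3$-uniform hypergraph on $[n]$ (sets $F' \subseteq \binom{[n]}{3}$ with $F' \cong F$), and for $uvw \in Q(i)$, $0 \le k \le e_F - 2$, let $W_{uvw,F,k}(i)$ be the set of $F' \in \mathbf F_F$ with $uvw \in F' \cap Q(i)$, $|F' \cap Q(i)| = e_F - k$ and $|F' \cap \mathcal H_i|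 = k$. Trajectories: $p(t) := 1 - 6t$, $q(t) := \exp\bigl\{-\sum_{F \in \mathfrak F} \frac{6 e_F}{|\mathrm{Aut}(F)|} (6t)^{e_F - 1}\bigr\}$ (sum over isomorphism classes, $\mathrm{Aut}(F)$ the automorphism group), $\hat q(t) := p^3 q n^3/6$, $\hat y(t) := p^2 q n$, $\hat w_{F,k}(t) := \frac{6 e_F}{|\mathrm{Aut}(F)|}\binom{e_F - 1}{k}(6t)^k (p^3 q n)^{e_F - 1 - k}$. *)

theory Defs
  imports "HOL-Probability.Probability" "HOL-Combinatorics.Permutations" "HOL-Library.Ramsey"
begin

text \<open>A hypergraph is a pair (vertex set, edge set); isolated vertices are allowed.\<close>

type_synonym hypergraph = "nat set \<times> nat set set"

abbreviation num_verts :: "hypergraph \<Rightarrow> nat" where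
  "num_verts F \<equiv> card (fst F)"

abbreviation num_triples :: "hypergraph \<Rightarrow> nat" where
  "num_triples F \<equiv> card (snd F)"

definition three_uniform :: "hypergraph \<Rightarrow> bool" where
  "three_uniform F \<longleftrightarrow> finite (fst F) \<and> snd F \<subseteq> [fst F]\<^bsup>3\<^esup>"

definition subhypergraph :: "hypergraph \<Rightarrow> hypergraph \<Rightarrow> bool" where
  "subhypergraph J F \<longleftrightarrow> three_uniform J \<and> fst J \<subseteq> fst F \<and> snd J \<subseteq> snd F"

definition hg_iso :: "hypergraph \<Rightarrow> hypergraph \<Rightarrow> bool" where
  "hg_iso F G \<longleftrightarrow> (\<exists>\<phi>. bij_betw \<phi> (fst F) (fst G) \<and> (\<lambda>e. \<phi> ` e) ` snd F = snd G)"

definition hg_aut :: "hypergraph \<Rightarrow> (nat \<Rightarrow> nat) set" where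
  "hg_aut F = {\<pi>. \<pi> permutes fst F \<and> (\<lambda>e. \<pi> ` e) ` snd F = snd F}"

text \<open>
  The labelled members of \<open>\<FF>\<^sup>+\<close>. Every finite hypergraph is isomorphic to one whose vertex set
  is an initial segment of the naturals, so restricting to these loses no isomorphism class.
\<close>

definition labelled_Fplus :: "nat \<Rightarrow> hypergraph set" where
  "labelled_Fplus l = {F. (\<exists>v. fst F = {..<v}) \<and> three_uniform F \<and>
     4 \<le> num_verts F \<and> num_verts F \<le> l \<and> num_triples F = num_verts F - 2 \<and>
     \<not> (\<exists>J. subhypergraph J F \<and> J \<noteq> F \<and> 4 \<le> num_verts J \<and> num_triples J = num_verts J - 2)}"

text \<open>One representative of each isomorphism class, so that sums over \<open>\<FF>\<close> are over classes.\<close>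

definition Fplus :: "nat \<Rightarrow> hypergraph set" where
  "Fplus l = (\<lambda>C. SOME F. F \<in> C) `
     (labelled_Fplus l // {(F, G). F \<in> labelled_Fplus l \<and> G \<in> labelled_Fplus l \<and> hg_iso F G})"

definition Ffam :: "nat \<Rightarrow> hypergraph set" where
  "Ffam l = {F \<in> Fplus l. 6 \<le> num_verts F}"

text \<open>
  A copy is identified with its set of triples. This is harmless because members of \<open>\<FF>\<^sup>+\<close> have no
  isolated vertices: deleting such a vertex and one triple would leave a forbidden \<open>J\<close>.
\<close>

definition is_copy :: "nat set set \<Rightarrow> hypergraph \<Rightarrow> bool" where
  "is_copy F' F \<longleftrightarrow> hg_iso (\<Union>F', F') F"

definition copies :: "nat \<Rightarrow> hypergraph \<Rightarrow> nat set set set" where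
  "copies n F = {F'. F' \<subseteq> [{1..n}]\<^bsup>3\<^esup> \<and> is_copy F' F}"

text \<open>In the following, \<open>H\<close> is the current set of triples of the process.\<close>

definition available :: "nat \<Rightarrow> nat \<Rightarrow> nat set set \<Rightarrow> nat set set" where
  "available l n H = {e \<in> [{1..n}]\<^bsup>3\<^esup>. (\<forall>f\<in>H. card (e \<inter> f) \<le> 1) \<and>
     \<not> (\<exists>F\<in>Ffam l. \<exists>F'\<subseteq>insert e H. is_copy F' F)}"

definition open_pairs :: "nat \<Rightarrow> nat set set \<Rightarrow> nat set set" where
  "open_pairs n H = {d \<in> [{1..n}]\<^bsup>2\<^esup>. \<not> (\<exists>f\<in>H. d \<subseteq> f)}"

definition Yset :: "nat \<Rightarrow> nat \<Rightarrow> nat set set \<Rightarrow> nat \<Rightarrow> nat \<Rightarrow> nat set" where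
  "Yset l n H u v = {z \<in> {1..n} - {u, v}. {u, v, z} \<in> available l n H}"

definition Wset ::
  "nat \<Rightarrow> nat \<Rightarrow> nat set set \<Rightarrow> nat set \<Rightarrow> hypergraph \<Rightarrow> nat \<Rightarrow> nat set set set" where
  "Wset l n H e F k = {F' \<in> copies n F. e \<in> F' \<inter> available l n H \<and>
     card (F' \<inter> available l n H) = num_triples F - k \<and> card (F' \<inter> H) = k}"

text \<open>
  The law of the list of triples chosen in the first \<open>i\<close> steps; once no triple is available the
  list stays unchanged.
\<close>

primrec process_steps :: "nat \<Rightarrow> nat \<Rightarrow> nat \<Rightarrow> nat set list pmf" where
  "process_steps l n 0 = return_pmf []"
| "process_steps l n (Suc i) = bind_pmf (process_steps l n i) (\<lambda>es.
     if available l n (set es) = {} then return_pmf es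
     else map_pmf (\<lambda>e. es @ [e]) (pmf_of_set (available l n (set es))))"

text \<open>
  Every step adds a new triple, so after \<open>n choose 3\<close> steps the process has stopped
  (see \<open>triple_process_stopped\<close>). The hypergraph after \<open>i\<close> steps of a run \<open>es\<close> is
  \<open>set (take i es)\<close>, and it is the final one, with no triple available, if \<open>i \<ge> length es\<close>.
\<close>

definition triple_process :: "nat \<Rightarrow> nat \<Rightarrow> nat set list pmf" where
  "triple_process l n = process_steps l n (n choose 3)"

definition hypergraph_at :: "nat set list \<Rightarrow> nat \<Rightarrow> nat set set" where
  "hypergraph_at es i = set (take i es)"

lemma finite_available: "finite (available l n H)"
  unfolding available_def by (simp add: finite_imp_finite_nsets)

lemma available_not_mem: "e \<in> available l n H \<Longrightarrow> e \<notin> H"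
proof
  assume "e \<in> available l n H" "e \<in> H"
  then have "card (e \<inter> e) \<le> 1" "card e = 3"
    unfolding available_def nsets_def by blast+
  then show False by simp
qed

lemma process_steps_invariant:
  assumes "es \<in> set_pmf (process_steps l n i)"
  shows "distinct es \<and> set es \<subseteq> [{1..n}]\<^bsup>3\<^esup> \<and> (available l n (set es) = {} \<or> length es = i)"
  using assms
proof (induction i arbitrary: es)
  case 0
  then show ?case by simp
next
  case (Suc i)
  then obtain fs where fs: "fs \<in> set_pmf (process_steps l n i)"
    and es: "es \<in> set_pmf (if available l n (set fs) = {} then return_pmf fs
      else map_pmf (\<lambda>e. fs @ [e]) (pmf_of_set (available l n (set fs))))"
    by auto
  show ?case
  proof (cases "available l n (set fs) = {}")
    case True
    then show ?thesis using es Suc.IH[OF fs] by simp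
  next
    case False
    then obtain e where e: "e \<in> available l n (set fs)" "es = fs @ [e]"
      using es by (auto simp: set_pmf_of_set finite_available)
    have "e \<in> [{1..n}]\<^bsup>3\<^esup>" using e(1) by (simp add: available_def)
    then show ?thesis
      using Suc.IH[OF fs] False e available_not_mem[OF e(1)] by simp
  qed
qed

lemma triple_process_stopped:
  assumes "es \<in> set_pmf (triple_process l n)"
  shows "available l n (set es) = {}"
proof (rule ccontr)
  assume ne: "available l n (set es) \<noteq> {}"
  have *: "distinct es" "set es \<subseteq> [{1..n}]\<^bsup>3\<^esup>" "length es = n choose 3"
    using process_steps_invariant[OF assms[unfolded triple_process_def]] ne by auto
  have "card ([{1..n}]\<^bsup>3\<^esup>) = n choose 3" by simp
  then have "set es = [{1..n}]\<^bsup>3\<^esup>"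
    using * by (intro card_subset_eq) (simp_all add: finite_imp_finite_nsets distinct_card)
  moreover have "available l n (set es) \<subseteq> [{1..n}]\<^bsup>3\<^esup>"
    unfolding available_def by blast
  ultimately show False
    using ne available_not_mem by blast
qed

definition traj_p :: "real \<Rightarrow> real" where
  "traj_p t = 1 - 6 * t"

definition traj_q :: "nat \<Rightarrow> real \<Rightarrow> real" where
  "traj_q l t = exp (- (\<Sum>F\<in>Ffam l.
     6 * real (num_triples F) / real (card (hg_aut F)) * (6 * t) ^ (num_triples F - 1)))"

definition Q_hat :: "nat \<Rightarrow> nat \<Rightarrow> real \<Rightarrow> real" where
  "Q_hat l n t = traj_p t ^ 3 * traj_q l t * real n ^ 3 / 6"

definition Y_hat :: "nat \<Rightarrow> nat \<Rightarrow> real \<Rightarrow> real" where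
  "Y_hat l n t = traj_p t ^ 2 * traj_q l t * real n"

definition W_hat :: "nat \<Rightarrow> nat \<Rightarrow> hypergraph \<Rightarrow> nat \<Rightarrow> real \<Rightarrow> real" where
  "W_hat l n F k t =
     6 * real (num_triples F) / real (card (hg_aut F)) * real ((num_triples F - 1) choose k) *
     (6 * t) ^ k * (traj_p t ^ 3 * traj_q l t * real n) ^ (num_triples F - 1 - k)"

definition plus_minus :: "real \<Rightarrow> real \<Rightarrow> real set" (infix \<open>\<plusminus>\<close> 60) where
  "a \<plusminus> b = {a - b..a + b}"

definition m_zero :: "real \<Rightarrow> nat \<Rightarrow> nat" where
  "m_zero \<beta> n = nat \<lceil>(1 - real n powr (-\<beta>)) * real n ^ 2 / 6\<rceil>"

definition tracks :: "nat \<Rightarrow> nat \<Rightarrow> real \<Rightarrow> real \<Rightarrow> nat set list \<Rightarrow> nat \<Rightarrow> bool" where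
  "tracks l n \<alpha> A es i \<longleftrightarrow>
     (let H = hypergraph_at es i; Q = available l n H; t = real i / real n ^ 2; p = traj_p t in
       card Q > 0 \<and>
       real (card Q) \<in> Q_hat l n t \<plusminus> (p powr (-A) * real n powr \<alpha> * (p * real n ^ 2)) \<and>
       (\<forall>u v. {u, v} \<in> open_pairs n H \<longrightarrow>
          real (card (Yset l n H u v)) \<in> Y_hat l n t \<plusminus> (p powr (-A) * real n powr \<alpha>)) \<and>
       (\<forall>e\<in>Q. \<forall>F\<in>Ffam l. \<forall>k\<le>num_triples F - 2.
          real (card (Wset l n H e F k)) \<in> W_hat l n F k t \<plusminus>
            (p powr (-A) * real n powr \<alpha> * (p ^ 2 * real n) ^ (num_triples F - (2 + k)))))"

end

theory Submission
  imports Defs "HOL-Real_Asymp.Real_Asymp"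
begin

text \<open>
  Differential equation method. As every available triple lies over three uncovered pairs, whose
  number is deterministic, \<open>|Q(i)|\<close> is controlled by the numbers \<open>|Y\<^sub>u\<^sub>v(i)|\<close>, so only the latter
  and the \<open>|W|\<close> have to be tracked. A triple \<open>f\<close> is closed by \<open>g\<close> if they share a pair or if together
  they complete a forbidden copy, so the expected one-step changes are determined by the \<open>Y\<close> and
  the \<open>W\<close> with \<open>k = e\<^sub>F - 2\<close>, up to overcounts. Errors feed back at rate \<open>O(1/p)\<close> only, whereas the
  relative growth rate of \<open>p\<^sup>-\<^sup>A\<close> is \<open>6A/p\<close>: for large \<open>A\<close> the deviations minus their
  allowances are supermartingales, and an exponential potential bounds the probability that one
  of them becomes positive.

  The overcounts and the largest one-step changes are numbers of rooted extensions contained in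
  the current hypergraph \<open>H\<close>. While \<open>|Q|\<close> stays large, a set \<open>S\<close> of triples lies in \<open>H\<close> with
  probability at most \<open>n\<close> to the power \<open>- (1 - o(1)) |S|\<close>, so high moments show that an extension
  count exceeds its expectation, maximised over the sub-extensions, by a small power of \<open>n\<close>
  only with tiny probability. The minimality of the members of \<open>\<FF>\<close> makes all counts that
  occur smaller than the main terms by a factor of almost \<open>n\<close>, hence \<open>\<alpha> = 9/10\<close> leaves ample room.
\<close>

section \<open>The process and its potential functions\<close>

text \<open>The argument is threatened by a circle: step bounds need extension counts, extension
  counts need |Q| to be large, and that is part of the claim. The circle is cut at the first
  failure. Every probability estimated below concerns step i of a run whose earlier states were all
  good (\<open>survives\<close>), and these events are then summed over i. All k up to e_F - 2 must
  be tracked because a copy with k triples in H arises from one with k - 1. The scales are integer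
  powers of u = n^(1/100). The allowance n^\<alpha> is u^90, a quantity of order n^m changes by at
  most a constant times n^(m-1) u in one step, and p stays so large that even p^-(A+3) is at most u.
  Extension counts lose the 2^L-th power of the ratio between the true triple probability and 1/n;
  this loss has to stay below u, which forces \<beta> to be of order 1/2^L.\<close>

lemma finite_set_process_steps: "finite (set_pmf (process_steps l n i))"
  by (induction i) (auto simp: finite_available)

lemma length_process_steps:
  "es \<in> set_pmf (process_steps l n i) \<Longrightarrow> length es \<le> i"
proof (induction i arbitrary: es)
  case (Suc i)
  then obtain fs where "fs \<in> set_pmf (process_steps l n i)"
    and "es \<in> set_pmf (if available l n (set fs) = {} then return_pmf fs
      else map_pmf (\<lambda>e. fs @ [e]) (pmf_of_set (available l n (set fs))))"
    by auto
  then show ?case using Suc.IH[of fs] by (auto split: if_splits)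
qed simp

abbreviation pexp :: "nat \<Rightarrow> nat \<Rightarrow> nat \<Rightarrow> (nat set list \<Rightarrow> real) \<Rightarrow> real" where
  "pexp l n i f \<equiv> measure_pmf.expectation (process_steps l n i) f"

definition step_mean :: "nat \<Rightarrow> nat \<Rightarrow> (nat set list \<Rightarrow> real) \<Rightarrow> nat set list \<Rightarrow> real" where
  "step_mean l n f es = (if available l n (set es) = {} then f es
     else (\<Sum>g\<in>available l n (set es). f (es @ [g])) / real (card (available l n (set es))))"

lemma pexp_integrable: "integrable (measure_pmf (process_steps l n i)) (f :: _ \<Rightarrow> real)"
  by (rule integrable_measure_pmf_finite[OF finite_set_process_steps])

lemma pexp_mono:
  assumes "\<And>es. es \<in> set_pmf (process_steps l n i) \<Longrightarrow> f es \<le> g es"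
  shows "pexp l n i f \<le> pexp l n i g"
  by (rule integral_mono_AE) (auto simp: pexp_integrable AE_measure_pmf_iff assms)

lemma pexp_Suc: "pexp l n (Suc i) f = pexp l n i (step_mean l n f)"
proof -
  let ?P = "process_steps l n i"
  let ?g = "\<lambda>es. if available l n (set es) = {} then return_pmf es
      else map_pmf (\<lambda>e. es @ [e]) (pmf_of_set (available l n (set es)))"
  have "pexp l n (Suc i) f = (\<Sum>a\<in>set_pmf ?P. pmf ?P a *\<^sub>R measure_pmf.expectation (?g a) f)"
    unfolding process_steps.simps
    by (rule pmf_expectation_bind) (auto simp: finite_set_process_steps finite_available)
  also have "\<dots> = (\<Sum>a\<in>set_pmf ?P. step_mean l n f a * pmf ?P a)"
    by (rule sum.cong) (auto simp: step_mean_def integral_pmf_of_set finite_available)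
  also have "\<dots> = pexp l n i (step_mean l n f)"
    by (rule integral_measure_pmf_real[symmetric]) (auto simp: finite_set_process_steps)
  finally show ?thesis .
qed

lemma prob_eq_pexp:
  "measure_pmf.prob (process_steps l n i) {es. P es} = pexp l n i (\<lambda>es. of_bool (P es))"
proof -
  have "(\<lambda>es. of_bool (P es)) = (indicat_real {es. P es} :: nat set list \<Rightarrow> real)"
    by (auto simp: indicator_def)
  then show ?thesis by simp
qed

lemma pexp_potential_le:
  assumes step: "\<And>i es. i < m \<Longrightarrow> es \<in> set_pmf (process_steps l n i) \<Longrightarrow>
      step_mean l n (Z (Suc i)) es \<le> c * Z i es"
    and c: "c \<ge> 0" and i: "i \<le> m"
  shows "pexp l n i (Z i) \<le> c ^ i * Z 0 []"
  using i
proof (induction i)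
  case (Suc i)
  have "pexp l n (Suc i) (Z (Suc i)) \<le> pexp l n i (\<lambda>es. c * Z i es)"
    unfolding pexp_Suc by (rule pexp_mono) (use step Suc.prems in auto)
  also have "\<dots> = c * pexp l n i (Z i)" by simp
  also have "\<dots> \<le> c * (c ^ i * Z 0 [])" using Suc c by (intro mult_left_mono) auto
  finally show ?case by (simp add: mult_ac)
qed simp

text \<open>Only the proper prefixes have to be good. Thus \<open>survives G i es\<close> together
  with \<open>\<not> G es\<close> says that \<open>G\<close> fails at step i for the first time, and
  the length condition excludes runs that stopped early.\<close>

definition survives :: "(nat set list \<Rightarrow> bool) \<Rightarrow> nat \<Rightarrow> nat set list \<Rightarrow> bool" where
  "survives G i es \<longleftrightarrow> length es = i \<and> (\<forall>j<i. G (take j es))"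

lemma survives_snoc: "survives G (Suc i) (es @ [g]) \<longleftrightarrow> survives G i es \<and> G es"
  unfolding survives_def by (auto simp: less_Suc_eq)

lemma survives_length: "survives G i es \<Longrightarrow> length es = i"
  by (simp add: survives_def)

section \<open>High moments of the number of configurations contained in a run\<close>

lemma power_add_ge_linear:
  fixes x y :: real
  assumes "x \<ge> 0" "y \<ge> 0"
  shows "x ^ k + real k * y * x ^ (k - 1) \<le> (x + y) ^ k"
proof (induction k)
  case (Suc k)
  have "x ^ Suc k + real (Suc k) * y * x ^ k \<le> (x + y) * (x ^ k + real k * y * x ^ (k - 1))"
  proof (cases k)
    case (Suc j)
    have "0 \<le> y * (real k * y * x ^ (k - 1))" using assms by simp
    then show ?thesis using Suc by (simp add: algebra_simps)
  qed (simp add: algebra_simps)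
  also have "\<dots> \<le> (x + y) * (x + y) ^ k" using Suc assms by (intro mult_left_mono) auto
  finally show ?case by simp
qed simp

text \<open>Induction on the number of steps, for all \<open>S\<close> at once. The last step either
  changes nothing or adds one s in \<open>S\<close>, which has probability at most 1/\<kappa>; the
  resulting terms are the first two of the binomial expansion of ((i + 1)/\<kappa>)^|S|.\<close>

lemma pexp_contains_le:
  assumes kap: "\<kappa> > 0" and G: "\<And>es. G es \<Longrightarrow> \<kappa> \<le> real (card (available l n (set es)))"
    and "finite S"
  shows "pexp l n i (\<lambda>es. of_bool (S \<subseteq> set es \<and> survives G i es)) \<le> (real i / \<kappa>) ^ card S"
  using \<open>finite S\<close>
proof (induction i arbitrary: S)
  case 0
  then show ?case by (cases "S = {}") auto
next
  case (Suc i)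
  let ?f = "\<lambda>i S es. of_bool (S \<subseteq> set es \<and> survives G i es) :: real"
  let ?k = "card S"
  have le: "step_mean l n (?f (Suc i) S) es \<le> ?f i S es + (\<Sum>s\<in>S. ?f i (S - {s}) es / \<kappa>)"
    if es: "es \<in> set_pmf (process_steps l n i)" for es
  proof (cases "available l n (set es) \<noteq> {} \<and> survives G i es \<and> G es")
    case False
    have "step_mean l n (?f (Suc i) S) es = 0"
    proof (cases "available l n (set es) = {}")
      case True
      have "\<not> survives G (Suc i) es" using length_process_steps[OF es] by (auto simp: survives_def)
      then show ?thesis using True by (simp add: step_mean_def)
    next
      case ne: False
      then show ?thesis using False by (auto simp: step_mean_def survives_snoc)
    qed
    also have "0 \<le> ?f i S es + (\<Sum>s\<in>S. ?f i (S - {s}) es / \<kappa>)"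
      using kap by (intro add_nonneg_nonneg sum_nonneg) auto
    finally show ?thesis .
  next
    case True
    let ?Q = "available l n (set es)"
    have Q: "?Q \<noteq> {}" "survives G i es" "G es" using True by auto
    have cQ: "\<kappa> \<le> real (card ?Q)" using G Q by blast
    \<comment> \<open>The new triple completes \<open>S\<close> only if it is a member s of
      \<open>S\<close> and \<open>S - {s}\<close> was already there. Summed over g, each s is
      charged at most once.\<close>
    have "(\<Sum>g\<in>?Q. ?f (Suc i) S (es @ [g]))
        \<le> (\<Sum>g\<in>?Q. ?f i S es + (\<Sum>s\<in>S. if s = g then ?f i (S - {s}) es else 0))"
    proof (rule sum_mono)
      fix g
      have nn: "(\<Sum>s\<in>S. if s = g then ?f i (S - {s}) es else 0) \<ge> 0"
        by (intro sum_nonneg) auto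
      show "?f (Suc i) S (es @ [g])
        \<le> ?f i S es + (\<Sum>s\<in>S. if s = g then ?f i (S - {s}) es else 0)"
      proof (cases "S \<subseteq> set es \<or> \<not> S \<subseteq> insert g (set es)")
        case True
        then show ?thesis using nn Q by (auto simp: survives_snoc)
      next
        case False
        then have "g \<in> S" "S - {g} \<subseteq> set es" by auto
        then show ?thesis using Q Suc.prems by (simp add: survives_snoc)
      qed
    qed
    also have "\<dots> = real (card ?Q) * ?f i S es
        + (\<Sum>s\<in>S. \<Sum>g\<in>?Q. if s = g then ?f i (S - {s}) es else 0)"
      by (subst sum.swap) (simp add: sum.distrib)
    also have "\<dots> \<le> real (card ?Q) * ?f i S es + (\<Sum>s\<in>S. ?f i (S - {s}) es)"
      by (intro add_left_mono sum_mono) (auto simp: finite_available sum.delta')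
    finally have "step_mean l n (?f (Suc i) S) es
      \<le> (real (card ?Q) * ?f i S es + (\<Sum>s\<in>S. ?f i (S - {s}) es)) / real (card ?Q)"
      using Q by (simp add: step_mean_def divide_right_mono)
    also have "\<dots> = ?f i S es + (\<Sum>s\<in>S. ?f i (S - {s}) es) / real (card ?Q)"
      using cQ kap by (simp add: add_divide_distrib)
    also have "\<dots> \<le> ?f i S es + (\<Sum>s\<in>S. ?f i (S - {s}) es) / \<kappa>"
      using cQ kap by (intro add_left_mono divide_left_mono mult_pos_pos sum_nonneg) auto
    finally show ?thesis by (simp add: sum_divide_distrib)
  qed
  have "pexp l n (Suc i) (?f (Suc i) S)
      \<le> pexp l n i (\<lambda>es. ?f i S es + (\<Sum>s\<in>S. ?f i (S - {s}) es / \<kappa>))"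
    unfolding pexp_Suc by (rule pexp_mono) (rule le)
  also have "\<dots> = pexp l n i (?f i S) + (\<Sum>s\<in>S. pexp l n i (?f i (S - {s})) / \<kappa>)"
    by (simp add: pexp_integrable)
  also have "\<dots> \<le> (real i / \<kappa>) ^ ?k + (\<Sum>s\<in>S. (real i / \<kappa>) ^ (?k - 1) / \<kappa>)"
  proof (intro add_mono sum_mono divide_right_mono)
    fix s assume "s \<in> S"
    then show "pexp l n i (?f i (S - {s})) \<le> (real i / \<kappa>) ^ (?k - 1)"
      using Suc.IH[of "S - {s}"] Suc.prems by simp
  qed (use Suc kap in auto)
  also have "\<dots> = (real i / \<kappa>) ^ ?k + real ?k * (1 / \<kappa>) * (real i / \<kappa>) ^ (?k - 1)" by simp
  also have "\<dots> \<le> (real i / \<kappa> + 1 / \<kappa>) ^ ?k"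
    by (rule power_add_ge_linear) (use kap in auto)
  also have "real i / \<kappa> + 1 / \<kappa> = real (Suc i) / \<kappa>" by (simp add: add_divide_distrib)
  finally show ?case .
qed

text \<open>The power is expanded one factor at a time. In the inner claim \<open>T\<close> is the
  union of the sets chosen so far; a further factor multiplies the bound by the sum of \<pi>^|S x -
  T|, since triples already in \<open>T\<close> come for free. This is why the hypothesis
  \<open>sum_le\<close> must hold relative to every small \<open>T\<close>.\<close>

lemma pexp_moment_le:
  fixes I :: "'a set" and S :: "'a \<Rightarrow> nat set set"
  assumes "finite I" and S: "\<And>x. x \<in> I \<Longrightarrow> finite (S x) \<and> card (S x) \<le> D"
    and pr: "\<And>T. finite T \<Longrightarrow> pexp l n i (\<lambda>es. of_bool (T \<subseteq> set es \<and> P es)) \<le> \<pi> ^ card T"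
    and pi: "\<pi> \<ge> 0" and mu: "\<mu> \<ge> 0"
    and sum_le: "\<And>T. finite T \<Longrightarrow> card T \<le> M * D \<Longrightarrow> (\<Sum>x\<in>I. \<pi> ^ card (S x - T)) \<le> \<mu>"
  shows "pexp l n i (\<lambda>es. real (card {x \<in> I. S x \<subseteq> set es}) ^ M * of_bool (P es)) \<le> \<mu> ^ M"
proof -
  let ?X = "\<lambda>es. real (card {x \<in> I. S x \<subseteq> set es})"
  have "pexp l n i (\<lambda>es. ?X es ^ j * of_bool (T \<subseteq> set es \<and> P es)) \<le> \<mu> ^ j * \<pi> ^ card T"
    if "j \<le> M" "finite T" "card T \<le> (M - j) * D" for j T
    using that
  proof (induction j arbitrary: T)
    case 0
    then show ?case using pr by simp
  next
    case (Suc j)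
    have X: "?X es = (\<Sum>x\<in>I. of_bool (S x \<subseteq> set es))" for es
    proof -
      have "(\<Sum>x\<in>I. of_bool (S x \<subseteq> set es)) = (\<Sum>x\<in>{x \<in> I. S x \<subseteq> set es}. 1 :: real)"
        using \<open>finite I\<close> by (intro sum.mono_neutral_cong_right) auto
      then show ?thesis by simp
    qed
    have eq: "?X es ^ Suc j * of_bool (T \<subseteq> set es \<and> P es)
        = (\<Sum>x\<in>I. ?X es ^ j * of_bool (T \<union> S x \<subseteq> set es \<and> P es))" for es
    proof -
      have "?X es ^ Suc j * of_bool (T \<subseteq> set es \<and> P es)
        = (\<Sum>x\<in>I. of_bool (S x \<subseteq> set es)) * (?X es ^ j * of_bool (T \<subseteq> set es \<and> P es))"
        unfolding X by simp
      also have "\<dots> = (\<Sum>x\<in>I. of_bool (S x \<subseteq> set es) * (?X es ^ j * of_bool (T \<subseteq> set es \<and> P es)))"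
        by (rule sum_distrib_right)
      also have "\<dots> = (\<Sum>x\<in>I. ?X es ^ j * of_bool (T \<union> S x \<subseteq> set es \<and> P es))"
        by (rule sum.cong) auto
      finally show ?thesis .
    qed
    have "pexp l n i (\<lambda>es. ?X es ^ Suc j * of_bool (T \<subseteq> set es \<and> P es))
        = (\<Sum>x\<in>I. pexp l n i (\<lambda>es. ?X es ^ j * of_bool (T \<union> S x \<subseteq> set es \<and> P es)))"
      unfolding eq by (simp add: pexp_integrable)
    also have "\<dots> \<le> (\<Sum>x\<in>I. \<mu> ^ j * \<pi> ^ card (T \<union> S x))"
    proof (rule sum_mono)
      fix x assume x: "x \<in> I"
      have "card (T \<union> S x) \<le> card T + card (S x)" by (rule card_Un_le)
      also have "\<dots> \<le> (M - Suc j) * D + D" using S[OF x] Suc.prems by simp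
      also have "\<dots> = (M - j) * D"
        using Suc.prems by (metis Suc_diff_Suc Suc_le_lessD add.commute mult_Suc)
      finally show "pexp l n i (\<lambda>es. ?X es ^ j * of_bool (T \<union> S x \<subseteq> set es \<and> P es))
          \<le> \<mu> ^ j * \<pi> ^ card (T \<union> S x)"
        using Suc S[OF x] by (intro Suc.IH) auto
    qed
    also have "\<dots> = \<mu> ^ j * \<pi> ^ card T * (\<Sum>x\<in>I. \<pi> ^ card (S x - T))"
    proof -
      have "card (T \<union> S x) = card T + card (S x - T)" if "x \<in> I" for x
        using Suc.prems S[OF that] card_Un_disjoint[of T "S x - T"] by (simp add: Un_Diff_cancel)
      then have "(\<Sum>x\<in>I. \<mu> ^ j * \<pi> ^ card (T \<union> S x))
          = (\<Sum>x\<in>I. \<mu> ^ j * \<pi> ^ card T * \<pi> ^ card (S x - T))"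
        by (intro sum.cong) (auto simp: power_add)
      then show ?thesis by (simp add: sum_distrib_left)
    qed
    also have "\<dots> \<le> \<mu> ^ j * \<pi> ^ card T * \<mu>"
    proof (rule mult_left_mono)
      have "(M - Suc j) * D \<le> M * D" by simp
      then have "card T \<le> M * D" using Suc.prems by linarith
      then show "(\<Sum>x\<in>I. \<pi> ^ card (S x - T)) \<le> \<mu>" using Suc.prems by (intro sum_le) auto
    qed (use pi mu in auto)
    finally show ?case by (simp add: mult_ac)
  qed
  from this[of M "{}"] show ?thesis by simp
qed

text \<open>Markov's inequality for the M-th power, restricted to an event.\<close>

lemma prob_moment_le:
  assumes "pexp l n i (\<lambda>es. X es ^ M * of_bool (P es)) \<le> \<mu> ^ M" and "b > 0"
    and "\<And>es. X es \<ge> 0"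
  shows "measure_pmf.prob (process_steps l n i) {es. P es \<and> X es \<ge> b} \<le> (\<mu> / b) ^ M"
proof -
  have "pexp l n i (\<lambda>es. of_bool (P es \<and> X es \<ge> b))
      \<le> pexp l n i (\<lambda>es. X es ^ M * of_bool (P es) / b ^ M)"
  proof (rule pexp_mono)
    fix es
    have "b ^ M \<le> X es ^ M" if "X es \<ge> b" using that assms by (intro power_mono) auto
    then show "of_bool (P es \<and> b \<le> X es) \<le> X es ^ M * of_bool (P es) / b ^ M"
      using assms by auto
  qed
  also have "\<dots> = pexp l n i (\<lambda>es. X es ^ M * of_bool (P es)) / b ^ M" by simp
  also have "\<dots> \<le> \<mu> ^ M / b ^ M" using assms by (intro divide_right_mono) auto
  finally show ?thesis by (simp add: prob_eq_pexp power_divide)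
qed

section \<open>Exponential potential for a tracked quantity\<close>

lemma exp_le_quadratic:
  fixes x :: real
  assumes "\<bar>x\<bar> \<le> 1"
  shows "exp x \<le> 1 + x + x\<^sup>2"
proof (cases "x \<ge> 0")
  case True
  then show ?thesis using exp_bound[of x] assms by simp
next
  case False
  then have neg: "x < 0" by simp
  \<comment> \<open>For negative x the claim is multiplied by 1 - x > 0: then (1 - x) exp x is at
    most 1, hence at most 1 - x^3, which is (1 - x)(1 + x + x^2).\<close>
  have "1 - x \<le> exp (- x)" using exp_ge_add_one_self[of "- x"] by simp
  then have "(1 - x) * exp x \<le> exp (- x) * exp x" by (intro mult_right_mono) auto
  also have "\<dots> = 1" by (simp flip: exp_add)
  also have "\<dots> \<le> 1 - x ^ 3"
    using neg by (simp add: power3_eq_cube mult_nonneg_nonpos2 mult_nonpos_nonpos mult_le_0_iff)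
  also have "\<dots> = (1 - x) * (1 + x + x\<^sup>2)" by (simp add: algebra_simps power2_eq_square power3_eq_cube)
  finally show ?thesis using neg by simp
qed

text \<open>
  The exponential potential is set to zero as soon as the run has left the good event or the
  tracked object has died, so no stopping times are needed.
\<close>

lemma prob_tracking_failure_le:
  assumes step: "\<And>i es. i < m \<Longrightarrow> es \<in> set_pmf (process_steps l n i) \<Longrightarrow> survives G i es \<Longrightarrow> G es \<Longrightarrow>
      alive es \<Longrightarrow> available l n (set es) \<noteq> {} \<Longrightarrow>
      \<exists>\<Delta>. (\<forall>g\<in>available l n (set es). (alive (es @ [g]) \<longrightarrow> X (Suc i) (es @ [g]) \<le> X i es + \<Delta> g)
             \<and> \<bar>\<Delta> g\<bar> \<le> R) \<and>
          (\<Sum>g\<in>available l n (set es). \<Delta> g) \<le> 0 \<and>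
          (\<Sum>g\<in>available l n (set es). \<bar>\<Delta> g\<bar>) \<le> V * real (card (available l n (set es)))"
    and alive: "\<And>es g. alive (es @ [g]) \<Longrightarrow> alive es"
    and th: "\<theta> \<ge> 0" "\<theta> * R \<le> 1" and RV: "R \<ge> 0" "V \<ge> 0" and i: "i \<le> m"
  shows "measure_pmf.prob (process_steps l n i) {es. survives G i es \<and> alive es \<and> X i es \<ge> 0}
    \<le> exp (\<theta> * X 0 [] + real i * (\<theta>\<^sup>2 * R * V))"
proof -
  define Z where "Z = (\<lambda>i es. of_bool (survives G i es \<and> alive es) * exp (\<theta> * X i es))"
  let ?c = "1 + \<theta>\<^sup>2 * R * V"
  have c: "?c \<ge> 0" using RV by (intro add_nonneg_nonneg mult_nonneg_nonneg) auto
  have Z0: "Z i es \<ge> 0" for i es by (simp add: Z_def)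
  have "step_mean l n (Z (Suc i)) es \<le> ?c * Z i es"
    if im: "i < m" and es: "es \<in> set_pmf (process_steps l n i)" for i es
  proof (cases "available l n (set es) = {}")
    case True
    have "\<not> survives G (Suc i) es" using length_process_steps[OF es] by (auto simp: survives_def)
    then have "step_mean l n (Z (Suc i)) es = 0" using True by (simp add: step_mean_def Z_def)
    then show ?thesis using c Z0 by simp
  next
    case ne: False
    let ?Q = "available l n (set es)"
    have Qpos: "real (card ?Q) > 0" using ne by (simp add: card_gt_0_iff finite_available)
    show ?thesis
    proof (cases "survives G i es \<and> G es \<and> alive es")
      case False
      then have "Z (Suc i) (es @ [g]) = 0" for g
        using alive by (auto simp: Z_def survives_snoc)
      then have "step_mean l n (Z (Suc i)) es = 0" using ne by (simp add: step_mean_def)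
      then show ?thesis using c Z0 by simp
    next
      case True
      then have sv: "survives G i es" "G es" "alive es" by auto
      from step[OF im es sv ne] obtain \<Delta> where
        D1: "\<And>g. g \<in> ?Q \<Longrightarrow> alive (es @ [g]) \<Longrightarrow> X (Suc i) (es @ [g]) \<le> X i es + \<Delta> g"
        and D2: "\<And>g. g \<in> ?Q \<Longrightarrow> \<bar>\<Delta> g\<bar> \<le> R"
        and D3: "(\<Sum>g\<in>?Q. \<Delta> g) \<le> 0" and D4: "(\<Sum>g\<in>?Q. \<bar>\<Delta> g\<bar>) \<le> V * real (card ?Q)"
        by blast
      have "(\<Sum>g\<in>?Q. Z (Suc i) (es @ [g])) \<le>
          (\<Sum>g\<in>?Q. exp (\<theta> * X i es) * (1 + \<theta> * \<Delta> g + \<theta>\<^sup>2 * R * \<bar>\<Delta> g\<bar>))"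
      proof (rule sum_mono)
        fix g assume g: "g \<in> ?Q"
        have abs: "\<bar>\<theta> * \<Delta> g\<bar> \<le> 1"
        proof -
          have "\<bar>\<theta> * \<Delta> g\<bar> = \<theta> * \<bar>\<Delta> g\<bar>" using th by (simp add: abs_mult)
          also have "\<dots> \<le> \<theta> * R" using D2[OF g] th by (intro mult_left_mono) auto
          finally show ?thesis using th by simp
        qed
        have "Z (Suc i) (es @ [g]) \<le> exp (\<theta> * X i es + \<theta> * \<Delta> g)"
        proof (cases "alive (es @ [g])")
          case True
          have "\<theta> * X (Suc i) (es @ [g]) \<le> \<theta> * (X i es + \<Delta> g)"
            using D1[OF g True] th by (intro mult_left_mono) auto
          then show ?thesis by (simp add: Z_def algebra_simps)
        qed (simp add: Z_def)
        also have "\<dots> \<le> exp (\<theta> * X i es) * (1 + \<theta> * \<Delta> g + (\<theta> * \<Delta> g)\<^sup>2)"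
          unfolding exp_add using exp_le_quadratic[OF abs] by (intro mult_left_mono) auto
        \<comment> \<open>The worst case \<open>R\<close> is used for one of the two factors only.
          The other one is averaged and gives \<open>V\<close>, so the variance per step is R V
          instead of R^2, as in Freedman's inequality.\<close>
        also have "(\<theta> * \<Delta> g)\<^sup>2 \<le> \<theta>\<^sup>2 * R * \<bar>\<Delta> g\<bar>"
        proof -
          have "(\<theta> * \<Delta> g)\<^sup>2 = \<theta>\<^sup>2 * (\<bar>\<Delta> g\<bar> * \<bar>\<Delta> g\<bar>)" by (simp add: power_mult_distrib power2_eq_square)
          also have "\<dots> \<le> \<theta>\<^sup>2 * (R * \<bar>\<Delta> g\<bar>)" using D2[OF g] by (intro mult_left_mono mult_right_mono) auto
          finally show ?thesis by (simp add: mult_ac)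
        qed
        finally show "Z (Suc i) (es @ [g]) \<le> exp (\<theta> * X i es) * (1 + \<theta> * \<Delta> g + \<theta>\<^sup>2 * R * \<bar>\<Delta> g\<bar>)"
          by simp
      qed
      also have "\<dots> = exp (\<theta> * X i es) *
          (real (card ?Q) + \<theta> * (\<Sum>g\<in>?Q. \<Delta> g) + \<theta>\<^sup>2 * R * (\<Sum>g\<in>?Q. \<bar>\<Delta> g\<bar>))"
        by (simp add: sum.distrib sum_distrib_left[symmetric])
      also have "\<dots> \<le> exp (\<theta> * X i es) * (real (card ?Q) + 0 + \<theta>\<^sup>2 * R * (V * real (card ?Q)))"
        using th RV D3 D4
        by (intro mult_left_mono add_mono) (auto simp: mult_nonneg_nonpos intro!: mult_left_mono)
      also have "\<dots> = ?c * Z i es * real (card ?Q)" using sv by (simp add: Z_def algebra_simps)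
      finally show ?thesis using ne Qpos by (simp add: step_mean_def pos_divide_le_eq)
    qed
  qed
  then have "pexp l n i (Z i) \<le> ?c ^ i * Z 0 []" using c i by (intro pexp_potential_le[where m = m]) auto
  also have "\<dots> \<le> exp (\<theta>\<^sup>2 * R * V) ^ i * exp (\<theta> * X 0 [])"
  proof (intro mult_mono power_mono)
    show "?c \<le> exp (\<theta>\<^sup>2 * R * V)" using exp_ge_add_one_self by simp
    show "Z 0 [] \<le> exp (\<theta> * X 0 [])" by (simp add: Z_def)
  qed (use c Z0 in auto)
  also have "\<dots> = exp (\<theta> * X 0 [] + real i * (\<theta>\<^sup>2 * R * V))"
    by (simp add: exp_add exp_of_nat_mult)
  finally have "pexp l n i (Z i) \<le> exp (\<theta> * X 0 [] + real i * (\<theta>\<^sup>2 * R * V))" .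
  moreover have "pexp l n i (\<lambda>es. of_bool (survives G i es \<and> alive es \<and> X i es \<ge> 0)) \<le> pexp l n i (Z i)"
    by (rule pexp_mono) (use th in \<open>auto simp: Z_def\<close>)
  ultimately show ?thesis by (simp add: prob_eq_pexp)
qed

text \<open>Lets an event about the first i steps of the full process be estimated in
  \<open>process_steps l n i\<close>.\<close>

lemma map_take_process_steps:
  "map_pmf (take i) (process_steps l n (i + k)) = process_steps l n i"
proof (induction k)
  case 0
  have "map_pmf (take i) (process_steps l n i) = map_pmf id (process_steps l n i)"
    by (rule map_pmf_cong) (auto dest: length_process_steps)
  then show ?case by simp
next
  case (Suc k)
  have "map_pmf (take i) (process_steps l n (i + Suc k))
      = bind_pmf (process_steps l n (i + k)) (\<lambda>es. return_pmf (take i es))"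
    unfolding add_Suc_right process_steps.simps map_bind_pmf
  proof (rule bind_pmf_cong[OF refl])
    fix es assume es: "es \<in> set_pmf (process_steps l n (i + k))"
    show "map_pmf (take i) (if available l n (set es) = {} then return_pmf es
      else map_pmf (\<lambda>e. es @ [e]) (pmf_of_set (available l n (set es)))) = return_pmf (take i es)"
    proof (cases "available l n (set es) = {}")
      case False
      then have "length es = i + k" using process_steps_invariant[OF es] by auto
      then have "(\<lambda>e. take i (es @ [e])) = (\<lambda>e. take i es)" by auto
      then show ?thesis using False by (simp add: map_pmf_comp map_pmf_const)
    qed simp
  qed
  also have "\<dots> = process_steps l n i" using Suc.IH by (simp add: map_pmf_def)
  finally show ?case .
qed

text \<open>Union bound over the first index at which the run is too short or not good.\<close>

lemma prob_triple_process_good: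
  assumes m: "m \<le> n choose 3" and G: "\<And>es. G es \<Longrightarrow> available l n (set es) \<noteq> {}"
  shows "measure_pmf.prob (triple_process l n) {es. \<forall>i\<le>m. length (take i es) = i \<and> G (take i es)}
    \<ge> 1 - (\<Sum>i\<le>m. measure_pmf.prob (process_steps l n i) {es. survives G i es \<and> \<not> G es})"
proof -
  let ?P = "triple_process l n"
  let ?A = "{es. \<forall>i\<le>m. length (take i es) = i \<and> G (take i es)}"
  let ?B = "\<lambda>i. {es. survives G i (take i es) \<and> \<not> G (take i es)}"
  have sub: "set_pmf ?P - ?A \<subseteq> (\<Union>i\<le>m. ?B i)"
  proof
    fix es assume es: "es \<in> set_pmf ?P - ?A"
    define bad where "bad i \<longleftrightarrow> length (take i es) \<noteq> i \<or> \<not> G (take i es)" for i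
    define i where "i = (LEAST i. bad i)"
    obtain i' where i': "i' \<le> m" "bad i'" using es by (auto simp: bad_def)
    then have "bad i" unfolding i_def by (intro LeastI)
    have "i \<le> m" using i' Least_le[of bad i'] unfolding i_def by simp
    have good: "\<not> bad j" if "j < i" for j using not_less_Least[of j bad] that unfolding i_def by blast
    have len: "length (take i es) = i"
    proof (rule ccontr)
      \<comment> \<open>A run that stops before i was still good in its final state, so a triple
        would have been available there, although the process had stopped.\<close>
      assume ne: "length (take i es) \<noteq> i"
      then have lt: "length es < i" by auto
      then have "\<not> bad (length es)" by (rule good)
      then have "G es" by (simp add: bad_def)
      then have "available l n (set es) \<noteq> {}" by (rule G)
      moreover have "available l n (set es) = {}" using es by (intro triple_process_stopped) auto
      ultimately show False by simp
    qed
    have "G (take j (take i es))" if "j < i" for j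
    proof -
      have "take j (take i es) = take j es" using that by (simp add: min_def)
      then show ?thesis using good[OF that] by (simp add: bad_def)
    qed
    then have "survives G i (take i es)" using len by (simp add: survives_def)
    moreover have "\<not> G (take i es)" using \<open>bad i\<close> len by (auto simp: bad_def)
    ultimately show "es \<in> (\<Union>i\<le>m. ?B i)" using \<open>i \<le> m\<close> by auto
  qed
  have "1 - measure_pmf.prob ?P ?A = measure_pmf.prob ?P (- ?A)"
    by (subst measure_pmf.prob_compl[symmetric]) (auto simp: Compl_eq_Diff_UNIV)
  also have "\<dots> = measure_pmf.prob ?P (- ?A \<inter> set_pmf ?P)" by (simp add: measure_Int_set_pmf)
  also have "\<dots> \<le> measure_pmf.prob ?P (\<Union>i\<le>m. ?B i)"
    using sub by (intro measure_pmf.finite_measure_mono) auto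
  also have "\<dots> \<le> (\<Sum>i\<le>m. measure_pmf.prob ?P (?B i))"
    by (rule measure_pmf.finite_measure_subadditive_finite) simp_all
  also have "\<dots> = (\<Sum>i\<le>m. measure_pmf.prob (process_steps l n i) {es. survives G i es \<and> \<not> G es})"
  proof (rule sum.cong[OF refl])
    fix i assume "i \<in> {..m}"
    then have "i + ((n choose 3) - i) = n choose 3" using m by auto
    then have eq: "process_steps l n i = map_pmf (take i) ?P"
      using map_take_process_steps[of i l n "(n choose 3) - i"] by (simp add: triple_process_def)
    have "measure_pmf.prob (process_steps l n i) {es. survives G i es \<and> \<not> G es}
      = measure_pmf.prob ?P (take i -` {es. survives G i es \<and> \<not> G es})"
      unfolding eq by (rule measure_map_pmf)
    then show "measure_pmf.prob ?P (?B i)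
        = measure_pmf.prob (process_steps l n i) {es. survives G i es \<and> \<not> G es}"
      by (simp add: vimage_def)
  qed
  finally show ?thesis by simp
qed

section \<open>Extension counts\<close>

text \<open>
  The last condition says that, given a vertex set \<open>U\<close> containing the root \<open>R\<close>, about \<open>n\<close> to the
  power \<open>\<kappa>\<close> completions are expected at most, when every triple is present with probability \<open>1/n\<close>.
\<close>

definition ext_set :: "nat \<Rightarrow> nat \<Rightarrow> nat set \<Rightarrow> nat \<Rightarrow> (nat set \<times> nat set set) set" where
  "ext_set n L R \<kappa> = {(V, S). R \<subseteq> V \<and> V \<subseteq> {1..n} \<and> card V \<le> L \<and> S \<subseteq> [V]\<^bsup>3\<^esup> \<and>
     (\<forall>U. R \<subseteq> U \<and> U \<subseteq> V \<longrightarrow> card V \<le> card U + \<kappa> + card {e \<in> S. \<not> e \<subseteq> U})}"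

definition ext_ok :: "nat \<Rightarrow> nat \<Rightarrow> real \<Rightarrow> nat set set \<Rightarrow> bool" where
  "ext_ok n L u H \<longleftrightarrow> (\<forall>R\<subseteq>{1..n}. \<forall>\<kappa>\<le>L.
     real (card {x \<in> ext_set n L R \<kappa>. snd x \<subseteq> H}) \<le> real n ^ \<kappa> * u)"

lemma ext_set_subset: "ext_set n L R \<kappa> \<subseteq> (SIGMA V:{V. V \<subseteq> {1..n} \<and> card V \<le> L}. Pow ([V]\<^bsup>3\<^esup>))"
  by (auto simp: ext_set_def)

lemma finite_ext_set: "finite (ext_set n L R \<kappa>)"
proof (rule finite_subset[OF ext_set_subset])
  show "finite (SIGMA V:{V. V \<subseteq> {1..n} \<and> card V \<le> L}. Pow ([V]\<^bsup>3\<^esup>))"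
    by (rule finite_SigmaI) (auto intro!: finite_imp_finite_nsets dest: finite_subset)
qed

lemma ext_set_root:
  assumes "x \<in> ext_set n L R \<kappa>" shows "R \<subseteq> {1..n} \<and> card R \<le> L"
proof -
  have V: "R \<subseteq> fst x" "fst x \<subseteq> {1..n}" "card (fst x) \<le> L" using assms by (auto simp: ext_set_def)
  then have "card R \<le> card (fst x)" by (intro card_mono) (auto dest: finite_subset)
  then show ?thesis using V by auto
qed

lemma card_nsets3_le:
  assumes "finite V" "card V \<le> L" shows "card ([V]\<^bsup>3\<^esup>) \<le> 2 ^ L"
proof -
  have "card ([V]\<^bsup>3\<^esup>) \<le> card (Pow V)" using assms by (intro card_mono) (auto simp: nsets_def)
  also have "\<dots> \<le> 2 ^ L" using assms by (simp add: card_Pow)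
  finally show ?thesis .
qed

lemma sum_small_subsets_le:
  assumes n: "n \<ge> 1"
  shows "(\<Sum>B | B \<subseteq> {1..n} \<and> card B \<le> L. 1 / real n ^ card B) \<le> real (L + 1)"
proof -
  have "{B. B \<subseteq> {1..n} \<and> card B \<le> L} = (\<Union>b\<le>L. {B. B \<subseteq> {1..n} \<and> card B = b})" by auto
  then have "(\<Sum>B | B \<subseteq> {1..n} \<and> card B \<le> L. 1 / real n ^ card B)
      = (\<Sum>b\<le>L. \<Sum>B | B \<subseteq> {1..n} \<and> card B = b. 1 / real n ^ card B)"
    by (simp only:) (rule sum.UNION_disjoint, auto)
  also have "\<dots> = (\<Sum>b\<le>L. real (n choose b) / real n ^ b)"
    by (rule sum.cong) (auto simp: n_subsets)
  also have "\<dots> \<le> (\<Sum>b\<le>L. 1)"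
  proof (rule sum_mono)
    fix b
    have "(n choose b) \<le> n ^ b" using n by (cases "b \<le> n") (auto simp: binomial_le_pow binomial_eq_0)
    then have "real (n choose b) \<le> real n ^ b" by (metis of_nat_le_iff of_nat_power)
    then show "real (n choose b) / real n ^ b \<le> 1" using n by (simp add: divide_le_eq)
  qed
  finally show ?thesis by simp
qed

lemma card_small_subsets_le:
  assumes n: "n \<ge> 1"
  shows "real (card {B. B \<subseteq> {1..n} \<and> card B \<le> L}) \<le> real (L + 1) * real n ^ L"
proof -
  have "real (card {B. B \<subseteq> {1..n} \<and> card B \<le> L}) = (\<Sum>B | B \<subseteq> {1..n} \<and> card B \<le> L. 1)" by simp
  also have "\<dots> \<le> (\<Sum>B | B \<subseteq> {1..n} \<and> card B \<le> L. (1 / real n ^ card B) * real n ^ L)"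
    using n by (intro sum_mono) (auto simp: field_simps intro!: power_increasing)
  also have "\<dots> = (\<Sum>B | B \<subseteq> {1..n} \<and> card B \<le> L. 1 / real n ^ card B) * real n ^ L"
    by (rule sum_distrib_right[symmetric])
  also have "\<dots> \<le> real (L + 1) * real n ^ L"
    using sum_small_subsets_le[OF n] by (intro mult_right_mono) auto
  finally show ?thesis .
qed

text \<open>The three factors bound the choices of a triple set on at most \<open>L\<close>
  vertices, the choices of the part of V inside the at most L + 3 M 2^L vertices of the root and of
  the given triples, and the sum over the sizes of the rest of V.\<close>

definition ext_const :: "nat \<Rightarrow> nat \<Rightarrow> real" where
  "ext_const L M = 2 ^ (2 ^ L) * 2 ^ (L + 3 * (M * 2 ^ L)) * real (L + 1)"

text \<open>Let W consist of the root and the vertices of \<open>T\<close>. The defining condition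
  of \<open>ext_set\<close> at U = V \<inter> W bounds |V - W| by \<kappa> plus the number of
  triples not inside U, and those triples all lie outside \<open>T\<close>. Every vertex outside W
  is therefore paid for by a factor 1/n, up to n^\<kappa>.\<close>

lemma ext_set_sum_le:
  assumes n: "n \<ge> 1" and v: "1 \<le> v" "v \<le> real n" and T: "finite T" "card T \<le> M * 2 ^ L"
  shows "(\<Sum>x\<in>ext_set n L R \<kappa>. (v / real n) ^ card (snd x - T))
    \<le> ext_const L M * v ^ (2 ^ L) * real n ^ \<kappa>"
proof (cases "R \<subseteq> {1..n} \<and> card R \<le> L")
  case False
  then have "ext_set n L R \<kappa> = {}" using ext_set_root by blast
  then show ?thesis using v by (simp add: ext_const_def)
next
  case True
  let ?N = "real n" and ?D = "2 ^ L :: nat"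
  \<comment> \<open>\<open>T\<close> is an arbitrary finite set here; only genuine triples can occur
    in \<open>S\<close>, and dropping the others keeps W finite and small.\<close>
  define T' where "T' = {e \<in> T. finite e \<and> card e = 3}"
  define W where "W = R \<union> \<Union>T'"
  have N: "?N \<ge> 1" using n by simp
  have finR: "finite R" using True finite_subset by blast
  have finT': "finite T'" using T by (simp add: T'_def)
  have finW: "finite W" using finR finT' by (auto simp: W_def T'_def)
  have "card (\<Union>T') \<le> (\<Sum>e\<in>T'. card e)" by (rule card_Union_le_sum_card)
  also have "\<dots> = 3 * card T'" by (simp add: T'_def)
  also have "\<dots> \<le> 3 * card T" using T by (simp add: T'_def card_mono)
  finally have "card W \<le> L + 3 * (M * ?D)"
    using True T card_Un_le[of R "\<Union>T'"] by (simp add: W_def)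
  then have cW: "(2::real) ^ card W \<le> 2 ^ (L + 3 * (M * ?D))" by (intro power_increasing) auto
  let ?VS = "{V. V \<subseteq> {1..n} \<and> card V \<le> L}"
  have finVS: "finite ?VS" by simp
  have term_le: "(v / ?N) ^ card (snd x - T) \<le> v ^ ?D * ?N ^ \<kappa> * (1 / ?N ^ card (fst x - W))"
    if x: "x \<in> ext_set n L R \<kappa>" for x
  proof -
    obtain V S where xV: "x = (V, S)" by (cases x)
    let ?U = "V \<inter> W"
    let ?j = "card {e \<in> S. \<not> e \<subseteq> ?U}"
    have VS: "R \<subseteq> V" "V \<subseteq> {1..n}" "card V \<le> L" "S \<subseteq> [V]\<^bsup>3\<^esup>"
      and ext: "\<And>U. R \<subseteq> U \<Longrightarrow> U \<subseteq> V \<Longrightarrow> card V \<le> card U + \<kappa> + card {e \<in> S. \<not> e \<subseteq> U}"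
      using x xV by (auto simp: ext_set_def)
    have finV: "finite V" using VS finite_subset by blast
    have finS: "finite S" using VS finV by (meson finite_imp_finite_nsets finite_subset)
    have cS: "card S \<le> ?D"
      using VS finV card_nsets3_le[of V L] card_mono[OF finite_imp_finite_nsets[OF finV] VS(4)] by linarith
    have sub: "{e \<in> S. \<not> e \<subseteq> ?U} \<subseteq> S - T"
    proof
      fix e assume e: "e \<in> {e \<in> S. \<not> e \<subseteq> ?U}"
      then have e3: "e \<subseteq> V" "finite e" "card e = 3" using VS by (auto simp: nsets_def)
      have "e \<notin> T"
      proof
        assume "e \<in> T"
        then have "e \<subseteq> W" using e3 by (auto simp: W_def T'_def)
        then show False using e e3 by auto
      qed
      then show "e \<in> S - T" using e by auto
    qed
    have jD: "?j \<le> ?D" using cS card_mono[OF finS, of "{e \<in> S. \<not> e \<subseteq> ?U}"] by auto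
    have "card V \<le> card ?U + \<kappa> + ?j" using VS by (intro ext) (auto simp: W_def)
    then have "card (V - W) \<le> \<kappa> + ?j" using finV by (simp add: card_Diff_subset_Int)
    then have pw: "?N ^ card (V - W) \<le> ?N ^ \<kappa> * ?N ^ ?j"
      using N by (simp add: power_increasing flip: power_add)
    have "(v / ?N) ^ card (S - T) \<le> (v / ?N) ^ ?j"
      using v N finS by (intro power_decreasing card_mono sub) (auto simp: divide_le_eq)
    also have "\<dots> = v ^ ?j / ?N ^ ?j" by (simp add: power_divide)
    also have "\<dots> \<le> v ^ ?D / ?N ^ ?j"
      using v N jD by (intro divide_right_mono power_increasing) auto
    also have "\<dots> = v ^ ?D * (1 / ?N ^ ?j)" by simp
    also have "\<dots> \<le> v ^ ?D * (?N ^ \<kappa> * (1 / ?N ^ card (V - W)))"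
      using pw N v by (intro mult_left_mono) (auto simp: field_simps)
    finally show ?thesis by (simp add: xV mult_ac)
  qed
  have "(\<Sum>x\<in>ext_set n L R \<kappa>. (v / ?N) ^ card (snd x - T))
      \<le> (\<Sum>x\<in>ext_set n L R \<kappa>. v ^ ?D * ?N ^ \<kappa> * (1 / ?N ^ card (fst x - W)))"
    by (rule sum_mono) (rule term_le)
  also have "\<dots> \<le> (\<Sum>x\<in>(SIGMA V:?VS. Pow ([V]\<^bsup>3\<^esup>)). v ^ ?D * ?N ^ \<kappa> * (1 / ?N ^ card (fst x - W)))"
  proof (rule sum_mono2)
    show "finite (SIGMA V:?VS. Pow ([V]\<^bsup>3\<^esup>))"
      by (rule finite_SigmaI) (auto intro!: finite_imp_finite_nsets dest: finite_subset)
  qed (use v N ext_set_subset in auto)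
  also have "\<dots> = (\<Sum>V\<in>?VS. \<Sum>S\<in>Pow ([V]\<^bsup>3\<^esup>). v ^ ?D * ?N ^ \<kappa> * (1 / ?N ^ card (V - W)))"
    by (subst sum.Sigma) (auto simp: case_prod_unfold intro!: finite_imp_finite_nsets dest: finite_subset)
  also have "\<dots> \<le> (\<Sum>V\<in>?VS. 2 ^ ?D * (v ^ ?D * ?N ^ \<kappa>) * (1 / ?N ^ card (V - W)))"
  proof (rule sum_mono)
    fix V assume V: "V \<in> ?VS"
    then have fV: "finite V" using finite_subset by blast
    have "real (card (Pow ([V]\<^bsup>3\<^esup>))) \<le> 2 ^ ?D"
      using card_nsets3_le[OF fV] V by (simp add: card_Pow fV finite_imp_finite_nsets)
    then have "real (card (Pow ([V]\<^bsup>3\<^esup>))) * (v ^ ?D * ?N ^ \<kappa> * (1 / ?N ^ card (V - W)))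
      \<le> 2 ^ ?D * (v ^ ?D * ?N ^ \<kappa> * (1 / ?N ^ card (V - W)))"
      using v N by (intro mult_right_mono) auto
    then show "(\<Sum>S\<in>Pow ([V]\<^bsup>3\<^esup>). v ^ ?D * ?N ^ \<kappa> * (1 / ?N ^ card (V - W)))
      \<le> 2 ^ ?D * (v ^ ?D * ?N ^ \<kappa>) * (1 / ?N ^ card (V - W))" by (simp add: mult_ac)
  qed
  also have "\<dots> = 2 ^ ?D * (v ^ ?D * ?N ^ \<kappa>) * (\<Sum>V\<in>?VS. 1 / ?N ^ card (V - W))"
    by (rule sum_distrib_left[symmetric])
  also have "\<dots> \<le> 2 ^ ?D * (v ^ ?D * ?N ^ \<kappa>) * (2 ^ card W * real (L + 1))"
  proof (rule mult_left_mono)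
    \<comment> \<open>V is determined by its parts inside and outside W; there are 2^|W| candidates
      for the former, and the latter is again a small set.\<close>
    let ?h = "\<lambda>V. (V \<inter> W, V - W)"
    have inj: "inj_on ?h ?VS" by (rule inj_onI) blast
    have "(\<Sum>V\<in>?VS. 1 / ?N ^ card (V - W)) = (\<Sum>z\<in>?h ` ?VS. 1 / ?N ^ card (snd z))"
      by (subst sum.reindex[OF inj]) simp
    also have "\<dots> \<le> (\<Sum>z\<in>Pow W \<times> ?VS. 1 / ?N ^ card (snd z))"
    proof (rule sum_mono2)
      show "?h ` ?VS \<subseteq> Pow W \<times> ?VS"
      proof
        fix z assume "z \<in> ?h ` ?VS"
        then obtain V where V: "z = ?h V" "V \<subseteq> {1..n}" "card V \<le> L" by auto
        then have "finite V" using finite_subset by blast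
        then have "card (V - W) \<le> L" using V card_mono[of V "V - W"] by auto
        then show "z \<in> Pow W \<times> ?VS" using V by auto
      qed
    qed (use finW finVS N in auto)
    also have "\<dots> = (\<Sum>U\<in>Pow W. \<Sum>B\<in>?VS. 1 / ?N ^ card B)"
      by (subst sum.cartesian_product) (simp only: case_prod_unfold)
    also have "\<dots> = 2 ^ card W * (\<Sum>B\<in>?VS. 1 / ?N ^ card B)"
      using finW by (simp add: card_Pow)
    also have "\<dots> \<le> 2 ^ card W * real (L + 1)"
      using sum_small_subsets_le[OF n, of L] by (intro mult_left_mono) auto
    finally show "(\<Sum>V\<in>?VS. 1 / ?N ^ card (V - W)) \<le> 2 ^ card W * real (L + 1)" .
  qed (use v N in auto)
  also have "\<dots> \<le> 2 ^ ?D * (v ^ ?D * ?N ^ \<kappa>) * (2 ^ (L + 3 * (M * ?D)) * real (L + 1))"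
    using cW v N by (intro mult_left_mono mult_right_mono) auto
  finally show ?thesis by (simp add: ext_const_def mult_ac)
qed

text \<open>For a fixed root the expectation n^\<kappa> cancels against the threshold n^\<kappa> u,
  which leaves the M-th power of a quantity that is small once v^(2^L) is well below u. A large M
  then pays for the union bound over about n^L roots.\<close>

lemma prob_not_ext_ok_le:
  assumes n: "n \<ge> 1" and kap: "kQ > 0"
    and G: "\<And>es. G es \<Longrightarrow> kQ \<le> real (card (available l n (set es)))"
    and v: "1 \<le> v" "v \<le> real n" "real i / kQ \<le> v / real n" and u: "u > 0"
  shows "measure_pmf.prob (process_steps l n i) {es. survives G i es \<and> \<not> ext_ok n L u (set es)}
    \<le> real (L + 1) * real n ^ L * (real (L + 1) * (ext_const L M * v ^ (2 ^ L) / u) ^ M)"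
proof -
  let ?P = "process_steps l n i" and ?N = "real n" and ?D = "2 ^ L :: nat"
  let ?X = "\<lambda>R \<kappa> H. real (card {x \<in> ext_set n L R \<kappa>. snd x \<subseteq> H})"
  let ?A = "\<lambda>R \<kappa>. {es. survives G i es \<and> ?X R \<kappa> (set es) \<ge> ?N ^ \<kappa> * u}"
  let ?RS = "{R. R \<subseteq> {1..n} \<and> card R \<le> L}"
  let ?b = "(ext_const L M * v ^ ?D / u) ^ M"
  have N: "?N \<ge> 1" using n by simp
  have one: "measure_pmf.prob ?P (?A R \<kappa>) \<le> ?b" for R \<kappa>
  proof -
    have "pexp l n i (\<lambda>es. ?X R \<kappa> (set es) ^ M * of_bool (survives G i es))
        \<le> (ext_const L M * v ^ ?D * ?N ^ \<kappa>) ^ M"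
    proof (rule pexp_moment_le[OF finite_ext_set, where \<pi> = "v / ?N" and D = ?D])
      fix x assume x: "x \<in> ext_set n L R \<kappa>"
      then have V: "fst x \<subseteq> {1..n}" "card (fst x) \<le> L" and S: "snd x \<subseteq> [fst x]\<^bsup>3\<^esup>"
        by (auto simp: ext_set_def)
      have fV: "finite (fst x)" using V finite_subset by blast
      show "finite (snd x) \<and> card (snd x) \<le> ?D"
        using S card_nsets3_le[OF fV V(2)] card_mono[OF finite_imp_finite_nsets[OF fV] S]
          finite_subset[OF S finite_imp_finite_nsets[OF fV]] by linarith
    next
      fix T :: "nat set set" assume T: "finite T"
      have "pexp l n i (\<lambda>es. of_bool (T \<subseteq> set es \<and> survives G i es)) \<le> (real i / kQ) ^ card T"
        by (rule pexp_contains_le[OF kap G T])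
      also have "\<dots> \<le> (v / ?N) ^ card T" using v kap by (intro power_mono) auto
      finally show "pexp l n i (\<lambda>es. of_bool (T \<subseteq> set es \<and> survives G i es)) \<le> (v / ?N) ^ card T" .
    next
      show "v / ?N \<ge> 0" "ext_const L M * v ^ ?D * ?N ^ \<kappa> \<ge> 0"
        using v N by (auto simp: ext_const_def)
    next
      fix T :: "nat set set" assume T: "finite T" "card T \<le> M * ?D"
      then show "(\<Sum>x\<in>ext_set n L R \<kappa>. (v / ?N) ^ card (snd x - T)) \<le> ext_const L M * v ^ ?D * ?N ^ \<kappa>"
        by (intro ext_set_sum_le n v) auto
    qed
    then have "measure_pmf.prob ?P (?A R \<kappa>) \<le> (ext_const L M * v ^ ?D * ?N ^ \<kappa> / (?N ^ \<kappa> * u)) ^ M"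
      by (rule prob_moment_le) (use u N in auto)
    also have "ext_const L M * v ^ ?D * ?N ^ \<kappa> / (?N ^ \<kappa> * u) = ext_const L M * v ^ ?D / u"
      using N u by (simp add: field_simps)
    finally show ?thesis .
  qed
  have b0: "?b \<ge> 0" using v u by (simp add: ext_const_def)
  have sub: "{es. survives G i es \<and> \<not> ext_ok n L u (set es)} \<subseteq> (\<Union>R\<in>?RS. \<Union>\<kappa>\<le>L. ?A R \<kappa>)"
  proof
    fix es assume es: "es \<in> {es. survives G i es \<and> \<not> ext_ok n L u (set es)}"
    then obtain R \<kappa> where R: "R \<subseteq> {1..n}" "\<kappa> \<le> L" "?X R \<kappa> (set es) > ?N ^ \<kappa> * u"
      by (auto simp: ext_ok_def not_le)
    have "card R \<le> L"
    proof (rule ccontr)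
      assume "\<not> card R \<le> L"
      then have "ext_set n L R \<kappa> = {}" using ext_set_root by blast
      then have "?X R \<kappa> (set es) = 0" by simp
      moreover have "?N ^ \<kappa> * u \<ge> 0" using u by simp
      ultimately show False using R by linarith
    qed
    then show "es \<in> (\<Union>R\<in>?RS. \<Union>\<kappa>\<le>L. ?A R \<kappa>)" 
      using R(1,2) less_imp_le[OF R(3)] es by blast
  qed
  have "measure_pmf.prob ?P {es. survives G i es \<and> \<not> ext_ok n L u (set es)}
      \<le> measure_pmf.prob ?P (\<Union>R\<in>?RS. \<Union>\<kappa>\<le>L. ?A R \<kappa>)"
    using sub by (intro measure_pmf.finite_measure_mono) simp_all
  also have "\<dots> \<le> (\<Sum>R\<in>?RS. measure_pmf.prob ?P (\<Union>\<kappa>\<le>L. ?A R \<kappa>))"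
    by (rule measure_pmf.finite_measure_subadditive_finite) simp_all
  also have "\<dots> \<le> (\<Sum>R\<in>?RS. \<Sum>\<kappa>\<le>L. measure_pmf.prob ?P (?A R \<kappa>))"
    by (intro sum_mono measure_pmf.finite_measure_subadditive_finite) simp_all
  also have "\<dots> \<le> (\<Sum>R\<in>?RS. \<Sum>\<kappa>\<le>L. ?b)" by (intro sum_mono one)
  also have "\<dots> = real (card ?RS) * (real (L + 1) * ?b)" by simp
  also have "\<dots> \<le> real (L + 1) * ?N ^ L * (real (L + 1) * ?b)"
    using card_small_subsets_le[OF n, of L] b0 by (intro mult_right_mono) auto
  finally show ?thesis .
qed

section \<open>Minimal configurations\<close>

text \<open>The members of \<FF> seen through their triples alone. Minimality is turned into an
  inequality: a proper subset with at least |U| - 2 triples would contain one with exactly |U| - 2.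
  The set \<open>U\<close> may have isolated vertices and may be the whole vertex set.\<close>

definition conf :: "nat \<Rightarrow> nat set set \<Rightarrow> bool" where
  "conf l F \<longleftrightarrow> finite (\<Union>F) \<and> (\<forall>e\<in>F. card e = 3) \<and> 6 \<le> card (\<Union>F) \<and> card (\<Union>F) \<le> l \<and>
     card F + 2 = card (\<Union>F) \<and>
     (\<forall>J U. J \<subset> F \<and> \<Union>J \<subseteq> U \<and> U \<subseteq> \<Union>F \<and> 4 \<le> card U \<longrightarrow> card J + 3 \<le> card U)"

lemma conf_finite: "conf l F \<Longrightarrow> finite F"
  unfolding conf_def using finite_UnionD by blast

lemma conf_basic:
  assumes "conf l F"
  shows "finite (\<Union>F)" "finite F" "6 \<le> card (\<Union>F)" "card (\<Union>F) \<le> l" "card F + 2 = card (\<Union>F)"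
  using assms conf_finite[OF assms] unfolding conf_def by simp_all

lemma conf_dense:
  "conf l F \<Longrightarrow> J \<subset> F \<Longrightarrow> \<Union>J \<subseteq> U \<Longrightarrow> U \<subseteq> \<Union>F \<Longrightarrow> 4 \<le> card U \<Longrightarrow> card J + 3 \<le> card U"
  unfolding conf_def by blast

lemma conf_edge_finite: "conf l F \<Longrightarrow> e \<in> F \<Longrightarrow> finite e \<and> card e = 3 \<and> e \<subseteq> \<Union>F"
  unfolding conf_def by (metis Union_upper card.infinite zero_neq_numeral)

lemma card3_Un_ge:
  assumes "card e = 3" "card f = 3" "e \<noteq> f" shows "4 \<le> card (e \<union> f)"
proof -
  have fin: "finite e" "finite f" using assms by (metis card.infinite zero_neq_numeral)+
  have "e \<subset> e \<union> f" using assms fin by (metis card_seteq le_sup_iff order_refl psubsetI sup_ge1 sup_ge2)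
  then have "card e < card (e \<union> f)" using fin by (intro psubset_card_mono) auto
  then show ?thesis using assms by simp
qed

text \<open>A configuration properly inside another one would be too dense a part of it.\<close>

lemma conf_antichain:
  assumes "conf l F" "conf l F'" "F' \<subseteq> F" shows "F' = F"
proof (rule ccontr)
  assume "F' \<noteq> F"
  then have "F' \<subset> F" using assms by blast
  then have "card F' + 3 \<le> card (\<Union>F')"
    using assms(3) conf_basic(3)[OF assms(2)] by (intro conf_dense[OF assms(1)]) auto
  then show False using conf_basic(5)[OF assms(2)] by simp
qed

text \<open>Two triples sharing a pair are two triples on four vertices, which minimality
  forbids.\<close>

lemma conf_linear:
  assumes F: "conf l F" and e: "e \<in> F" "f \<in> F" "e \<noteq> f" shows "card (e \<inter> f) \<le> 1"
proof (rule ccontr)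
  assume c: "\<not> card (e \<inter> f) \<le> 1"
  have fin: "finite e" "finite f" "card e = 3" "card f = 3" using conf_edge_finite[OF F] e by auto
  have "card (e \<union> f) + card (e \<inter> f) = 6" using fin card_Un_Int[of e f] by simp
  then have 4: "card (e \<union> f) = 4" using c card3_Un_ge[of e f] fin e by simp
  have "card F \<ge> 4" using conf_basic[OF F] by simp
  then have "card {e, f} \<noteq> card F" using e by simp
  then have "{e, f} \<noteq> F" by metis
  then have "{e, f} \<subset> F" using e by auto
  then have "card {e, f} + 3 \<le> card (e \<union> f)"
    using 4 e by (intro conf_dense[OF F]) auto
  then show False using 4 e by simp
qed

text \<open>Minimality is silent about fewer than four vertices. There the trivial bounds take over:
  three vertices carry at most one triple and two carry none.\<close>

lemma conf_edges_inside:
  assumes F: "conf l F" and X: "\<not> \<Union>F \<subseteq> X"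
  shows "4 \<le> card (\<Union>F \<inter> X) \<Longrightarrow> card {e \<in> F. e \<subseteq> X} + 3 \<le> card (\<Union>F \<inter> X)"
    and "card (\<Union>F \<inter> X) \<le> 3 \<Longrightarrow> card {e \<in> F. e \<subseteq> X} \<le> 1"
    and "card (\<Union>F \<inter> X) \<le> 2 \<Longrightarrow> card {e \<in> F. e \<subseteq> X} = 0"
proof -
  have fin: "finite (\<Union>F \<inter> X)" using conf_basic[OF F] by simp
  show "card {e \<in> F. e \<subseteq> X} + 3 \<le> card (\<Union>F \<inter> X)" if "4 \<le> card (\<Union>F \<inter> X)"
    using that X by (intro conf_dense[OF F]) auto
  have eq: "e = \<Union>F \<inter> X \<and> card (\<Union>F \<inter> X) = 3" if c: "card (\<Union>F \<inter> X) \<le> 3" and e: "e \<in> F" "e \<subseteq> X" for e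
  proof -
    have "e \<subseteq> \<Union>F \<inter> X" "card e = 3" using conf_edge_finite[OF F e(1)] e by auto
    then show ?thesis using c fin by (metis card_mono card_seteq order_antisym)
  qed
  show "card {e \<in> F. e \<subseteq> X} \<le> 1" if "card (\<Union>F \<inter> X) \<le> 3"
  proof -
    have "{e \<in> F. e \<subseteq> X} \<subseteq> {\<Union>F \<inter> X}" using eq[OF that] by blast
    then show ?thesis using card_mono[of "{\<Union>F \<inter> X}"] by fastforce
  qed
  show "card {e \<in> F. e \<subseteq> X} = 0" if "card (\<Union>F \<inter> X) \<le> 2"
  proof -
    have "{e \<in> F. e \<subseteq> X} = {}"
    proof (rule ccontr)
      assume "{e \<in> F. e \<subseteq> X} \<noteq> {}"
      then obtain e where "e \<in> F" "e \<subseteq> X" by auto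
      then have "card (\<Union>F \<inter> X) = 3" using eq that by auto
      then show False using that by simp
    qed
    then show ?thesis by (metis card.empty)
  qed
qed

lemma conf_split_edges:
  assumes F: "conf l F"
  shows "card {e \<in> F. e \<subseteq> X} + card {e \<in> F. \<not> e \<subseteq> X} = card F"
proof -
  have "card F = card ({e \<in> F. e \<subseteq> X} \<union> {e \<in> F. \<not> e \<subseteq> X})"
    by (rule arg_cong[where f = card]) blast
  also have "\<dots> = card {e \<in> F. e \<subseteq> X} + card {e \<in> F. \<not> e \<subseteq> X}"
    by (rule card_Un_disjoint) (use conf_finite[OF F] in auto)
  finally show ?thesis by simp
qed

text \<open>The total is |V| - 2 triples and at most |U \<inter> V| - 3 of them lie inside a proper
  part with at least four vertices. Hence the new vertices are outnumbered by the new triples, and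
  each triple costs 1/n; this surplus is the source of the saved factor n.\<close>

lemma conf_edges_outside:
  assumes F: "conf l F"
  shows "3 \<le> card (\<Union>F \<inter> U) \<Longrightarrow> card (\<Union>F - U) \<le> card {e \<in> F. \<not> e \<subseteq> U}"
    and "4 \<le> card (\<Union>F \<inter> U) \<Longrightarrow> \<not> \<Union>F \<subseteq> U \<Longrightarrow> card (\<Union>F - U) + 1 \<le> card {e \<in> F. \<not> e \<subseteq> U}"
proof -
  have fin: "finite (\<Union>F)" and cF: "card F + 2 = card (\<Union>F)" using conf_basic[OF F] by simp_all
  have d: "card (\<Union>F - U) + card (\<Union>F \<inter> U) = card (\<Union>F)"
    using fin card_Int_Diff[of "\<Union>F" U] by simp
  note s = conf_split_edges[OF F, of U]
  show 2: "card (\<Union>F - U) + 1 \<le> card {e \<in> F. \<not> e \<subseteq> U}"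
    if "4 \<le> card (\<Union>F \<inter> U)" "\<not> \<Union>F \<subseteq> U"
    using conf_edges_inside(1)[OF F that(2,1)] d s cF by linarith
  show "card (\<Union>F - U) \<le> card {e \<in> F. \<not> e \<subseteq> U}" if 3: "3 \<le> card (\<Union>F \<inter> U)"
  proof (cases "\<Union>F \<subseteq> U")
    case True
    then have "\<Union>F - U = {}" by blast
    then show ?thesis by (metis card.empty le0)
  next
    case False
    then show ?thesis
      using 2 conf_edges_inside(2)[OF F False] 3 d s cF by (cases "4 \<le> card (\<Union>F \<inter> U)") linarith+
  qed
qed

text \<open>A minimal configuration cannot be glued together along at most three vertices. If both
  parts have at least four vertices, they carry at most |V| + 3 - 6 triples in all, one too few;
  smaller parts carry even less.\<close>

lemma conf_two_parts:
  assumes F: "conf l F" and cov: "\<And>e. e \<in> F \<Longrightarrow> e \<subseteq> X \<or> e \<subseteq> Y"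
    and I: "card (\<Union>F \<inter> X \<inter> Y) \<le> 3"
  shows "\<Union>F \<subseteq> X \<or> \<Union>F \<subseteq> Y"
proof (rule ccontr)
  assume "\<not> ?thesis"
  then have X: "\<not> \<Union>F \<subseteq> X" and Y: "\<not> \<Union>F \<subseteq> Y" by auto
  have fin: "finite (\<Union>F)" and cF: "card F + 2 = card (\<Union>F)" "card (\<Union>F) \<ge> 6"
    using conf_basic[OF F] by simp_all
  let ?x = "card (\<Union>F \<inter> X)" and ?y = "card (\<Union>F \<inter> Y)" and ?i = "card (\<Union>F \<inter> X \<inter> Y)"
  let ?J = "card {e \<in> F. e \<subseteq> X}" and ?K = "card {e \<in> F. e \<subseteq> Y}"
  have un: "(\<Union>F \<inter> X) \<union> (\<Union>F \<inter> Y) = \<Union>F" using cov by blast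
  have int: "(\<Union>F \<inter> X) \<inter> (\<Union>F \<inter> Y) = \<Union>F \<inter> X \<inter> Y" by blast
  have xy: "?x + ?y = card (\<Union>F) + ?i"
    using card_Un_Int[of "\<Union>F \<inter> X" "\<Union>F \<inter> Y"] fin unfolding un int by simp
  have "F = {e \<in> F. e \<subseteq> X} \<union> {e \<in> F. e \<subseteq> Y}" using cov by auto
  then have JK: "card F \<le> ?J + ?K" by (metis card_Un_le)
  have ix: "?i < ?x"
  proof (rule psubset_card_mono)
    show "\<Union>F \<inter> X \<inter> Y \<subset> \<Union>F \<inter> X" using un Y by blast
  qed (use fin in auto)
  have iy: "?i < ?y"
  proof (rule psubset_card_mono)
    show "\<Union>F \<inter> X \<inter> Y \<subset> \<Union>F \<inter> Y" using un X by blast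
  qed (use fin in auto)
  note x = conf_edges_inside[OF F X] and y = conf_edges_inside[OF F Y]
  consider "?x \<ge> 4" "?y \<ge> 4" | "?x \<le> 3" "?y \<le> 3" | "?x = 3" "?y \<ge> 4" | "?x \<le> 2" "?y \<ge> 4"
    | "?y = 3" "?x \<ge> 4" | "?y \<le> 2" "?x \<ge> 4" by linarith
  then show False
  proof cases
    case 1
    then show ?thesis using x(1) y(1) xy JK cF I by linarith
  next
    case 2
    then show ?thesis using x(2) y(2) JK cF by linarith
  next
    case 3
    then show ?thesis using x(2) y(1) JK cF xy ix by linarith
  next
    case 4
    then show ?thesis using x(3) y(1) JK cF xy ix by linarith
  next
    case 5
    then show ?thesis using x(1) y(2) JK cF xy iy by linarith
  next
    case 6
    then show ?thesis using x(1) y(3) JK cF xy iy by linarith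
  qed
qed

text \<open>
  A second configuration brings at least one triple more than new vertices, unless all its
  vertices are already there; then \<open>conf_two_parts\<close> supplies a triple that is not.
\<close>

lemma conf_pair_edges_outside:
  assumes F: "conf l F" and F': "conf l F'" and ne: "F \<noteq> F'"
    and f: "f \<in> F" "f \<subseteq> U" and h: "h \<in> F" "h \<in> F'" "h \<noteq> f"
    and h': "h' \<in> F'" "h' \<noteq> h" "h' \<subseteq> U \<union> \<Union>F" and nU: "\<not> \<Union>F \<subseteq> U"
  shows "card ((\<Union>F \<union> \<Union>F') - U) + 1 \<le> card {e \<in> F \<union> F'. \<not> e \<subseteq> U}"
proof -
  let ?V = "\<Union>F" and ?V' = "\<Union>F'"
  let ?O = "{e \<in> F. \<not> e \<subseteq> U}" and ?O' = "{e \<in> F'. \<not> e \<subseteq> U \<union> ?V}"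
  let ?E = "{e \<in> F' - F. e \<subseteq> U \<union> ?V \<and> \<not> e \<subseteq> U}"
  have fin: "finite ?V" "finite ?V'" "finite F" "finite F'"
    using conf_basic[OF F] conf_basic[OF F'] by simp_all
  have "(?V \<union> ?V') - U = (?V - U) \<union> (?V' - (U \<union> ?V))" by blast
  then have "card ((?V \<union> ?V') - U) = card (?V - U) + card (?V' - (U \<union> ?V))"
    using fin by (simp only:) (rule card_Un_disjoint, auto)
  \<comment> \<open>Three disjoint classes of triples: those of F leaving U, those of F' leaving U
    and F, and those which F' adds without new vertices. The surplus triple may come from any of
    them.\<close>
  moreover have "card ?O + card ?O' + card ?E \<le> card {e \<in> F \<union> F'. \<not> e \<subseteq> U}"
  proof -
    have d: "(?O \<union> ?O') \<inter> ?E = {}" "?O \<inter> ?O' = {}" by blast+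
    have "card ?O + card ?O' + card ?E = card ((?O \<union> ?O') \<union> ?E)"
      using d fin by (simp add: card_Un_disjoint)
    also have "\<dots> \<le> card {e \<in> F \<union> F'. \<not> e \<subseteq> U}"
      using fin by (intro card_mono) auto
    finally show ?thesis .
  qed
  moreover have c3: "3 \<le> card (?V \<inter> U)"
  proof -
    have "card f \<le> card (?V \<inter> U)" using f fin by (intro card_mono) auto
    then show ?thesis using conf_edge_finite[OF F f(1)] by simp
  qed
  moreover have c4: "4 \<le> card (?V' \<inter> (U \<union> ?V))"
  proof -
    have "card (h \<union> h') \<le> card (?V' \<inter> (U \<union> ?V))" using h h' fin by (intro card_mono) auto
    moreover have "4 \<le> card (h \<union> h')"
      using h h' conf_edge_finite[OF F'] by (intro card3_Un_ge) auto
    ultimately show ?thesis by simp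
  qed
  moreover note o1 = conf_edges_outside(1)[OF F c3]
  moreover have o2: "card (?V' - (U \<union> ?V)) \<le> card ?O'"
    using conf_edges_outside(1)[OF F', of "U \<union> ?V"] c4 by linarith
  moreover consider "\<not> ?V' \<subseteq> U \<union> ?V" | "?V' \<subseteq> U \<union> ?V" "4 \<le> card (?V \<inter> U)"
    | "?V' \<subseteq> U \<union> ?V" "card (?V \<inter> U) \<le> 3" by linarith
  then have "card (?V - U) + card (?V' - (U \<union> ?V)) + 1 \<le> card ?O + card ?O' + card ?E"
  proof cases
    case 1
    then show ?thesis using conf_edges_outside(2)[OF F' c4] o1 by linarith
  next
    case 2
    then show ?thesis using conf_edges_outside(2)[OF F _ nU] o2 by linarith
  next
    case 3
    have Vf: "?V \<inter> U = f"
    proof -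
      have "f \<subseteq> ?V \<inter> U" using f by auto
      then show ?thesis
        using 3 conf_edge_finite[OF F f(1)] fin by (metis card_seteq finite_Int)
    qed
    \<comment> \<open>Here F meets U in f only, and F' has no vertex of its own. If F' added no
      triple either, each of its triples would lie in U or in V; the overlap is too small for a
      gluing, so F' sits inside V because of h. Its triples inside U then equal f, so F' is
      contained in F and hence equal to it.\<close>
    have "?E \<noteq> {}"
    proof
      assume E: "?E = {}"
      have cov: "e \<subseteq> ?V \<or> e \<subseteq> U" if "e \<in> F'" for e using E that 3 by blast
      have "card (?V' \<inter> ?V \<inter> U) \<le> 3"
        using 3 fin card_mono[of "?V \<inter> U" "?V' \<inter> ?V \<inter> U"] by force
      from conf_two_parts[OF F' cov this] have "?V' \<subseteq> ?V \<or> ?V' \<subseteq> U" by auto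
      moreover have "\<not> h \<subseteq> U"
      proof
        assume "h \<subseteq> U"
        then have "h \<subseteq> f" using h Vf by auto
        then show False using h conf_edge_finite[OF F f(1)] conf_edge_finite[OF F h(1)]
          by (metis card_subset_eq)
      qed
      ultimately have V'V: "?V' \<subseteq> ?V" using h by auto
      have "F' \<subseteq> F"
      proof
        fix e assume e: "e \<in> F'"
        show "e \<in> F"
        proof (rule ccontr)
          assume "e \<notin> F"
          then have "e \<subseteq> U" using E e 3 by blast
          then have "e \<subseteq> f" using e V'V Vf by auto
          then have "e = f" using conf_edge_finite[OF F f(1)] conf_edge_finite[OF F' e]
            by (metis card_subset_eq)
          then show False using \<open>e \<notin> F\<close> f by simp
        qed
      qed
      then show False using conf_antichain[OF F F'] ne by simp
    qed
    then have "card ?E \<ge> 1" using fin by (simp add: Suc_le_eq card_gt_0_iff)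
    then show ?thesis using o1 o2 by linarith
  qed
  ultimately show ?thesis by linarith
qed

lemma card_le_fibres:
  assumes "finite B" "f ` A \<subseteq> B" "finite A" "\<And>b. b \<in> B \<Longrightarrow> card {a \<in> A. f a = b} \<le> c"
  shows "card A \<le> c * card B"
proof -
  have "A = (\<Union>b\<in>B. {a \<in> A. f a = b})" using assms by auto
  then have "card A \<le> (\<Sum>b\<in>B. card {a \<in> A. f a = b})"
    using card_UN_le[OF assms(1), of "\<lambda>b. {a \<in> A. f a = b}"] by simp
  also have "\<dots> \<le> (\<Sum>b\<in>B. c)" by (intro sum_mono assms)
  finally show ?thesis by (simp add: mult.commute)
qed

lemma ext_okD:
  assumes "ext_ok n L u H" "R \<subseteq> {1..n}" "\<kappa> \<le> L"
  shows "real (card {x \<in> ext_set n L R \<kappa>. snd x \<subseteq> H}) \<le> real n ^ \<kappa> * u"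
  using assms unfolding ext_ok_def by blast

text \<open>Each of the \<open>s\<close> triples outside the root that may be missing from
  \<open>H\<close> is worth a factor n. The four root vertices yield one triple more than new
  vertices, which lowers the exponent to s - 1.\<close>

definition conf_singles :: "nat \<Rightarrow> nat \<Rightarrow> nat set set \<Rightarrow> nat set \<Rightarrow> nat \<Rightarrow> nat set set set" where
  "conf_singles l n H R s = {F. conf l F \<and> F \<subseteq> [{1..n}]\<^bsup>3\<^esup> \<and> 4 \<le> card (\<Union>F \<inter> R) \<and>
     card {e \<in> F - H. \<not> e \<subseteq> R} \<le> s}"

text \<open>The shape of all overcounts involving two copies: they share a triple h besides the root
  triple f. The triple h' ensures that F' has at least four vertices in the root and F, and by the
  last condition F' has no missing triples beyond those of F and of the root.\<close>

definition conf_pairs ::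
  "nat \<Rightarrow> nat \<Rightarrow> nat set set \<Rightarrow> nat set \<Rightarrow> nat set \<Rightarrow> nat \<Rightarrow> (nat set set \<times> nat set set) set" where
  "conf_pairs l n H R f s = {(F, F'). conf l F \<and> conf l F' \<and> F \<subseteq> [{1..n}]\<^bsup>3\<^esup> \<and> F' \<subseteq> [{1..n}]\<^bsup>3\<^esup> \<and>
     F \<noteq> F' \<and> f \<in> F \<and>
     (\<exists>h h'. h \<in> F \<and> h \<in> F' \<and> h \<noteq> f \<and> h' \<in> F' \<and> h' \<noteq> h \<and> h' \<subseteq> R \<union> \<Union>F) \<and>
     card {e \<in> (F \<union> F') - H. \<not> e \<subseteq> R} \<le> s \<and> (\<forall>e\<in>F' - H. e \<in> F \<or> e \<subseteq> R)}"

lemma finite_conf_singles: "finite (conf_singles l n H R s)"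
  by (rule finite_subset[of _ "Pow (Pow {1..n})"]) (auto simp: conf_singles_def nsets_def)

lemma finite_conf_pairs: "finite (conf_pairs l n H R f s)"
  by (rule finite_subset[of _ "Pow (Pow {1..n}) \<times> Pow (Pow {1..n})"])
    (auto simp: conf_pairs_def nsets_def)

lemma nsets3_Union: "F \<subseteq> [{1..n}]\<^bsup>3\<^esup> \<Longrightarrow> \<Union>F \<subseteq> {1..n}"
  by (auto simp: nsets_def)

lemma conf_in_nsets: "conf l F \<Longrightarrow> \<Union>F \<subseteq> V \<Longrightarrow> F \<subseteq> [V]\<^bsup>3\<^esup>"
  using conf_edge_finite by (fastforce simp: nsets_def)

lemma card_le_filter_Un:
  assumes "finite B" "finite C" "{e \<in> A. P e} \<subseteq> B \<union> C" shows "card {e \<in> A. P e} \<le> card B + card C"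
  using card_mono[OF _ assms(3)] card_Un_le[of B C] assms by force

text \<open>The triples present in \<open>H\<close>, on the vertices of F and the root, form an
  extension with \<kappa> = s - 1: \<open>conf_edges_outside\<close> supplies one triple more than
  new vertices, and at most \<open>s\<close> of these are missing. An extension determines F up to a
  bounded number of choices.\<close>

lemma card_conf_singles_le:
  assumes ext: "ext_ok n L u H" and R: "R \<subseteq> {1..n}" "card R \<le> 6" and s: "1 \<le> s" "s \<le> L"
    and L: "2 * l + 6 \<le> L"
  shows "real (card (conf_singles l n H R s)) \<le> 2 ^ (2 ^ L) * real n ^ (s - 1) * u"
proof -
  let ?A = "conf_singles l n H R s"
  let ?B = "{x \<in> ext_set n L R (s - 1). snd x \<subseteq> H}"
  let ?f = "\<lambda>F. (R \<union> \<Union>F, F \<inter> H)"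
  have "?f ` ?A \<subseteq> ?B"
  proof
    fix x assume "x \<in> ?f ` ?A"
    then obtain F where x: "x = ?f F" and F: "conf l F" "F \<subseteq> [{1..n}]\<^bsup>3\<^esup>" "4 \<le> card (\<Union>F \<inter> R)"
      "card {e \<in> F - H. \<not> e \<subseteq> R} \<le> s" by (auto simp: conf_singles_def)
    let ?V = "R \<union> \<Union>F"
    have fin: "finite (\<Union>F)" "finite F" "card (\<Union>F) \<le> l" using conf_basic[OF F(1)] by simp_all
    have finR: "finite R" using R finite_subset by blast
    have "card ?V \<le> card U + (s - 1) + card {e \<in> F \<inter> H. \<not> e \<subseteq> U}" if U: "R \<subseteq> U" "U \<subseteq> ?V" for U
    proof -
      have "?V = U \<union> (\<Union>F - U)" using U by blast
      then have cV: "card ?V \<le> card U + card (\<Union>F - U)" by (metis card_Un_le)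
      have c4: "4 \<le> card (\<Union>F \<inter> U)"
        using F(3) card_mono[of "\<Union>F \<inter> U" "\<Union>F \<inter> R"] fin U by fastforce
      show ?thesis
      proof (cases "\<Union>F \<subseteq> U")
        case True
        then have "\<Union>F - U = {}" by blast
        then have "card (\<Union>F - U) = 0" by (simp only: card.empty)
        then show ?thesis using cV by linarith
      next
        case False
        have "card {e \<in> F. \<not> e \<subseteq> U} \<le> card {e \<in> F \<inter> H. \<not> e \<subseteq> U} + card {e \<in> F - H. \<not> e \<subseteq> R}"
          using fin U by (intro card_le_filter_Un) auto
        then show ?thesis using conf_edges_outside(2)[OF F(1) c4 False] cV F(4) s by linarith
      qed
    qed
    moreover have "card ?V \<le> L" using card_Un_le[of R "\<Union>F"] fin R L by linarith
    moreover have "?V \<subseteq> {1..n}" using R nsets3_Union[OF F(2)] by blast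
    moreover have "F \<inter> H \<subseteq> [?V]\<^bsup>3\<^esup>" using conf_in_nsets[OF F(1), of ?V] by blast
    ultimately show "x \<in> ?B" by (auto simp: x ext_set_def)
  qed
  moreover have "card {a \<in> ?A. ?f a = b} \<le> 2 ^ (2 ^ L)" if b: "b \<in> ?B" for b
  proof -
    have V: "card (fst b) \<le> L" "finite (fst b)"
      using b by (auto simp: ext_set_def dest: finite_subset)
    have "{a \<in> ?A. ?f a = b} \<subseteq> Pow (Pow (fst b))" by auto
    then have "card {a \<in> ?A. ?f a = b} \<le> card (Pow (Pow (fst b)))" using V by (intro card_mono) auto
    also have "\<dots> \<le> 2 ^ (2 ^ L)" using V by (simp add: card_Pow)
    finally show ?thesis .
  qed
  ultimately have "card ?A \<le> 2 ^ (2 ^ L) * card ?B"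
    using finite_ext_set finite_conf_singles by (intro card_le_fibres) auto
  then have "real (card ?A) \<le> real (2 ^ (2 ^ L) * card ?B)" by (rule of_nat_mono)
  also have "\<dots> = 2 ^ (2 ^ L) * real (card ?B)" by simp
  also have "\<dots> \<le> 2 ^ (2 ^ L) * (real n ^ (s - 1) * u)"
    using ext_okD[OF ext R(1), of "s - 1"] s by (intro mult_left_mono) auto
  finally show ?thesis by (simp add: mult_ac)
qed

text \<open>As for single configurations, with \<open>conf_pair_edges_outside\<close> supplying the
  surplus triple.\<close>

lemma card_conf_pairs_le:
  assumes ext: "ext_ok n L u H" and R: "R \<subseteq> {1..n}" "card R \<le> 6" "f \<subseteq> R" and s: "1 \<le> s" "s \<le> L"
    and L: "2 * l + 6 \<le> L"
  shows "real (card (conf_pairs l n H R f s)) \<le> (2 ^ (2 ^ L))\<^sup>2 * real n ^ (s - 1) * u"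
proof -
  let ?A = "conf_pairs l n H R f s"
  let ?B = "{x \<in> ext_set n L R (s - 1). snd x \<subseteq> H}"
  let ?f = "\<lambda>(F, F'). (R \<union> (\<Union>F \<union> \<Union>F'), (F \<union> F') \<inter> H)"
  have "?f ` ?A \<subseteq> ?B"
  proof
    fix x assume "x \<in> ?f ` ?A"
    then obtain z where "x = ?f z" "z \<in> ?A" by (elim imageE)
    then obtain F F' where x: "x = ?f (F, F')" and m: "(F, F') \<in> ?A" by (cases z) simp
    have F: "conf l F" "F \<subseteq> [{1..n}]\<^bsup>3\<^esup>" and F': "conf l F'" "F' \<subseteq> [{1..n}]\<^bsup>3\<^esup>"
      and ne: "F \<noteq> F'" and f: "f \<in> F"
      and ex: "\<exists>h h'. h \<in> F \<and> h \<in> F' \<and> h \<noteq> f \<and> h' \<in> F' \<and> h' \<noteq> h \<and> h' \<subseteq> R \<union> \<Union>F"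
      and cs: "card {e \<in> (F \<union> F') - H. \<not> e \<subseteq> R} \<le> s"
      and out: "\<forall>e\<in>F' - H. e \<in> F \<or> e \<subseteq> R"
      using m unfolding conf_pairs_def by simp_all
    from ex obtain h h' where h: "h \<in> F" "h \<in> F'" "h \<noteq> f"
      and h': "h' \<in> F'" "h' \<noteq> h" "h' \<subseteq> R \<union> \<Union>F" by blast
    let ?W = "\<Union>F \<union> \<Union>F'"
    let ?V = "R \<union> ?W"
    have fin: "finite (\<Union>F)" "finite F" "card (\<Union>F) \<le> l" "finite (\<Union>F')" "finite F'" "card (\<Union>F') \<le> l"
      using conf_basic[OF F(1)] conf_basic[OF F'(1)] by simp_all
    have finR: "finite R" using R finite_subset by blast
    have "card ?V \<le> card U + (s - 1) + card {e \<in> (F \<union> F') \<inter> H. \<not> e \<subseteq> U}"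
      if U: "R \<subseteq> U" "U \<subseteq> ?V" for U
    proof -
      have "?V = U \<union> (?W - U)" using U by blast
      then have cV: "card ?V \<le> card U + card (?W - U)" by (metis card_Un_le)
      have h'U: "h' \<subseteq> U \<union> \<Union>F" using h' U by blast
      show ?thesis
      proof (cases "\<Union>F \<subseteq> U")
        \<comment> \<open>If U already contains F, only F' remains to be paid for. No surplus is
          available now, but none is needed: by the last condition in \<open>conf_pairs\<close> all
          triples of F' leaving U are present in \<open>H\<close>.\<close>
        case True
        have "card (h \<union> h') \<le> card (\<Union>F' \<inter> U)" using h h'(1) h'U True fin by (intro card_mono) auto
        moreover have "4 \<le> card (h \<union> h')"
          using h h' conf_edge_finite[OF F'(1)] by (intro card3_Un_ge) auto
        ultimately have "card (\<Union>F' - U) \<le> card {e \<in> F'. \<not> e \<subseteq> U}"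
          by (intro conf_edges_outside(1)[OF F'(1)]) linarith
        also have "\<dots> \<le> card {e \<in> (F \<union> F') \<inter> H. \<not> e \<subseteq> U}"
        proof (rule card_mono)
          show "{e \<in> F'. \<not> e \<subseteq> U} \<subseteq> {e \<in> (F \<union> F') \<inter> H. \<not> e \<subseteq> U}"
          proof
            fix e assume e: "e \<in> {e \<in> F'. \<not> e \<subseteq> U}"
            then have "e \<notin> F" "\<not> e \<subseteq> R" using True U by auto
            then have "e \<in> H" using out e by blast
            then show "e \<in> {e \<in> (F \<union> F') \<inter> H. \<not> e \<subseteq> U}" using e by auto
          qed
        qed (use fin in auto)
        finally have "card (\<Union>F' - U) \<le> card {e \<in> (F \<union> F') \<inter> H. \<not> e \<subseteq> U}" .
        moreover have "?W - U = \<Union>F' - U" using True by blast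
        ultimately have "card (?W - U) \<le> card {e \<in> (F \<union> F') \<inter> H. \<not> e \<subseteq> U}" by (simp only:)
        then show ?thesis using cV by linarith
      next
        case False
        have "card {e \<in> F \<union> F'. \<not> e \<subseteq> U}
            \<le> card {e \<in> (F \<union> F') \<inter> H. \<not> e \<subseteq> U} + card {e \<in> (F \<union> F') - H. \<not> e \<subseteq> R}"
          using fin U by (intro card_le_filter_Un) auto
        moreover have "card (?W - U) + 1 \<le> card {e \<in> F \<union> F'. \<not> e \<subseteq> U}"
          using R(3) U by (intro conf_pair_edges_outside[OF F(1) F'(1) ne f _ h h'(1,2) h'U False]) auto
        ultimately show ?thesis using cV cs s by linarith
      qed
    qed
    moreover have "card ?V \<le> L"
      using card_Un_le[of R ?W] card_Un_le[of "\<Union>F" "\<Union>F'"] fin R L by linarith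
    moreover have "?V \<subseteq> {1..n}" using R nsets3_Union[OF F(2)] nsets3_Union[OF F'(2)] by blast
    moreover have "(F \<union> F') \<inter> H \<subseteq> [?V]\<^bsup>3\<^esup>"
      using conf_in_nsets[OF F(1), of ?V] conf_in_nsets[OF F'(1), of ?V] by blast
    ultimately show "x \<in> ?B" by (auto simp: x ext_set_def)
  qed
  moreover have "card {a \<in> ?A. ?f a = b} \<le> (2 ^ (2 ^ L))\<^sup>2" if b: "b \<in> ?B" for b
  proof -
    have V: "card (fst b) \<le> L" "finite (fst b)"
      using b by (auto simp: ext_set_def dest: finite_subset)
    have "{a \<in> ?A. ?f a = b} \<subseteq> Pow (Pow (fst b)) \<times> Pow (Pow (fst b))" by auto
    then have "card {a \<in> ?A. ?f a = b} \<le> card (Pow (Pow (fst b)) \<times> Pow (Pow (fst b)))"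
      using V by (intro card_mono) auto
    also have "\<dots> = (2 ^ (2 ^ card (fst b)))\<^sup>2"
      using V by (simp add: card_Pow power2_eq_square card_cartesian_product)
    also have "\<dots> \<le> (2 ^ (2 ^ L))\<^sup>2" using V by (intro power_mono power_increasing) auto
    finally show ?thesis .
  qed
  ultimately have "card ?A \<le> (2 ^ (2 ^ L))\<^sup>2 * card ?B"
    using finite_ext_set finite_conf_pairs by (intro card_le_fibres) auto
  then have "real (card ?A) \<le> real ((2 ^ (2 ^ L))\<^sup>2 * card ?B)" by (rule of_nat_mono)
  also have "\<dots> = (2 ^ (2 ^ L))\<^sup>2 * real (card ?B)" by simp
  also have "\<dots> \<le> (2 ^ (2 ^ L))\<^sup>2 * (real n ^ (s - 1) * u)"
    using ext_okD[OF ext R(1), of "s - 1"] s by (intro mult_left_mono) auto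
  finally show ?thesis by (simp add: mult_ac)
qed

section \<open>Copies of forbidden hypergraphs\<close>

lemma hg_iso_refl: "hg_iso F F"
  unfolding hg_iso_def by (rule exI[of _ id]) simp

lemma hg_iso_trans:
  assumes "hg_iso F G" "hg_iso G K" shows "hg_iso F K"
proof -
  obtain \<phi> where p: "bij_betw \<phi> (fst F) (fst G)" "(\<lambda>e. \<phi> ` e) ` snd F = snd G"
    using assms(1) unfolding hg_iso_def by blast
  obtain \<psi> where q: "bij_betw \<psi> (fst G) (fst K)" "(\<lambda>e. \<psi> ` e) ` snd G = snd K"
    using assms(2) unfolding hg_iso_def by blast
  have "bij_betw (\<psi> \<circ> \<phi>) (fst F) (fst K)" by (rule bij_betw_trans[OF p(1) q(1)])
  moreover have "(\<lambda>e. (\<psi> \<circ> \<phi>) ` e) ` snd F = snd K"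
    unfolding q(2)[symmetric] p(2)[symmetric] by (simp only: image_image o_def)
  ultimately show ?thesis unfolding hg_iso_def by blast
qed

lemma hg_iso_sym:
  assumes "hg_iso F G" and sub: "\<Union>(snd F) \<subseteq> fst F" shows "hg_iso G F"
proof -
  from assms obtain \<phi> where b: "bij_betw \<phi> (fst F) (fst G)" and e: "(\<lambda>e. \<phi> ` e) ` snd F = snd G"
    unfolding hg_iso_def by blast
  let ?\<psi> = "inv_into (fst F) \<phi>"
  have inv: "?\<psi> ` \<phi> ` d = d" if "d \<in> snd F" for d
    using that sub b by (intro inv_into_image_cancel) (auto simp: bij_betw_def)
  have "(\<lambda>e. ?\<psi> ` e) ` snd G = (\<lambda>d. ?\<psi> ` \<phi> ` d) ` snd F" by (simp add: e[symmetric] image_image)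
  also have "\<dots> = snd F" using inv by (simp cong: image_cong)
  finally have "(\<lambda>e. ?\<psi> ` e) ` snd G = snd F" .
  then show ?thesis unfolding hg_iso_def using bij_betw_inv_into[OF b] by blast
qed

lemma labelled_Fplus_edges: "F \<in> labelled_Fplus l \<Longrightarrow> \<Union>(snd F) \<subseteq> fst F"
  by (auto simp: labelled_Fplus_def three_uniform_def nsets_def)

lemma finite_labelled_Fplus: "finite (labelled_Fplus l)"
proof (rule finite_subset)
  show "labelled_Fplus l \<subseteq> ((\<lambda>v. {..<v}) ` {..l}) \<times> Pow (Pow {..<l})"
  proof
    fix F assume F: "F \<in> labelled_Fplus l"
    then obtain v where v: "fst F = {..<v}" "num_verts F \<le> l" by (auto simp: labelled_Fplus_def)
    then have "v \<le> l" by simp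
    moreover have "\<Union>(snd F) \<subseteq> {..<v}" using labelled_Fplus_edges[OF F] v by simp
    then have "snd F \<subseteq> Pow {..<l}" using \<open>v \<le> l\<close> by fastforce
    ultimately show "F \<in> ((\<lambda>v. {..<v}) ` {..l}) \<times> Pow (Pow {..<l})"
      using v(1) by (cases F) auto
  qed
qed auto

definition iso_rel :: "nat \<Rightarrow> (hypergraph \<times> hypergraph) set" where
  "iso_rel l = {(F, G). F \<in> labelled_Fplus l \<and> G \<in> labelled_Fplus l \<and> hg_iso F G}"

lemma equiv_iso_rel: "equiv (labelled_Fplus l) (iso_rel l)"
proof (rule equivI)
  show "refl_on (labelled_Fplus l) (iso_rel l)" by (auto simp: refl_on_def iso_rel_def hg_iso_refl)
  show "sym (iso_rel l)" 
    unfolding sym_def iso_rel_def mem_Collect_eq prod.case using hg_iso_sym labelled_Fplus_edges by blast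
  show "trans (iso_rel l)" 
    unfolding trans_def iso_rel_def mem_Collect_eq prod.case using hg_iso_trans by blast
qed (auto simp: iso_rel_def)

lemma Fplus_some:
  assumes "F \<in> Fplus l"
  obtains C where "C \<in> labelled_Fplus l // iso_rel l" "F \<in> C" "F = (SOME F. F \<in> C)"
proof -
  from assms obtain C where C: "C \<in> labelled_Fplus l // iso_rel l" and F: "F = (SOME F. F \<in> C)"
    unfolding Fplus_def iso_rel_def by blast
  have "C \<noteq> {}" using in_quotient_imp_non_empty[OF equiv_iso_rel C] .
  then have "F \<in> C" unfolding F by (rule some_in_eq[THEN iffD2])
  then show ?thesis using C F that by blast
qed

lemma Fplus_labelled: "F \<in> Fplus l \<Longrightarrow> F \<in> labelled_Fplus l"
  by (metis Fplus_some equiv_iso_rel in_quotient_imp_subset subsetD)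

lemma Fplus_iso_eq:
  assumes F: "F \<in> Fplus l" "G \<in> Fplus l" and iso: "hg_iso F G" shows "F = G"
proof -
  obtain C where C: "C \<in> labelled_Fplus l // iso_rel l" "F \<in> C" "F = (SOME F. F \<in> C)"
    by (rule Fplus_some[OF F(1)])
  obtain D where D: "D \<in> labelled_Fplus l // iso_rel l" "G \<in> D" "G = (SOME F. F \<in> D)"
    by (rule Fplus_some[OF F(2)])
  have "(F, G) \<in> iso_rel l" using F iso Fplus_labelled by (auto simp: iso_rel_def)
  then have "C = D" using C D by (intro quotient_eqI[OF equiv_iso_rel]) auto
  then show ?thesis using C D by simp
qed

lemma finite_Ffam: "finite (Ffam l)"
proof -
  have "Ffam l \<subseteq> labelled_Fplus l" using Fplus_labelled by (auto simp: Ffam_def)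
  then show ?thesis using finite_labelled_Fplus finite_subset by blast
qed

lemma Ffam_labelled: "F \<in> Ffam l \<Longrightarrow> F \<in> labelled_Fplus l"
  using Fplus_labelled by (auto simp: Ffam_def)

lemma Ffam_props:
  assumes "F \<in> Ffam l"
  obtains v where "fst F = {..<v}" "6 \<le> v" "v \<le> l" "num_triples F + 2 = v" "snd F \<subseteq> [{..<v}]\<^bsup>3\<^esup>" "finite (snd F)"
proof -
  have F: "F \<in> labelled_Fplus l" "6 \<le> num_verts F" using assms Ffam_labelled by (auto simp: Ffam_def)
  then obtain v where v: "fst F = {..<v}" by (auto simp: labelled_Fplus_def)
  have e: "snd F \<subseteq> [{..<v}]\<^bsup>3\<^esup>" using F v by (auto simp: labelled_Fplus_def three_uniform_def)
  have fin: "finite (snd F)" using e by (rule finite_subset) (auto intro: finite_imp_finite_nsets)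
  show ?thesis
    by (rule that[of v]) (use F v e fin in \<open>simp_all add: labelled_Fplus_def\<close>)
qed

lemma Ffam_minimal:
  assumes F: "F \<in> Ffam l" and "U \<subseteq> fst F" "J \<subseteq> snd F" "\<Union>J \<subseteq> U" "(U, J) \<noteq> F" "4 \<le> card U"
  shows "card J \<noteq> card U - 2"
proof
  assume c: "card J = card U - 2"
  have tu: "three_uniform F" using Ffam_labelled[OF F] by (simp add: labelled_Fplus_def)
  then have "J \<subseteq> [U]\<^bsup>3\<^esup>" "finite U"
    using assms(2-4) by (auto simp: nsets_def three_uniform_def intro: finite_subset)
  then have "subhypergraph (U, J) F"
    using assms by (simp add: subhypergraph_def three_uniform_def)
  then have "\<exists>J. subhypergraph J F \<and> J \<noteq> F \<and> 4 \<le> num_verts J \<and> num_triples J = num_verts J - 2"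
    using assms c by (intro exI[of _ "(U, J)"]) simp
  then show False using Ffam_labelled[OF F] unfolding labelled_Fplus_def by blast
qed

lemma Ffam_Union:
  assumes F: "F \<in> Ffam l" shows "\<Union>(snd F) = fst F"
proof -
  obtain v where v: "fst F = {..<v}" "6 \<le> v" "num_triples F + 2 = v" "snd F \<subseteq> [{..<v}]\<^bsup>3\<^esup>" "finite (snd F)"
    by (rule Ffam_props[OF F])
  note no = Ffam_minimal[OF F, unfolded v(1)]
  have sub: "\<Union>(snd F) \<subseteq> {..<v}" using v(4) by (auto simp: nsets_def)
  have "x \<in> \<Union>(snd F)" if x: "x < v" for x
  proof (rule ccontr)
    assume nx: "x \<notin> \<Union>(snd F)"
    have "snd F \<noteq> {}" using v by auto
    then obtain d where d: "d \<in> snd F" by auto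
    have "card (snd F - {d}) \<noteq> card ({..<v} - {x}) - 2"
    proof (rule no)
      show "({..<v} - {x}, snd F - {d}) \<noteq> F" using x v(1) by (metis Diff_iff fst_conv insertCI lessThan_iff)
      show "\<Union>(snd F - {d}) \<subseteq> {..<v} - {x}" using sub nx by blast
    qed (use x v in auto)
    then show False using d x v by simp
  qed
  then show ?thesis using sub v(1) by auto
qed

lemma image_image_inj_on:
  assumes "inj_on \<phi> V" "\<Union>A \<subseteq> V" shows "inj_on (\<lambda>e. \<phi> ` e) A"
proof (rule inj_onI)
  fix d e assume "d \<in> A" "e \<in> A" and eq: "\<phi> ` d = \<phi> ` e"
  then have "d \<subseteq> V" "e \<subseteq> V" using assms by auto
  then show "d = e" using eq inj_on_image_eq_iff[OF assms(1)] by blast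
qed

lemma is_copy_conf:
  assumes F: "F \<in> Ffam l" and c: "is_copy F' F"
  shows "conf l F'" "card F' = num_triples F"
proof -
  obtain v where v: "fst F = {..<v}" "6 \<le> v" "v \<le> l" "num_triples F + 2 = v" "snd F \<subseteq> [{..<v}]\<^bsup>3\<^esup>" "finite (snd F)"
    by (rule Ffam_props[OF F])
  note no = Ffam_minimal[OF F, unfolded v(1)]
  from c obtain \<phi> where b: "bij_betw \<phi> (\<Union>F') {..<v}" and e: "(\<lambda>e. \<phi> ` e) ` F' = snd F"
    unfolding is_copy_def hg_iso_def using v(1) by auto
  have inj: "inj_on \<phi> (\<Union>F')" using b by (simp add: bij_betw_def)
  have injE: "inj_on (\<lambda>e. \<phi> ` e) F'" using inj by (rule image_image_inj_on) simp
  have fin: "finite (\<Union>F')" using bij_betw_finite[OF b] by simp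
  then have finF: "finite F'" by (rule finite_UnionD)
  have cV: "card (\<Union>F') = v" using bij_betw_same_card[OF b] by simp
  show cF: "card F' = num_triples F" using card_image[OF injE] e by simp
  have c3: "card d = 3" if d: "d \<in> F'" for d
  proof -
    have "card (\<phi> ` d) = 3" using d e v(5) by (auto simp: nsets_def)
    moreover have "inj_on \<phi> d" using inj d by (meson Union_upper inj_on_subset)
    ultimately show ?thesis by (simp add: card_image)
  qed
  have dense: "card J + 3 \<le> card U" if J: "J \<subset> F'" and U: "\<Union>J \<subseteq> U" "U \<subseteq> \<Union>F'" "4 \<le> card U" for J U
  proof (rule ccontr)
    assume "\<not> card J + 3 \<le> card U"
    then have "card U - 2 \<le> card J" by simp
    then obtain J0 where J0: "J0 \<subseteq> J" "card J0 = card U - 2" by (meson obtain_subset_with_card_n)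
    have J0F: "J0 \<subseteq> F'" using J0 J by blast
    let ?K = "(\<lambda>e. \<phi> ` e) ` J0"
    have cU: "card (\<phi> ` U) = card U" using inj U by (intro card_image) (rule inj_on_subset)
    have cK: "card ?K = card J0" using injE J0F by (intro card_image) (rule inj_on_subset)
    have "card ?K \<noteq> card (\<phi> ` U) - 2"
    proof (rule no)
      show "\<phi> ` U \<subseteq> {..<v}"
        using image_mono[OF U(2), of \<phi>] bij_betw_imp_surj_on[OF b] by simp
      show "?K \<subseteq> snd F" using J0F e by auto
      show "\<Union>?K \<subseteq> \<phi> ` U" using U J0 by blast
      show "(\<phi> ` U, ?K) \<noteq> F"
      proof
        assume eq: "(\<phi> ` U, ?K) = F"
        then have "?K = (\<lambda>e. \<phi> ` e) ` F'" using e by (metis snd_conv)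
        then have "J0 = F'" using injE J0F by (metis inj_on_image_eq_iff order_refl)
        then show False using J0 J by blast
      qed
      show "4 \<le> card (\<phi> ` U)" using cU U by simp
    qed
    then show False using cU cK J0 by simp
  qed
  have "card F' + 2 = card (\<Union>F')" using cV cF v(4) by simp
  then show "conf l F'" unfolding conf_def using fin c3 cV v dense by simp
qed

lemma is_copy_unique:
  assumes F: "F \<in> Ffam l" "G \<in> Ffam l" and c: "is_copy F' F" "is_copy F' G" shows "F = G"
proof -
  have "hg_iso F (\<Union>F', F')" using c(1) unfolding is_copy_def by (rule hg_iso_sym) simp
  then have "hg_iso F G" using c(2) unfolding is_copy_def by (rule hg_iso_trans)
  then show ?thesis using F by (intro Fplus_iso_eq) (auto simp: Ffam_def)
qed

lemma finite_hg_aut: "finite (fst F) \<Longrightarrow> finite (hg_aut F)"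
  by (rule finite_subset[OF _ finite_permutations]) (auto simp: hg_aut_def)

lemma hg_aut_card_pos: "finite (fst F) \<Longrightarrow> card (hg_aut F) > 0"
proof -
  assume "finite (fst F)"
  moreover have "id \<in> hg_aut F" by (simp add: hg_aut_def permutes_id)
  ultimately show ?thesis using finite_hg_aut card_gt_0_iff by blast
qed

text \<open>Extensional functions, so that maps agreeing on \<open>A\<close> are counted
  once.\<close>

definition inj_maps :: "'a set \<Rightarrow> 'b set \<Rightarrow> ('a \<Rightarrow> 'b) set" where
  "inj_maps A B = {f \<in> A \<rightarrow>\<^sub>E B. inj_on f A}"

lemma finite_inj_maps: "finite A \<Longrightarrow> finite B \<Longrightarrow> finite (inj_maps A B)"
  unfolding inj_maps_def by (rule finite_subset[of _ "A \<rightarrow>\<^sub>E B"]) (auto intro: finite_PiE)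

lemma card_inj_maps:
  assumes "finite A" "finite B"
  shows "card (inj_maps A B) = (\<Prod>i<card A. card B - i)"
  using card_inj_on_subset_funcset[OF assms subset_refl] by (simp add: inj_maps_def lessThan_atLeast0)

lemma card_inj_maps_bounds:
  assumes "finite A" "finite B"
  shows "card (inj_maps A B) \<le> card B ^ card A" "(card B - card A) ^ card A \<le> card (inj_maps A B)"
proof -
  have "(\<Prod>i<card A. card B - i) \<le> (\<Prod>i<card A. card B)" by (rule prod_mono) auto
  then show "card (inj_maps A B) \<le> card B ^ card A" using assms by (simp add: card_inj_maps)
  have "(\<Prod>i<card A. card B - card A) \<le> (\<Prod>i<card A. card B - i)" by (rule prod_mono) auto
  then show "(card B - card A) ^ card A \<le> card (inj_maps A B)" using assms by (simp add: card_inj_maps)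
qed

text \<open>Such an injection consists of one of the 3! bijections from d to e and an injection of
  the remaining vertices that avoids e.\<close>

lemma card_inj_maps_onto_edge:
  assumes V: "finite V" "d \<subseteq> V" "card d = 3" and B: "finite B" "e \<subseteq> B" "card e = 3"
  shows "card {\<phi> \<in> inj_maps V B. \<phi> ` d = e} = 6 * card (inj_maps (V - d) (B - e))"
proof -
  have fin: "finite d" "finite e" using V B finite_subset by blast+
  let ?S = "{\<phi> \<in> inj_maps V B. \<phi> ` d = e}" and ?T = "inj_maps d e \<times> inj_maps (V - d) (B - e)"
  let ?f = "\<lambda>\<phi>. (restrict \<phi> d, restrict \<phi> (V - d))"
  let ?g = "\<lambda>(\<alpha>, \<beta>) x. if x \<in> d then \<alpha> x else \<beta> x"
  have "bij_betw ?f ?S ?T"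
  proof (rule bij_betwI[where g = ?g])
    show "?f \<in> ?S \<rightarrow> ?T"
    proof
      fix \<phi> assume \<phi>: "\<phi> \<in> ?S"
      then have inj: "inj_on \<phi> V" and fn: "\<And>x. x \<in> V \<Longrightarrow> \<phi> x \<in> B" and im: "\<phi> ` d = e"
        by (auto simp: inj_maps_def)
      have "\<phi> x \<notin> e" if "x \<in> V - d" for x
      proof
        assume "\<phi> x \<in> e"
        then obtain y where "y \<in> d" "\<phi> x = \<phi> y" using im by auto
        then show False using inj that V by (auto simp: inj_on_def)
      qed
      moreover have "inj_on \<phi> d" "inj_on \<phi> (V - d)"
        using inj V(2) by (auto intro: inj_on_subset)
      moreover have "\<And>x. x \<in> d \<Longrightarrow> \<phi> x \<in> e" using im by blast
      ultimately show "?f \<phi> \<in> ?T"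
        using fn by (simp add: inj_maps_def inj_on_restrict_eq)
    qed
    show "?g \<in> ?T \<rightarrow> ?S"
    proof
      fix z assume "z \<in> ?T"
      then obtain \<alpha> \<beta> where z: "z = (\<alpha>, \<beta>)" and a: "\<alpha> \<in> d \<rightarrow>\<^sub>E e" "inj_on \<alpha> d"
        and b: "\<beta> \<in> (V - d) \<rightarrow>\<^sub>E (B - e)" "inj_on \<beta> (V - d)" by (auto simp: inj_maps_def)
      let ?h = "\<lambda>x. if x \<in> d then \<alpha> x else \<beta> x"
      have ha: "\<And>x. x \<in> d \<Longrightarrow> ?h x \<in> e" and hb: "\<And>x. x \<in> V - d \<Longrightarrow> ?h x \<in> B - e"
        using a(1) b(1) by (auto simp: PiE_iff)
      have "?h \<in> V \<rightarrow>\<^sub>E B"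
      proof (rule PiE_I)
        fix x assume "x \<in> V"
        then show "?h x \<in> B" using ha[of x] hb[of x] B(2) by (cases "x \<in> d") auto
      next
        fix x assume "x \<notin> V"
        then show "?h x = undefined" using V(2) b(1) by (auto simp: PiE_iff extensional_def)
      qed
      moreover have "inj_on ?h V"
      proof (rule inj_onI)
        fix x y assume xy: "x \<in> V" "y \<in> V" "?h x = ?h y"
        show "x = y"
        proof (cases "x \<in> d \<longleftrightarrow> y \<in> d")
          case True
          then show ?thesis using xy a(2) b(2) by (auto simp: inj_on_def split: if_splits)
        next
          case False
          then show ?thesis using xy ha[of x] hb[of y] ha[of y] hb[of x] by auto
        qed
      qed
      moreover have "?h ` d = e"
      proof -
        have "?h ` d = \<alpha> ` d" by auto
        also have "\<dots> = e"
          using a fin V B by (intro card_seteq) (auto simp: card_image)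
        finally show ?thesis .
      qed
      ultimately show "?g z \<in> ?S" using z by (simp add: inj_maps_def)
    qed
    show "?g (?f \<phi>) = \<phi>" if "\<phi> \<in> ?S" for \<phi>
    proof
      fix x show "?g (?f \<phi>) x = \<phi> x"
        using that V by (auto simp: inj_maps_def PiE_iff extensional_def restrict_def)
    qed
    show "?f (?g z) = z" if "z \<in> ?T" for z
    proof -
      obtain \<alpha> \<beta> where z: "z = (\<alpha>, \<beta>)" by (cases z)
      have a: "\<alpha> \<in> d \<rightarrow>\<^sub>E e" and b: "\<beta> \<in> (V - d) \<rightarrow>\<^sub>E (B - e)"
        using that unfolding z inj_maps_def by simp_all
      have "restrict (?g z) d = \<alpha>" using z a by (intro ext) (auto simp: PiE_iff extensional_def restrict_def)
      moreover have "restrict (?g z) (V - d) = \<beta>"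
        using z b by (intro ext) (auto simp: PiE_iff extensional_def restrict_def)
      ultimately show ?thesis using z by simp
    qed
  qed
  then have "card ?S = card ?T" by (rule bij_betw_same_card)
  also have "\<dots> = card (inj_maps d e) * card (inj_maps (V - d) (B - e))"
    by (rule card_cartesian_product)
  also have "card (inj_maps d e) = 6"
    using fin V B by (simp add: card_inj_maps lessThan_nat_numeral numeral_3_eq_3)
  finally show ?thesis .
qed

lemma card_eq_sum_fibres:
  assumes "finite A" "finite B" "f ` A \<subseteq> B"
  shows "card A = (\<Sum>b\<in>B. card {a \<in> A. f a = b})"
  using sum.group[OF assms, of "\<lambda>_. 1 :: nat"] by simp

text \<open>Each copy of \<open>F\<close> is the image of \<open>F\<close> under exactly \<open>|Aut F|\<close> injections.\<close>

lemma card_copies_through_edge: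
  assumes F: "F \<in> Ffam l" and e: "e \<in> [{1..n}]\<^bsup>3\<^esup>"
  shows "card {F' \<in> copies n F. e \<in> F'} * card (hg_aut F)
    = num_triples F * (6 * card (inj_maps {..<num_triples F - 1} {..<n - 3}))"
proof -
  obtain v where v: "fst F = {..<v}" "6 \<le> v" "v \<le> l" "num_triples F + 2 = v" "snd F \<subseteq> [{..<v}]\<^bsup>3\<^esup>" "finite (snd F)"
    by (rule Ffam_props[OF F])
  let ?V = "{..<v}" and ?B = "{1..n}"
  have UV: "\<Union>(snd F) = ?V" using Ffam_Union[OF F] v by simp
  let ?im = "\<lambda>\<phi>. (\<lambda>d. \<phi> ` d) ` snd F"
  let ?I = "{\<phi> \<in> inj_maps ?V ?B. e \<in> ?im \<phi>}"
  let ?C = "{F' \<in> copies n F. e \<in> F'}"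
  have finI: "finite ?I" by (simp add: finite_inj_maps)
  have im_C: "?im ` ?I \<subseteq> ?C"
  proof
    fix F' assume "F' \<in> ?im ` ?I"
    then obtain \<phi> where \<phi>: "inj_on \<phi> ?V" "\<phi> ` ?V \<subseteq> ?B" "e \<in> F'" "F' = ?im \<phi>" by (auto simp: inj_maps_def)
    have "\<Union>(?im \<phi>) = \<phi> ` \<Union>(snd F)" by blast
    then have U: "\<Union>F' = \<phi> ` ?V" using \<phi>(4) UV by simp
    have "F' \<subseteq> [?B]\<^bsup>3\<^esup>"
    proof
      fix d' assume "d' \<in> F'"
      then obtain d where d: "d \<in> snd F" "d' = \<phi> ` d" using \<phi> by auto
      then have "d \<subseteq> ?V" "finite d" "card d = 3" using v(5) by (auto simp: nsets_def)
      moreover then have "inj_on \<phi> d" using \<phi>(1) inj_on_subset by blast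
      ultimately show "d' \<in> [?B]\<^bsup>3\<^esup>" using d \<phi>(2) by (auto simp: nsets_def card_image)
    qed
    moreover have "hg_iso F (\<Union>F', F')"
      unfolding hg_iso_def using \<phi> U v(1) by (intro exI[of _ \<phi>]) (auto simp: bij_betw_def)
    then have "is_copy F' F" unfolding is_copy_def
      by (rule hg_iso_sym) (simp add: UV v(1))
    ultimately show "F' \<in> ?C" using \<phi> by (simp add: copies_def)
  qed
  have fibre: "card {\<phi> \<in> ?I. ?im \<phi> = F'} = card (hg_aut F)" if F': "F' \<in> ?C" for F'
  proof -
    have cp: "is_copy F' F" and sB: "\<Union>F' \<subseteq> ?B" and eF': "e \<in> F'"
      using F' by (auto simp: copies_def nsets_def)
    have "hg_iso F (\<Union>F', F')" using cp unfolding is_copy_def by (rule hg_iso_sym) simp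
    then obtain \<psi> where \<psi>: "bij_betw \<psi> ?V (\<Union>F')" "?im \<psi> = F'"
      unfolding hg_iso_def v(1) fst_conv snd_conv by blast
    have injp: "inj_on \<psi> ?V" and imp: "\<psi> ` ?V = \<Union>F'" using \<psi>(1) by (auto simp: bij_betw_def)
    \<comment> \<open>Fix one parametrisation \<psi> of the copy. Every other one differs from it by
      a unique automorphism; \<open>restrict\<close> brings the composition into the extensional
      form required by \<open>inj_maps\<close>.\<close>
    let ?h = "\<lambda>\<pi>. restrict (\<psi> \<circ> \<pi>) ?V"
    have sub_V: "d \<subseteq> ?V" if "d \<in> snd F" for d using that UV by auto
    have im_restrict: "?im (restrict f ?V) = ?im f" for f :: "nat \<Rightarrow> nat"
      by (rule image_cong[OF refl], rule image_cong[OF refl]) (use sub_V in auto)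
    have "bij_betw ?h (hg_aut F) {\<phi> \<in> ?I. ?im \<phi> = F'}"
      unfolding bij_betw_def
    proof
      show "inj_on ?h (hg_aut F)"
      proof (rule inj_onI)
        fix \<pi> \<rho> assume p: "\<pi> \<in> hg_aut F" "\<rho> \<in> hg_aut F" and eq: "?h \<pi> = ?h \<rho>"
        have perm: "\<pi> permutes ?V" "\<rho> permutes ?V" using p v(1) by (auto simp: hg_aut_def)
        show "\<pi> = \<rho>"
        proof
          fix x show "\<pi> x = \<rho> x"
          proof (cases "x \<in> ?V")
            case True
            then have "\<psi> (\<pi> x) = \<psi> (\<rho> x)" using fun_cong[OF eq, of x] by simp
            moreover have "\<pi> x \<in> ?V" "\<rho> x \<in> ?V" using True perm by (meson permutes_in_image)+
            ultimately show ?thesis using injp by (meson inj_onD)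
          next
            case False
            then show ?thesis using perm by (metis permutes_not_in)
          qed
        qed
      qed
      show "?h ` hg_aut F = {\<phi> \<in> ?I. ?im \<phi> = F'}"
      proof (intro equalityI subsetI)
        fix \<phi> assume "\<phi> \<in> ?h ` hg_aut F"
        then obtain \<pi> where \<pi>: "\<pi> \<in> hg_aut F" "\<phi> = ?h \<pi>" by auto
        have perm: "\<pi> permutes ?V" and aut: "?im \<pi> = snd F" using \<pi> v(1) by (auto simp: hg_aut_def)
        have "?im \<phi> = ?im (\<psi> \<circ> \<pi>)" unfolding \<pi>(2) by (rule im_restrict)
        also have "\<dots> = (\<lambda>d. \<psi> ` d) ` ?im \<pi>" by (simp only: image_image o_def)
        also have "\<dots> = F'" using aut \<psi>(2) by simp
        finally have imF: "?im \<phi> = F'" .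
        have "inj_on (\<psi> \<circ> \<pi>) ?V"
          using perm injp by (intro comp_inj_on) (auto simp: permutes_image permutes_inj_on)
        then have "inj_on \<phi> ?V" unfolding \<pi>(2) by (simp add: inj_on_def)
        moreover have "\<psi> (\<pi> x) \<in> ?B" if "x \<in> ?V" for x
        proof -
          have "\<pi> x \<in> ?V" using that perm by (meson permutes_in_image)
          then have "\<psi> (\<pi> x) \<in> \<Union>F'" using imp by blast
          then show ?thesis using sB by blast
        qed
        then have "\<phi> \<in> ?V \<rightarrow>\<^sub>E ?B" unfolding \<pi>(2) by (intro PiE_I) (simp_all add: restrict_def)
        ultimately show "\<phi> \<in> {\<phi> \<in> ?I. ?im \<phi> = F'}"
          using imF eF' by (simp add: inj_maps_def)
      next
        fix \<phi> assume "\<phi> \<in> {\<phi> \<in> ?I. ?im \<phi> = F'}"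
        then have \<phi>: "\<phi> \<in> ?V \<rightarrow>\<^sub>E ?B" "inj_on \<phi> ?V" "?im \<phi> = F'" by (auto simp: inj_maps_def)
        have imV: "\<phi> ` ?V = \<psi> ` ?V"
        proof -
          have "\<Union>(?im \<phi>) = \<phi> ` \<Union>(snd F)" by blast
          then show ?thesis using \<phi>(3) imp UV by simp
        qed
        let ?inv = "inv_into ?V \<psi>"
        define \<pi> where "\<pi> = (\<lambda>x. if x \<in> ?V then ?inv (\<phi> x) else x)"
        have psi_pi: "\<psi> (\<pi> x) = \<phi> x" if "x \<in> ?V" for x
        proof -
          have "\<phi> x \<in> \<psi> ` ?V" using that imV by blast
          then show ?thesis using that by (simp add: \<pi>_def f_inv_into_f)
        qed
        have "\<pi> ` ?V \<subseteq> ?V"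
        proof
          fix y assume "y \<in> \<pi> ` ?V"
          then obtain x where x: "x \<in> ?V" "y = \<pi> x" by auto
          then have "\<phi> x \<in> \<psi> ` ?V" using imV by blast
          then show "y \<in> ?V" using x inv_into_into[of "\<phi> x" \<psi> ?V] by (simp add: \<pi>_def)
        qed
        moreover have "inj_on \<pi> ?V"
          by (rule inj_onI) (metis psi_pi \<phi>(2) inj_onD)
        ultimately have "bij_betw \<pi> ?V ?V" by (simp add: bij_betw_def endo_inj_surj)
        then have perm: "\<pi> permutes ?V" by (rule bij_imp_permutes) (simp add: \<pi>_def)
        have "(\<lambda>d. \<psi> ` d) ` ?im \<pi> = ?im \<phi>"
          unfolding image_image by (intro image_cong refl) (use psi_pi sub_V in blast)
        also have "\<dots> = (\<lambda>d. \<psi> ` d) ` snd F" using \<phi>(3) \<psi>(2) by simp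
        finally have "?im \<pi> = snd F"
        proof (rule inj_on_image_eq_iff[THEN iffD1, rotated 3])
          show "inj_on (\<lambda>d. \<psi> ` d) (Pow ?V)" using injp by (rule image_image_inj_on) simp
          show "snd F \<subseteq> Pow ?V" using sub_V by blast
          show "?im \<pi> \<subseteq> Pow ?V"
          proof
            fix d' assume "d' \<in> ?im \<pi>"
            then obtain d where "d \<in> snd F" "d' = \<pi> ` d" by auto
            then show "d' \<in> Pow ?V" using sub_V[of d] \<open>\<pi> ` ?V \<subseteq> ?V\<close> by blast
          qed
        qed
        then have "\<pi> \<in> hg_aut F" using perm v(1) by (simp add: hg_aut_def)
        moreover have "\<phi> = ?h \<pi>"
        proof
          fix x show "\<phi> x = ?h \<pi> x" using psi_pi \<phi>(1) by (auto simp: PiE_iff extensional_def restrict_def)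
        qed
        ultimately show "\<phi> \<in> ?h ` hg_aut F" by blast
      qed
    qed
    then show ?thesis by (rule bij_betw_same_card[symmetric])
  qed
  have finC: "finite ?C"
  proof (rule finite_subset)
    show "?C \<subseteq> Pow (Pow ?B)" by (auto simp: copies_def nsets_def)
  qed simp
  have "card ?I = (\<Sum>F'\<in>?C. card {\<phi> \<in> ?I. ?im \<phi> = F'})"
    by (rule card_eq_sum_fibres[OF finI finC im_C])
  also have "\<dots> = (\<Sum>F'\<in>?C. card (hg_aut F))" by (rule sum.cong[OF refl fibre])
  also have "\<dots> = card ?C * card (hg_aut F)" by simp
  finally have c1: "card ?I = card ?C * card (hg_aut F)" .
  have "card ?I = (\<Sum>d\<in>snd F. card {\<phi> \<in> inj_maps ?V ?B. \<phi> ` d = e})"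
  proof -
    \<comment> \<open>The injections are sorted by the triple d that is sent onto e; this d is
      unique by injectivity.\<close>
    have "?I = (\<Union>d\<in>snd F. {\<phi> \<in> inj_maps ?V ?B. \<phi> ` d = e})" by auto
    then have "card ?I = card (\<Union>d\<in>snd F. {\<phi> \<in> inj_maps ?V ?B. \<phi> ` d = e})" by (rule arg_cong)
    also have "\<dots> = (\<Sum>d\<in>snd F. card {\<phi> \<in> inj_maps ?V ?B. \<phi> ` d = e})"
    proof (rule card_UN_disjoint)
      show "\<forall>d\<in>snd F. \<forall>d'\<in>snd F. d \<noteq> d' \<longrightarrow>
        {\<phi> \<in> inj_maps ?V ?B. \<phi> ` d = e} \<inter> {\<phi> \<in> inj_maps ?V ?B. \<phi> ` d' = e} = {}"
      proof (intro ballI impI)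
        fix d d' assume d: "d \<in> snd F" "d' \<in> snd F" "d \<noteq> d'"
        then have "d \<subseteq> ?V" "d' \<subseteq> ?V" using UV by auto
        then show "{\<phi> \<in> inj_maps ?V ?B. \<phi> ` d = e} \<inter> {\<phi> \<in> inj_maps ?V ?B. \<phi> ` d' = e} = {}"
          using d(3) inj_on_image_eq_iff by (fastforce simp: inj_maps_def)
      qed
    qed (simp_all add: v(6) finite_inj_maps)
    finally show ?thesis .
  qed
  also have "\<dots> = (\<Sum>d\<in>snd F. 6 * card (inj_maps {..<num_triples F - 1} {..<n - 3}))"
  proof (rule sum.cong[OF refl])
    fix d assume d: "d \<in> snd F"
    have d3: "d \<subseteq> ?V" "card d = 3" "finite d" using d v(5) by (auto simp: nsets_def)
    have e3: "e \<subseteq> ?B" "card e = 3" "finite e" using e by (auto simp: nsets_def)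
    have "card (?V - d) = num_triples F - 1" "card (?B - e) = n - 3"
      using d3 e3 v by (simp_all add: card_Diff_subset)
    then have "card (inj_maps (?V - d) (?B - e)) = card (inj_maps {..<num_triples F - 1} {..<n - 3})"
      by (simp add: card_inj_maps)
    then show "card {\<phi> \<in> inj_maps ?V ?B. \<phi> ` d = e} = 6 * card (inj_maps {..<num_triples F - 1} {..<n - 3})"
      using card_inj_maps_onto_edge[of ?V d ?B e] d3 e3 by simp
  qed
  also have "\<dots> = num_triples F * (6 * card (inj_maps {..<num_triples F - 1} {..<n - 3}))" by simp
  finally show ?thesis using c1 by simp
qed

text \<open>Gives the initial value of |W| for k = 0. The count is a falling factorial of n - 3 with
  e_F - 1 factors, all between n - v and n, and Bernoulli's inequality compares it with the power of
  n.\<close>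

lemma copies_through_edge_estimate:
  assumes F: "F \<in> Ffam l" and e: "e \<in> [{1..n}]\<^bsup>3\<^esup>" and n: "n \<ge> l"
  shows "\<bar>real (card {F' \<in> copies n F. e \<in> F'})
      - 6 * real (num_triples F) / real (card (hg_aut F)) * real n ^ (num_triples F - 1)\<bar>
    \<le> 6 * real l ^ 3 * real n ^ (num_triples F - 2)"
proof -
  obtain v where v: "fst F = {..<v}" "6 \<le> v" "v \<le> l" "num_triples F + 2 = v" by (rule Ffam_props[OF F])
  let ?E = "num_triples F" and ?a = "real (card (hg_aut F))"
  let ?m = "?E - 1"
  let ?J = "real (card (inj_maps {..<?m} {..<n - 3}))"
  have a1: "?a \<ge> 1" using hg_aut_card_pos[of F] v(1) by (simp add: Suc_le_eq)
  have nv: "v \<le> n" "n > 0" using n v by auto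
  have "real (card {F' \<in> copies n F. e \<in> F'}) * ?a = real ?E * (6 * ?J)"
    using arg_cong[OF card_copies_through_edge[OF F e], of real] by simp
  then have c: "real (card {F' \<in> copies n F. e \<in> F'}) = 6 * real ?E / ?a * ?J"
    using a1 by (simp add: field_simps)
  have up: "?J \<le> real n ^ ?m"
  proof -
    have "card (inj_maps {..<?m} {..<n - 3}) \<le> (n - 3) ^ ?m"
      using card_inj_maps_bounds(1)[of "{..<?m}" "{..<n - 3}"] by simp
    also have "\<dots> \<le> n ^ ?m" by (rule power_mono) auto
    finally show ?thesis by (metis of_nat_le_iff of_nat_power)
  qed
  have lo: "real n ^ ?m - real ?m * real v * real n ^ (?m - 1) \<le> ?J"
  proof -
    have "n - 3 - ?m = n - v" using v by simp
    then have "(n - v) ^ ?m \<le> card (inj_maps {..<?m} {..<n - 3})"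
      using card_inj_maps_bounds(2)[of "{..<?m}" "{..<n - 3}"] by simp
    then have "(real n - real v) ^ ?m \<le> ?J" using nv by (metis of_nat_diff of_nat_le_iff of_nat_power)
    moreover have "real n ^ ?m - real ?m * real v * real n ^ (?m - 1) \<le> (real n - real v) ^ ?m"
    proof -
      have "1 + real ?m * (- (real v / real n)) \<le> (1 + - (real v / real n)) ^ ?m"
        using nv by (intro Bernoulli_inequality) (simp add: divide_le_eq)
      then have "real n ^ ?m * (1 + real ?m * (- (real v / real n))) \<le> real n ^ ?m * (1 + - (real v / real n)) ^ ?m"
        by (intro mult_left_mono) auto
      also have "\<dots> = (real n - real v) ^ ?m"
        using nv by (simp add: power_mult_distrib[symmetric] right_diff_distrib)
      finally have le: "real n ^ ?m - real ?m * real v * (real n ^ ?m / real n) \<le> (real n - real v) ^ ?m"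
        by (simp add: algebra_simps)
      have eq: "real n ^ ?m / real n = real n ^ (?m - 1)"
        using nv v by (simp add: power_diff)
      show ?thesis using le unfolding eq .
    qed
    ultimately show ?thesis by linarith
  qed
  have "\<bar>real (card {F' \<in> copies n F. e \<in> F'}) - 6 * real ?E / ?a * real n ^ ?m\<bar>
      = 6 * real ?E / ?a * \<bar>?J - real n ^ ?m\<bar>"
    unfolding c right_diff_distrib[symmetric] abs_mult using a1 by simp
  also have "\<dots> \<le> (6 * real ?E) * (real ?m * real v * real n ^ (?m - 1))"
  proof (rule mult_mono)
    show "6 * real ?E / ?a \<le> 6 * real ?E" 
      using divide_left_mono[OF a1, of "6 * real ?E"] a1 by simp
    show "\<bar>?J - real n ^ ?m\<bar> \<le> real ?m * real v * real n ^ (?m - 1)" using up lo by linarith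
  qed auto
  also have "\<dots> \<le> (6 * real l) * (real l * real l * real n ^ (?m - 1))"
    using v by (intro mult_mono) auto
  also have "\<dots> = 6 * real l ^ 3 * real n ^ (?E - 2)"
    by (simp add: power3_eq_cube numeral_2_eq_2)
  finally show ?thesis .
qed

section \<open>One step of the process\<close>

lemma card_UN_le_const:
  assumes "finite A" "\<And>x. x \<in> A \<Longrightarrow> card (f x) \<le> c" shows "card (\<Union>x\<in>A. f x) \<le> c * card A"
proof -
  have "card (\<Union>x\<in>A. f x) \<le> (\<Sum>x\<in>A. card (f x))" using assms(1) by (rule card_UN_le)
  also have "\<dots> \<le> (\<Sum>x\<in>A. c)" using assms(2) by (rule sum_mono)
  finally show ?thesis by (simp add: mult.commute)
qed

lemma num_triples_ge: "F \<in> Ffam l \<Longrightarrow> 4 \<le> num_triples F \<and> num_triples F + 2 \<le> l"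
proof -
  assume "F \<in> Ffam l"
  then obtain v where "6 \<le> v" "v \<le> l" "num_triples F + 2 = v" by (rule Ffam_props)
  then show ?thesis by linarith
qed

text \<open>The counting in this section is deterministic: \<open>H\<close> is any set of triples,
  whether or not the process can reach it.\<close>

locale triple_state =
  fixes l n :: nat and H :: "nat set set"
  assumes H_sub: "H \<subseteq> [{1..n}]\<^bsup>3\<^esup>"
begin

abbreviation "Q \<equiv> available l n H"

definition closers :: "nat set \<Rightarrow> nat set set" where
  "closers f = {g \<in> Q. g \<noteq> f \<and> f \<notin> available l n (insert g H)}"

definition closing_copy :: "nat set \<Rightarrow> nat set \<Rightarrow> nat set set \<Rightarrow> bool" where
  "closing_copy f g F' \<longleftrightarrow> (\<exists>F\<in>Ffam l. is_copy F' F) \<and> f \<in> F' \<and> g \<in> F' \<and> F' - {f, g} \<subseteq> H"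

lemma finite_Q: "finite Q" by (rule finite_available)

lemma finite_closers: "finite (closers f)"
  unfolding closers_def using finite_Q by simp

lemma Q_D:
  assumes "f \<in> Q" shows "f \<in> [{1..n}]\<^bsup>3\<^esup>" "f \<subseteq> {1..n}" "finite f" "card f = 3" "f \<notin> H"
  using assms available_not_mem[OF assms] by (auto simp: available_def nsets_def)

text \<open>As f and g are both available, neither completes a forbidden copy on its own. A copy
  that appears when both are added must contain both.\<close>

lemma closed_iff:
  assumes f: "f \<in> Q" and g: "g \<in> Q" and ne: "f \<noteq> g"
  shows "f \<notin> available l n (insert g H) \<longleftrightarrow> 2 \<le> card (f \<inter> g) \<or> (\<exists>F'. closing_copy f g F')"
proof
  assume na: "f \<notin> available l n (insert g H)"
  show "2 \<le> card (f \<inter> g) \<or> (\<exists>F'. closing_copy f g F')"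
  proof (rule disjCI)
    assume nex: "\<nexists>F'. closing_copy f g F'"
    show "2 \<le> card (f \<inter> g)"
    proof (rule ccontr)
      assume "\<not> 2 \<le> card (f \<inter> g)"
      then have c1: "card (f \<inter> g) \<le> 1" by simp
      have f': "f \<in> [{1..n}]\<^bsup>3\<^esup>" "\<forall>h\<in>H. card (f \<inter> h) \<le> 1"
        "\<not> (\<exists>F\<in>Ffam l. \<exists>F'\<subseteq>insert f H. is_copy F' F)" using f unfolding available_def by blast+
      have g': "\<not> (\<exists>F\<in>Ffam l. \<exists>F'\<subseteq>insert g H. is_copy F' F)" using g unfolding available_def by blast
      have "\<exists>F\<in>Ffam l. \<exists>F'\<subseteq>insert f (insert g H). is_copy F' F"
        using na f'(1,2) c1 unfolding available_def by blast
      then obtain F F' where F: "F \<in> Ffam l" "F' \<subseteq> insert f (insert g H)" "is_copy F' F" by blast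
      have "f \<in> F'" using F g' by blast
      moreover have "g \<in> F'" using F f'(3) by blast
      ultimately have "closing_copy f g F'" using F unfolding closing_copy_def by blast
      then show False using nex by blast
    qed
  qed
next
  assume r: "2 \<le> card (f \<inter> g) \<or> (\<exists>F'. closing_copy f g F')"
  show "f \<notin> available l n (insert g H)"
  proof
    assume a: "f \<in> available l n (insert g H)"
    then have "card (f \<inter> g) \<le> 1" unfolding available_def by blast
    then obtain F' where "closing_copy f g F'" using r by auto
    then obtain F where "F \<in> Ffam l" "is_copy F' F" "F' \<subseteq> insert f (insert g H)"
      unfolding closing_copy_def by blast
    then show False using a unfolding available_def by blast
  qed
qed

lemma closing_copyD:
  assumes f: "f \<in> Q" and g: "g \<in> Q" and ne: "f \<noteq> g" and c: "closing_copy f g F'"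
  shows "conf l F'" "F' \<subseteq> [{1..n}]\<^bsup>3\<^esup>" "F' - H = {f, g}" "card (f \<inter> g) \<le> 1" "f \<in> F'" "g \<in> F'"
proof -
  obtain F where F: "F \<in> Ffam l" "is_copy F' F" and s: "f \<in> F'" "g \<in> F'" "F' - {f, g} \<subseteq> H"
    using c unfolding closing_copy_def by blast
  show cf: "conf l F'" by (rule is_copy_conf(1)[OF F])
  show "F' \<subseteq> [{1..n}]\<^bsup>3\<^esup>" using s H_sub Q_D(1)[OF f] Q_D(1)[OF g] by blast
  show "F' - H = {f, g}" using s Q_D(5)[OF f] Q_D(5)[OF g] by blast
  show "card (f \<inter> g) \<le> 1" by (rule conf_linear[OF cf s(1,2) ne])
  show "f \<in> F'" "g \<in> F'" using s by auto
qed

lemma closersD: "g \<in> closers f \<Longrightarrow> g \<in> Q \<and> g \<noteq> f"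
  unfolding closers_def by blast

lemma closers_cases:
  assumes f: "f \<in> Q" and g: "g \<in> closers f"
  obtains "2 \<le> card (f \<inter> g)" | F' where "closing_copy f g F'"
  using closed_iff[OF f] g unfolding closers_def by blast

lemma available_insert:
  assumes g: "g \<in> Q" shows "available l n (insert g H) = {f \<in> Q. f \<noteq> g \<and> g \<notin> closers f}"
proof (intro equalityI subsetI)
  fix f assume f: "f \<in> available l n (insert g H)"
  have "f \<in> Q" using f unfolding available_def by blast
  moreover have "f \<noteq> g" using f available_not_mem by blast
  moreover have "g \<notin> closers f" using f unfolding closers_def by blast
  ultimately show "f \<in> {f \<in> Q. f \<noteq> g \<and> g \<notin> closers f}" by blast
next
  fix f assume "f \<in> {f \<in> Q. f \<noteq> g \<and> g \<notin> closers f}"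
  then show "f \<in> available l n (insert g H)" using g unfolding closers_def by blast
qed

lemma Wset_D:
  assumes F: "F \<in> Ffam l" and W: "F' \<in> Wset l n H f F k" and k: "k \<le> num_triples F"
  shows "conf l F'" "F' \<subseteq> [{1..n}]\<^bsup>3\<^esup>" "F' - H = F' \<inter> Q" "card (F' \<inter> Q) = num_triples F - k"
    "f \<in> F'" "f \<in> Q" "card F' = num_triples F" "card (F' \<inter> H) = k" "is_copy F' F" "finite F'"
proof -
  have w: "F' \<subseteq> [{1..n}]\<^bsup>3\<^esup>" "is_copy F' F" "f \<in> F'" "f \<in> Q" "card (F' \<inter> Q) = num_triples F - k" "card (F' \<inter> H) = k"
    using W unfolding Wset_def copies_def by auto
  show cf: "conf l F'" and cF: "card F' = num_triples F" using is_copy_conf[OF F w(2)] by auto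
  show fin: "finite F'" using conf_basic(2)[OF cf] .
  have disj: "(F' \<inter> Q) \<inter> (F' \<inter> H) = {}" using Q_D(5) by blast
  have "card ((F' \<inter> Q) \<union> (F' \<inter> H)) = card F'"
    using card_Un_disjoint[OF _ _ disj] fin w(5,6) cF k by simp
  then have "(F' \<inter> Q) \<union> (F' \<inter> H) = F'" using fin by (intro card_subset_eq) auto
  then show "F' - H = F' \<inter> Q" using Q_D(5) by blast
qed (use assms in \<open>auto simp: Wset_def copies_def\<close>)

lemma finite_Wset: "finite (Wset l n H f F k)"
proof (rule finite_subset)
  show "Wset l n H f F k \<subseteq> Pow (Pow {1..n})" unfolding Wset_def copies_def nsets_def by blast
qed simp

lemma card_through_pair:
  assumes "u \<noteq> v"
  shows "card {g \<in> Q. {u, v} \<subseteq> g} = card (Yset l n H u v)"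
proof -
  have "bij_betw (\<lambda>z. {u, v, z}) (Yset l n H u v) {g \<in> Q. {u, v} \<subseteq> g}"
    unfolding bij_betw_def
  proof
    show "inj_on (\<lambda>z. {u, v, z}) (Yset l n H u v)"
    proof (rule inj_onI)
      fix z z' assume z: "z \<in> Yset l n H u v" "z' \<in> Yset l n H u v" and eq: "{u, v, z} = {u, v, z'}"
      have "z \<notin> {u, v}" "z' \<notin> {u, v}" using z by (simp_all add: Yset_def)
      then show "z = z'" using eq by blast
    qed
    show "(\<lambda>z. {u, v, z}) ` Yset l n H u v = {g \<in> Q. {u, v} \<subseteq> g}"
    proof (intro equalityI subsetI)
      fix g assume g: "g \<in> {g \<in> Q. {u, v} \<subseteq> g}"
      have g3: "card g = 3" "finite g" "g \<subseteq> {1..n}" using g Q_D by auto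
      have "card (g - {u, v}) = 1" using g g3 assms by (simp add: card_Diff_subset)
      then obtain z where z: "g - {u, v} = {z}" by (auto simp: card_1_singleton_iff)
      then have "g = {u, v, z}" using g by auto
      moreover have "z \<in> Yset l n H u v" using z g g3 calculation unfolding Yset_def by auto
      ultimately show "g \<in> (\<lambda>z. {u, v, z}) ` Yset l n H u v" by blast
    qed (auto simp: Yset_def)
  qed
  then show ?thesis by (rule bij_betw_same_card[symmetric])
qed

definition close_copies :: "nat set \<Rightarrow> nat set set set" where
  "close_copies f = (\<Union>F\<in>Ffam l. Wset l n H f F (num_triples F - 2))"

text \<open>With e_F - 2 triples in \<open>H\<close>, exactly two are available: f and a single
  further triple, which is the one that closes f.\<close>

lemma close_copies_iff:
  assumes f: "f \<in> Q"
  shows "F' \<in> close_copies f \<longleftrightarrow> (\<exists>g\<in>Q. g \<noteq> f \<and> closing_copy f g F')"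
proof
  assume "F' \<in> close_copies f"
  then obtain F where F: "F \<in> Ffam l" and W: "F' \<in> Wset l n H f F (num_triples F - 2)"
    unfolding close_copies_def by blast
  note D = Wset_D[OF F W diff_le_self]
  have "card (F' \<inter> Q) = 2" using D(4) num_triples_ge[OF F] by simp
  then have "card (F' \<inter> Q - {f}) = 1" using D(5,6) D(10) by simp
  then obtain g where g: "F' \<inter> Q - {f} = {g}" by (auto simp: card_1_singleton_iff)
  then have "g \<in> Q" "g \<noteq> f" "g \<in> F'" by auto
  moreover have "F' - {f, g} \<subseteq> H" using D(3) g by blast
  ultimately show "\<exists>g\<in>Q. g \<noteq> f \<and> closing_copy f g F'"
    using F D(5,9) unfolding closing_copy_def by blast
next
  assume "\<exists>g\<in>Q. g \<noteq> f \<and> closing_copy f g F'"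
  then obtain g where g: "g \<in> Q" "f \<noteq> g" "closing_copy f g F'" by blast
  then obtain F where F: "F \<in> Ffam l" "is_copy F' F" unfolding closing_copy_def by blast
  note D = closing_copyD[OF f g]
  have fin: "finite F'" "card F' = num_triples F" using is_copy_conf[OF F] conf_basic(2) by auto
  have "F' \<inter> Q = {f, g}" using D(3) Q_D(5) f g(1) by blast
  then have c2: "card (F' \<inter> Q) = 2" using g by simp
  have "F' \<inter> H = F' - {f, g}" using D(3) by blast
  then have cH: "card (F' \<inter> H) = num_triples F - 2" using fin D g(2) by simp
  have "F' \<in> Wset l n H f F (num_triples F - 2)"
    unfolding Wset_def copies_def using F D f c2 cH num_triples_ge[OF F(1)] by simp
  then show "F' \<in> close_copies f" using F unfolding close_copies_def by blast
qed

lemma card_close_copies: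
  "card (close_copies f) = (\<Sum>F\<in>Ffam l. card (Wset l n H f F (num_triples F - 2)))"
  unfolding close_copies_def
proof (rule card_UN_disjoint[OF finite_Ffam])
  show "\<forall>F\<in>Ffam l. finite (Wset l n H f F (num_triples F - 2))" using finite_Wset by blast
  show "\<forall>F\<in>Ffam l. \<forall>G\<in>Ffam l. F \<noteq> G \<longrightarrow>
    Wset l n H f F (num_triples F - 2) \<inter> Wset l n H f G (num_triples G - 2) = {}"
    using is_copy_unique unfolding Wset_def copies_def by blast
qed

lemma finite_close_copies: "finite (close_copies f)"
  unfolding close_copies_def using finite_Ffam finite_Wset by blast

definition pair_closers :: "nat set \<Rightarrow> nat set set" where
  "pair_closers f = {g \<in> Q. g \<noteq> f \<and> 2 \<le> card (f \<inter> g)}"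

definition copy_closers :: "nat set \<Rightarrow> nat set set" where
  "copy_closers f = {g \<in> Q. g \<noteq> f \<and> (\<exists>F'. closing_copy f g F')}"

text \<open>The two ways of closing exclude each other, as triples of a forbidden copy share at most
  one vertex.\<close>

lemma card_closers_split:
  assumes f: "f \<in> Q"
  shows "card (closers f) = card (pair_closers f) + card (copy_closers f)"
proof -
  have "closers f = pair_closers f \<union> copy_closers f"
    unfolding closers_def pair_closers_def copy_closers_def using closed_iff[OF f] by blast
  moreover have "pair_closers f \<inter> copy_closers f = {}"
  proof (rule ccontr)
    assume "pair_closers f \<inter> copy_closers f \<noteq> {}"
    then obtain g F' where g: "g \<in> Q" "f \<noteq> g" "closing_copy f g F'" and "2 \<le> card (f \<inter> g)"
      unfolding pair_closers_def copy_closers_def by blast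
    then show False using closing_copyD(4)[OF f g] by simp
  qed
  ultimately show ?thesis
    using finite_Q card_Un_disjoint[of "pair_closers f" "copy_closers f"]
    by (simp add: pair_closers_def copy_closers_def)
qed

lemma two_common_elements:
  assumes f: "f = {a, b, c}" and c2: "2 \<le> card (f \<inter> g)"
  shows "{a, b} \<subseteq> g \<or> {a, c} \<subseteq> g \<or> {b, c} \<subseteq> g"
proof (rule ccontr)
  assume "\<not> ?thesis"
  then have "f \<inter> g \<subseteq> {a} \<or> f \<inter> g \<subseteq> {b} \<or> f \<inter> g \<subseteq> {c}" using f by blast
  then have "card (f \<inter> g) \<le> 1" using card_mono[of "{_}" "f \<inter> g"] by fastforce
  then show False using c2 by simp
qed

text \<open>Available triples over two different pairs of f contain f, so only f itself is counted
  repeatedly. It occurs once in each of the three numbers |Y|, hence the 3.\<close>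

lemma card_pair_closers:
  assumes f: "{a, b, c} \<in> Q" and d: "a \<noteq> b" "a \<noteq> c" "b \<noteq> c"
  shows "card (pair_closers {a, b, c}) + 3
    = card (Yset l n H a b) + card (Yset l n H a c) + card (Yset l n H b c)"
proof -
  let ?f = "{a, b, c}"
  let ?A = "\<lambda>x y. {g \<in> Q. {x, y} \<subseteq> g}"
  have eq3: "g = ?f" if "g \<in> Q" "?f \<subseteq> g" for g
    using card_subset_eq[of g ?f] that Q_D[OF that(1)] Q_D(4)[OF f] by simp
  have un: "pair_closers ?f = (?A a b - {?f}) \<union> (?A a c - {?f}) \<union> (?A b c - {?f})"
  proof (intro equalityI subsetI)
    fix g assume "g \<in> pair_closers ?f"
    then show "g \<in> (?A a b - {?f}) \<union> (?A a c - {?f}) \<union> (?A b c - {?f})"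
      using two_common_elements[OF refl, of a b c g] unfolding pair_closers_def by blast
  next
    fix g assume g: "g \<in> (?A a b - {?f}) \<union> (?A a c - {?f}) \<union> (?A b c - {?f})"
    then obtain x y where xy: "x \<noteq> y" "{x, y} \<subseteq> ?f \<inter> g" using d by blast
    then have "card {x, y} \<le> card (?f \<inter> g)" by (intro card_mono) auto
    then show "g \<in> pair_closers ?f" using g xy unfolding pair_closers_def by auto
  qed
  have fin: "finite (?A x y - {?f})" for x y using finite_Q by simp
  have disj: "(?A a b - {?f}) \<inter> (?A a c - {?f}) = {}"
    "((?A a b - {?f}) \<union> (?A a c - {?f})) \<inter> (?A b c - {?f}) = {}" using eq3 by blast+
  have c: "card (?A x y - {?f}) + 1 = card (Yset l n H x y)" if "x \<noteq> y" "{x, y} \<subseteq> ?f" for x y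
  proof -
    have "?f \<in> ?A x y" using f that by blast
    then have "card (?A x y - {?f}) + 1 = card (?A x y)"
      using finite_Q card_Suc_Diff1[of "?A x y" ?f] by simp
    then show ?thesis using card_through_pair[OF that(1)] by simp
  qed
  have "card (pair_closers ?f) = card (?A a b - {?f}) + card (?A a c - {?f}) + card (?A b c - {?f})"
    unfolding un card_Un_disjoint[OF finite_UnI[OF fin fin] fin disj(2)]
      card_Un_disjoint[OF fin fin disj(1)] by simp
  then show ?thesis using c[of a b] c[of a c] c[of b c] d by simp
qed

text \<open>Select one closing copy for each closing triple. Any further copy closing f through the
  same g forms with the selected one a pair sharing f and g, with g as the only missing triple
  outside the root; such pairs are rare.\<close>

lemma copy_closers_le: 
  assumes f: "f \<in> Q" shows "card (copy_closers f) \<le> card (close_copies f)"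
    and "card (close_copies f) \<le> card (copy_closers f) + card (conf_pairs l n H f f 1)"
proof -
  define r where "r g = (SOME F'. closing_copy f g F')" for g
  have r: "closing_copy f g (r g)" if "g \<in> copy_closers f" for g
    using that someI_ex[of "closing_copy f g"] unfolding copy_closers_def r_def by blast
  have fin: "finite (copy_closers f)" using finite_Q by (simp add: copy_closers_def)
  have "inj_on r (copy_closers f)"
  proof (rule inj_onI)
    fix g h assume g: "g \<in> copy_closers f" and h: "h \<in> copy_closers f" and eq: "r g = r h"
    have g': "g \<in> Q" "f \<noteq> g" and h': "h \<in> Q" "f \<noteq> h" using g h by (auto simp: copy_closers_def)
    have "{f, g} = {f, h}"
      using closing_copyD(3)[OF f g' r[OF g]] closing_copyD(3)[OF f h' r[OF h]] eq by simp
    then show "g = h" using g' h' by blast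
  qed
  moreover have "r ` copy_closers f \<subseteq> close_copies f"
  proof
    fix F' assume "F' \<in> r ` copy_closers f"
    then obtain g where "g \<in> copy_closers f" "F' = r g" by blast
    then show "F' \<in> close_copies f" using r[of g] close_copies_iff[OF f] unfolding copy_closers_def by blast
  qed
  ultimately show "card (copy_closers f) \<le> card (close_copies f)"
    using finite_close_copies by (rule card_inj_on_le)
  have "close_copies f \<subseteq> r ` copy_closers f \<union> fst ` conf_pairs l n H f f 1"
  proof
    fix F' assume "F' \<in> close_copies f"
    then obtain g where g: "g \<in> Q" "f \<noteq> g" "closing_copy f g F'" using close_copies_iff[OF f] by blast
    then have gc: "g \<in> copy_closers f" unfolding copy_closers_def by blast
    show "F' \<in> r ` copy_closers f \<union> fst ` conf_pairs l n H f f 1"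
    proof (cases "F' = r g")
      case True
      then show ?thesis using gc by blast
    next
      case False
      note D = closing_copyD[OF f g] and D' = closing_copyD[OF f g(1,2) r[OF gc]]
      have nH: "(F' \<union> r g) - H = {f, g}" using D(3) D'(3) by blast
      then have "{e \<in> (F' \<union> r g) - H. \<not> e \<subseteq> f} \<subseteq> {g}" by blast
      then have "card {e \<in> (F' \<union> r g) - H. \<not> e \<subseteq> f} \<le> 1"
        using card_mono[of "{g}"] by fastforce
      moreover have "\<exists>h h'. h \<in> F' \<and> h \<in> r g \<and> h \<noteq> f \<and> h' \<in> r g \<and> h' \<noteq> h \<and> h' \<subseteq> f \<union> \<Union>F'"
        using D(5,6) D'(5,6) g(2) by blast
      moreover have "\<forall>e\<in>r g - H. e \<in> F' \<or> e \<subseteq> f" using D' D(5,6) by blast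
      ultimately have "(F', r g) \<in> conf_pairs l n H f f 1"
        unfolding conf_pairs_def using D D' False by simp
      then show ?thesis by force
    qed
  qed
  then have "card (close_copies f) \<le> card (r ` copy_closers f \<union> fst ` conf_pairs l n H f f 1)"
    using fin finite_conf_pairs by (intro card_mono) auto
  also have "\<dots> \<le> card (r ` copy_closers f) + card (fst ` conf_pairs l n H f f 1)" by (rule card_Un_le)
  also have "\<dots> \<le> card (copy_closers f) + card (conf_pairs l n H f f 1)"
    using fin finite_conf_pairs by (intro add_mono card_image_le)
  finally show "card (close_copies f) \<le> card (copy_closers f) + card (conf_pairs l n H f f 1)" .
qed

end

text \<open>The value 2 l + 6 leaves room for two configurations and a root consisting of two
  triples.\<close>

locale ext_state = triple_state +
  fixes L :: nat and u :: real
  assumes ext: "ext_ok n L u H" and L: "2 * l + 6 \<le> L" and u: "u \<ge> 1" and l_ge: "4 \<le> l"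
begin

text \<open>Bounds the pairs of triple sets that belong to one extension.\<close>

definition CP :: real where "CP = (2 ^ (2 ^ L))\<^sup>2"

lemma CP_ge: "2 ^ (2 ^ L) \<le> CP" "1 \<le> CP"
proof -
  have "(1::real) \<le> 2 ^ (2 ^ L)" by simp
  then have "(2::real) ^ (2 ^ L) * 1 \<le> 2 ^ (2 ^ L) * 2 ^ (2 ^ L)" by (intro mult_left_mono) auto
  then show "2 ^ (2 ^ L) \<le> CP" by (simp add: CP_def power2_eq_square)
  then show "1 \<le> CP" using \<open>(1::real) \<le> 2 ^ (2 ^ L)\<close> by linarith
qed

lemma pairs_le:
  assumes "R \<subseteq> {1..n}" "card R \<le> 6" "f \<subseteq> R" "1 \<le> s" "s \<le> l"
  shows "real (card (conf_pairs l n H R f s)) \<le> CP * real n ^ (s - 1) * u"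
  using card_conf_pairs_le[OF ext assms(1-4) _ L] assms(5) L by (simp add: CP_def)

lemma singles_le:
  assumes "R \<subseteq> {1..n}" "card R \<le> 6" "1 \<le> s" "s \<le> l"
  shows "real (card (conf_singles l n H R s)) \<le> CP * real n ^ (s - 1) * u"
proof -
  have "real (card (conf_singles l n H R s)) \<le> 2 ^ (2 ^ L) * real n ^ (s - 1) * u"
    using card_conf_singles_le[OF ext assms(1-3) _ L] assms(4) L by simp
  also have "\<dots> \<le> CP * real n ^ (s - 1) * u" using CP_ge u by (intro mult_right_mono) auto
  finally show ?thesis .
qed

end

section \<open>Overlaps of closing sets and the one-step loss of Y\<close>

lemma sum_card_swap:
  assumes "finite A" "finite B"
  shows "(\<Sum>a\<in>A. card {b \<in> B. P a b}) = (\<Sum>b\<in>B. card {a \<in> A. P a b})"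
proof -
  have c: "card {x \<in> X. R x} = (\<Sum>x\<in>X. if R x then 1 else 0)" if "finite X" for X :: "'z set" and R
    using sum.inter_filter[OF that, of "\<lambda>_. 1::nat" R] by simp
  have c': "card {x \<in> X. R x} = (\<Sum>x\<in>X. if R x then 1 else 0)" if "finite X" for X :: "'y set" and R
    using sum.inter_filter[OF that, of "\<lambda>_. 1::nat" R] by simp
  show ?thesis using assms by (simp add: c c' sum.swap[of _ B A])
qed

context ext_state
begin

text \<open>64 bounds the subsets of the union of two triples; the rest counts the triples in the
  configurations of \<open>conf_singles\<close> and \<open>conf_pairs\<close>.\<close>

definition CC :: real where "CC = 64 + 2 * real l * CP"

lemma CC_ge: "CC \<ge> 1"
  using CP_ge by (simp add: CC_def add_increasing2)

lemma card_Union_conf_le: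
  assumes "finite A" "\<And>F. F \<in> A \<Longrightarrow> conf l F" shows "card (\<Union>F\<in>A. F) \<le> l * card A"
proof (rule card_UN_le_const[OF assms(1)])
  fix F assume "F \<in> A"
  then show "card F \<le> l" using conf_basic(4,5)[of l F] assms(2) by force
qed

text \<open>As f and f' share at most one vertex, two vertices of f' in g bring at least one new
  vertex. This supplies the four root vertices demanded by \<open>conf_singles\<close>.\<close>

lemma two_common_ge4:
  assumes "card f = 3" "card (f \<inter> f') \<le> 1" "2 \<le> card (f' \<inter> g)" "finite f" "finite f'"
  shows "4 \<le> card (f \<union> (f' \<inter> g))"
proof -
  have "card (f \<inter> (f' \<inter> g)) \<le> card (f \<inter> f')" using assms by (intro card_mono) auto
  moreover have "card (f \<union> (f' \<inter> g)) + card (f \<inter> (f' \<inter> g)) = card f + card (f' \<inter> g)"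
    using assms by (metis card_Un_Int finite_Int)
  ultimately show ?thesis using assms by linarith
qed

lemma single_memI:
  assumes "conf l F'" "F' \<subseteq> [{1..n}]\<^bsup>3\<^esup>" "X \<subseteq> \<Union>F' \<inter> R" "4 \<le> card X"
    "{e \<in> F' - H. \<not> e \<subseteq> R} \<subseteq> Y" "finite Y" "card Y \<le> s"
  shows "F' \<in> conf_singles l n H R s"
proof -
  have "card X \<le> card (\<Union>F' \<inter> R)" using conf_basic(1)[OF assms(1)] assms(3) by (intro card_mono) auto
  moreover have "card {e \<in> F' - H. \<not> e \<subseteq> R} \<le> s" using card_mono[OF assms(6,5)] assms(7) by linarith
  ultimately show ?thesis unfolding conf_singles_def using assms(1,2,4) by simp
qed

text \<open>A triple g closing both f and f' shares a pair with both, or a pair with one and a copy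
  with the other, or copies with both. These cases lead to subsets of f \<union> f', to
  \<open>conf_singles\<close> and to \<open>conf_pairs\<close>, with g as the only missing triple
  outside the root, so no factor n arises.\<close>

lemma closers_Int_le:
  assumes f: "f \<in> Q" and f': "f' \<in> Q" and ne: "f \<noteq> f'" and c1: "card (f \<inter> f') \<le> 1"
  shows "real (card (closers f \<inter> closers f')) \<le> CC * u"
proof -
  let ?R = "f \<union> f'"
  let ?S = "conf_singles l n H ?R 1" and ?P = "conf_pairs l n H ?R f 1"
  have fin: "finite f" "finite f'" "card f = 3" "card f' = 3" using Q_D f f' by auto
  have R: "?R \<subseteq> {1..n}" "card ?R \<le> 6" "finite ?R"
    using Q_D(2)[OF f] Q_D(2)[OF f'] fin card_Un_le[of f f'] by auto
  have c1': "card (f' \<inter> f) \<le> 1" using c1 by (simp add: Int_commute)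
  have sub: "closers f \<inter> closers f' \<subseteq> Pow ?R \<union> (\<Union>F\<in>?S. F) \<union> (\<Union>F\<in>fst ` ?P. F)"
  proof
    fix g assume g: "g \<in> closers f \<inter> closers f'"
    have gQ: "g \<in> Q" "f \<noteq> g" "f' \<noteq> g" using g closersD by blast+
    have g3: "finite g" "card g = 3" using Q_D gQ by auto
    have single: "g \<in> (\<Union>F\<in>?S. F)"
      if a: "a \<in> Q" "b \<in> Q" "card (a \<inter> b) \<le> 1" "a \<union> b = ?R" "a \<noteq> g" "2 \<le> card (b \<inter> g)" "closing_copy a g F'" for a b F'
    proof -
      note D = closing_copyD[OF a(1) gQ(1) a(5,7)]
      have "F' \<in> ?S"
      proof (rule single_memI[OF D(1,2)])
        show "a \<union> (b \<inter> g) \<subseteq> \<Union>F' \<inter> ?R" using D(5,6) a(4) by blast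
        show "4 \<le> card (a \<union> (b \<inter> g))" using a Q_D by (intro two_common_ge4) auto
        show "{e \<in> F' - H. \<not> e \<subseteq> ?R} \<subseteq> {g}" using D(3) a(4) by blast
      qed auto
      then show ?thesis using D(6) by blast
    qed
    show "g \<in> Pow ?R \<union> (\<Union>F\<in>?S. F) \<union> (\<Union>F\<in>fst ` ?P. F)"
    proof (rule closers_cases[OF f, of g])
      show "g \<in> closers f" using g by blast
    next
      assume p: "2 \<le> card (f \<inter> g)"
      show ?thesis
      proof (rule closers_cases[OF f', of g])
        show "g \<in> closers f'" using g by blast
      next
        assume p': "2 \<le> card (f' \<inter> g)"
        \<comment> \<open>Two vertices in f and two in f', with at most one in common, already make
          up all of g.\<close>
        have "card (f \<inter> g) + card (f' \<inter> g) = card ((f \<inter> g) \<union> (f' \<inter> g)) + card ((f \<inter> g) \<inter> (f' \<inter> g))"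
          using fin by (intro card_Un_Int) auto
        moreover have "card ((f \<inter> g) \<inter> (f' \<inter> g)) \<le> card (f \<inter> f')" using fin by (intro card_mono) auto
        ultimately have "3 \<le> card ((f \<inter> g) \<union> (f' \<inter> g))" using p p' c1 by linarith
        then have "(f \<inter> g) \<union> (f' \<inter> g) = g" using g3 by (intro card_seteq) auto
        then show ?thesis by blast
      next
        fix F' assume "closing_copy f' g F'"
        then show ?thesis using single[of f' f F'] f f' c1' p gQ by (simp add: Un_commute)
      qed
    next
      fix F1 assume F1: "closing_copy f g F1"
      show ?thesis
      proof (rule closers_cases[OF f', of g])
        show "g \<in> closers f'" using g by blast
      next
        assume "2 \<le> card (f' \<inter> g)"
        then show ?thesis using single[of f f' F1] f f' c1 gQ F1 by simp
      next
        fix F2 assume F2: "closing_copy f' g F2"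
        note D = closing_copyD[OF f gQ(1,2) F1] and D' = closing_copyD[OF f' gQ(1,3) F2]
        have "f' \<notin> F1" using D(3) Q_D(5)[OF f'] ne gQ by blast
        then have F12: "F1 \<noteq> F2" using D'(5) by blast
        have "{e \<in> (F1 \<union> F2) - H. \<not> e \<subseteq> ?R} \<subseteq> {g}" using D(3) D'(3) by blast
        then have "card {e \<in> (F1 \<union> F2) - H. \<not> e \<subseteq> ?R} \<le> 1" using card_mono[of "{g}"] by fastforce
        moreover have "\<exists>h h'. h \<in> F1 \<and> h \<in> F2 \<and> h \<noteq> f \<and> h' \<in> F2 \<and> h' \<noteq> h \<and> h' \<subseteq> ?R \<union> \<Union>F1"
          using D(5,6) D'(5,6) gQ by blast
        moreover have "\<forall>e\<in>F2 - H. e \<in> F1 \<or> e \<subseteq> ?R" using D'(3) D(6) by blast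
        ultimately have "(F1, F2) \<in> ?P"
          unfolding conf_pairs_def using D D' F12 by simp
        then have "F1 \<in> fst ` ?P" by force
        then show ?thesis using D(6) by blast
      qed
    qed
  qed
  have "card (closers f \<inter> closers f') \<le> card (Pow ?R \<union> (\<Union>F\<in>?S. F) \<union> (\<Union>F\<in>fst ` ?P. F))"
  proof (rule card_mono[OF _ sub])
    have "finite F" if "F \<in> ?S" for F using that conf_finite unfolding conf_singles_def by blast
    moreover have "finite F" if "F \<in> fst ` ?P" for F using that conf_finite unfolding conf_pairs_def by auto
    ultimately show "finite (Pow ?R \<union> (\<Union>F\<in>?S. F) \<union> (\<Union>F\<in>fst ` ?P. F))"
      using R finite_conf_singles finite_conf_pairs by simp
  qed
  also have "\<dots> \<le> card (Pow ?R) + card (\<Union>F\<in>?S. F) + card (\<Union>F\<in>fst ` ?P. F)"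
    using card_Un_le[of "Pow ?R \<union> (\<Union>F\<in>?S. F)" "\<Union>F\<in>fst ` ?P. F"] card_Un_le[of "Pow ?R" "\<Union>F\<in>?S. F"] by linarith
  also have "\<dots> \<le> 64 + l * card ?S + l * card ?P"
  proof -
    have "card (Pow ?R) \<le> 2 ^ 6"
      unfolding card_Pow[OF R(3)] using R(2) by (intro power_increasing) auto
    then have "card (Pow ?R) \<le> 64" by simp
    moreover have "card (\<Union>F\<in>?S. F) \<le> l * card ?S"
      by (rule card_Union_conf_le[OF finite_conf_singles]) (simp add: conf_singles_def)
    moreover have "card (\<Union>F\<in>fst ` ?P. F) \<le> l * card (fst ` ?P)"
      using finite_conf_pairs by (intro card_Union_conf_le) (auto simp: conf_pairs_def)
    moreover have "card (fst ` ?P) \<le> card ?P" by (rule card_image_le[OF finite_conf_pairs])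
    then have "l * card (fst ` ?P) \<le> l * card ?P" by (rule mult_le_mono2)
    ultimately show ?thesis by linarith
  qed
  finally have "card (closers f \<inter> closers f') \<le> 64 + l * card ?S + l * card ?P" .
  then have "real (card (closers f \<inter> closers f')) \<le> real (64 + l * card ?S + l * card ?P)" by (rule of_nat_mono)
  also have "\<dots> = 64 + real l * real (card ?S) + real l * real (card ?P)" by simp
  also have "\<dots> \<le> 64 * u + real l * (CP * u) + real l * (CP * u)"
    using singles_le[OF R(1,2), of 1] pairs_le[OF R(1,2), of f 1] u l_ge
    by (intro add_mono mult_left_mono) auto
  finally show ?thesis by (simp add: CC_def algebra_simps)
qed

text \<open>A lost z lies in g or in a closing copy. Such a copy contains the at least four vertices
  of {a, b} \<union> g, and {a, b, z} is its only missing triple outside this root.\<close>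

lemma Y_loss_le:
  assumes ab: "a \<noteq> b" "{a, b} \<subseteq> {1..n}" and g: "g \<in> Q" "\<not> {a, b} \<subseteq> g"
  shows "real (card {z \<in> Yset l n H a b. {a, b, z} \<notin> available l n (insert g H)}) \<le> 3 + real l * (CP * u)"
proof -
  let ?R = "{a, b} \<union> g"
  let ?S = "conf_singles l n H ?R 1"
  let ?Z = "{z \<in> Yset l n H a b. {a, b, z} \<notin> available l n (insert g H)}"
  have g3: "finite g" "card g = 3" "g \<subseteq> {1..n}" using Q_D g by auto
  have R: "?R \<subseteq> {1..n}" "card ?R \<le> 6" "finite ?R"
    using ab g3 card_Un_le[of "{a, b}" g] by auto
  have R4: "4 \<le> card ?R"
  proof -
    have "card g < card ?R" using g(2) R by (intro psubset_card_mono) blast+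
    then show ?thesis using g3 by simp
  qed
  have sub: "?Z \<subseteq> g \<union> (\<Union>F\<in>?S. \<Union>F)"
  proof
    fix z assume z: "z \<in> ?Z"
    let ?f = "{a, b, z}"
    have fQ: "?f \<in> Q" using z unfolding Yset_def by blast
    have ne: "?f \<noteq> g" using g by blast
    from closed_iff[OF fQ g(1) ne] z consider "2 \<le> card (?f \<inter> g)" | F' where "closing_copy ?f g F'" by blast
    then show "z \<in> g \<union> (\<Union>F\<in>?S. \<Union>F)"
    proof cases
      case 1
      then show ?thesis using two_common_elements[OF refl 1] g(2) by blast
    next
      case 2
      note D = closing_copyD[OF fQ g(1) ne 2]
      have "F' \<in> ?S"
      proof (rule single_memI[OF D(1,2) _ R4])
        show "?R \<subseteq> \<Union>F' \<inter> ?R" using D(5,6) by blast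
        show "{e \<in> F' - H. \<not> e \<subseteq> ?R} \<subseteq> {?f}" using D(3) by blast
      qed auto
      then show ?thesis using D(5) by blast
    qed
  qed
  have "card ?Z \<le> card (g \<union> (\<Union>F\<in>?S. \<Union>F))"
  proof (rule card_mono[OF _ sub])
    have "finite (\<Union>F)" if "F \<in> ?S" for F using that conf_basic(1) unfolding conf_singles_def by blast
    then show "finite (g \<union> (\<Union>F\<in>?S. \<Union>F))" using finite_conf_singles g3 by simp
  qed
  also have "\<dots> \<le> 3 + card (\<Union>F\<in>?S. \<Union>F)" using card_Un_le[of g] g3 by metis
  also have "\<dots> \<le> 3 + l * card ?S"
  proof -
    have "card (\<Union>F\<in>?S. \<Union>F) \<le> l * card ?S"
      by (rule card_UN_le_const[OF finite_conf_singles]) (simp add: conf_singles_def conf_basic(4))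
    then show ?thesis by simp
  qed
  finally have "card ?Z \<le> 3 + l * card ?S" .
  then have "real (card ?Z) \<le> real (3 + l * card ?S)" by (rule of_nat_mono)
  also have "\<dots> = 3 + real l * real (card ?S)" by simp
  also have "\<dots> \<le> 3 + real l * (CP * u)"
    using singles_le[OF R(1,2), of 1] l_ge by (intro add_left_mono mult_left_mono) auto
  finally show ?thesis .
qed

end

section \<open>The change of W in one step\<close>

context triple_state
begin

definition keep :: "nat set \<Rightarrow> nat set set" where
  "keep f = {g \<in> Q. f \<in> available l n (insert g H)}"

lemma keep_iff: "f \<in> Q \<Longrightarrow> g \<in> keep f \<longleftrightarrow> g \<in> Q \<and> g \<noteq> f \<and> g \<notin> closers f"
  using available_insert[of g] unfolding keep_def by blast

definition W_lost :: "nat set \<Rightarrow> hypergraph \<Rightarrow> nat \<Rightarrow> nat set \<Rightarrow> nat set set set" where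
  "W_lost f F k g = {F' \<in> Wset l n H f F k. \<exists>f'\<in>F' \<inter> Q. f' = g \<or> g \<in> closers f'}"

text \<open>A copy reaches k by moving g from the available triples to \<open>H\<close>. It is
  counted only if g closes none of its other available triples.\<close>

definition W_new :: "nat set \<Rightarrow> hypergraph \<Rightarrow> nat \<Rightarrow> nat set \<Rightarrow> nat set set set" where
  "W_new f F k g = (if k = 0 then {} else
     {F' \<in> Wset l n H f F (k - 1). g \<in> F' \<and> (\<forall>f'\<in>F' \<inter> Q. f' = g \<or> g \<notin> closers f')})"

text \<open>The two cardinalities in \<open>Wset\<close> add up to e_F, so each triple of a counted
  copy is in \<open>H\<close> or available. After the step, a copy without g must have kept all its
  available triples, and a copy with g must have lost exactly g.\<close>

lemma W_insert:
  assumes F: "F \<in> Ffam l" and k: "k \<le> num_triples F - 2" and f: "f \<in> Q" and g: "g \<in> keep f"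
  shows "Wset l n (insert g H) f F k = (Wset l n H f F k - W_lost f F k g) \<union> W_new f F k g"
proof -
  let ?K = "available l n (insert g H)"
  have gQ: "g \<in> Q" "g \<noteq> f" "g \<notin> closers f" using keep_iff[OF f] g by auto
  have K: "?K = {f \<in> Q. f \<noteq> g \<and> g \<notin> closers f}" by (rule available_insert[OF gQ(1)])
  have gH: "g \<notin> H" using Q_D(5) gQ by blast
  have fK: "f \<in> ?K" using K f gQ by blast
  have kE: "k \<le> num_triples F" "k - 1 \<le> num_triples F" using k by auto
  have E4: "4 \<le> num_triples F" using num_triples_ge[OF F] by simp
  show ?thesis
  proof (intro equalityI subsetI)
    fix F' assume F': "F' \<in> Wset l n (insert g H) f F k"
    have w: "F' \<in> copies n F" "f \<in> F'" "card (F' \<inter> ?K) = num_triples F - k" "card (F' \<inter> insert g H) = k"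
      using F' unfolding Wset_def by auto
    have "is_copy F' F" using w(1) by (simp add: copies_def)
    then have cF: "card F' = num_triples F" and fin: "finite F'"
      using is_copy_conf[OF F] conf_basic(2) by auto
    show "F' \<in> (Wset l n H f F k - W_lost f F k g) \<union> W_new f F k g"
    proof (cases "g \<in> F'")
      case False
      have disj: "(F' \<inter> Q) \<inter> (F' \<inter> H) = {}" using Q_D(5) by blast
      have cH: "card (F' \<inter> H) = k" using w(4) False by simp
      have "card (F' \<inter> Q) + card (F' \<inter> H) \<le> card F'"
        using card_Un_disjoint[OF _ _ disj] fin card_mono[of F' "(F' \<inter> Q) \<union> (F' \<inter> H)"] by simp
      then have le: "card (F' \<inter> Q) \<le> num_triples F - k" using cH cF by simp
      have "F' \<inter> ?K = F' \<inter> Q" using le w(3) K fin by (intro card_seteq) auto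
      then have "F' \<in> Wset l n H f F k" "F' \<notin> W_lost f F k g"
        using w cH f K unfolding Wset_def W_lost_def by auto
      then show ?thesis by blast
    next
      case True
      have "F' \<inter> insert g H = insert g (F' \<inter> H)" using True by blast
      then have cH: "card (F' \<inter> H) + 1 = k" using w(4) gH fin by simp
      have disj: "(F' \<inter> Q) \<inter> (F' \<inter> H) = {}" using Q_D(5) by blast
      have "card (F' \<inter> Q) + card (F' \<inter> H) \<le> card F'"
        using card_Un_disjoint[OF _ _ disj] fin card_mono[of F' "(F' \<inter> Q) \<union> (F' \<inter> H)"] by simp
      then have le: "card (F' \<inter> Q) \<le> num_triples F - (k - 1)" using cH cF by simp
      have "insert g (F' \<inter> ?K) \<subseteq> F' \<inter> Q" using K True gQ by blast
      moreover have "card (insert g (F' \<inter> ?K)) = num_triples F - (k - 1)"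
        using K fin w(3) cH kE by simp
      ultimately have eq: "insert g (F' \<inter> ?K) = F' \<inter> Q" using le fin by (intro card_seteq) auto
      then have cQ: "card (F' \<inter> Q) = num_triples F - (k - 1)"
        using \<open>card (insert g (F' \<inter> ?K)) = num_triples F - (k - 1)\<close> by simp
      have "F' \<in> Wset l n H f F (k - 1)" using w f cQ cH unfolding Wset_def by auto
      moreover have "\<forall>f'\<in>F' \<inter> Q. f' = g \<or> g \<notin> closers f'" using eq K by blast
      ultimately show ?thesis using True cH unfolding W_new_def by auto
    qed
  next
    fix F' assume "F' \<in> (Wset l n H f F k - W_lost f F k g) \<union> W_new f F k g"
    then show "F' \<in> Wset l n (insert g H) f F k"
    proof
      assume a: "F' \<in> Wset l n H f F k - W_lost f F k g"
      then have W: "F' \<in> Wset l n H f F k" by blast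
      note D = Wset_D[OF F W kE(1)]
      have "F' \<inter> ?K = F' \<inter> Q" using a K unfolding W_lost_def by blast
      moreover have "g \<notin> F'" using a gQ unfolding W_lost_def by blast
      ultimately show ?thesis using W fK unfolding Wset_def by auto
    next
      assume a: "F' \<in> W_new f F k g"
      then have k0: "k \<noteq> 0" and W: "F' \<in> Wset l n H f F (k - 1)" and gF: "g \<in> F'"
        and al: "\<forall>f'\<in>F' \<inter> Q. f' = g \<or> g \<notin> closers f'" unfolding W_new_def by (auto split: if_splits)
      note D = Wset_D[OF F W kE(2)]
      have "F' \<inter> ?K = (F' \<inter> Q) - {g}" using al K by blast
      then have cK: "card (F' \<inter> ?K) = num_triples F - k" using D(4,10) gF gQ k0 kE by simp
      have "F' \<inter> insert g H = insert g (F' \<inter> H)" using gF by blast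
      then have cH: "card (F' \<inter> insert g H) = k" using D(8,10) gH k0 by simp
      show ?thesis using W cK cH fK unfolding Wset_def by auto
    qed
  qed
qed

lemma W_insert_card:
  assumes F: "F \<in> Ffam l" and k: "k \<le> num_triples F - 2" and f: "f \<in> Q" and g: "g \<in> keep f"
  shows "real (card (Wset l n (insert g H) f F k)) - real (card (Wset l n H f F k))
    = real (card (W_new f F k g)) - real (card (W_lost f F k g))"
proof -
  have fin: "finite (Wset l n H f F k)" "finite (W_new f F k g)"
    using finite_Wset unfolding W_new_def by auto
  have "(Wset l n H f F k - W_lost f F k g) \<inter> W_new f F k g = {}"
    unfolding W_new_def Wset_def by auto
  then have "card (Wset l n (insert g H) f F k)
      = card (Wset l n H f F k - W_lost f F k g) + card (W_new f F k g)"
    unfolding W_insert[OF assms] using fin by (intro card_Un_disjoint) auto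
  moreover have "W_lost f F k g \<subseteq> Wset l n H f F k" unfolding W_lost_def by blast
  then have "card (Wset l n H f F k - W_lost f F k g) + card (W_lost f F k g) = card (Wset l n H f F k)"
    using fin by (metis card_Diff_subset card_mono finite_subset le_add_diff_inverse2)
  ultimately show ?thesis by linarith
qed

end

context ext_state
begin

text \<open>A gained copy contains f and g. A lost copy contains g, or has a triple f' sharing a
  pair with g, or has a triple f' that a second copy through g closes; the first two cases are
  single configurations and the third is a pair. In each case e_F - 1 - k missing triples lie
  outside the root, one less than the power of n in |W| suggests.\<close>

lemma W_change_le:
  assumes F: "F \<in> Ffam l" and k: "k \<le> num_triples F - 2" and f: "f \<in> Q" and g: "g \<in> keep f"
  shows "real (card (W_new f F k g)) \<le> CP * real n ^ (num_triples F - 2 - k) * u"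
    and "real (card (W_lost f F k g)) \<le> 2 * (CP * real n ^ (num_triples F - 2 - k) * u)"
proof -
  let ?E = "num_triples F"
  let ?R = "f \<union> g" and ?s = "?E - 1 - k"
  let ?S = "conf_singles l n H ?R ?s" and ?P = "conf_pairs l n H ?R f ?s"
  have gQ: "g \<in> Q" "g \<noteq> f" "g \<notin> closers f" using keep_iff[OF f] g by auto
  have fin: "finite f" "finite g" "card f = 3" "card g = 3" using Q_D f gQ by auto
  have R: "?R \<subseteq> {1..n}" "card ?R \<le> 6" "f \<subseteq> ?R"
    using Q_D(2)[OF f] Q_D(2)[OF gQ(1)] fin card_Un_le[of f g] by auto
  have E: "4 \<le> ?E" "?E + 2 \<le> l" using num_triples_ge[OF F] by auto
  have s: "1 \<le> ?s" "?s \<le> l" "?s - 1 = ?E - 2 - k" using E k by auto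
  have R4: "4 \<le> card ?R" using fin gQ by (intro card3_Un_ge) auto
  note Sle = singles_le[OF R(1,2) s(1,2), unfolded s(3)] and Ple = pairs_le[OF R s(1,2), unfolded s(3)]
  have kE: "k \<le> ?E" "k - 1 \<le> ?E" using k by auto
  have gS: "F' \<in> ?S" if W: "F' \<in> Wset l n H f F j" and j: "j = k \<or> j + 1 = k" and gF: "g \<in> F'" for F' j
  proof -
    have "j \<le> ?E" using j kE by auto
    note D = Wset_D[OF F W this]
    show ?thesis
    proof (rule single_memI[OF D(1,2) _ R4])
      show "?R \<subseteq> \<Union>F' \<inter> ?R" using D(5) gF by blast
      show "{e \<in> F' - H. \<not> e \<subseteq> ?R} \<subseteq> F' \<inter> Q - {f, g}" using D(3) by blast
      have "card (F' \<inter> Q - {f, g}) = card (F' \<inter> Q) - card {f, g}"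
        using D(5,6) gF gQ by (intro card_Diff_subset) auto
      then show "card (F' \<inter> Q - {f, g}) \<le> ?s" using D(4) gQ j by auto
    qed (use D(10) in auto)
  qed
  have "W_new f F k g \<subseteq> ?S"
  proof
    fix F' assume "F' \<in> W_new f F k g"
    then have "F' \<in> Wset l n H f F (k - 1)" "g \<in> F'" "k \<noteq> 0" unfolding W_new_def by (auto split: if_splits)
    then show "F' \<in> ?S" by (intro gS[of F' "k - 1"]) auto
  qed
  then have "card (W_new f F k g) \<le> card ?S" by (rule card_mono[OF finite_conf_singles])
  then show "real (card (W_new f F k g)) \<le> CP * real n ^ (?E - 2 - k) * u" using Sle by linarith
  have "W_lost f F k g \<subseteq> ?S \<union> fst ` ?P"
  proof
    fix F' assume "F' \<in> W_lost f F k g"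
    then obtain f' where W: "F' \<in> Wset l n H f F k" and f': "f' \<in> F'" "f' \<in> Q" "f' = g \<or> g \<in> closers f'"
      unfolding W_lost_def by blast
    note D = Wset_D[OF F W kE(1)]
    show "F' \<in> ?S \<union> fst ` ?P"
    proof (cases "g \<in> F'")
      case True
      then show ?thesis using gS[OF W] by blast
    next
      case False
      then have gc: "g \<in> closers f'" "f' \<noteq> g" using f' by auto
      have f'f: "f' \<noteq> f" using gc gQ by blast
      have cf: "card (F' \<inter> Q - {f}) \<le> ?s" using D(4,5,6,10) by simp
      from closers_cases[OF f'(2) gc(1)] consider "2 \<le> card (f' \<inter> g)" | F2 where "closing_copy f' g F2" by blast
      then show ?thesis
      proof cases
        case 1
        have "F' \<in> ?S"
        proof (rule single_memI[OF D(1,2)])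
          show "f \<union> (f' \<inter> g) \<subseteq> \<Union>F' \<inter> ?R" using D(5) f'(1) by blast
          show "4 \<le> card (f \<union> (f' \<inter> g))"
            using conf_linear[OF D(1,5) f'(1)] f'f fin Q_D(3)[OF f'(2)] 1 by (intro two_common_ge4) auto
          show "{e \<in> F' - H. \<not> e \<subseteq> ?R} \<subseteq> F' \<inter> Q - {f}" using D(3) by blast
        qed (use D(10) cf in auto)
        then show ?thesis by blast
      next
        case 2
        note D' = closing_copyD[OF f'(2) gQ(1) gc(2) 2]
        have "F' \<noteq> F2" using False D'(6) by blast
        moreover have "card {e \<in> (F' \<union> F2) - H. \<not> e \<subseteq> ?R} \<le> ?s"
        proof -
          have "(F' \<union> F2) - H \<subseteq> insert g (F' \<inter> Q)" unfolding Un_Diff D(3) D'(3) using f' by simp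
          then have "{e \<in> (F' \<union> F2) - H. \<not> e \<subseteq> ?R} \<subseteq> F' \<inter> Q - {f}" by auto
          then have "card {e \<in> (F' \<union> F2) - H. \<not> e \<subseteq> ?R} \<le> card (F' \<inter> Q - {f})"
            using D(10) by (intro card_mono) simp_all
          then show ?thesis using cf by linarith
        qed
        moreover have "\<exists>h h'. h \<in> F' \<and> h \<in> F2 \<and> h \<noteq> f \<and> h' \<in> F2 \<and> h' \<noteq> h \<and> h' \<subseteq> ?R \<union> \<Union>F'"
          using f' f'f D'(5,6) gc by blast
        moreover have "\<forall>e\<in>F2 - H. e \<in> F' \<or> e \<subseteq> ?R" unfolding D'(3) using f' by simp
        ultimately have "(F', F2) \<in> ?P" unfolding conf_pairs_def using D D' by simp
        then show ?thesis by force
      qed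
    qed
  qed
  then have "card (W_lost f F k g) \<le> card (?S \<union> fst ` ?P)"
    using finite_conf_singles finite_conf_pairs by (intro card_mono) auto
  also have "\<dots> \<le> card ?S + card ?P"
    using card_Un_le[of ?S "fst ` ?P"] card_image_le[OF finite_conf_pairs, of fst l n H ?R f ?s] by linarith
  finally show "real (card (W_lost f F k g)) \<le> 2 * (CP * real n ^ (?E - 2 - k) * u)"
    using Sle Ple by linarith
qed

text \<open>Double counting: each copy with k - 1 triples in \<open>H\<close> has e_F - k available
  triples besides f, and choosing any of them advances it unless this closes another triple of the
  copy. Two triples of one copy share no pair, so such a closing needs a second copy, and the pair
  belongs to \<open>conf_pairs\<close>.\<close>

lemma W_gain_sum:
  assumes F: "F \<in> Ffam l" and k: "0 < k" "k \<le> num_triples F - 2" and f: "f \<in> Q"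
  shows "\<bar>real (\<Sum>g\<in>keep f. card (W_new f F k g)) - real (num_triples F - k) * real (card (Wset l n H f F (k - 1)))\<bar>
    \<le> real l * (CP * real n ^ (num_triples F - 1 - k) * u)"
proof -
  let ?E = "num_triples F" and ?W = "Wset l n H f F (k - 1)"
  let ?s = "?E - k"
  let ?P = "conf_pairs l n H f f ?s"
  let ?ok = "\<lambda>F' g. g \<in> F' \<and> (\<forall>f'\<in>F' \<inter> Q. f' = g \<or> g \<notin> closers f')"
  let ?bad = "\<lambda>F'. {g \<in> F' \<inter> Q - {f}. \<not> ?ok F' g}"
  have E: "4 \<le> ?E" "?E + 2 \<le> l" using num_triples_ge[OF F] by auto
  have kE: "k - 1 \<le> ?E" using k by simp
  have fin: "finite (keep f)" using finite_Q by (simp add: keep_def)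
  have split: "card {g \<in> keep f. ?ok F' g} + card (?bad F') = ?E - k" if W: "F' \<in> ?W" for F'
  proof -
    note D = Wset_D[OF F W kE]
    have "{g \<in> keep f. ?ok F' g} = {g \<in> F' \<inter> Q - {f}. ?ok F' g}"
      using keep_iff[OF f] D(5,6) by blast
    moreover have "card {g \<in> F' \<inter> Q - {f}. ?ok F' g} + card (?bad F') = card (F' \<inter> Q - {f})"
    proof -
      have "F' \<inter> Q - {f} = {g \<in> F' \<inter> Q - {f}. ?ok F' g} \<union> ?bad F'" by blast
      moreover have "card ({g \<in> F' \<inter> Q - {f}. ?ok F' g} \<union> ?bad F') = card {g \<in> F' \<inter> Q - {f}. ?ok F' g} + card (?bad F')"
        using D(10) by (intro card_Un_disjoint) auto
      ultimately show ?thesis by (simp only:)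
    qed
    moreover have "card (F' \<inter> Q - {f}) = ?E - k" using D(4,5,6,10) k by simp
    ultimately show ?thesis by simp
  qed
  have "(\<Sum>g\<in>keep f. card (W_new f F k g)) = (\<Sum>g\<in>keep f. card {F' \<in> ?W. ?ok F' g})"
    using k by (simp add: W_new_def)
  also have "\<dots> = (\<Sum>F'\<in>?W. card {g \<in> keep f. ?ok F' g})"
    by (rule sum_card_swap[OF fin finite_Wset])
  finally have eq: "(\<Sum>g\<in>keep f. card (W_new f F k g)) + (\<Sum>F'\<in>?W. card (?bad F')) = ?s * card ?W"
    using split by (simp add: sum.distrib[symmetric])
  have "(\<Sum>F'\<in>?W. card (?bad F')) = card (SIGMA F':?W. ?bad F')"
    using finite_Wset finite_Q by (intro card_SigmaI[symmetric]) auto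
  also have "\<dots> \<le> card (\<Union>z\<in>?P. {fst z} \<times> fst z)"
  proof (rule card_mono)
    show "finite (\<Union>z\<in>?P. {fst z} \<times> fst z)"
      using finite_conf_pairs conf_finite by (auto simp: conf_pairs_def intro!: finite_UN_I[OF finite_conf_pairs])
    show "(SIGMA F':?W. ?bad F') \<subseteq> (\<Union>z\<in>?P. {fst z} \<times> fst z)"
    proof
      fix z assume "z \<in> (SIGMA F':?W. ?bad F')"
      then obtain F' g where z: "z = (F', g)" and W: "F' \<in> ?W" and g: "g \<in> F'" "g \<in> Q" "g \<noteq> f" "\<not> ?ok F' g" by auto
      note D = Wset_D[OF F W kE]
      obtain g' where g': "g' \<in> F'" "g' \<in> Q" "g' \<noteq> g" "g \<in> closers g'" using g by blast
      have c1: "card (g' \<inter> g) \<le> 1" by (rule conf_linear[OF D(1) g'(1) g(1) g'(3)])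
      from closers_cases[OF g'(2,4)] c1 obtain F2 where F2: "closing_copy g' g F2" by fastforce
      note D' = closing_copyD[OF g'(2) g(2) g'(3) F2]
      have F2H: "card (F2 - H) = 2" using D'(3) g'(3) by simp
      have F1H: "card (F' - H) = ?E - (k - 1)" using D(3,4) by simp
      \<comment> \<open>The second copy lacks exactly two triples, whereas F' lacks e_F - k + 1,
        which is at least three.\<close>
      have "F' \<noteq> F2" using F2H F1H k E by auto
      moreover have "card {e \<in> (F' \<union> F2) - H. \<not> e \<subseteq> f} \<le> ?s"
      proof -
        have "(F' \<union> F2) - H \<subseteq> F' \<inter> Q" unfolding Un_Diff D(3) D'(3) using g g' by simp
        then have "{e \<in> (F' \<union> F2) - H. \<not> e \<subseteq> f} \<subseteq> F' \<inter> Q - {f}" by auto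
        then have "card {e \<in> (F' \<union> F2) - H. \<not> e \<subseteq> f} \<le> card (F' \<inter> Q - {f})"
          using D(10) by (intro card_mono) simp_all
        then show ?thesis using D(4,5,6,10) k by simp
      qed
      moreover have "\<exists>h h'. h \<in> F' \<and> h \<in> F2 \<and> h \<noteq> f \<and> h' \<in> F2 \<and> h' \<noteq> h \<and> h' \<subseteq> f \<union> \<Union>F'"
        using g g' D'(5,6) by blast
      moreover have "\<forall>e\<in>F2 - H. e \<in> F' \<or> e \<subseteq> f" unfolding D'(3) using g g' by simp
      ultimately have "(F', F2) \<in> ?P" unfolding conf_pairs_def using D D' by simp
      then show "z \<in> (\<Union>z\<in>?P. {fst z} \<times> fst z)" using z g by force
    qed
  qed
  also have "\<dots> \<le> l * card ?P"
  proof (rule card_UN_le_const[OF finite_conf_pairs])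
    fix z assume "z \<in> ?P"
    then have "conf l (fst z)" by (auto simp: conf_pairs_def)
    then have "card (fst z) \<le> l" using conf_basic(4,5)[of l "fst z"] by linarith
    then show "card ({fst z} \<times> fst z) \<le> l" by (simp add: card_cartesian_product)
  qed
  finally have bad: "(\<Sum>F'\<in>?W. card (?bad F')) \<le> l * card ?P" .
  have "real (\<Sum>F'\<in>?W. card (?bad F')) \<le> real (l * card ?P)" using bad by (rule of_nat_mono)
  also have "\<dots> = real l * real (card ?P)" by simp
  also have "\<dots> \<le> real l * (CP * real n ^ (?s - 1) * u)"
    using Q_D[OF f] E k by (intro mult_left_mono pairs_le) auto
  also have "?s - 1 = ?E - 1 - k" using k by simp
  finally have b: "real (\<Sum>F'\<in>?W. card (?bad F')) \<le> real l * (CP * real n ^ (?E - 1 - k) * u)" .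
  have "real (\<Sum>g\<in>keep f. card (W_new f F k g)) + real (\<Sum>F'\<in>?W. card (?bad F')) = real ?s * real (card ?W)"
    using arg_cong[OF eq, of real] by (simp only: of_nat_add of_nat_mult)
  then show ?thesis using b by linarith
qed

text \<open>A copy is destroyed by choosing or closing one of its e_F - 1 - k available triples
  other than f. Their closing sets have almost equal sizes and are almost disjoint by
  \<open>closers_Int_le\<close>, so the union has nearly the size of the sum.\<close>

lemma W_loss_sum:
  assumes F: "F \<in> Ffam l" and k: "k \<le> num_triples F - 2" and f: "f \<in> Q"
    and cl: "\<And>f'. f' \<in> Q \<Longrightarrow> \<bar>real (card (closers f')) - c\<bar> \<le> d"
  shows "\<bar>real (\<Sum>g\<in>keep f. card (W_lost f F k g)) - real (card (Wset l n H f F k)) * (real (num_triples F - 1 - k) * c)\<bar>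
    \<le> real (card (Wset l n H f F k)) * (real (num_triples F - 1 - k) * (d + 1 + real l * (CC * u)))"
proof -
  let ?E = "num_triples F" and ?W = "Wset l n H f F k"
  let ?m = "?E - 1 - k"
  let ?P = "\<lambda>F' g. \<exists>f'\<in>F' \<inter> Q. f' = g \<or> g \<in> closers f'"
  let ?e = "d + 1 + real l * (CC * u)"
  have E: "4 \<le> ?E" "?E + 2 \<le> l" using num_triples_ge[OF F] by auto
  have kE: "k \<le> ?E" using k by simp
  have CCu: "CC * u \<ge> 0" using CC_ge u by simp
  have fin: "finite (keep f)" using finite_Q by (simp add: keep_def)
  have one: "\<bar>real (card {g \<in> keep f. ?P F' g}) - real ?m * c\<bar> \<le> real ?m * ?e" if W: "F' \<in> ?W" for F'
  proof -
    note D = Wset_D[OF F W kE]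
    let ?A = "F' \<inter> Q - {f}"
    have finA: "finite ?A" using D(10) by simp
    have cA: "card ?A = ?m" using D(4,5,6,10) by simp
    have "{g \<in> keep f. ?P F' g} \<subseteq> ?A \<union> (\<Union>f'\<in>?A. closers f')"
      using keep_iff[OF f] by blast
    then have "card {g \<in> keep f. ?P F' g} \<le> card (?A \<union> (\<Union>f'\<in>?A. closers f'))"
      using finA finite_closers by (intro card_mono) auto
    also have "\<dots> \<le> ?m + card (\<Union>f'\<in>?A. closers f')" using card_Un_le[of ?A] cA by metis
    also have "card (\<Union>f'\<in>?A. closers f') \<le> (\<Sum>f'\<in>?A. card (closers f'))" by (rule card_UN_le[OF finA])
    finally have "real (card {g \<in> keep f. ?P F' g}) \<le> real (?m + (\<Sum>f'\<in>?A. card (closers f')))"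
      by (intro of_nat_mono) simp
    also have "\<dots> = real ?m + (\<Sum>f'\<in>?A. real (card (closers f')))" by simp
    also have "\<dots> \<le> real ?m + (\<Sum>f'\<in>?A. c + d)"
      using cl by (intro add_left_mono sum_mono) (force simp: abs_le_iff)
    also have "\<dots> = real ?m * c + real ?m * (d + 1)" using cA by (simp add: algebra_simps)
    finally have up: "real (card {g \<in> keep f. ?P F' g}) \<le> real ?m * c + real ?m * (d + 1)" .
    \<comment> \<open>The choices closing f' and no other available triple of the copy, in
      particular not f. These sets are disjoint and consist of choices that keep f available, which
      gives the lower bound.\<close>
    let ?B = "\<lambda>f'. closers f' - {f} - (\<Union>f''\<in>F' \<inter> Q - {f'}. closers f'')"
    have "(\<Union>f'\<in>?A. ?B f') \<subseteq> {g \<in> keep f. ?P F' g}"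
    proof
      fix g assume "g \<in> (\<Union>f'\<in>?A. ?B f')"
      then obtain f' where f': "f' \<in> ?A" "g \<in> closers f'" "g \<noteq> f"
        and nc: "\<And>f''. f'' \<in> F' \<inter> Q - {f'} \<Longrightarrow> g \<notin> closers f''" by blast
      have "g \<notin> closers f" using nc[of f] f'(1) D(5,6) by blast
      then have "g \<in> keep f" using keep_iff[OF f] f' closersD by blast
      then show "g \<in> {g \<in> keep f. ?P F' g}" using f' by blast
    qed
    then have "card (\<Union>f'\<in>?A. ?B f') \<le> card {g \<in> keep f. ?P F' g}" using fin by (intro card_mono) auto
    moreover have "card (\<Union>f'\<in>?A. ?B f') = (\<Sum>f'\<in>?A. card (?B f'))"
    proof (rule card_UN_disjoint[OF finA])
      show "\<forall>f'\<in>?A. finite (?B f')" using finite_closers by blast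
      show "\<forall>f'\<in>?A. \<forall>f''\<in>?A. f' \<noteq> f'' \<longrightarrow> ?B f' \<inter> ?B f'' = {}" by blast
    qed
    ultimately have "real (\<Sum>f'\<in>?A. card (?B f')) \<le> real (card {g \<in> keep f. ?P F' g})"
      by (intro of_nat_mono) simp
    moreover have "(\<Sum>f'\<in>?A. c - ?e) \<le> real (\<Sum>f'\<in>?A. card (?B f'))"
      unfolding of_nat_sum
    proof (rule sum_mono)
      fix f' assume f': "f' \<in> ?A"
      let ?O = "F' \<inter> Q - {f'}"
      have finO: "finite ?O" using D(10) by simp
      have "closers f' \<subseteq> ?B f' \<union> {f} \<union> (\<Union>f''\<in>?O. closers f' \<inter> closers f'')" by blast
      then have "card (closers f') \<le> card (?B f' \<union> {f} \<union> (\<Union>f''\<in>?O. closers f' \<inter> closers f''))"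
        using finite_closers finO by (intro card_mono) auto
      also have "\<dots> \<le> card (?B f') + 1 + card (\<Union>f''\<in>?O. closers f' \<inter> closers f'')"
      proof -
        have "card {f} = 1" by simp
        then show ?thesis
          using card_Un_le[of "?B f' \<union> {f}" "\<Union>f''\<in>?O. closers f' \<inter> closers f''"]
            card_Un_le[of "?B f'" "{f}"] by linarith
      qed
      also have "card (\<Union>f''\<in>?O. closers f' \<inter> closers f'') \<le> (\<Sum>f''\<in>?O. card (closers f' \<inter> closers f''))"
        by (rule card_UN_le[OF finO])
      finally have "real (card (closers f')) \<le> real (card (?B f') + 1 + (\<Sum>f''\<in>?O. card (closers f' \<inter> closers f'')))"
        by (intro of_nat_mono) simp
      also have "\<dots> = real (card (?B f')) + 1 + (\<Sum>f''\<in>?O. real (card (closers f' \<inter> closers f'')))" by simp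
      also have "\<dots> \<le> real (card (?B f')) + 1 + (\<Sum>f''\<in>?O. CC * u)"
      proof (intro add_left_mono sum_mono)
        fix f'' assume f'': "f'' \<in> ?O"
        show "real (card (closers f' \<inter> closers f'')) \<le> CC * u"
          using f' f'' conf_linear[OF D(1), of f' f''] by (intro closers_Int_le) auto
      qed
      also have "\<dots> = real (card (?B f')) + 1 + real (card ?O) * (CC * u)" by simp
      also have "\<dots> \<le> real (card (?B f')) + 1 + real l * (CC * u)"
      proof -
        have "card ?O \<le> card F'" using D(10) by (intro card_mono) auto
        then have "card ?O \<le> l" using D(7) E by linarith
        then show ?thesis using CCu by (intro add_left_mono mult_right_mono) auto
      qed
      finally have "real (card (closers f')) \<le> real (card (?B f')) + 1 + real l * (CC * u)" .
      moreover have "c - d \<le> real (card (closers f'))" using cl[of f'] f' by (auto simp: abs_le_iff)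
      ultimately show "c - ?e \<le> real (card (?B f'))" by linarith
    qed
    moreover have "(\<Sum>f'\<in>?A. c - ?e) = real ?m * c - real ?m * ?e" using cA by (simp add: algebra_simps)
    ultimately have lo: "real ?m * c - real ?m * ?e \<le> real (card {g \<in> keep f. ?P F' g})" by linarith
    have "real ?m * (d + 1) \<le> real ?m * ?e" using CCu by (intro mult_left_mono) auto
    then show ?thesis using up lo by linarith
  qed
  have "(\<Sum>g\<in>keep f. card (W_lost f F k g)) = (\<Sum>F'\<in>?W. card {g \<in> keep f. ?P F' g})"
    unfolding W_lost_def by (rule sum_card_swap[OF fin finite_Wset])
  then have "\<bar>real (\<Sum>g\<in>keep f. card (W_lost f F k g)) - real (card ?W) * (real ?m * c)\<bar>
      = \<bar>\<Sum>F'\<in>?W. real (card {g \<in> keep f. ?P F' g}) - real ?m * c\<bar>"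
    by (simp add: sum_subtractf)
  also have "\<dots> \<le> (\<Sum>F'\<in>?W. \<bar>real (card {g \<in> keep f. ?P F' g}) - real ?m * c\<bar>)" by (rule sum_abs)
  also have "\<dots> \<le> (\<Sum>F'\<in>?W. real ?m * ?e)" by (rule sum_mono[OF one])
  finally show ?thesis by simp
qed

end

section \<open>Trajectories\<close>

text \<open>Twice continuously differentiable on the whole line, in a form closed under sums,
  products, powers and exponentials, so that Taylor estimates never need an explicit second
  derivative.\<close>

definition C2 :: "(real \<Rightarrow> real) \<Rightarrow> bool" where
  "C2 f \<longleftrightarrow> (\<exists>f' f''. (\<forall>t. (f has_real_derivative f' t) (at t)) \<and>
     (\<forall>t. (f' has_real_derivative f'' t) (at t)) \<and> continuous_on UNIV f'')"

lemma C2_const: "C2 (\<lambda>_. c)"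
  unfolding C2_def by (rule exI[of _ "\<lambda>_. 0"], rule exI[of _ "\<lambda>_. 0"]) auto

lemma C2_ident: "C2 (\<lambda>t. t)"
  unfolding C2_def by (rule exI[of _ "\<lambda>_. 1"], rule exI[of _ "\<lambda>_. 0"]) auto

lemma C2_continuous:
  assumes "\<And>t. (f has_real_derivative f' t) (at t)" shows "continuous_on UNIV f"
  using assms by (meson DERIV_isCont continuous_at_imp_continuous_on)

lemma C2_add: assumes "C2 f" "C2 g" shows "C2 (\<lambda>t. f t + g t)"
proof -
  obtain f' f'' g' g'' where
    "\<And>t. (f has_real_derivative f' t) (at t)" "\<And>t. (f' has_real_derivative f'' t) (at t)" "continuous_on UNIV f''"
    "\<And>t. (g has_real_derivative g' t) (at t)" "\<And>t. (g' has_real_derivative g'' t) (at t)" "continuous_on UNIV g''"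
    using assms unfolding C2_def by blast
  then show ?thesis unfolding C2_def
    by (intro exI[of _ "\<lambda>t. f' t + g' t"] exI[of _ "\<lambda>t. f'' t + g'' t"])
      (auto intro!: DERIV_add continuous_on_add)
qed

lemma C2_mult: assumes "C2 f" "C2 g" shows "C2 (\<lambda>t. f t * g t)"
proof -
  obtain f' f'' g' g'' where
    f: "\<And>t. (f has_real_derivative f' t) (at t)" "\<And>t. (f' has_real_derivative f'' t) (at t)" "continuous_on UNIV f''" and
    g: "\<And>t. (g has_real_derivative g' t) (at t)" "\<And>t. (g' has_real_derivative g'' t) (at t)" "continuous_on UNIV g''"
    using assms unfolding C2_def by blast
  have "((\<lambda>t. f t * g t) has_real_derivative f' t * g t + f t * g' t) (at t)" for t
    using DERIV_mult[OF f(1) g(1)] by (simp add: mult.commute)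
  moreover have "((\<lambda>t. f' t * g t + f t * g' t) has_real_derivative
      f'' t * g t + 2 * (f' t * g' t) + f t * g'' t) (at t)" for t
    using DERIV_add[OF DERIV_mult[OF f(2) g(1)] DERIV_mult[OF f(1) g(2)]] by (simp add: algebra_simps)
  moreover have "continuous_on UNIV (\<lambda>t. f'' t * g t + 2 * (f' t * g' t) + f t * g'' t)"
    using C2_continuous[OF f(1)] C2_continuous[OF f(2)] C2_continuous[OF g(1)] C2_continuous[OF g(2)] f(3) g(3)
    by (intro continuous_intros)
  ultimately show ?thesis unfolding C2_def
    by (intro exI[of _ "\<lambda>t. f' t * g t + f t * g' t"]
        exI[of _ "\<lambda>t. f'' t * g t + 2 * (f' t * g' t) + f t * g'' t"]) simp
qed

lemma C2_exp: assumes "C2 f" shows "C2 (\<lambda>t. exp (f t))"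
proof -
  obtain f' f'' where
    f: "\<And>t. (f has_real_derivative f' t) (at t)" "\<And>t. (f' has_real_derivative f'' t) (at t)" "continuous_on UNIV f''"
    using assms unfolding C2_def by blast
  have d: "((\<lambda>t. exp (f t)) has_real_derivative exp (f t) * f' t) (at t)" for t
    by (rule DERIV_fun_exp[OF f(1)])
  moreover have "((\<lambda>t. exp (f t) * f' t) has_real_derivative
      exp (f t) * f' t * f' t + exp (f t) * f'' t) (at t)" for t
    using DERIV_mult[OF d f(2)] by (simp add: algebra_simps)
  moreover have "continuous_on UNIV (\<lambda>t. exp (f t) * f' t * f' t + exp (f t) * f'' t)"
    using C2_continuous[OF f(1)] C2_continuous[OF f(2)] f(3) by (intro continuous_intros)
  ultimately show ?thesis unfolding C2_def
    by (intro exI[of _ "\<lambda>t. exp (f t) * f' t"]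
        exI[of _ "\<lambda>t. exp (f t) * f' t * f' t + exp (f t) * f'' t"]) simp
qed

lemma C2_power: "C2 f \<Longrightarrow> C2 (\<lambda>t. f t ^ k)"
  by (induction k) (auto intro: C2_const C2_mult)

lemma C2_sum: "(\<And>x. x \<in> S \<Longrightarrow> C2 (f x)) \<Longrightarrow> C2 (\<lambda>t. \<Sum>x\<in>S. f x t)"
  by (induction S rule: infinite_finite_induct) (auto intro: C2_const C2_add)

text \<open>The second derivative is bounded on [0, 1] by compactness. As \<open>d\<close> may be
  any derivative at t, explicit formulas can be inserted later, independently of how
  \<open>C2\<close> was established.\<close>

lemma C2_taylor:
  assumes "C2 f"
  obtains B where "B \<ge> 0" "\<And>s t d. 0 \<le> t \<Longrightarrow> t < s \<Longrightarrow> s \<le> 1 \<Longrightarrow> (f has_real_derivative d) (at t) \<Longrightarrow>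
    \<bar>f s - f t - d * (s - t)\<bar> \<le> B * (s - t)\<^sup>2 \<and> \<bar>f s - f t\<bar> \<le> B * (s - t)"
proof -
  obtain f' f'' where
    f: "\<And>t. (f has_real_derivative f' t) (at t)" "\<And>t. (f' has_real_derivative f'' t) (at t)" "continuous_on UNIV f''"
    using assms unfolding C2_def by blast
  have "\<exists>B. \<forall>x\<in>{0..1}. \<bar>g x\<bar> \<le> B" if g: "continuous_on UNIV g" for g :: "real \<Rightarrow> real"
  proof -
    have "compact (g ` {0..1})" using g by (intro compact_continuous_image) (auto intro: continuous_on_subset)
    then have "bounded (g ` {0..1})" by (rule compact_imp_bounded)
    then show ?thesis unfolding bounded_iff by (auto simp: real_norm_def)
  qed
  then obtain B1 B2 where B: "\<And>x. x \<in> {0..1} \<Longrightarrow> \<bar>f' x\<bar> \<le> B1" "\<And>x. x \<in> {0..1} \<Longrightarrow> \<bar>f'' x\<bar> \<le> B2"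
    using C2_continuous[OF f(2)] f(3) by meson
  show ?thesis
  proof (rule that[of "max B1 B2"])
    have "0 \<le> \<bar>f' 0\<bar>" by simp
    also have "\<dots> \<le> max B1 B2" using B(1)[of 0] by simp
    finally show "0 \<le> max B1 B2" .
    fix s t d assume st: "0 \<le> t" "t < s" "s \<le> (1::real)" and d: "(f has_real_derivative d) (at t)"
    have d': "d = f' t" using DERIV_unique[OF d f(1)] .
    obtain \<xi> where x: "t < \<xi>" "\<xi> < s" "f s - f t = (s - t) * f' \<xi>"
      using MVT2[OF st(2), of f f'] f(1) by blast
    obtain \<zeta> where z: "t < \<zeta>" "\<zeta> < \<xi>" "f' \<xi> - f' t = (\<xi> - t) * f'' \<zeta>"
      using MVT2[OF x(1), of f' f''] f(2) by blast
    have "f s - f t - d * (s - t) = (s - t) * ((\<xi> - t) * f'' \<zeta>)"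
      unfolding d' x(3) z(3)[symmetric] by (simp add: algebra_simps)
    then have "\<bar>f s - f t - d * (s - t)\<bar> = (s - t) * ((\<xi> - t) * \<bar>f'' \<zeta>\<bar>)"
      using st x by (simp add: abs_mult)
    also have "\<dots> \<le> (s - t) * ((s - t) * max B1 B2)"
      using st x z B(2)[of \<zeta>] by (intro mult_left_mono mult_mono) auto
    finally have 1: "\<bar>f s - f t - d * (s - t)\<bar> \<le> max B1 B2 * (s - t)\<^sup>2"
      by (simp add: power2_eq_square mult_ac)
    have "\<bar>f s - f t\<bar> = (s - t) * \<bar>f' \<xi>\<bar>" using x st by (simp add: abs_mult)
    also have "\<dots> \<le> (s - t) * max B1 B2" using st x B(1)[of \<xi>] by (intro mult_left_mono) auto
    finally have "\<bar>f s - f t\<bar> \<le> max B1 B2 * (s - t)" by (simp add: mult.commute)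
    with 1 show "\<bar>f s - f t - d * (s - t)\<bar> \<le> max B1 B2 * (s - t)\<^sup>2 \<and> \<bar>f s - f t\<bar> \<le> max B1 B2 * (s - t)" by blast
  qed
qed

section \<open>The trajectories without their powers of n, and their derivatives\<close>

definition cF :: "hypergraph \<Rightarrow> real" where
  "cF F = 6 * real (num_triples F) / real (card (hg_aut F))"

lemma cF_nonneg: "cF F \<ge> 0" by (simp add: cF_def)

text \<open>The logarithmic derivative of \<open>traj_q\<close>.\<close>

definition lamq :: "nat \<Rightarrow> real \<Rightarrow> real" where
  "lamq l t = - (\<Sum>F\<in>Ffam l. cF F * (real (num_triples F - 1) * 6 * (6 * t) ^ (num_triples F - 2)))"

definition phiY :: "nat \<Rightarrow> real \<Rightarrow> real" where
  "phiY l t = traj_p t ^ 2 * traj_q l t"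

definition phiW :: "nat \<Rightarrow> hypergraph \<Rightarrow> nat \<Rightarrow> real \<Rightarrow> real" where
  "phiW l F k t = cF F * real ((num_triples F - 1) choose k) * (6 * t) ^ k *
     (traj_p t ^ 3 * traj_q l t) ^ (num_triples F - 1 - k)"

text \<open>The expected number of triples closing a given available triple: over its three pairs,
  and through copies lacking only two triples.\<close>

definition C_hat :: "nat \<Rightarrow> nat \<Rightarrow> real \<Rightarrow> real" where
  "C_hat l n t = 3 * Y_hat l n t + (\<Sum>F\<in>Ffam l. W_hat l n F (num_triples F - 2) t)"

lemma traj_q_alt: "traj_q l t = exp (- (\<Sum>F\<in>Ffam l. cF F * (6 * t) ^ (num_triples F - 1)))"
  by (simp add: traj_q_def cF_def)

lemma Y_hat_phi: "Y_hat l n t = real n * phiY l t"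
  by (simp add: Y_hat_def phiY_def)

lemma W_hat_phi: "W_hat l n F k t = real n ^ (num_triples F - 1 - k) * phiW l F k t"
  by (simp add: W_hat_def phiW_def cF_def power_mult_distrib)

lemma C2_traj_p: "C2 traj_p"
proof -
  have "C2 (\<lambda>t. 1 + (-6) * t)" by (intro C2_add C2_mult C2_const C2_ident)
  then show ?thesis by (simp add: traj_p_def[abs_def])
qed

lemma C2_traj_q: "C2 (traj_q l)"
proof -
  have "C2 (\<lambda>t. exp ((-1) * (\<Sum>F\<in>Ffam l. cF F * (6 * t) ^ (num_triples F - 1))))"
    by (intro C2_exp C2_mult C2_const C2_sum C2_power C2_ident)
  then show ?thesis by (simp add: traj_q_alt[abs_def])
qed

lemma C2_phiY: "C2 (phiY l)"
  unfolding phiY_def[abs_def] by (intro C2_mult C2_power C2_traj_p C2_traj_q)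

lemma C2_phiW: "C2 (phiW l F k)"
  unfolding phiW_def[abs_def] by (intro C2_mult C2_power C2_traj_p C2_traj_q C2_const C2_ident)

lemma traj_p_deriv: "(traj_p has_real_derivative -6) (at t)"
  unfolding traj_p_def[abs_def] by (auto intro!: derivative_eq_intros)

lemma six_power_deriv: "((\<lambda>t. (6 * t) ^ k) has_real_derivative real k * 6 * (6 * t) ^ (k - 1)) (at t)"
proof -
  have "((\<lambda>t. 6 * t) has_real_derivative 6) (at t)" by (auto intro!: derivative_eq_intros)
  from DERIV_power[OF this, of k] show ?thesis by (simp only: mult.assoc One_nat_def)
qed

lemma six_power_le_one: "0 \<le> t \<Longrightarrow> 6 * t \<le> 1 \<Longrightarrow> (6 * t) ^ k \<le> (1::real)"
  by (rule power_le_one) simp_all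

lemma traj_q_deriv: "(traj_q l has_real_derivative traj_q l t * lamq l t) (at t)"
proof -
  have "((\<lambda>t. - (\<Sum>F\<in>Ffam l. cF F * (6 * t) ^ (num_triples F - 1))) has_real_derivative lamq l t) (at t)"
    unfolding lamq_def
  proof (intro DERIV_minus DERIV_sum DERIV_cmult)
    fix F assume "F \<in> Ffam l"
    have "num_triples F - 1 - 1 = num_triples F - 2" by simp
    then show "((\<lambda>t. (6 * t) ^ (num_triples F - 1)) has_real_derivative
        real (num_triples F - 1) * 6 * (6 * t) ^ (num_triples F - 2)) (at t)"
      using six_power_deriv[of "num_triples F - 1" t] by (simp only:)
  qed
  from DERIV_fun_exp[OF this] show ?thesis unfolding traj_q_alt[abs_def] by simp
qed

lemma phiY_deriv:
  "(phiY l has_real_derivative traj_p t * traj_q l t * (-12 + traj_p t * lamq l t)) (at t)"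
proof -
  have "(phiY l has_real_derivative
      2 * traj_p t * (-6) * traj_q l t + traj_p t ^ 2 * (traj_q l t * lamq l t)) (at t)"
    unfolding phiY_def[abs_def]
    by (rule derivative_eq_intros traj_p_deriv traj_q_deriv refl)+ simp
  then show ?thesis by (simp add: algebra_simps power2_eq_square)
qed

lemma phiW_deriv:
  assumes "m = num_triples F - 1 - k"
  shows "(phiW l F k has_real_derivative cF F * real ((num_triples F - 1) choose k) *
      (real k * 6 * (6 * t) ^ (k - 1) * (traj_p t ^ 3 * traj_q l t) ^ m +
       (6 * t) ^ k * (real m * (traj_p t ^ 3 * traj_q l t) ^ (m - 1) *
         (traj_p t ^ 2 * traj_q l t * (-18 + traj_p t * lamq l t))))) (at t)"
proof -
  have d1: "((\<lambda>t. traj_p t ^ 3 * traj_q l t) has_real_derivative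
      traj_p t ^ 2 * traj_q l t * (-18 + traj_p t * lamq l t)) (at t)"
  proof -
    have "((\<lambda>t. traj_p t ^ 3 * traj_q l t) has_real_derivative
      3 * traj_p t ^ 2 * (-6) * traj_q l t + traj_p t ^ 3 * (traj_q l t * lamq l t)) (at t)"
      by (rule derivative_eq_intros traj_p_deriv traj_q_deriv refl)+ simp
    then show ?thesis by (simp add: algebra_simps power2_eq_square power3_eq_cube)
  qed
  have d2: "((\<lambda>t. (traj_p t ^ 3 * traj_q l t) ^ m) has_real_derivative
      real m * (traj_p t ^ 3 * traj_q l t) ^ (m - 1) * (traj_p t ^ 2 * traj_q l t * (-18 + traj_p t * lamq l t))) (at t)"
    using DERIV_power[OF d1, of m] by (simp add: mult_ac)
  have d3: "((\<lambda>t. (6 * t) ^ k) has_real_derivative real k * 6 * (6 * t) ^ (k - 1)) (at t)"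
    by (rule six_power_deriv)
  have "((\<lambda>t. cF F * real ((num_triples F - 1) choose k) * ((6 * t) ^ k * (traj_p t ^ 3 * traj_q l t) ^ m)) has_real_derivative
      cF F * real ((num_triples F - 1) choose k) *
      (real k * 6 * (6 * t) ^ (k - 1) * (traj_p t ^ 3 * traj_q l t) ^ m +
       (real m * (traj_p t ^ 3 * traj_q l t) ^ (m - 1) *
         (traj_p t ^ 2 * traj_q l t * (-18 + traj_p t * lamq l t))) * (6 * t) ^ k)) (at t)"
    by (rule DERIV_cmult[OF DERIV_mult[OF d3 d2]])
  then show ?thesis unfolding phiW_def[abs_def] assms by (simp add: mult_ac)
qed

text \<open>Summing the trajectories with k = e_F - 2 differentiates the exponent of q. Consequently
  \<open>C_hat\<close> divided by \<open>Q_hat\<close> is minus the logarithmic derivative of p^3 q,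
  divided by n^2: an available triple is closed at just the rate at which p^3 q decays, and this
  explains the form of q.\<close>

lemma C_hat_alt: "C_hat l n t = real n * (traj_p t ^ 2 * traj_q l t) * (3 - traj_p t * lamq l t / 6)"
proof -
  have "W_hat l n F (num_triples F - 2) t = cF F * (real (num_triples F - 1) * 6 * (6 * t) ^ (num_triples F - 2))
      * (real n * traj_p t ^ 3 * traj_q l t / 6)" if F: "F \<in> Ffam l" for F
  proof -
    have E: "4 \<le> num_triples F" using num_triples_ge[OF F] by simp
    have 1: "num_triples F - 1 - (num_triples F - 2) = 1" using E by simp
    have "(num_triples F - 1) choose (num_triples F - 2) = num_triples F - 1"
    proof -
      obtain j where "num_triples F - 1 = Suc j" using E by (cases "num_triples F - 1") auto
      moreover then have "num_triples F - 2 = j" by simp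
      ultimately show ?thesis by simp
    qed
    then show ?thesis unfolding W_hat_phi phiW_def 1 by (simp add: mult_ac)
  qed
  then have "(\<Sum>F\<in>Ffam l. W_hat l n F (num_triples F - 2) t) = - lamq l t * (real n * traj_p t ^ 3 * traj_q l t / 6)"
    unfolding lamq_def minus_minus sum_distrib_right by (rule sum.cong[OF refl])
  then show ?thesis unfolding C_hat_def Y_hat_def by (simp add: algebra_simps power2_eq_square power3_eq_cube)
qed

text \<open>Uniform constants for 0 \<le> t \<le> 1/6: \<open>q_min\<close> is a lower bound for q,
  \<open>Lam\<close> bounds |\<open>lamq\<close>|, and \<open>Kphi\<close> bounds W relative to its
  power of p^2 n.\<close>

definition q_min :: "nat \<Rightarrow> real" where "q_min l = exp (- (\<Sum>F\<in>Ffam l. cF F))"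
definition Lam :: "nat \<Rightarrow> real" where "Lam l = (\<Sum>F\<in>Ffam l. cF F * (real (num_triples F) * 6))"
definition Kphi :: "nat \<Rightarrow> real" where "Kphi l = 1 + (\<Sum>F\<in>Ffam l. cF F * 2 ^ num_triples F)"

lemma q_min_pos: "q_min l > 0" by (simp add: q_min_def)

lemma Kphi_ge: "Kphi l \<ge> 1" by (simp add: Kphi_def sum_nonneg cF_nonneg)

lemma Lam_nonneg: "Lam l \<ge> 0" by (simp add: Lam_def sum_nonneg cF_nonneg)

lemma traj_q_bounds:
  assumes "0 \<le> t" "6 * t \<le> 1" shows "q_min l \<le> traj_q l t" "traj_q l t \<le> 1"
proof -
  have "(\<Sum>F\<in>Ffam l. cF F * (6 * t) ^ (num_triples F - 1)) \<le> (\<Sum>F\<in>Ffam l. cF F)"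
    by (intro sum_mono mult_left_le cF_nonneg six_power_le_one[OF assms])
  then show "q_min l \<le> traj_q l t" by (simp add: q_min_def traj_q_alt)
  have "0 \<le> (\<Sum>F\<in>Ffam l. cF F * (6 * t) ^ (num_triples F - 1))"
    using assms by (intro sum_nonneg) (auto simp: cF_nonneg)
  then show "traj_q l t \<le> 1" by (simp add: traj_q_alt)
qed

lemma lamq_bounds:
  assumes "0 \<le> t" "6 * t \<le> 1" shows "- Lam l \<le> lamq l t" "lamq l t \<le> 0"
proof -
  have "(\<Sum>F\<in>Ffam l. cF F * (real (num_triples F - 1) * 6 * (6 * t) ^ (num_triples F - 2)))
    \<le> (\<Sum>F\<in>Ffam l. cF F * (real (num_triples F) * 6))"
  proof (intro sum_mono mult_left_mono)
    fix F
    have "real (num_triples F - 1) * 6 * (6 * t) ^ (num_triples F - 2) \<le> real (num_triples F) * 6 * 1"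
      using assms(1) by (intro mult_mono six_power_le_one[OF assms]) auto
    then show "real (num_triples F - 1) * 6 * (6 * t) ^ (num_triples F - 2) \<le> real (num_triples F) * 6" by simp
  qed (auto simp: cF_nonneg)
  then show "- Lam l \<le> lamq l t" by (simp add: lamq_def Lam_def)
  have "0 \<le> (\<Sum>F\<in>Ffam l. cF F * (real (num_triples F - 1) * 6 * (6 * t) ^ (num_triples F - 2)))"
    using assms by (intro sum_nonneg mult_nonneg_nonneg) (auto simp: cF_nonneg)
  then show "lamq l t \<le> 0" by (simp add: lamq_def)
qed

lemma Y_hat_bounds:
  assumes "0 \<le> t" "6 * t \<le> 1" shows "0 \<le> Y_hat l n t" "Y_hat l n t \<le> traj_p t ^ 2 * real n"
proof -
  have q: "0 \<le> traj_q l t" "traj_q l t \<le> 1" using traj_q_bounds[OF assms, of l] q_min_pos[of l] by auto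
  show "0 \<le> Y_hat l n t" using q by (simp add: Y_hat_def)
  have "traj_p t ^ 2 * traj_q l t * real n \<le> traj_p t ^ 2 * 1 * real n"
    using q by (intro mult_right_mono mult_left_mono) auto
  then show "Y_hat l n t \<le> traj_p t ^ 2 * real n" by (simp add: Y_hat_def)
qed

lemma C_hat_bounds:
  assumes "0 \<le> t" "6 * t \<le> 1"
  shows "0 \<le> C_hat l n t" "C_hat l n t \<le> (3 + Lam l) * (traj_p t ^ 2 * real n)"
proof -
  have q: "0 \<le> traj_q l t" "traj_q l t \<le> 1" using traj_q_bounds[OF assms, of l] q_min_pos[of l] by auto
  have p: "0 \<le> traj_p t" "traj_p t \<le> 1" using assms by (auto simp: traj_p_def)
  have lam: "- Lam l \<le> lamq l t" "lamq l t \<le> 0" using lamq_bounds[OF assms] by auto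
  have pl: "0 \<le> - (traj_p t * lamq l t)" using p lam by (simp add: mult_nonneg_nonpos)
  have "- (traj_p t * lamq l t) \<le> 1 * Lam l"
    using mult_mono[OF p(2), of "- lamq l t" "Lam l"] p lam by simp
  then have 3: "3 - traj_p t * lamq l t / 6 \<le> 3 + Lam l" "0 \<le> 3 - traj_p t * lamq l t / 6"
    using Lam_nonneg[of l] pl by linarith+
  have b: "0 \<le> real n * (traj_p t ^ 2 * traj_q l t)" using q by simp
  show "0 \<le> C_hat l n t" unfolding C_hat_alt using b 3(2) by (rule mult_nonneg_nonneg)
  have "real n * (traj_p t ^ 2 * traj_q l t) \<le> real n * (traj_p t ^ 2 * 1)"
    using q by (intro mult_left_mono) auto
  then have "C_hat l n t \<le> real n * (traj_p t ^ 2 * 1) * (3 + Lam l)"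
    unfolding C_hat_alt by (rule mult_mono[OF _ 3(1) _ 3(2)]) simp
  then show "C_hat l n t \<le> (3 + Lam l) * (traj_p t ^ 2 * real n)" by (simp add: mult_ac)
qed

lemma W_hat_bounds:
  assumes "0 \<le> t" "6 * t \<le> 1" and F: "F \<in> Ffam l" and k: "k \<le> num_triples F - 1"
  shows "0 \<le> W_hat l n F k t" "W_hat l n F k t \<le> Kphi l * (traj_p t ^ 2 * real n) ^ (num_triples F - 1 - k)"
proof -
  let ?m = "num_triples F - 1 - k"
  have q: "0 \<le> traj_q l t" "traj_q l t \<le> 1" using traj_q_bounds[OF assms(1,2), of l] q_min_pos[of l] by auto
  have p: "0 \<le> traj_p t" "traj_p t \<le> 1" using assms by (auto simp: traj_p_def)
  have pq0: "0 \<le> traj_p t ^ 3 * traj_q l t * real n" using p q by simp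
  show "0 \<le> W_hat l n F k t" unfolding W_hat_def
    using assms(1) zero_le_power[OF pq0] by (intro mult_nonneg_nonneg[OF _ zero_le_power[OF pq0]]) auto
  have "traj_p t ^ 3 * traj_q l t \<le> traj_p t ^ 2 * 1"
    using p q by (intro mult_mono power_decreasing) auto
  then have "traj_p t ^ 3 * traj_q l t * real n \<le> traj_p t ^ 2 * real n"
    by (intro mult_right_mono) auto
  then have pq: "(traj_p t ^ 3 * traj_q l t * real n) ^ ?m \<le> (traj_p t ^ 2 * real n) ^ ?m"
    using pq0 by (intro power_mono)
  have "(num_triples F - 1) choose k \<le> 2 ^ (num_triples F - 1)" by (rule binomial_le_pow2)
  then have "real ((num_triples F - 1) choose k) \<le> 2 ^ (num_triples F - 1)"
    by (metis of_nat_le_iff of_nat_numeral of_nat_power)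
  also have "\<dots> \<le> 2 ^ num_triples F" by (intro power_increasing) auto
  finally have bin: "real ((num_triples F - 1) choose k) \<le> 2 ^ num_triples F" .
  have "W_hat l n F k t = (cF F * real ((num_triples F - 1) choose k) * (6 * t) ^ k) * (traj_p t ^ 3 * traj_q l t * real n) ^ ?m"
    by (simp add: W_hat_def cF_def)
  also have "\<dots> \<le> (cF F * 2 ^ num_triples F * 1) * (traj_p t ^ 2 * real n) ^ ?m"
    using bin pq pq0 cF_nonneg[of F] assms(1) by (intro mult_mono six_power_le_one[OF assms(1,2)]) auto
  also have "\<dots> \<le> Kphi l * (traj_p t ^ 2 * real n) ^ ?m"
  proof (rule mult_right_mono)
    have "cF F * 2 ^ num_triples F \<le> (\<Sum>F\<in>Ffam l. cF F * 2 ^ num_triples F)"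
      using F finite_Ffam cF_nonneg by (intro member_le_sum) auto
    then show "cF F * 2 ^ num_triples F * 1 \<le> Kphi l" by (simp add: Kphi_def)
  qed simp
  finally show "W_hat l n F k t \<le> Kphi l * (traj_p t ^ 2 * real n) ^ ?m" .
qed

text \<open>The left side is the expected change of |Y|. Each of its triples is lost through its
  closing triples, except those over the pair uv itself: they cover the pair, after which Y is no
  longer observed. The right side is the derivative of \<open>phiY\<close>, times n, per step of
  length 1/n^2.\<close>

lemma Y_drift_identity:
  assumes "traj_p t \<noteq> 0" "n > 0"
  shows "- (Y_hat l n t * (C_hat l n t - Y_hat l n t)) / Q_hat l n t
    = traj_p t * traj_q l t * (-12 + traj_p t * lamq l t) * real n / real n ^ 2"
proof -
  have q: "traj_q l t \<noteq> 0" by (simp add: traj_q_def)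
  show ?thesis unfolding C_hat_alt Y_hat_def Q_hat_def using assms q
    by (simp add: field_simps power2_eq_square power3_eq_cube)
qed

definition W_gain_hat :: "nat \<Rightarrow> nat \<Rightarrow> hypergraph \<Rightarrow> nat \<Rightarrow> real \<Rightarrow> real" where
  "W_gain_hat l n F k t = (if k = 0 then 0 else real (num_triples F - k) * W_hat l n F (k - 1) t)"

text \<open>Gain and loss reproduce the two terms of the product rule for (6t)^k (p^3 q)^m. The loss
  term uses that \<open>C_hat\<close> over \<open>Q_hat\<close> is the decay rate of p^3 q.\<close>

lemma W_drift_identity:
  assumes p: "traj_p t \<noteq> 0" and n: "n > 0" and m: "m = num_triples F - 1 - k" "1 \<le> m"
  shows "(W_gain_hat l n F k t - W_hat l n F k t * (real m * C_hat l n t)) / Q_hat l n t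
    = cF F * real ((num_triples F - 1) choose k) *
      (real k * 6 * (6 * t) ^ (k - 1) * (traj_p t ^ 3 * traj_q l t) ^ m +
       (6 * t) ^ k * (real m * (traj_p t ^ 3 * traj_q l t) ^ (m - 1) *
         (traj_p t ^ 2 * traj_q l t * (-18 + traj_p t * lamq l t)))) * real n ^ m / real n ^ 2"
proof -
  let ?E = "num_triples F" and ?N = "real n" and ?p = "traj_p t" and ?q = "traj_q l t"
  let ?x = "?p ^ 3 * ?q"
  have q: "?q \<noteq> 0" by (simp add: traj_q_def)
  have x: "?x \<noteq> 0" using p q by simp
  have Q: "Q_hat l n t = ?x * ?N ^ 3 / 6" by (simp add: Q_hat_def)
  have gain: "W_gain_hat l n F k t / Q_hat l n t
      = cF F * real ((?E - 1) choose k) * (real k * 6 * (6 * t) ^ (k - 1) * ?x ^ m) * ?N ^ m / ?N ^ 2"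
  proof (cases k)
    case (Suc j)
    \<comment> \<open>The number of ways to gain a triple matches the derivative of (6t)^k by
      binomial absorption.\<close>
    have bin: "real (?E - k) * real ((?E - 1) choose j) = real k * real ((?E - 1) choose k)"
    proof -
      obtain a where a: "?E - 1 = Suc a" using m Suc by (cases "?E - 1") auto
      have "Suc j * (Suc a choose Suc j) = Suc a * (a choose j)" using Suc_times_binomial[of j a] by simp
      moreover have "(Suc a - j) * (Suc a choose j) = Suc a * (a choose j)"
        using binomial_absorb_comp[of "Suc a" j] by simp
      moreover have "?E - k = Suc a - j" using a Suc by simp
      ultimately have "(?E - k) * ((?E - 1) choose j) = k * ((?E - 1) choose k)" using a Suc by simp
      then show ?thesis by (metis of_nat_mult)
    qed
    have e: "?E - 1 - j = Suc m" using m Suc by simp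
    have "W_gain_hat l n F k t = real (?E - k) * real ((?E - 1) choose j) * (cF F * (6 * t) ^ j * (?N ^ Suc m * ?x ^ Suc m))"
      unfolding W_gain_hat_def W_hat_phi phiW_def Suc diff_Suc_1 e by (simp add: mult_ac)
    also have "\<dots> = real k * real ((?E - 1) choose k) * (cF F * (6 * t) ^ j * (?N ^ Suc m * ?x ^ Suc m))"
      unfolding bin ..
    also have "\<dots> / Q_hat l n t = cF F * real ((?E - 1) choose k) * (real k * 6 * (6 * t) ^ (k - 1) * ?x ^ m) * ?N ^ m / ?N ^ 2"
    proof -
      have "?N ^ Suc m * ?x ^ Suc m / (?x * ?N ^ 3 / 6) = 6 * (?N ^ m * ?x ^ m) / ?N ^ 2"
        using x n by (simp add: field_simps power2_eq_square power3_eq_cube)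
      moreover have "real k * real ((?E - 1) choose k) * (cF F * (6 * t) ^ j * (?N ^ Suc m * ?x ^ Suc m)) / (?x * ?N ^ 3 / 6)
         = real k * real ((?E - 1) choose k) * (cF F * (6 * t) ^ j) * (?N ^ Suc m * ?x ^ Suc m / (?x * ?N ^ 3 / 6))"
        by (simp only: times_divide_eq_right mult.assoc)
      ultimately show ?thesis unfolding Q using Suc by (simp add: mult_ac)
    qed
    finally show ?thesis .
  qed (simp add: W_gain_hat_def)
  have loss: "W_hat l n F k t * (real m * C_hat l n t) / Q_hat l n t
      = - (cF F * real ((?E - 1) choose k) * ((6 * t) ^ k * (real m * ?x ^ (m - 1) *
         (?p ^ 2 * ?q * (-18 + ?p * lamq l t)))) * ?N ^ m / ?N ^ 2)"
  proof -
    obtain j where j: "m = Suc j" using m(2) by (cases m) auto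
    have W: "W_hat l n F k t = cF F * real ((?E - 1) choose k) * (6 * t) ^ k * (?N ^ m * (?x ^ j * ?x))"
      unfolding W_hat_phi phiW_def m(1)[symmetric] unfolding j by (simp add: mult_ac)
    have "?x * C_hat l n t / Q_hat l n t = - (?p ^ 2 * ?q * (-18 + ?p * lamq l t)) / ?N ^ 2"
      unfolding Q C_hat_alt using x p q n by (simp add: field_simps power2_eq_square power3_eq_cube)
    moreover have "W_hat l n F k t * (real m * C_hat l n t) / Q_hat l n t
      = cF F * real ((?E - 1) choose k) * (6 * t) ^ k * ?N ^ m * real m * ?x ^ j * (?x * C_hat l n t / Q_hat l n t)"
      unfolding W by (simp add: mult_ac)
    ultimately show ?thesis using j by (simp add: mult_ac)
  qed
  show ?thesis unfolding diff_divide_distrib gain loss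
    by (simp add: add_divide_distrib distrib_left distrib_right)
qed

text \<open>The bound is scale invariant in \<open>p\<close>, which is what makes the error growth rate \<open>O(1/p)\<close>.\<close>

lemma drift_ratio_error:
  fixes N p q q0 \<eta> K S S' Qr :: real
  assumes N: "N > 0" and p: "0 < p" and q: "0 < q0" "q0 \<le> q" and eta: "0 \<le> \<eta>" "\<eta> \<le> q0 * (p\<^sup>2 * N) / 12"
    and Qr: "\<bar>Qr - p ^ 3 * q * N ^ 3 / 6\<bar> \<le> \<eta> * (p * N\<^sup>2)" and m: "m \<ge> 1" and K: "K \<ge> 0"
    and S: "\<bar>S - S'\<bar> \<le> K * (p\<^sup>2 * N) * (\<eta> * (p\<^sup>2 * N) ^ (m - 1))" and S': "\<bar>S'\<bar> \<le> K * (p\<^sup>2 * N) ^ (m + 1)"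
  shows "q0 * (p ^ 3 * N ^ 3) / 12 \<le> Qr"
    and "\<bar>S / Qr - S' / (p ^ 3 * q * N ^ 3 / 6)\<bar> \<le> K * (12 / q0 + 72 / q0\<^sup>2) * (\<eta> * (p\<^sup>2 * N) ^ (m - 1) / (p * N\<^sup>2))"
proof -
  let ?Q = "p ^ 3 * q * N ^ 3 / 6" and ?e = "\<eta> * (p\<^sup>2 * N) ^ (m - 1)"
  have pN: "p ^ 3 * N ^ 3 > 0" using p N by simp
  have Q6: "q0 * (p ^ 3 * N ^ 3) / 6 \<le> ?Q"
    using mult_right_mono[OF q(2), of "p ^ 3 * N ^ 3"] pN by (simp add: mult_ac)
  have "\<eta> * (p * N\<^sup>2) \<le> q0 * (p\<^sup>2 * N) / 12 * (p * N\<^sup>2)" using eta p N by (intro mult_right_mono) auto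
  also have "\<dots> = q0 * (p ^ 3 * N ^ 3) / 12" by (simp add: power2_eq_square power3_eq_cube)
  finally show Qlow: "q0 * (p ^ 3 * N ^ 3) / 12 \<le> Qr" using Qr Q6 by linarith
  let ?b = "q0 * (p ^ 3 * N ^ 3) / 12"
  have b0: "?b > 0" using q pN by simp
  have Qr0: "Qr > 0" using Qlow b0 by linarith
  have Q0: "?Q > 0" using Q6 b0 by linarith
  have e0: "?e \<ge> 0" using eta p N by simp
  have "\<bar>(S - S') / Qr\<bar> \<le> K * (p\<^sup>2 * N) * ?e / ?b"
    unfolding abs_divide using S Qlow b0 Qr0 K p N e0 by (intro frac_le) auto
  also have "\<dots> = K * (12 / q0) * (?e / (p * N\<^sup>2))"
    using p N q by (simp add: field_simps power2_eq_square power3_eq_cube)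
  finally have 1: "\<bar>(S - S') / Qr\<bar> \<le> K * (12 / q0) * (?e / (p * N\<^sup>2))" .
  have "\<bar>S' * (?Q - Qr) / (Qr * ?Q)\<bar> = \<bar>S'\<bar> * \<bar>Qr - ?Q\<bar> / (Qr * ?Q)"
  proof -
    have "\<bar>S' * (?Q - Qr) / (Qr * ?Q)\<bar> = \<bar>S'\<bar> * \<bar>?Q - Qr\<bar> / \<bar>Qr * ?Q\<bar>"
      by (simp only: abs_divide abs_mult)
    moreover have "\<bar>Qr * ?Q\<bar> = Qr * ?Q" by (rule abs_of_pos[OF mult_pos_pos[OF Qr0 Q0]])
    ultimately show ?thesis by (simp only: abs_minus_commute)
  qed
  also have "\<dots> \<le> (K * (p\<^sup>2 * N) ^ (m + 1)) * (\<eta> * (p * N\<^sup>2)) / (?b * (q0 * (p ^ 3 * N ^ 3) / 6))"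
  proof (rule frac_le)
    show "\<bar>S'\<bar> * \<bar>Qr - ?Q\<bar> \<le> (K * (p\<^sup>2 * N) ^ (m + 1)) * (\<eta> * (p * N\<^sup>2))"
      using S' Qr K p N by (intro mult_mono) auto
    show "?b * (q0 * (p ^ 3 * N ^ 3) / 6) \<le> Qr * ?Q" using Qlow Q6 b0 Qr0 by (intro mult_mono) auto
  qed (use K p N eta b0 in auto)
  also have "\<dots> = K * (72 / q0\<^sup>2) * (?e / (p * N\<^sup>2))"
  proof -
    have "m + 1 = (m - 1) + 2" using m by simp
    then have "(p\<^sup>2 * N) ^ (m + 1) = (p\<^sup>2 * N) ^ (m - 1) * (p\<^sup>2 * N)\<^sup>2" by (metis power_add)
    then show ?thesis using p N q by (simp add: field_simps power2_eq_square power3_eq_cube)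
  qed
  finally have 2: "\<bar>S' * (?Q - Qr) / (Qr * ?Q)\<bar> \<le> K * (72 / q0\<^sup>2) * (?e / (p * N\<^sup>2))" .
  \<comment> \<open>The error of the numerator and the error of the denominator are separated; they
    yield the terms with 12 and with 72.\<close>
  have "S / x - S' / y = (S - S') / x + S' * (y - x) / (x * y)" if "x > 0" "y > 0" for x y :: real
    using that by (simp add: field_simps)
  from this[OF Qr0 Q0] have "\<bar>S / Qr - S' / ?Q\<bar> \<le> \<bar>(S - S') / Qr\<bar> + \<bar>S' * (?Q - Qr) / (Qr * ?Q)\<bar>"
    by (simp only: abs_triangle_ineq)
  also have "\<dots> \<le> K * (12 / q0) * (?e / (p * N\<^sup>2)) + K * (72 / q0\<^sup>2) * (?e / (p * N\<^sup>2))"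
    by (rule add_mono[OF 1 2])
  also have "\<dots> = K * (12 / q0 + 72 / q0\<^sup>2) * (?e / (p * N\<^sup>2))"
    by (simp only: distrib_left distrib_right)
  finally show "\<bar>S / Qr - S' / ?Q\<bar> \<le> K * (12 / q0 + 72 / q0\<^sup>2) * (?e / (p * N\<^sup>2))" .
qed

section \<open>Error growth and concentration\<close>

text \<open>With y = x / p this is 1 + a y \<le> (1 - y)^-a, which follows from Bernoulli's
  inequality since (1 + y)^a (1 - y)^a \<le> 1.\<close>

lemma inverse_power_growth:
  fixes p x :: real
  assumes "0 \<le> x" "x < p"
  shows "1 / p ^ a + real a * x / p * (1 / p ^ a) \<le> 1 / (p - x) ^ a"
proof -
  let ?y = "x / p"
  have p: "p > 0" using assms by simp
  have y: "0 \<le> ?y" "?y < 1" using assms p by simp_all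
  have "1 + real a * ?y \<le> (1 + ?y) ^ a" using y by (intro Bernoulli_inequality) linarith
  then have "(1 + real a * ?y) * (1 - ?y) ^ a \<le> (1 + ?y) ^ a * (1 - ?y) ^ a"
    using y by (intro mult_right_mono) auto
  also have "\<dots> = (1 - ?y\<^sup>2) ^ a" by (simp add: power_mult_distrib[symmetric] algebra_simps power2_eq_square)
  also have "\<dots> \<le> 1" using y by (intro power_le_one) (auto simp: power_le_one)
  finally have *: "(1 + real a * ?y) * (1 - ?y) ^ a \<le> 1" .
  have "(p - x) ^ a = p ^ a * (1 - ?y) ^ a"
    using p by (simp add: power_mult_distrib[symmetric] right_diff_distrib)
  moreover have "(1 - ?y) ^ a > 0" using y by simp
  moreover have "(1 + real a * ?y) / p ^ a \<le> 1 / (p ^ a * (1 - ?y) ^ a)"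
  proof -
    have "1 + real a * ?y \<le> 1 / (1 - ?y) ^ a" using * \<open>(1 - ?y) ^ a > 0\<close> by (simp add: pos_le_divide_eq)
    then have "(1 + real a * ?y) / p ^ a \<le> 1 / (1 - ?y) ^ a / p ^ a" using p by (intro divide_right_mono) auto
    then show ?thesis by (simp add: mult.commute)
  qed
  moreover have "(1 + real a * ?y) / p ^ a = 1 / p ^ a + real a * x / p * (1 / p ^ a)"
    by (simp add: add_divide_distrib)
  ultimately show ?thesis by simp
qed

text \<open>\<open>K0\<close> collects all constants independent of n. The two conditions in
  \<open>A_ge\<close> keep a nonnegative power of 1/p in every allowance and make the allowances
  grow faster than the errors feed back. By \<open>p_u\<close> powers of 1/p up to the exponent A +
  3 cost at most one factor u.\<close>

locale run_params =
  fixes l n L A m0 :: nat and u K0 :: real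
  assumes l4: "4 \<le> l" and L_def: "L = 2 * l + 6" and n_pos: "n > 0"
    and uN: "u ^ 100 = real n"
    and A_ge: "2 * l \<le> A" "2 * K0 \<le> 6 * (real A - 2 * real l)" and K0: "K0 \<ge> 1"
    and p_pos: "\<And>i. i \<le> m0 \<Longrightarrow> 0 < traj_p (real i / real n ^ 2)"
    and p_u: "\<And>i. i \<le> m0 \<Longrightarrow> 1 \<le> u * traj_p (real i / real n ^ 2) ^ (A + 3)"
    and u_big: "2 * K0 + 6 * real A \<le> u" "4 \<le> u"
    and m0_le: "m0 \<le> n ^ 2"
begin

abbreviation "N \<equiv> real n"
abbreviation "tt i \<equiv> real i / real n ^ 2"
abbreviation "pp i \<equiv> traj_p (tt i)"

definition eta :: "nat \<Rightarrow> real" where "eta i = u ^ 90 / pp i ^ A"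
text \<open>The allowance for a quantity of order n^m: m = 1 for Y and m = e_F - 1 - k for
  W.\<close>

definition err :: "nat \<Rightarrow> nat \<Rightarrow> real" where "err m i = eta i * (pp i ^ 2 * N) ^ (m - 1)"

lemma u_pos: "0 < u" "1 \<le> u" using u_big by auto

lemma N_pos: "0 < N" "1 \<le> N" using n_pos by auto

lemma pp_le1: "pp i \<le> 1" by (simp add: traj_p_def)

lemma tt_bounds: assumes "i \<le> m0" shows "0 \<le> tt i" "6 * tt i \<le> 1" "tt i \<le> 1"
  using p_pos[OF assms] by (simp_all add: traj_p_def)

lemma inv_p_le:
  assumes i: "i \<le> m0" and a: "a \<le> A + 3" shows "1 / pp i ^ a \<le> u"
proof -
  have p: "0 < pp i" using p_pos[OF i] .
  have "pp i ^ (A + 3) \<le> pp i ^ a" using p pp_le1 a by (intro power_decreasing) auto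
  then have "u * pp i ^ (A + 3) \<le> u * pp i ^ a" using u_pos by (intro mult_left_mono) auto
  then have "1 \<le> u * pp i ^ a" using p_u[OF i] by linarith
  then show ?thesis using p by (simp add: pos_divide_le_eq)
qed

lemma eta_bounds: assumes i: "i \<le> m0" shows "u ^ 90 \<le> eta i" "eta i \<le> u ^ 91" "eta i * u ^ 8 \<le> pp i ^ 2 * N"
proof -
  have p: "0 < pp i" using p_pos[OF i] .
  have "pp i ^ A \<le> 1" using p pp_le1 by (intro power_le_one) auto
  then show "u ^ 90 \<le> eta i" unfolding eta_def
    using p u_pos by (simp add: pos_le_divide_eq mult_left_le)
  have "u ^ 90 * (1 / pp i ^ A) \<le> u ^ 90 * u" using inv_p_le[OF i, of A] u_pos by (intro mult_left_mono) auto
  then show "eta i \<le> u ^ 91" unfolding eta_def by (simp add: power_Suc2[symmetric] del: power_Suc2)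
  have e: "eta i * (1 / pp i ^ 2) = u ^ 90 * (1 / pp i ^ (A + 2))"
    by (simp add: eta_def power_add power2_eq_square)
  have "u ^ 90 * (1 / pp i ^ (A + 2)) \<le> u ^ 90 * u"
    using inv_p_le[OF i, of "A + 2"] u_pos by (intro mult_left_mono) auto
  then have "eta i * (1 / pp i ^ 2) \<le> u ^ 91" unfolding e by (simp add: power_Suc2[symmetric] del: power_Suc2)
  then have "eta i \<le> u ^ 91 * pp i ^ 2" using p by (simp add: pos_divide_le_eq)
  then have "eta i * u ^ 8 \<le> u ^ 91 * pp i ^ 2 * u ^ 8" using u_pos by (intro mult_right_mono) auto
  also have "\<dots> = pp i ^ 2 * u ^ 99" by (simp add: mult_ac flip: power_add)
  also have "\<dots> \<le> pp i ^ 2 * u ^ 100" using u_pos by (intro mult_left_mono power_increasing) auto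
  finally show "eta i * u ^ 8 \<le> pp i ^ 2 * N" unfolding uN .
qed

text \<open>Collecting the powers of p shows that the factor (p^2 n)^(m-1) takes 2 (m - 1) away from
  the exponent A. Only the remainder makes the allowance grow, hence A must exceed 2 l by a multiple
  of K0.\<close>

lemma err_alt:
  assumes i: "i \<le> m0" and m: "1 \<le> m" "m \<le> l"
  shows "err m i = u ^ 90 * N ^ (m - 1) * (1 / pp i ^ (A - 2 * (m - 1)))"
proof -
  have p: "0 < pp i" using p_pos[OF i] .
  have "A = (A - 2 * (m - 1)) + 2 * (m - 1)" using A_ge m by simp
  then have "pp i ^ A = pp i ^ (A - 2 * (m - 1)) * pp i ^ (2 * (m - 1))" by (metis power_add)
  then show ?thesis unfolding err_def eta_def using p
    by (simp add: power_mult_distrib power_mult[symmetric])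
qed

lemma err_bounds:
  assumes i: "i \<le> m0" and m: "1 \<le> m" "m \<le> l"
  shows "N ^ (m - 1) \<le> err m i / pp i" "err m i / pp i \<le> N ^ m" "0 \<le> err m i" "err m i \<le> (pp i ^ 2 * N) ^ m"
proof -
  let ?a = "A - 2 * (m - 1)"
  have p: "0 < pp i" using p_pos[OF i] .
  have e: "err m i / pp i = u ^ 90 * N ^ (m - 1) * (1 / pp i ^ (?a + 1))"
    unfolding err_alt[OF assms] by (simp add: mult.commute)
  have "1 \<le> 1 / pp i ^ (?a + 1)" using p pp_le1[of i] by (simp add: power_le_one mult_le_one)
  moreover have "1 \<le> u ^ 90" using u_pos by simp
  ultimately have "1 * N ^ (m - 1) * 1 \<le> u ^ 90 * N ^ (m - 1) * (1 / pp i ^ (?a + 1))"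
    by (intro mult_mono) auto
  then show "N ^ (m - 1) \<le> err m i / pp i" unfolding e by simp
  have "u ^ 90 * N ^ (m - 1) * (1 / pp i ^ (?a + 1)) \<le> u ^ 90 * N ^ (m - 1) * u"
    using inv_p_le[OF i, of "?a + 1"] u_pos by (intro mult_left_mono) auto
  also have "\<dots> = N ^ (m - 1) * u ^ 91" by (simp add: power_Suc2[symmetric] del: power_Suc2)
  also have "\<dots> \<le> N ^ (m - 1) * u ^ 100" using u_pos by (intro mult_left_mono power_increasing) auto
  also have "\<dots> = N ^ m" unfolding uN using m by (cases m) auto
  finally show "err m i / pp i \<le> N ^ m" unfolding e .
  have e0: "0 \<le> eta i" using eta_bounds(1)[OF i] u_pos by (meson order_trans zero_le_power less_imp_le)
  show "0 \<le> err m i" unfolding err_def using e0 by simp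
  have "1 \<le> u ^ 8" using u_pos by simp
  then have "eta i * 1 \<le> eta i * u ^ 8" using e0 by (rule mult_left_mono)
  then have "eta i \<le> pp i ^ 2 * N" using eta_bounds(3)[OF i] by simp
  then have "err m i \<le> (pp i ^ 2 * N) * (pp i ^ 2 * N) ^ (m - 1)"
    unfolding err_def by (intro mult_right_mono) auto
  then show "err m i \<le> (pp i ^ 2 * N) ^ m" using m by (cases m) auto
qed

text \<open>One step lowers p by 6/n^2. The resulting increase of the allowance pays for the errors
  in the drift.\<close>

lemma err_growth:
  assumes i: "Suc i \<le> m0" and m: "1 \<le> m" "m \<le> l"
  shows "err m i + 6 * real (A - 2 * (m - 1)) * (err m i / (pp i * N\<^sup>2)) \<le> err m (Suc i)"
proof -
  let ?a = "A - 2 * (m - 1)"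
  have i': "i \<le> m0" using i by simp
  have p: "0 < pp i" using p_pos[OF i'] .
  have pS: "pp (Suc i) = pp i - 6 / N\<^sup>2" by (simp add: traj_p_def add_divide_distrib algebra_simps)
  have "1 / pp i ^ ?a + real ?a * (6 / N\<^sup>2) / pp i * (1 / pp i ^ ?a) \<le> 1 / (pp i - 6 / N\<^sup>2) ^ ?a"
    using p_pos[OF i] unfolding pS by (intro inverse_power_growth) auto
  then have "u ^ 90 * N ^ (m - 1) * (1 / pp i ^ ?a + real ?a * (6 / N\<^sup>2) / pp i * (1 / pp i ^ ?a))
      \<le> u ^ 90 * N ^ (m - 1) * (1 / (pp i - 6 / N\<^sup>2) ^ ?a)"
    using u_pos by (intro mult_left_mono) auto
  then show ?thesis unfolding err_alt[OF i' m] err_alt[OF i m] pS by (simp add: distrib_left mult_ac)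
qed

text \<open>Serves Y and W and both directions; \<sigma> is the sign of the deviation. Only the
  average of \<delta> has to match the trajectory, up to an error proportional to the allowance
  divided by p n^2.\<close>

lemma prob_tracking_one_sided:
  fixes X :: "nat set set \<Rightarrow> real" and \<sigma> :: real
  assumes sg: "\<bar>\<sigma>\<bar> = 1" and m: "1 \<le> m" "m \<le> l"
    and taylor: "\<And>s t. 0 \<le> t \<Longrightarrow> t < s \<Longrightarrow> s \<le> 1 \<Longrightarrow>
      \<bar>\<phi> s - \<phi> t - \<phi>' t * (s - t)\<bar> \<le> K0 * (s - t)\<^sup>2 \<and> \<bar>\<phi> s - \<phi> t\<bar> \<le> K0 * (s - t)"
    and alive: "\<And>es g. alive (es @ [g]) \<Longrightarrow> alive es"
    and step: "\<And>i es. i < m0 \<Longrightarrow> es \<in> set_pmf (process_steps l n i) \<Longrightarrow> survives G i es \<Longrightarrow> G es \<Longrightarrow>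
      alive es \<Longrightarrow> available l n (set es) \<noteq> {} \<Longrightarrow>
      \<exists>\<delta>. (\<forall>g\<in>available l n (set es). (alive (es @ [g]) \<longrightarrow> X (insert g (set es)) = X (set es) + \<delta> g) \<and>
          \<bar>\<delta> g\<bar> \<le> K0 * N ^ (m - 1) * u) \<and>
        \<bar>(\<Sum>g\<in>available l n (set es). \<delta> g) / real (card (available l n (set es))) - \<phi>' (tt i) * N ^ m / N\<^sup>2\<bar>
          \<le> K0 * (err m i / (pp i * N\<^sup>2)) \<and>
        (\<Sum>g\<in>available l n (set es). \<bar>\<delta> g\<bar>) \<le> K0 * (N ^ m / N\<^sup>2) * real (card (available l n (set es)))"
    and init: "\<bar>X {} - N ^ m * \<phi> 0\<bar> \<le> K0 * N ^ (m - 1)" and i: "i \<le> m0"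
  shows "measure_pmf.prob (process_steps l n i)
      {es. survives G i es \<and> alive es \<and> \<sigma> * (X (set es) - N ^ m * \<phi> (tt i)) - err m i \<ge> 0} \<le> exp (- u)"
proof -
  define Z where "Z = (\<lambda>i es. \<sigma> * (X (set es) - N ^ m * \<phi> (tt i)) - err m i)"
  \<comment> \<open>\<open>R\<close> and \<open>V\<close> exceed the actual bounds by enough powers
    of u to swallow all constants. The exponent 50 in \<theta> only needs to lie in a wide window:
    \<theta> R is u^-47, \<theta> times half the initial allowance is u^40 / 2, and the accumulated
    variance term over n^2 steps is u^4.\<close>
  define R where "R = N ^ m / u ^ 97"
  define V where "V = N ^ m / N\<^sup>2 * u"
  define \<theta> where "\<theta> = u ^ 50 / N ^ m"
  define a where "a = A - 2 * (m - 1)"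
  have u0: "0 < u" "1 \<le> u" using u_pos by auto
  have N0: "0 < N" "1 \<le> N" using N_pos by auto
  have Nm: "0 < N ^ m" using N0 by simp
  have N2: "N\<^sup>2 = u ^ 200" unfolding uN[symmetric] by (simp flip: power_mult)
  have mN: "N ^ (m - 1) = N ^ m / u ^ 100" unfolding uN using m N0 by (cases m) auto
  have aA: "real a \<le> real A" "2 * K0 \<le> 6 * real a"
    using A_ge m by (auto simp: a_def of_nat_diff)
  have step': "\<exists>\<Delta>. (\<forall>g\<in>available l n (set es). (alive (es @ [g]) \<longrightarrow> Z (Suc i) (es @ [g]) \<le> Z i es + \<Delta> g) \<and> \<bar>\<Delta> g\<bar> \<le> R) \<and>
      (\<Sum>g\<in>available l n (set es). \<Delta> g) \<le> 0 \<and>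
      (\<Sum>g\<in>available l n (set es). \<bar>\<Delta> g\<bar>) \<le> V * real (card (available l n (set es)))"
    if im: "i < m0" and es: "es \<in> set_pmf (process_steps l n i)" and sv: "survives G i es" "G es" "alive es"
      and ne: "available l n (set es) \<noteq> {}" for i es
  proof -
    let ?Q = "available l n (set es)"
    let ?q = "real (card ?Q)"
    have i': "i \<le> m0" "Suc i \<le> m0" using im by auto
    have q0: "?q > 0" using ne by (simp add: card_gt_0_iff finite_available)
    obtain \<delta> where d1: "\<And>g. g \<in> ?Q \<Longrightarrow> alive (es @ [g]) \<Longrightarrow> X (insert g (set es)) = X (set es) + \<delta> g"
      and d2: "\<And>g. g \<in> ?Q \<Longrightarrow> \<bar>\<delta> g\<bar> \<le> K0 * N ^ (m - 1) * u"
      and d3: "\<bar>(\<Sum>g\<in>?Q. \<delta> g) / ?q - \<phi>' (tt i) * N ^ m / N\<^sup>2\<bar> \<le> K0 * (err m i / (pp i * N\<^sup>2))"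
      and d4: "(\<Sum>g\<in>?Q. \<bar>\<delta> g\<bar>) \<le> K0 * (N ^ m / N\<^sup>2) * ?q"
      using step[OF im es sv ne] by blast
    define e where "e = err m i / (pp i * N\<^sup>2)"
    define f where "f = N ^ m * (\<phi> (tt (Suc i)) - \<phi> (tt i))"
    have p: "0 < pp i" using p_pos[OF i'(1)] .
    have st: "tt (Suc i) - tt i = 1 / N\<^sup>2" by (simp add: add_divide_distrib)
    have tl: "\<bar>\<phi> (tt (Suc i)) - \<phi> (tt i) - \<phi>' (tt i) * (1 / N\<^sup>2)\<bar> \<le> K0 * (1 / N\<^sup>2)\<^sup>2"
      "\<bar>\<phi> (tt (Suc i)) - \<phi> (tt i)\<bar> \<le> K0 * (1 / N\<^sup>2)"
      using taylor[of "tt i" "tt (Suc i)"] tt_bounds[OF i'(1)] tt_bounds[OF i'(2)] N0 unfolding st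
      by (auto simp: divide_strict_right_mono)
    have e_eq: "e = (err m i / pp i) / N\<^sup>2" by (simp add: e_def)
    have e_up: "e \<le> N ^ m / N\<^sup>2" unfolding e_eq using err_bounds(2)[OF i'(1) m] by (intro divide_right_mono) auto
    have e0: "0 \<le> e" unfolding e_def using err_bounds(3)[OF i'(1) m] p by simp
    have f_le: "\<bar>f\<bar> \<le> K0 * (N ^ m / N\<^sup>2)"
    proof -
      have "\<bar>f\<bar> = N ^ m * \<bar>\<phi> (tt (Suc i)) - \<phi> (tt i)\<bar>" unfolding f_def using Nm by (simp add: abs_mult)
      also have "\<dots> \<le> N ^ m * (K0 * (1 / N\<^sup>2))" using tl(2) Nm by (intro mult_left_mono) auto
      finally show ?thesis by (simp add: mult_ac)
    qed
    have f_dr: "\<bar>f - \<phi>' (tt i) * N ^ m / N\<^sup>2\<bar> \<le> K0 * e"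
    proof -
      have "f - \<phi>' (tt i) * N ^ m / N\<^sup>2 = N ^ m * (\<phi> (tt (Suc i)) - \<phi> (tt i) - \<phi>' (tt i) * (1 / N\<^sup>2))"
        unfolding f_def by (simp add: algebra_simps)
      then have "\<bar>f - \<phi>' (tt i) * N ^ m / N\<^sup>2\<bar> = N ^ m * \<bar>\<phi> (tt (Suc i)) - \<phi> (tt i) - \<phi>' (tt i) * (1 / N\<^sup>2)\<bar>"
        using Nm by (simp add: abs_mult)
      also have "\<dots> \<le> N ^ m * (K0 * (1 / N\<^sup>2)\<^sup>2)" using tl(1) Nm by (intro mult_left_mono) auto
      also have "\<dots> = K0 * ((N ^ m / N\<^sup>2) / N\<^sup>2)" by (simp add: power2_eq_square)
      also have "\<dots> \<le> K0 * e"
      proof (rule mult_left_mono)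
        have "N ^ m / N\<^sup>2 \<le> N ^ (m - 1)"
          unfolding mN N2 using Nm u0 by (intro divide_left_mono power_increasing) auto
        also have "\<dots> \<le> err m i / pp i" by (rule err_bounds(1)[OF i'(1) m])
        finally show "(N ^ m / N\<^sup>2) / N\<^sup>2 \<le> e" unfolding e_eq by (intro divide_right_mono) auto
      qed (use K0 in simp)
      finally show ?thesis .
    qed
    \<comment> \<open>The change of the quantity, minus that of the trajectory, minus the growth of
      the allowance. The last term has to dominate the drift error and the Taylor error, each at
      most K0 e, which is the condition 2 K0 \<le> 6 a.\<close>
    define \<Delta> where "\<Delta> g = \<sigma> * \<delta> g - \<sigma> * f - 6 * real a * e" for g
    have D1: "Z (Suc i) (es @ [g]) \<le> Z i es + \<Delta> g" if g: "g \<in> ?Q" "alive (es @ [g])" for g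
    proof -
      have "err m i + 6 * real a * e \<le> err m (Suc i)"
        unfolding e_def a_def by (rule err_growth[OF i'(2) m])
      moreover have "\<sigma> * (X (set (es @ [g])) - N ^ m * \<phi> (tt (Suc i)))
          = \<sigma> * (X (set es) - N ^ m * \<phi> (tt i)) + (\<sigma> * \<delta> g - \<sigma> * f)"
        using d1[OF g] by (simp add: f_def algebra_simps)
      ultimately show ?thesis unfolding Z_def \<Delta>_def by linarith
    qed
    have ab: "\<bar>\<Delta> g\<bar> \<le> \<bar>\<delta> g\<bar> + K0 * (N ^ m / N\<^sup>2) + 6 * real A * (N ^ m / N\<^sup>2)" for g
    proof -
      have "\<bar>\<Delta> g\<bar> \<le> \<bar>\<sigma> * \<delta> g\<bar> + \<bar>\<sigma> * f\<bar> + \<bar>6 * real a * e\<bar>" unfolding \<Delta>_def by linarith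
      also have "\<dots> = \<bar>\<delta> g\<bar> + \<bar>f\<bar> + 6 * real a * e" using sg e0 by (simp add: abs_mult)
      also have "6 * real a * e \<le> 6 * real A * (N ^ m / N\<^sup>2)" using aA e_up e0 by (intro mult_mono) auto
      finally show ?thesis using f_le by linarith
    qed
    have D2: "\<bar>\<Delta> g\<bar> \<le> R" if g: "g \<in> ?Q" for g
    proof -
      have "\<bar>\<Delta> g\<bar> \<le> K0 * N ^ (m - 1) * u + K0 * (N ^ m / N\<^sup>2) + 6 * real A * (N ^ m / N\<^sup>2)"
        using ab[of g] d2[OF g] by linarith
      also have "\<dots> = N ^ m * (K0 * u / u ^ 100 + (K0 + 6 * real A) / u ^ 200)"
        unfolding mN N2 by (simp add: algebra_simps add_divide_distrib)
      also have "\<dots> \<le> N ^ m * (1 / u ^ 97)"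
      proof (rule mult_left_mono)
        have "(K0 + 6 * real A) / u ^ 200 \<le> u / u ^ 200" using u_big K0 u0 by (intro divide_right_mono) auto
        also have "\<dots> \<le> u / u ^ 100" using u0 by (intro divide_left_mono power_increasing) auto
        finally have "K0 * u / u ^ 100 + (K0 + 6 * real A) / u ^ 200 \<le> (K0 * u + u) / u ^ 100"
          by (simp add: add_divide_distrib)
        also have "\<dots> \<le> u ^ 3 / u ^ 100"
        proof (rule divide_right_mono)
          have "(K0 + 1) * u \<le> u * u" using u_big K0 u0 by (intro mult_right_mono) auto
          also have "\<dots> \<le> u ^ 3" using power_increasing[of 2 3 u] u0 by (simp add: power2_eq_square)
          finally show "K0 * u + u \<le> u ^ 3" by (simp add: algebra_simps)
        qed (use u0 in auto)
        also have "\<dots> = 1 / u ^ 97"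
        proof -
          have "u ^ 3 * u ^ 97 = 1 * u ^ 100" by (simp flip: power_add)
          then show ?thesis using u0 by (subst frac_eq_eq) auto
        qed
        finally show "K0 * u / u ^ 100 + (K0 + 6 * real A) / u ^ 200 \<le> 1 / u ^ 97" .
      qed (use Nm in auto)
      finally show ?thesis by (simp add: R_def)
    qed
    have D3: "(\<Sum>g\<in>?Q. \<Delta> g) \<le> 0"
    proof -
      define av where "av = (\<Sum>g\<in>?Q. \<delta> g) / ?q"
      have "(\<Sum>g\<in>?Q. \<Delta> g) = \<sigma> * (\<Sum>g\<in>?Q. \<delta> g) - ?q * (\<sigma> * f + 6 * real a * e)"
        unfolding \<Delta>_def by (simp add: sum_subtractf sum_distrib_left[symmetric] algebra_simps)
      also have "\<dots> = ?q * (\<sigma> * (av - f) - 6 * real a * e)"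
        using q0 by (simp add: av_def field_simps)
      also have "\<dots> \<le> 0"
      proof -
        have "\<sigma> * (av - f) \<le> \<bar>\<sigma> * (av - f)\<bar>" by simp
        also have "\<dots> = \<bar>av - f\<bar>" using sg by (simp add: abs_mult)
        also have "\<dots> \<le> K0 * e + K0 * e" using d3 f_dr unfolding av_def[symmetric] e_def[symmetric] by linarith
        also have "\<dots> \<le> 6 * real a * e" using aA(2) mult_right_mono[OF aA(2) e0] by simp
        finally have "\<sigma> * (av - f) - 6 * real a * e \<le> 0" by simp
        then show ?thesis using q0 by (intro mult_nonneg_nonpos) auto
      qed
      finally show ?thesis .
    qed
    have D4: "(\<Sum>g\<in>?Q. \<bar>\<Delta> g\<bar>) \<le> V * ?q"
    proof -
      have "(\<Sum>g\<in>?Q. \<bar>\<Delta> g\<bar>) \<le> (\<Sum>g\<in>?Q. \<bar>\<delta> g\<bar> + (K0 * (N ^ m / N\<^sup>2) + 6 * real A * (N ^ m / N\<^sup>2)))"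
        using ab by (intro sum_mono) (simp add: add.assoc)
      also have "\<dots> = (\<Sum>g\<in>?Q. \<bar>\<delta> g\<bar>) + ?q * (K0 * (N ^ m / N\<^sup>2) + 6 * real A * (N ^ m / N\<^sup>2))"
        by (simp add: sum.distrib)
      also have "\<dots> \<le> K0 * (N ^ m / N\<^sup>2) * ?q + ?q * (K0 * (N ^ m / N\<^sup>2) + 6 * real A * (N ^ m / N\<^sup>2))"
        using d4 by (rule add_right_mono)
      also have "\<dots> = N ^ m / N\<^sup>2 * (2 * K0 + 6 * real A) * ?q" by (simp add: algebra_simps)
      also have "\<dots> \<le> N ^ m / N\<^sup>2 * u * ?q"
        using u_big q0 Nm by (intro mult_right_mono mult_left_mono) auto
      finally show ?thesis by (simp add: V_def)
    qed
    show ?thesis using D1 D2 D3 D4 by (intro exI[of _ \<Delta>]) blast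
  qed
  have th: "\<theta> \<ge> 0" "R \<ge> 0" "V \<ge> 0" using u0 Nm unfolding \<theta>_def R_def V_def by auto
  have thR: "\<theta> * R \<le> 1"
  proof -
    have "\<theta> * R = u ^ 50 / u ^ 97" using Nm by (simp add: \<theta>_def R_def)
    also have "\<dots> \<le> 1" using u0 power_increasing[of 50 97 u] by (simp add: pos_divide_le_eq)
    finally show ?thesis .
  qed
  have "measure_pmf.prob (process_steps l n i) {es. survives G i es \<and> alive es \<and> Z i es \<ge> 0}
      \<le> exp (\<theta> * Z 0 [] + real i * (\<theta>\<^sup>2 * R * V))"
    by (rule prob_tracking_failure_le[where m = m0 and alive = alive]) (use step' alive th thR i in auto)
  also have "\<dots> \<le> exp (- u)"
  proof -
    \<comment> \<open>The initial deviation is at most K0 n^(m-1) and uses up less than half of the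
      initial allowance.\<close>
    have z0: "Z 0 [] \<le> - (u ^ 90 / 2) * N ^ (m - 1)"
    proof -
      have "\<sigma> * (X {} - N ^ m * \<phi> 0) \<le> \<bar>\<sigma> * (X {} - N ^ m * \<phi> 0)\<bar>" by simp
      also have "\<dots> = \<bar>X {} - N ^ m * \<phi> 0\<bar>" using sg by (simp add: abs_mult)
      also have "\<dots> \<le> K0 * N ^ (m - 1)" by (rule init)
      also have "\<dots> \<le> u ^ 90 / 2 * N ^ (m - 1)"
      proof (rule mult_right_mono)
        have "K0 \<le> u / 2" using u_big by simp
        also have "u \<le> u ^ 90" using power_increasing[of 1 90 u] u0 by simp
        finally show "K0 \<le> u ^ 90 / 2" by simp
      qed (use N0 in auto)
      finally have "\<sigma> * (X {} - N ^ m * \<phi> 0) \<le> u ^ 90 / 2 * N ^ (m - 1)" .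
      moreover have "err m 0 = u ^ 90 * N ^ (m - 1)" by (simp add: err_def eta_def traj_p_def)
      ultimately show ?thesis by (simp add: Z_def)
    qed
    have "\<theta> * Z 0 [] \<le> \<theta> * (- (u ^ 90 / 2) * N ^ (m - 1))" using z0 th by (intro mult_left_mono) auto
    also have "\<dots> = - (u ^ 40) / 2"
    proof -
      have "u ^ 50 * u ^ 90 = u ^ 100 * u ^ 40" by (simp flip: power_add)
      then show ?thesis using Nm u0 unfolding mN \<theta>_def by (simp add: field_simps)
    qed
    finally have t1: "\<theta> * Z 0 [] \<le> - (u ^ 40) / 2" .
    have "real i \<le> real (n ^ 2)" using i m0_le by (intro of_nat_mono) simp
    then have iN: "real i \<le> N\<^sup>2" by simp
    have "real i * (\<theta>\<^sup>2 * R * V) \<le> N\<^sup>2 * (\<theta>\<^sup>2 * R * V)" using iN th by (intro mult_right_mono) auto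
    also have "\<dots> = u ^ 4"
    proof -
      have "N\<^sup>2 * (\<theta>\<^sup>2 * R * V) = (u ^ 50)\<^sup>2 * u / u ^ 97"
        using Nm N0 u0 unfolding \<theta>_def R_def V_def by (simp add: field_simps power2_eq_square)
      also have "(u ^ 50)\<^sup>2 * u = u ^ 97 * u ^ 4"
        by (simp flip: power_mult power_add power_Suc2)
      also have "u ^ 97 * u ^ 4 / u ^ 97 = u ^ 4" using u0 by (intro nonzero_mult_div_cancel_left) auto
      finally show ?thesis .
    qed
    finally have t2: "real i * (\<theta>\<^sup>2 * R * V) \<le> u ^ 4" .
    have "u \<le> u ^ 4" using power_increasing[of 1 4 u] u0 by simp
    moreover have "4 * u ^ 4 \<le> u ^ 40"
    proof -
      have "4 * u ^ 4 \<le> u * u ^ 4" using u_big u0 by (intro mult_right_mono) auto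
      also have "\<dots> = u ^ 5" by (simp flip: power_Suc)
      also have "\<dots> \<le> u ^ 40" using u0 by (intro power_increasing) auto
      finally show ?thesis .
    qed
    ultimately have "\<theta> * Z 0 [] + real i * (\<theta>\<^sup>2 * R * V) \<le> - u" using t1 t2 by linarith
    then show ?thesis by simp
  qed
  finally show ?thesis unfolding Z_def .
qed

end

section \<open>Expected one-step changes along the trajectories\<close>

definition pair_const :: "nat \<Rightarrow> real" where "pair_const l = (2 ^ (2 ^ (2 * l + 6)))\<^sup>2"
text \<open>Three allowances for the three pairs, one for all overcounts, and one for each member of
  \<FF>.\<close>

definition close_const :: "nat \<Rightarrow> real" where "close_const l = 4 + real (card (Ffam l))"

text \<open>The first summand is needed for Y. The others belong to W: error of the gain, size of
  the gain, error of the loss, size of the loss.\<close>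

definition drift_const :: "nat \<Rightarrow> real" where
  "drift_const l = (2 * (close_const l + 2) + 4 + Lam l) + (real l + 1) + real l * Kphi l
     + real l * ((Kphi l + 1) * (close_const l + 1) + (3 + Lam l)) + real l * Kphi l * (3 + Lam l)"

lemma close_const_ge: "close_const l \<ge> 4" by (simp add: close_const_def)

lemma drift_const_ge:
  shows "2 * (close_const l + 2) + 4 + Lam l \<le> drift_const l"
    and "(real l + 1) + real l * ((Kphi l + 1) * (close_const l + 1) + (3 + Lam l)) \<le> drift_const l"
    and "real l * Kphi l + real l * Kphi l * (3 + Lam l) \<le> drift_const l" and "0 \<le> drift_const l"
proof -
  have 1: "0 \<le> 2 * (close_const l + 2) + 4 + Lam l" using close_const_ge[of l] Lam_nonneg[of l] by simp
  have 2: "0 \<le> real l * Kphi l" using Kphi_ge[of l] by simp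
  have 3: "0 \<le> real l * ((Kphi l + 1) * (close_const l + 1) + (3 + Lam l))"
    using Kphi_ge[of l] close_const_ge[of l] Lam_nonneg[of l] by (intro mult_nonneg_nonneg add_nonneg_nonneg) auto
  have 4: "0 \<le> real l * Kphi l * (3 + Lam l)" 
    by (rule mult_nonneg_nonneg[OF 2]) (use Lam_nonneg[of l] in simp)
  show "2 * (close_const l + 2) + 4 + Lam l \<le> drift_const l"
    "(real l + 1) + real l * ((Kphi l + 1) * (close_const l + 1) + (3 + Lam l)) \<le> drift_const l"
    "real l * Kphi l + real l * Kphi l * (3 + Lam l) \<le> drift_const l" "0 \<le> drift_const l"
    unfolding drift_const_def using 1 2 3 4 by linarith+
qed

text \<open>In \<open>K0_drift\<close> the numbers 12 and 72 come from
  \<open>drift_ratio_error\<close>, and the other 24 of the 36 cover the total absolute change.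
  \<open>K0_step\<close> bounds single steps, \<open>u_cst\<close> makes every overcount at most u^2
  and so at most the allowance, and \<open>u_q\<close> keeps |Q| above half of its guaranteed
  size.\<close>

locale run_consts = run_params +
  assumes K0_drift: "drift_const l * (36 / q_min l + 72 / (q_min l)\<^sup>2) \<le> K0"
    and K0_step: "3 + 3 * real l * pair_const l \<le> K0"
    and u_cst: "4 + pair_const l + real l * pair_const l + real l * (64 + 2 * real l * pair_const l) \<le> u"
    and u_q: "12 \<le> q_min l * u"

lemma (in triple_state) Q_open:
  assumes f: "f \<in> Q" and ab: "{a, b} \<subseteq> f" "a \<noteq> b" shows "{a, b} \<in> open_pairs n H"
proof -
  have "{a, b} \<in> [{1..n}]\<^bsup>2\<^esup>" using Q_D(2)[OF f] ab by (auto simp: nsets_def)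
  moreover have "\<not> {a, b} \<subseteq> h" if h: "h \<in> H" for h
  proof
    assume "{a, b} \<subseteq> h"
    then have "card {a, b} \<le> card (f \<inter> h)" using Q_D(3)[OF f] ab by (intro card_mono) auto
    moreover have "card (f \<inter> h) \<le> 1" using f h unfolding available_def by blast
    ultimately show False using ab by simp
  qed
  ultimately show ?thesis unfolding open_pairs_def by blast
qed

locale tracked_state = run_consts l n L A m0 u K0 + triple_state l n H
  for l n L A m0 :: nat and u K0 :: real and H +
  fixes i :: nat
  assumes ext_H: "ext_ok n L u H" and im: "i \<le> m0"
    and Qtr: "\<bar>real (card (available l n H)) - Q_hat l n (tt i)\<bar> \<le> eta i * (pp i * N\<^sup>2)"
    and Ytr: "\<And>a b. {a, b} \<in> open_pairs n H \<Longrightarrow> \<bar>real (card (Yset l n H a b)) - Y_hat l n (tt i)\<bar> \<le> eta i"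
    and Wtr: "\<And>e F k. e \<in> available l n H \<Longrightarrow> F \<in> Ffam l \<Longrightarrow> k \<le> num_triples F - 2 \<Longrightarrow>
      \<bar>real (card (Wset l n H e F k)) - W_hat l n F k (tt i)\<bar> \<le> eta i * (pp i ^ 2 * N) ^ (num_triples F - (2 + k))"
begin

sublocale ext_state l n H L u
  by unfold_locales (use ext_H L_def u_pos l4 in auto)

lemma CP_eq: "CP = pair_const l"
  unfolding CP_def pair_const_def by (simp only: L_def)

lemma CC_eq: "CC = 64 + 2 * real l * pair_const l"
  by (simp add: CC_def CP_eq)

abbreviation "P \<equiv> pp i ^ 2 * N"
abbreviation "t \<equiv> tt i"

lemma p0: "0 < pp i" using p_pos[OF im] .

lemma P0: "0 < P" using p0 N_pos by simp

lemma eta_ge1: "1 \<le> eta i" using eta_bounds(1)[OF im] u_pos one_le_power[of u 90] by linarith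

lemma u2_le_eta: "u * u \<le> eta i"
  using eta_bounds(1)[OF im] power_increasing[of 2 90 u] u_pos by (simp add: power2_eq_square)

lemma eta_le_P: "eta i \<le> P" "eta i \<le> q_min l * P / 12"
proof -
  have "1 \<le> u ^ 8" using u_pos by simp
  then have "eta i * 1 \<le> eta i * u ^ 8" using eta_ge1 by (intro mult_left_mono) auto
  then show "eta i \<le> P" using eta_bounds(3)[OF im] by simp
  have "u \<le> u ^ 8" using power_increasing[of 1 8 u] u_pos by simp
  then have "q_min l * u \<le> q_min l * u ^ 8" using q_min_pos[of l] by (intro mult_left_mono) auto
  then have "12 \<le> q_min l * u ^ 8" using u_q by linarith
  then have "12 * eta i \<le> (q_min l * u ^ 8) * eta i" using eta_ge1 by (intro mult_right_mono) auto
  also have "\<dots> = q_min l * (eta i * u ^ 8)" by (simp add: mult_ac)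
  also have "\<dots> \<le> q_min l * P" using eta_bounds(3)[OF im] q_min_pos[of l] by (intro mult_left_mono) auto
  finally show "eta i \<le> q_min l * P / 12" by simp
qed

lemma pair_const_nonneg: "0 \<le> pair_const l" by (simp add: pair_const_def)

lemma small_le_eta: "c \<le> u \<Longrightarrow> c * u \<le> eta i"
  using u2_le_eta mult_right_mono[of c u u] u_pos by linarith

text \<open>The three pairs of f are open, so their |Y| are tracked; the copies are counted by the W
  with k = e_F - 2. The overcount and the 3 for f itself fit into one further allowance.\<close>

lemma closers_estimate:
  assumes f: "f \<in> Q"
  shows "\<bar>real (card (closers f)) - C_hat l n t\<bar> \<le> close_const l * eta i"
proof -
  obtain a b c where abc: "f = {a, b, c}" "a \<noteq> b" "a \<noteq> c" "b \<noteq> c"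
    using Q_D(4)[OF f] by (metis card_3_iff)
  have Y: "\<bar>real (card (Yset l n H a b)) - Y_hat l n t\<bar> \<le> eta i"
    "\<bar>real (card (Yset l n H a c)) - Y_hat l n t\<bar> \<le> eta i"
    "\<bar>real (card (Yset l n H b c)) - Y_hat l n t\<bar> \<le> eta i"
    using abc by (intro Ytr Q_open[OF f]; auto)+
  have pr: "real (card (pair_closers f)) + 3
      = real (card (Yset l n H a b)) + real (card (Yset l n H a c)) + real (card (Yset l n H b c))"
    using card_pair_closers[of a b c] f abc by (metis of_nat_add of_nat_numeral)
  have sp: "real (card (closers f)) = real (card (pair_closers f)) + real (card (copy_closers f))"
    using card_closers_split[OF f] by simp
  have cp1: "real (card (copy_closers f)) \<le> real (card (close_copies f))"
    using copy_closers_le(1)[OF f] by simp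
  have "real (card (close_copies f)) \<le> real (card (copy_closers f)) + real (card (conf_pairs l n H f f 1))"
    using copy_closers_le(2)[OF f] by (metis of_nat_add of_nat_mono)
  moreover have "real (card (conf_pairs l n H f f 1)) \<le> CP * real n ^ (1 - 1) * u"
    using Q_D[OF f] l4 by (intro pairs_le) auto
  ultimately have cp2: "real (card (close_copies f)) \<le> real (card (copy_closers f)) + CP * u" by simp
  have "\<bar>real (card (close_copies f)) - (\<Sum>F\<in>Ffam l. W_hat l n F (num_triples F - 2) t)\<bar>
      = \<bar>\<Sum>F\<in>Ffam l. real (card (Wset l n H f F (num_triples F - 2))) - W_hat l n F (num_triples F - 2) t\<bar>"
    unfolding card_close_copies by (simp add: sum_subtractf)
  also have "\<dots> \<le> (\<Sum>F\<in>Ffam l. \<bar>real (card (Wset l n H f F (num_triples F - 2))) - W_hat l n F (num_triples F - 2) t\<bar>)"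
    by (rule sum_abs)
  also have "\<dots> \<le> (\<Sum>F\<in>Ffam l. eta i)"
  proof (rule sum_mono)
    fix F assume F: "F \<in> Ffam l"
    have "num_triples F - (2 + (num_triples F - 2)) = 0" by simp
    then show "\<bar>real (card (Wset l n H f F (num_triples F - 2))) - W_hat l n F (num_triples F - 2) t\<bar> \<le> eta i"
      using Wtr[OF f F order_refl] by simp
  qed
  also have "\<dots> = real (card (Ffam l)) * eta i" by simp
  finally have W: "\<bar>real (card (close_copies f)) - (\<Sum>F\<in>Ffam l. W_hat l n F (num_triples F - 2) t)\<bar>
      \<le> real (card (Ffam l)) * eta i" .
  have "3 + CP * u \<le> (3 + CP) * u" using u_pos by (simp add: algebra_simps)
  also have "\<dots> \<le> eta i"
  proof (rule small_le_eta)
    have "0 \<le> real l * pair_const l" using pair_const_nonneg by simp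
    moreover have "0 \<le> real l * (64 + 2 * real l * pair_const l)" using pair_const_nonneg by simp
    ultimately show "3 + CP \<le> u" using u_cst CP_eq by linarith
  qed
  finally have sm: "3 + CP * u \<le> eta i" .
  have "close_const l * eta i = 4 * eta i + real (card (Ffam l)) * eta i"
    by (simp add: close_const_def algebra_simps)
  moreover have "0 \<le> CP * u" using CP_ge u_pos by simp
  ultimately show ?thesis unfolding C_hat_def using Y pr sp cp1 cp2 W sm by linarith
qed

text \<open>Turns sums over all available triples into averages. \<open>T'\<close> is the sum
  predicted by the trajectories; the tracked size of \<open>Q\<close> enters through
  \<open>drift_ratio_error\<close>.\<close>

lemma step_from_totals:
  fixes \<delta> :: "nat set \<Rightarrow> real"
  assumes m: "1 \<le> m" "m \<le> l" and dr: "T' / Q_hat l n t = \<phi>' * N ^ m / N\<^sup>2"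
    and T: "\<bar>(\<Sum>g\<in>Q. \<delta> g) - T'\<bar> \<le> drift_const l * P * err m i"
    and T': "\<bar>T'\<bar> \<le> drift_const l * P ^ (m + 1)"
    and abs: "(\<Sum>g\<in>Q. \<bar>\<delta> g\<bar>) \<le> 2 * drift_const l * P ^ (m + 1)"
  shows "\<bar>(\<Sum>g\<in>Q. \<delta> g) / real (card Q) - \<phi>' * N ^ m / N\<^sup>2\<bar> \<le> K0 * (err m i / (pp i * N\<^sup>2))"
    and "(\<Sum>g\<in>Q. \<bar>\<delta> g\<bar>) \<le> K0 * (N ^ m / N\<^sup>2) * real (card Q)"
proof -
  let ?q0 = "q_min l" and ?D = "drift_const l"
  note tb = tt_bounds[OF im]
  have q0: "0 < ?q0" "?q0 \<le> traj_q l t" using q_min_pos traj_q_bounds[OF tb(1,2)] by auto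
  have Qr: "\<bar>real (card Q) - pp i ^ 3 * traj_q l t * N ^ 3 / 6\<bar> \<le> eta i * (pp i * N\<^sup>2)"
    using Qtr by (simp add: Q_hat_def)
  have eta0: "0 \<le> eta i" using eta_ge1 by linarith
  note D0 = drift_const_ge(4)[of l]
  note ratio = drift_ratio_error[OF N_pos(1) p0 q0 eta0 eta_le_P(2) Qr m(1) D0,
      of "\<Sum>g\<in>Q. \<delta> g" T', folded err_def]
  have Qlow: "?q0 * (pp i ^ 3 * N ^ 3) / 12 \<le> real (card Q)" by (rule ratio(1)[OF T T'])
  have e0: "0 \<le> err m i / (pp i * N\<^sup>2)" using err_bounds(3)[OF im m] p0 by simp
  have K1: "?D * (12 / ?q0 + 72 / ?q0\<^sup>2) \<le> K0" "?D * (24 / ?q0) \<le> K0"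
  proof -
    have a: "0 \<le> ?D * (12 / ?q0)" "0 \<le> ?D * (24 / ?q0)" "0 \<le> ?D * (72 / ?q0\<^sup>2)"
      using D0 q0 by simp_all
    have "?D * (36 / ?q0 + 72 / ?q0\<^sup>2) = ?D * (12 / ?q0) + ?D * (24 / ?q0) + ?D * (72 / ?q0\<^sup>2)"
      by (simp add: distrib_left)
    moreover have "?D * (12 / ?q0 + 72 / ?q0\<^sup>2) = ?D * (12 / ?q0) + ?D * (72 / ?q0\<^sup>2)"
      by (rule distrib_left)
    ultimately show "?D * (12 / ?q0 + 72 / ?q0\<^sup>2) \<le> K0" "?D * (24 / ?q0) \<le> K0"
      using a K0_drift by linarith+
  qed
  have "\<bar>(\<Sum>g\<in>Q. \<delta> g) / real (card Q) - \<phi>' * N ^ m / N\<^sup>2\<bar>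
      \<le> ?D * (12 / ?q0 + 72 / ?q0\<^sup>2) * (err m i / (pp i * N\<^sup>2))"
    using ratio(2)[OF T T'] unfolding dr[symmetric] Q_hat_def .
  also have "\<dots> \<le> K0 * (err m i / (pp i * N\<^sup>2))" using K1(1) e0 by (rule mult_right_mono)
  finally show "\<bar>(\<Sum>g\<in>Q. \<delta> g) / real (card Q) - \<phi>' * N ^ m / N\<^sup>2\<bar> \<le> K0 * (err m i / (pp i * N\<^sup>2))" .
  \<comment> \<open>As m \<ge> 1, the left side contains at least p^4, whereas the lower bound for
    |Q| contains only p^3.\<close>
  have "2 * ?D * P ^ (m + 1) \<le> ?D * (24 / ?q0) * (N ^ m / N\<^sup>2) * (?q0 * (pp i ^ 3 * N ^ 3) / 12)"
  proof -
    have "P ^ (m + 1) = pp i ^ (2 * (m + 1)) * N ^ (m + 1)"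
      by (simp only: power_mult_distrib power_mult)
    also have "\<dots> \<le> pp i ^ 3 * N ^ (m + 1)"
      using p0 pp_le1[of i] m by (intro mult_right_mono power_decreasing) auto
    finally have "2 * ?D * P ^ (m + 1) \<le> 2 * ?D * (pp i ^ 3 * N ^ (m + 1))"
      using D0 by (intro mult_left_mono) auto
    also have "\<dots> = ?D * (24 / ?q0) * (N ^ m / N\<^sup>2) * (?q0 * (pp i ^ 3 * N ^ 3) / 12)"
      using q0 N_pos by (simp add: field_simps power2_eq_square power3_eq_cube)
    finally show ?thesis .
  qed
  also have "\<dots> \<le> K0 * (N ^ m / N\<^sup>2) * real (card Q)"
    using K1(2) Qlow N_pos q0 p0 K0 by (intro mult_mono mult_right_mono) auto
  finally show "(\<Sum>g\<in>Q. \<bar>\<delta> g\<bar>) \<le> K0 * (N ^ m / N\<^sup>2) * real (card Q)" using abs by linarith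
qed

lemma card_Q_ge: "q_min l * (pp i ^ 3 * N ^ 3) / 12 \<le> real (card Q)"
proof (rule drift_ratio_error(1)[OF N_pos(1) p0 q_min_pos _ _ eta_le_P(2) _ order_refl order_refl, where S = 0 and S' = 0])
  show "q_min l \<le> traj_q l t" using traj_q_bounds[OF tt_bounds(1,2)[OF im]] by blast
  show "0 \<le> eta i" using eta_ge1 by linarith
  show "\<bar>real (card Q) - pp i ^ 3 * traj_q l t * N ^ 3 / 6\<bar> \<le> eta i * (pp i * N\<^sup>2)"
    using Qtr by (simp add: Q_hat_def)
qed simp_all

lemma Y_step:
  assumes ab: "{a, b} \<in> open_pairs n H"
  shows "\<exists>\<delta>. (\<forall>g\<in>Q. ({a, b} \<in> open_pairs n (insert g H) \<longrightarrow>
        real (card (Yset l n (insert g H) a b)) = real (card (Yset l n H a b)) + \<delta> g) \<and>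
        \<bar>\<delta> g\<bar> \<le> K0 * N ^ (1 - 1) * u) \<and>
      \<bar>(\<Sum>g\<in>Q. \<delta> g) / real (card Q) - pp i * traj_q l t * (-12 + pp i * lamq l t) * N ^ 1 / N\<^sup>2\<bar>
        \<le> K0 * (err 1 i / (pp i * N\<^sup>2)) \<and>
      (\<Sum>g\<in>Q. \<bar>\<delta> g\<bar>) \<le> K0 * (N ^ 1 / N\<^sup>2) * real (card Q)"
proof -
  let ?Y = "Yset l n H a b"
  let ?y = "real (card ?Y)" and ?yh = "Y_hat l n t" and ?ch = "C_hat l n t"
  let ?loss = "\<lambda>g. {z \<in> ?Y. {a, b, z} \<notin> available l n (insert g H)}"
  \<comment> \<open>A triple over the pair itself covers it. The pair is then no longer open, so the
    value may be set to zero.\<close>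
  define \<delta> where "\<delta> g = (if {a, b} \<subseteq> g then 0 else - real (card (?loss g)))" for g
  have abn: "a \<noteq> b" "{a, b} \<subseteq> {1..n}" using ab unfolding open_pairs_def nsets_def by (auto simp: card_2_iff)
  have finY: "finite ?Y" unfolding Yset_def by simp
  have eq: "real (card (Yset l n (insert g H) a b)) = ?y + \<delta> g"
    if g: "g \<in> Q" "{a, b} \<in> open_pairs n (insert g H)" for g
  proof -
    have ng: "\<not> {a, b} \<subseteq> g" using g unfolding open_pairs_def by blast
    have "available l n (insert g H) \<subseteq> Q" using available_insert[OF g(1)] by blast
    then have "Yset l n (insert g H) a b = ?Y - ?loss g" unfolding Yset_def by blast
    then have "card (Yset l n (insert g H) a b) = card ?Y - card (?loss g)"
      using finY by (simp add: card_Diff_subset)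
    moreover have "card (?loss g) \<le> card ?Y" using finY by (intro card_mono) auto
    moreover have "\<delta> g = - real (card (?loss g))" unfolding \<delta>_def using ng by (rule if_not_P)
    ultimately show ?thesis by linarith
  qed
  have step: "\<bar>\<delta> g\<bar> \<le> K0 * N ^ (1 - 1) * u" if g: "g \<in> Q" for g
  proof (cases "{a, b} \<subseteq> g")
    case True
    then show ?thesis using K0 u_pos by (simp add: \<delta>_def)
  next
    case False
    have "real (card (?loss g)) \<le> 3 + real l * (CP * u)" by (rule Y_loss_le[OF abn g False])
    also have "\<dots> \<le> (3 + 3 * real l * pair_const l) * u"
    proof -
      have "real l * (CP * u) \<le> 3 * real l * pair_const l * u"
        using u_pos pair_const_nonneg by (simp add: CP_eq mult_ac)
      then show ?thesis unfolding distrib_right using u_pos by linarith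
    qed
    also have "\<dots> \<le> K0 * u" using K0_step u_pos by (intro mult_right_mono) auto
    finally show ?thesis using False by (simp add: \<delta>_def)
  qed
  have total: "(\<Sum>g\<in>Q. \<delta> g) = - (\<Sum>z\<in>?Y. real (card (closers {a, b, z})) - ?y + 1)"
  proof -
    let ?Q' = "{g \<in> Q. \<not> {a, b} \<subseteq> g}"
    have finQ': "finite ?Q'" using finite_Q by simp
    \<comment> \<open>The y - 1 other available triples over the pair all close {a, b, z}, but they
      end the tracking and must be left out; {a, b, z} itself is not among its closing
      triples.\<close>
    have one: "real (card {g \<in> ?Q'. {a, b, z} \<notin> available l n (insert g H)}) = real (card (closers {a, b, z})) - ?y + 1"
      if z: "z \<in> ?Y" for z
    proof -
      let ?f = "{a, b, z}"
      have fQ: "?f \<in> Q" using z unfolding Yset_def by blast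
      let ?T = "{g \<in> Q. {a, b} \<subseteq> g}"
      have "{g \<in> ?Q'. ?f \<notin> available l n (insert g H)} = closers ?f - (?T - {?f})"
        unfolding closers_def by blast
      moreover have sub: "?T - {?f} \<subseteq> closers ?f"
      proof
        fix g assume g: "g \<in> ?T - {?f}"
        have "card {a, b} \<le> card (?f \<inter> g)" using g by (intro card_mono) auto
        then have "2 \<le> card (?f \<inter> g)" using abn by simp
        then show "g \<in> closers ?f" using closed_iff[OF fQ, of g] g unfolding closers_def by blast
      qed
      moreover have finT: "finite (?T - {?f})" using finite_Q by simp
      ultimately have "card {g \<in> ?Q'. ?f \<notin> available l n (insert g H)} = card (closers ?f) - card (?T - {?f})"
        by (simp add: card_Diff_subset)
      moreover have "card (?T - {?f}) \<le> card (closers ?f)" by (rule card_mono[OF finite_closers sub])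
      moreover have "card (?T - {?f}) + 1 = card ?Y"
      proof -
        have "?f \<in> ?T" using fQ by blast
        then have "Suc (card (?T - {?f})) = card ?T" using finite_Q by (intro card_Suc_Diff1) auto
        then show ?thesis using card_through_pair[OF abn(1)] by simp
      qed
      ultimately show ?thesis by linarith
    qed
    have "(\<Sum>g\<in>Q. \<delta> g) = (\<Sum>g\<in>?Q'. \<delta> g)"
      by (rule sum.mono_neutral_right[OF finite_Q]) (auto simp: \<delta>_def)
    also have "\<dots> = (\<Sum>g\<in>?Q'. - real (card (?loss g)))"
      by (rule sum.cong) (auto simp: \<delta>_def)
    also have "\<dots> = - real (\<Sum>g\<in>?Q'. card (?loss g))" by (simp add: sum_negf)
    also have "(\<Sum>g\<in>?Q'. card (?loss g)) = (\<Sum>z\<in>?Y. card {g \<in> ?Q'. {a, b, z} \<notin> available l n (insert g H)})"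
      by (rule sum_card_swap[OF finQ' finY])
    also have "real \<dots> = (\<Sum>z\<in>?Y. real (card (closers {a, b, z})) - ?y + 1)"
      unfolding of_nat_sum by (rule sum.cong[OF refl one])
    finally show ?thesis .
  qed
  note tb = tt_bounds[OF im]
  note yb = Y_hat_bounds[OF tb(1,2), of l n] and cb = C_hat_bounds[OF tb(1,2), of l n]
  have Yab: "\<bar>?y - ?yh\<bar> \<le> eta i" by (rule Ytr[OF ab])
  have y2: "?y \<le> 2 * P" using Yab yb eta_le_P(1) by linarith
  have cy: "\<bar>?ch - ?yh\<bar> \<le> (4 + Lam l) * P"
  proof -
    have "(4 + Lam l) * P = (3 + Lam l) * P + P" by (simp add: algebra_simps)
    then show ?thesis using yb cb P0 by linarith
  qed
  let ?T' = "- (?yh * (?ch - ?yh))"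
  have T: "\<bar>(\<Sum>g\<in>Q. \<delta> g) - ?T'\<bar> \<le> drift_const l * P * err 1 i"
  proof -
    have each: "\<bar>(real (card (closers {a, b, z})) - ?y + 1) - (?ch - ?yh)\<bar> \<le> (close_const l + 2) * eta i" if z: "z \<in> ?Y" for z
    proof -
      have "{a, b, z} \<in> Q" using z unfolding Yset_def by blast
      note ce = closers_estimate[OF this]
      have "(close_const l + 2) * eta i = close_const l * eta i + 2 * eta i" by (simp add: algebra_simps)
      then show ?thesis using ce Yab eta_ge1 by linarith
    qed
    have "\<bar>(\<Sum>z\<in>?Y. real (card (closers {a, b, z})) - ?y + 1) - ?y * (?ch - ?yh)\<bar>
        = \<bar>\<Sum>z\<in>?Y. (real (card (closers {a, b, z})) - ?y + 1) - (?ch - ?yh)\<bar>"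
      by (simp add: sum_subtractf sum.distrib)
    also have "\<dots> \<le> (\<Sum>z\<in>?Y. \<bar>(real (card (closers {a, b, z})) - ?y + 1) - (?ch - ?yh)\<bar>)" by (rule sum_abs)
    also have "\<dots> \<le> (\<Sum>z\<in>?Y. (close_const l + 2) * eta i)" by (rule sum_mono[OF each])
    also have "\<dots> = ?y * ((close_const l + 2) * eta i)" by simp
    also have "\<dots> \<le> 2 * P * ((close_const l + 2) * eta i)"
      using y2 close_const_ge[of l] eta_ge1 by (intro mult_right_mono) auto
    finally have s1: "\<bar>(\<Sum>z\<in>?Y. real (card (closers {a, b, z})) - ?y + 1) - ?y * (?ch - ?yh)\<bar>
        \<le> 2 * P * ((close_const l + 2) * eta i)" .
    have "\<bar>?y * (?ch - ?yh) - ?yh * (?ch - ?yh)\<bar> = \<bar>?y - ?yh\<bar> * \<bar>?ch - ?yh\<bar>"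
      by (simp add: abs_mult[symmetric] left_diff_distrib)
    also have "\<dots> \<le> eta i * ((4 + Lam l) * P)" using Yab cy by (intro mult_mono) auto
    finally have s2: "\<bar>?y * (?ch - ?yh) - ?yh * (?ch - ?yh)\<bar> \<le> eta i * ((4 + Lam l) * P)" .
    have "\<bar>(\<Sum>g\<in>Q. \<delta> g) - ?T'\<bar> \<le> 2 * P * ((close_const l + 2) * eta i) + eta i * ((4 + Lam l) * P)"
      unfolding total using s1 s2 by linarith
    also have "\<dots> = (2 * (close_const l + 2) + 4 + Lam l) * (P * eta i)" by (simp add: algebra_simps)
    also have "\<dots> \<le> drift_const l * (P * eta i)"
      using drift_const_ge(1)[of l] P0 eta_ge1 by (intro mult_right_mono) auto
    finally show ?thesis by (simp add: err_def mult.assoc)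
  qed
  have T': "\<bar>?T'\<bar> \<le> drift_const l * P ^ (1 + 1)"
  proof -
    have "\<bar>?T'\<bar> = \<bar>?yh\<bar> * \<bar>?ch - ?yh\<bar>" by (simp add: abs_mult)
    also have "\<dots> \<le> P * ((4 + Lam l) * P)" using yb cy P0 by (intro mult_mono) auto
    also have "\<dots> = (4 + Lam l) * P ^ (1 + 1)" by (simp add: power2_eq_square)
    also have "\<dots> \<le> drift_const l * P ^ (1 + 1)"
      using drift_const_ge(1)[of l] close_const_ge[of l] by (intro mult_right_mono) auto
    finally show ?thesis .
  qed
  have abs: "(\<Sum>g\<in>Q. \<bar>\<delta> g\<bar>) \<le> 2 * drift_const l * P ^ (1 + 1)"
  proof -
    have "(\<Sum>g\<in>Q. \<bar>\<delta> g\<bar>) = - (\<Sum>g\<in>Q. \<delta> g)"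
      unfolding sum_negf[symmetric] by (rule sum.cong) (auto simp: \<delta>_def)
    also have "\<dots> \<le> drift_const l * P ^ (1 + 1) + drift_const l * P * err 1 i" using T T' by linarith
    also have "drift_const l * P * err 1 i \<le> drift_const l * P * P"
      using eta_le_P(1) drift_const_ge(4)[of l] P0 by (intro mult_left_mono) (auto simp: err_def)
    finally have "(\<Sum>g\<in>Q. \<bar>\<delta> g\<bar>) \<le> drift_const l * P ^ (1 + 1) + drift_const l * P * P" by simp
    moreover have "drift_const l * P * P = drift_const l * P ^ (1 + 1)"
      by (simp only: power_Suc power_0 add_Suc_right add_0_right One_nat_def mult.assoc mult_1_right)
    ultimately show ?thesis by linarith
  qed
  have l1: "1 \<le> l" using l4 by simp
  have dr: "?T' / Q_hat l n t = (pp i * traj_q l t * (-12 + pp i * lamq l t)) * N ^ 1 / N\<^sup>2"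
    using Y_drift_identity[of t n l] p0 n_pos by simp
  note fin = step_from_totals[OF order_refl l1 dr T T' abs]
  show ?thesis using eq step fin by (intro exI[of _ \<delta>]) blast
qed

lemma W_step:
  assumes F: "F \<in> Ffam l" and k: "k \<le> num_triples F - 2" and f: "f \<in> Q" and m: "m = num_triples F - 1 - k"
  defines "\<phi>' \<equiv> cF F * real ((num_triples F - 1) choose k) *
      (real k * 6 * (6 * t) ^ (k - 1) * (pp i ^ 3 * traj_q l t) ^ m +
       (6 * t) ^ k * (real m * (pp i ^ 3 * traj_q l t) ^ (m - 1) *
         (pp i ^ 2 * traj_q l t * (-18 + pp i * lamq l t))))"
  shows "\<exists>\<delta>. (\<forall>g\<in>Q. (f \<in> available l n (insert g H) \<longrightarrow>
        real (card (Wset l n (insert g H) f F k)) = real (card (Wset l n H f F k)) + \<delta> g) \<and>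
        \<bar>\<delta> g\<bar> \<le> K0 * N ^ (m - 1) * u) \<and>
      \<bar>(\<Sum>g\<in>Q. \<delta> g) / real (card Q) - \<phi>' * N ^ m / N\<^sup>2\<bar> \<le> K0 * (err m i / (pp i * N\<^sup>2)) \<and>
      (\<Sum>g\<in>Q. \<bar>\<delta> g\<bar>) \<le> K0 * (N ^ m / N\<^sup>2) * real (card Q)"
proof -
  let ?E = "num_triples F"
  have E: "4 \<le> ?E" "?E + 2 \<le> l" using num_triples_ge[OF F] by auto
  have m1: "1 \<le> m" "m \<le> l" and m': "?E - 2 - k = m - 1" "?E - (2 + k) = m - 1" using E k m by auto
  let ?w = "real (card (Wset l n H f F k))" and ?wh = "W_hat l n F k t" and ?ch = "C_hat l n t"
  define \<delta> where "\<delta> g = (if g \<in> keep f then real (card (W_new f F k g)) - real (card (W_lost f F k g)) else 0)" for g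
  have kQ: "keep f \<subseteq> Q" by (auto simp: keep_def)
  have finK: "finite (keep f)" using kQ finite_Q finite_subset by blast
  have eq: "real (card (Wset l n (insert g H) f F k)) = ?w + \<delta> g"
    if g: "g \<in> Q" "f \<in> available l n (insert g H)" for g
  proof -
    have "g \<in> keep f" using g by (simp add: keep_def)
    then show ?thesis using W_insert_card[OF F k f, of g] by (simp add: \<delta>_def)
  qed
  have step: "\<bar>\<delta> g\<bar> \<le> K0 * N ^ (m - 1) * u" if g: "g \<in> Q" for g
  proof (cases "g \<in> keep f")
    case False
    then show ?thesis using K0 u_pos by (simp add: \<delta>_def)
  next
    case True
    note ch = W_change_le[OF F k f True, unfolded m']
    have "\<bar>\<delta> g\<bar> \<le> 3 * (CP * N ^ (m - 1) * u)" using ch True by (simp add: \<delta>_def)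
    also have "\<dots> = 3 * pair_const l * (N ^ (m - 1) * u)" by (simp add: CP_eq)
    also have "\<dots> \<le> K0 * (N ^ (m - 1) * u)"
    proof (rule mult_right_mono)
      have "1 * pair_const l \<le> real l * pair_const l" using l4 pair_const_nonneg by (intro mult_right_mono) auto
      then show "3 * pair_const l \<le> K0" using K0_step by linarith
    qed (use u_pos in auto)
    finally show ?thesis by (simp add: mult.assoc)
  qed
  define S1 where "S1 = real (\<Sum>g\<in>keep f. card (W_new f F k g))"
  define S2 where "S2 = real (\<Sum>g\<in>keep f. card (W_lost f F k g))"
  have tot: "(\<Sum>g\<in>Q. \<delta> g) = S1 - S2"
  proof -
    have "(\<Sum>g\<in>Q. \<delta> g) = (\<Sum>g\<in>keep f. \<delta> g)"
      by (rule sum.mono_neutral_right[OF finite_Q kQ]) (auto simp: \<delta>_def)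
    also have "\<dots> = (\<Sum>g\<in>keep f. real (card (W_new f F k g)) - real (card (W_lost f F k g)))"
      by (rule sum.cong) (auto simp: \<delta>_def)
    finally show ?thesis by (simp add: S1_def S2_def sum_subtractf)
  qed
  have atot: "(\<Sum>g\<in>Q. \<bar>\<delta> g\<bar>) \<le> S1 + S2"
  proof -
    have "(\<Sum>g\<in>Q. \<bar>\<delta> g\<bar>) = (\<Sum>g\<in>keep f. \<bar>\<delta> g\<bar>)"
      by (rule sum.mono_neutral_right[OF finite_Q kQ]) (auto simp: \<delta>_def)
    also have "\<dots> \<le> (\<Sum>g\<in>keep f. real (card (W_new f F k g)) + real (card (W_lost f F k g)))"
      by (rule sum_mono) (auto simp: \<delta>_def)
    finally show ?thesis by (simp add: S1_def S2_def sum.distrib)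
  qed
  note tb = tt_bounds[OF im]
  note cb = C_hat_bounds[OF tb(1,2), of l n]
  have kE: "k \<le> ?E - 1" "k - 1 \<le> ?E - 1" "k - 1 \<le> ?E - 2" using k E by auto
  note wb = W_hat_bounds[OF tb(1,2) F kE(1), of n, folded m]
  let ?e = "err m i"
  have e0: "0 \<le> ?e" "?e \<le> P ^ m" using err_bounds(3,4)[OF im m1] by auto
  have Pe: "P * ?e = eta i * P ^ m" unfolding err_def using m1 by (cases m) (auto simp: mult_ac)
  have Pm: "P ^ (m + 1) = P * P ^ m" by simp
  let ?g' = "W_gain_hat l n F k t"
  have g1: "\<bar>S1 - ?g'\<bar> \<le> (real l + 1) * (P * ?e)" and g2: "0 \<le> ?g'" "?g' \<le> real l * Kphi l * P ^ (m + 1)"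
  proof -
    have "\<bar>S1 - ?g'\<bar> \<le> (real l + 1) * (P * ?e) \<and> 0 \<le> ?g' \<and> ?g' \<le> real l * Kphi l * P ^ (m + 1)"
    proof (cases "k = 0")
      case True
      have "0 \<le> (real l + 1) * (P * ?e)" using P0 e0 by simp
      moreover have "0 \<le> real l * Kphi l * P ^ (m + 1)" using Kphi_ge[of l] P0 by simp
      ultimately show ?thesis using True by (simp add: S1_def W_new_def W_gain_hat_def)
    next
      case False
      let ?w1 = "real (card (Wset l n H f F (k - 1)))" and ?wh1 = "W_hat l n F (k - 1) t"
      have mm: "?E - (2 + (k - 1)) = m" "?E - 1 - (k - 1) = m + 1" using False k E m by auto
      have w1: "\<bar>?w1 - ?wh1\<bar> \<le> P * ?e" using Wtr[OF f F kE(3)] unfolding mm Pe .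
      note wb1 = W_hat_bounds[OF tb(1,2) F kE(2), of n, unfolded mm]
      have gs: "\<bar>S1 - real (?E - k) * ?w1\<bar> \<le> real l * (CP * N ^ m * u)"
        using W_gain_sum[OF F _ k f] False unfolding S1_def m by simp
      have El: "real (?E - k) \<le> real l" using E by simp
      \<comment> \<open>The overcount in the gain is of order n^m u, while the allowance times p^2 n
        has n^m with the factor u^90. The remaining power of 1/p only helps, because 2 m is at most
        A.\<close>
      have "real l * (CP * N ^ m * u) \<le> P * ?e"
      proof -
        have pm: "1 \<le> 1 / pp i ^ (A - 2 * m)" using p0 pp_le1[of i] by (simp add: power_le_one)
        have "real l * CP * u \<le> u * u"
        proof (rule mult_right_mono)
          have "0 \<le> real l * (64 + 2 * real l * pair_const l)" using pair_const_nonneg by simp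
          then show "real l * CP \<le> u" unfolding CP_eq using u_cst pair_const_nonneg by linarith
        qed (use u_pos in auto)
        also have "\<dots> \<le> u ^ 90" using power_increasing[of 2 90 u] u_pos by (simp add: power2_eq_square)
        also have "\<dots> * 1 \<le> u ^ 90 * (1 / pp i ^ (A - 2 * m))" using pm u_pos by (intro mult_left_mono) auto
        finally have c: "real l * CP * u \<le> u ^ 90 * (1 / pp i ^ (A - 2 * m))" by simp
        have "P * ?e = u ^ 90 * N ^ m * (1 / pp i ^ (A - 2 * m))"
        proof -
          have "A = (A - 2 * m) + 2 * m" using A_ge m1 by simp
          then have "pp i ^ A = pp i ^ (A - 2 * m) * pp i ^ (2 * m)" by (metis power_add)
          then show ?thesis unfolding Pe eta_def using p0
            by (simp add: power_mult_distrib power_mult[symmetric])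
        qed
        then have pe: "P * ?e = N ^ m * (u ^ 90 * (1 / pp i ^ (A - 2 * m)))" by (simp add: mult_ac)
        have "real l * (CP * N ^ m * u) = N ^ m * (real l * CP * u)" by (simp add: mult_ac)
        also have "\<dots> \<le> P * ?e" unfolding pe using c by (intro mult_left_mono) auto
        finally show ?thesis .
      qed
      moreover have "\<bar>real (?E - k) * ?w1 - real (?E - k) * ?wh1\<bar> \<le> real l * (P * ?e)"
      proof -
        have "\<bar>real (?E - k) * ?w1 - real (?E - k) * ?wh1\<bar> = real (?E - k) * \<bar>?w1 - ?wh1\<bar>"
          by (simp add: abs_mult flip: right_diff_distrib)
        also have "\<dots> \<le> real l * (P * ?e)" using El w1 by (intro mult_mono) auto
        finally show ?thesis .
      qed
      ultimately have a: "\<bar>S1 - real (?E - k) * ?wh1\<bar> \<le> (real l + 1) * (P * ?e)"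
        using gs by (simp add: algebra_simps) linarith
      have gg: "?g' = real (?E - k) * ?wh1" using False by (simp add: W_gain_hat_def)
      have "real (?E - k) * ?wh1 \<le> real l * (Kphi l * P ^ (m + 1))" using El wb1 by (intro mult_mono) auto
      moreover have "0 \<le> real (?E - k) * ?wh1" using wb1 by simp
      ultimately show ?thesis using a unfolding gg by (simp add: mult.assoc)
    qed
    then show "\<bar>S1 - ?g'\<bar> \<le> (real l + 1) * (P * ?e)" "0 \<le> ?g'" "?g' \<le> real l * Kphi l * P ^ (m + 1)" by auto
  qed
  let ?l' = "?wh * (real m * ?ch)"
  have ml: "real m \<le> real l" using m1 by simp
  have W1: "\<bar>?w - ?wh\<bar> \<le> ?e" using Wtr[OF f F k] unfolding m' err_def .
  have l1: "\<bar>S2 - ?l'\<bar> \<le> real l * ((Kphi l + 1) * (close_const l + 1) + (3 + Lam l)) * (P * ?e)"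
  proof -
    let ?d = "close_const l * eta i + 1 + real l * (CC * u)"
    have "\<bar>S2 - ?w * (real m * ?ch)\<bar> \<le> ?w * (real m * ?d)"
      unfolding S2_def m by (rule W_loss_sum[OF F k f closers_estimate])
    also have "\<dots> \<le> (Kphi l + 1) * P ^ m * (real l * ((close_const l + 1) * eta i))"
    proof (rule mult_mono)
      have "?w \<le> Kphi l * P ^ m + P ^ m" using W1 wb(2) e0 by linarith
      then show "?w \<le> (Kphi l + 1) * P ^ m" by (simp add: algebra_simps)
      have "1 + real l * (CC * u) \<le> (1 + real l * CC) * u" using u_pos by (simp add: algebra_simps)
      also have "\<dots> \<le> eta i"
      proof (rule small_le_eta)
        have "0 \<le> real l * pair_const l" using pair_const_nonneg by simp
        then show "1 + real l * CC \<le> u" unfolding CC_eq using u_cst pair_const_nonneg by linarith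
      qed
      finally have "?d \<le> (close_const l + 1) * eta i" by (simp add: algebra_simps)
      moreover have d0: "0 \<le> ?d" using close_const_ge[of l] eta_ge1 CC_ge u_pos by simp
      ultimately show "real m * ?d \<le> real l * ((close_const l + 1) * eta i)" using ml by (intro mult_mono) auto
      show "0 \<le> (Kphi l + 1) * P ^ m" using Kphi_ge[of l] P0 by simp
      show "0 \<le> real m * ?d" using d0 by simp
    qed
    also have "\<dots> = real l * ((Kphi l + 1) * (close_const l + 1)) * (P * ?e)" unfolding Pe by (simp add: mult_ac)
    finally have a: "\<bar>S2 - ?w * (real m * ?ch)\<bar> \<le> real l * ((Kphi l + 1) * (close_const l + 1)) * (P * ?e)" .
    have "\<bar>?w * (real m * ?ch) - ?l'\<bar> = \<bar>?w - ?wh\<bar> * (real m * ?ch)"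
      using cb by (simp add: abs_mult flip: left_diff_distrib)
    also have "\<dots> \<le> ?e * (real l * ((3 + Lam l) * P))"
      using W1 cb ml by (intro mult_mono) auto
    also have "\<dots> = real l * (3 + Lam l) * (P * ?e)" by (simp add: mult_ac)
    finally have b: "\<bar>?w * (real m * ?ch) - ?l'\<bar> \<le> real l * (3 + Lam l) * (P * ?e)" .
    have "real l * ((Kphi l + 1) * (close_const l + 1) + (3 + Lam l)) * (P * ?e)
        = real l * ((Kphi l + 1) * (close_const l + 1)) * (P * ?e) + real l * (3 + Lam l) * (P * ?e)"
      by (simp only: distrib_left distrib_right)
    then show ?thesis using a b by linarith
  qed
  have l2: "0 \<le> ?l'" "?l' \<le> real l * Kphi l * (3 + Lam l) * P ^ (m + 1)"
  proof -
    show "0 \<le> ?l'" using wb cb by simp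
    have "?l' \<le> (Kphi l * P ^ m) * (real l * ((3 + Lam l) * P))"
      using wb cb ml Kphi_ge[of l] P0 Lam_nonneg[of l] by (intro mult_mono) auto
    also have "\<dots> = real l * Kphi l * (3 + Lam l) * P ^ (m + 1)" by (simp add: mult_ac)
    finally show "?l' \<le> real l * Kphi l * (3 + Lam l) * P ^ (m + 1)" .
  qed
  let ?T' = "?g' - ?l'"
  have Pe0: "0 \<le> P * ?e" using P0 e0 by simp
  have sumb: "\<bar>S1 - ?g'\<bar> + \<bar>S2 - ?l'\<bar> \<le> drift_const l * (P * ?e)"
  proof -
    have "\<bar>S1 - ?g'\<bar> + \<bar>S2 - ?l'\<bar>
        \<le> ((real l + 1) + real l * ((Kphi l + 1) * (close_const l + 1) + (3 + Lam l))) * (P * ?e)"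
      using add_mono[OF g1 l1] by (simp only: distrib_right)
    also have "\<dots> \<le> drift_const l * (P * ?e)" using drift_const_ge(2)[of l] Pe0 by (rule mult_right_mono)
    finally show ?thesis .
  qed
  have hatb: "?g' + ?l' \<le> drift_const l * P ^ (m + 1)"
  proof -
    have "?g' + ?l' \<le> (real l * Kphi l + real l * Kphi l * (3 + Lam l)) * P ^ (m + 1)"
      using add_mono[OF g2(2) l2(2)] by (simp only: distrib_right)
    also have "\<dots> \<le> drift_const l * P ^ (m + 1)" using drift_const_ge(3)[of l] P0 by (intro mult_right_mono) auto
    finally show ?thesis .
  qed
  have T: "\<bar>(\<Sum>g\<in>Q. \<delta> g) - ?T'\<bar> \<le> drift_const l * P * ?e"
  proof -
    have "\<bar>(S1 - S2) - ?T'\<bar> \<le> \<bar>S1 - ?g'\<bar> + \<bar>S2 - ?l'\<bar>" by linarith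
    then show ?thesis unfolding tot using sumb by (simp only: mult.assoc)
  qed
  have T': "\<bar>?T'\<bar> \<le> drift_const l * P ^ (m + 1)" using hatb g2(1) l2(1) by linarith
  have abs: "(\<Sum>g\<in>Q. \<bar>\<delta> g\<bar>) \<le> 2 * drift_const l * P ^ (m + 1)"
  proof -
    have "drift_const l * (P * ?e) \<le> drift_const l * (P * P ^ m)"
      using e0 P0 drift_const_ge(4)[of l] by (intro mult_left_mono) auto
    then have "drift_const l * (P * ?e) \<le> drift_const l * P ^ (m + 1)" unfolding Pm .
    moreover have "S1 + S2 \<le> (?g' + ?l') + (\<bar>S1 - ?g'\<bar> + \<bar>S2 - ?l'\<bar>)" by linarith
    ultimately show ?thesis using atot sumb hatb by linarith
  qed
  have dr: "?T' / Q_hat l n t = \<phi>' * N ^ m / N\<^sup>2"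
    unfolding \<phi>'_def using W_drift_identity[OF _ n_pos m m1(1), of t l] p0 by simp
  note fin = step_from_totals[OF m1 dr T T' abs]
  show ?thesis using eq step fin by (intro exI[of _ \<delta>]) blast
qed

end

section \<open>Failure probabilities\<close>

definition dY :: "nat \<Rightarrow> real \<Rightarrow> real" where
  "dY l t = traj_p t * traj_q l t * (-12 + traj_p t * lamq l t)"

definition dW :: "nat \<Rightarrow> hypergraph \<Rightarrow> nat \<Rightarrow> real \<Rightarrow> real" where
  "dW l F k t = cF F * real ((num_triples F - 1) choose k) *
      (real k * 6 * (6 * t) ^ (k - 1) * (traj_p t ^ 3 * traj_q l t) ^ (num_triples F - 1 - k) +
       (6 * t) ^ k * (real (num_triples F - 1 - k) * (traj_p t ^ 3 * traj_q l t) ^ (num_triples F - 1 - k - 1) *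
         (traj_p t ^ 2 * traj_q l t * (-18 + traj_p t * lamq l t))))"

lemma process_steps_linear:
  assumes "es \<in> set_pmf (process_steps l n i)" "f \<in> set es" "g \<in> set es" "f \<noteq> g"
  shows "card (f \<inter> g) \<le> 1"
  using assms
proof (induction i arbitrary: es f g)
  case (Suc i)
  then obtain fs where fs: "fs \<in> set_pmf (process_steps l n i)"
    and es: "es \<in> set_pmf (if available l n (set fs) = {} then return_pmf fs
      else map_pmf (\<lambda>e. fs @ [e]) (pmf_of_set (available l n (set fs))))"
    by auto
  show ?case
  proof (cases "available l n (set fs) = {}")
    case True
    then show ?thesis using es Suc.IH[OF fs] Suc.prems by simp
  next
    case False
    then obtain e where e: "e \<in> available l n (set fs)" "es = fs @ [e]"
      using es by (auto simp: set_pmf_of_set finite_available)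
    have 1: "card (e \<inter> h) \<le> 1" if "h \<in> set fs" for h using e(1) that unfolding available_def by blast
    have 2: "card (h \<inter> e) \<le> 1" if "h \<in> set fs" for h by (subst Int_commute) (rule 1[OF that])
    have "f \<in> set fs \<or> f = e" "g \<in> set fs \<or> g = e" using Suc.prems(2,3) e(2) by auto
    then show ?thesis using 1 2 Suc.IH[OF fs] Suc.prems(4) by blast
  qed
qed simp

text \<open>Distinct triples cover disjoint sets of three pairs, so the number of open pairs depends
  only on the number of steps.\<close>

lemma card_open_pairs:
  assumes H: "H \<subseteq> [{1..n}]\<^bsup>3\<^esup>" and lin: "\<And>f g. f \<in> H \<Longrightarrow> g \<in> H \<Longrightarrow> f \<noteq> g \<Longrightarrow> card (f \<inter> g) \<le> 1"
  shows "card (open_pairs n H) + 3 * card H = n choose 2"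
proof -
  have finH: "finite H" using H by (rule finite_subset) (simp add: finite_imp_finite_nsets)
  have f3: "finite f" "card f = 3" "f \<subseteq> {1..n}" if "f \<in> H" for f using H that by (auto simp: nsets_def)
  let ?C = "\<Union>f\<in>H. [f]\<^bsup>2\<^esup>"
  have "open_pairs n H = [{1..n}]\<^bsup>2\<^esup> - ?C"
    unfolding open_pairs_def nsets_def by blast
  moreover have sub: "?C \<subseteq> [{1..n}]\<^bsup>2\<^esup>" using f3(3) unfolding nsets_def by blast
  moreover have fin2: "finite ([{1..n}]\<^bsup>2\<^esup>)" by (simp add: finite_imp_finite_nsets)
  ultimately have "card (open_pairs n H) = card ([{1..n}]\<^bsup>2\<^esup>) - card ?C"
    by (simp only:) (rule card_Diff_subset, auto intro: finite_subset)
  moreover have "card ?C \<le> card ([{1..n}]\<^bsup>2\<^esup>)" by (rule card_mono[OF fin2 sub])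
  moreover have "card ([{1..n}]\<^bsup>2\<^esup>) = n choose 2" by simp
  moreover have "card ?C = (\<Sum>f\<in>H. card ([f]\<^bsup>2\<^esup>))"
  proof (rule card_UN_disjoint[OF finH])
    show "\<forall>f\<in>H. finite ([f]\<^bsup>2\<^esup>)" using f3 by (simp add: finite_imp_finite_nsets)
    show "\<forall>f\<in>H. \<forall>g\<in>H. f \<noteq> g \<longrightarrow> [f]\<^bsup>2\<^esup> \<inter> [g]\<^bsup>2\<^esup> = {}"
    proof (intro ballI impI)
      fix f g assume fg: "f \<in> H" "g \<in> H" "f \<noteq> g"
      show "[f]\<^bsup>2\<^esup> \<inter> [g]\<^bsup>2\<^esup> = {}"
      proof (rule ccontr)
        assume "[f]\<^bsup>2\<^esup> \<inter> [g]\<^bsup>2\<^esup> \<noteq> {}"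
        then obtain d where d: "d \<subseteq> f \<inter> g" "card d = 2" by (auto simp: nsets_def)
        then have "card d \<le> card (f \<inter> g)" using f3(1)[OF fg(1)] by (intro card_mono) auto
        then show False using lin[OF fg] d by simp
      qed
    qed
  qed
  moreover have "(\<Sum>f\<in>H. card ([f]\<^bsup>2\<^esup>)) = 3 * card H"
  proof -
    have "card ([f]\<^bsup>2\<^esup>) = 3" if "f \<in> H" for f
      using f3[OF that] by (simp add: choose_two)
    then show ?thesis by simp
  qed
  ultimately show ?thesis by linarith
qed

lemma (in triple_state) sum_open_pairs:
  "(\<Sum>d\<in>open_pairs n H. card {f \<in> Q. d \<subseteq> f}) = 3 * card Q"
proof -
  have finO: "finite (open_pairs n H)"
  proof (rule finite_subset)
    show "open_pairs n H \<subseteq> [{1..n}]\<^bsup>2\<^esup>" unfolding open_pairs_def by blast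
  qed (simp add: finite_imp_finite_nsets)
  have "(\<Sum>d\<in>open_pairs n H. card {f \<in> Q. d \<subseteq> f}) = (\<Sum>f\<in>Q. card {d \<in> open_pairs n H. d \<subseteq> f})"
    by (rule sum_card_swap[OF finO finite_Q])
  also have "\<dots> = (\<Sum>f\<in>Q. 3)"
  proof (rule sum.cong[OF refl])
    fix f assume f: "f \<in> Q"
    have "{d \<in> open_pairs n H. d \<subseteq> f} = [f]\<^bsup>2\<^esup>"
    proof (intro equalityI subsetI)
      fix d assume d: "d \<in> [f]\<^bsup>2\<^esup>"
      then obtain a b where ab: "d = {a, b}" "a \<noteq> b" "d \<subseteq> f" by (auto simp: nsets_def card_2_iff)
      then show "d \<in> {d \<in> open_pairs n H. d \<subseteq> f}" using Q_open[OF f, of a b] by simp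
    qed (auto simp: open_pairs_def nsets_def)
    then show "card {d \<in> open_pairs n H. d \<subseteq> f} = 3" using Q_D[OF f] by (simp add: choose_two)
  qed
  finally show ?thesis by simp
qed

lemma available_empty:
  "available l n {} = [{1..n}]\<^bsup>3\<^esup>"
proof (intro equalityI subsetI)
  fix e assume e: "e \<in> [{1..n}]\<^bsup>3\<^esup>"
  have "\<not> is_copy F' F" if F: "F \<in> Ffam l" and s: "F' \<subseteq> {e}" for F F'
  proof
    assume c: "is_copy F' F"
    have "card F' \<le> card {e}" using s by (intro card_mono) auto
    moreover have "4 \<le> card F'" using is_copy_conf(2)[OF F c] num_triples_ge[OF F] by simp
    ultimately show False by simp
  qed
  then show "e \<in> available l n {}" using e unfolding available_def by blast
qed (auto simp: available_def)

locale run_final = run_consts +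
  assumes tayY: "\<And>s t. 0 \<le> t \<Longrightarrow> t < s \<Longrightarrow> s \<le> 1 \<Longrightarrow>
      \<bar>phiY l s - phiY l t - dY l t * (s - t)\<bar> \<le> K0 * (s - t)\<^sup>2 \<and> \<bar>phiY l s - phiY l t\<bar> \<le> K0 * (s - t)"
    and tayW: "\<And>F k s t. F \<in> Ffam l \<Longrightarrow> k \<le> num_triples F - 2 \<Longrightarrow> 0 \<le> t \<Longrightarrow> t < s \<Longrightarrow> s \<le> 1 \<Longrightarrow>
      \<bar>phiW l F k s - phiW l F k t - dW l F k t * (s - t)\<bar> \<le> K0 * (s - t)\<^sup>2 \<and> \<bar>phiW l F k s - phiW l F k t\<bar> \<le> K0 * (s - t)"
    and K0_init: "6 * real l ^ 3 \<le> K0" and n_ge: "l \<le> n"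
begin

lemma plus_minus_iff: "x \<in> a \<plusminus> b \<longleftrightarrow> \<bar>x - a\<bar> \<le> b"
  by (auto simp: plus_minus_def)

lemma eta_powr: assumes i: "i \<le> m0" shows "pp i powr (- real A) * N powr (9 / 10) = eta i"
proof -
  have p: "0 < pp i" using p_pos[OF i] .
  have "N powr (9 / 10) = (u powr 100) powr (9 / 10)"
    using uN u_pos powr_realpow[of u 100] by simp
  also have "\<dots> = u powr 90" by (simp add: powr_powr)
  also have "\<dots> = u ^ 90" using u_pos powr_realpow[of u 90] by simp
  finally have "N powr (9 / 10) = u ^ 90" .
  moreover have "pp i powr (- real A) = 1 / pp i ^ A"
    using p by (simp add: powr_minus powr_realpow divide_inverse)
  ultimately show ?thesis by (simp add: eta_def)
qed

lemma tracks_iff: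
  assumes i: "i \<le> m0"
  shows "tracks l n (9 / 10) (real A) es i \<longleftrightarrow>
    card (available l n (hypergraph_at es i)) > 0 \<and>
    \<bar>real (card (available l n (hypergraph_at es i))) - Q_hat l n (tt i)\<bar> \<le> eta i * (pp i * N\<^sup>2) \<and>
    (\<forall>a b. {a, b} \<in> open_pairs n (hypergraph_at es i) \<longrightarrow>
      \<bar>real (card (Yset l n (hypergraph_at es i) a b)) - Y_hat l n (tt i)\<bar> \<le> eta i) \<and>
    (\<forall>e\<in>available l n (hypergraph_at es i). \<forall>F\<in>Ffam l. \<forall>k\<le>num_triples F - 2.
      \<bar>real (card (Wset l n (hypergraph_at es i) e F k)) - W_hat l n F k (tt i)\<bar>
        \<le> eta i * (pp i ^ 2 * N) ^ (num_triples F - (2 + k)))"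
  unfolding tracks_def Let_def plus_minus_iff eta_powr[OF i] ..

text \<open>Every available triple lies over three open pairs, hence 3 |Q| is the sum of the |Y|
  over the open pairs.\<close>

lemma Q_from_Y:
  assumes H: "H \<subseteq> [{1..n}]\<^bsup>3\<^esup>" and lin: "\<And>f g. f \<in> H \<Longrightarrow> g \<in> H \<Longrightarrow> f \<noteq> g \<Longrightarrow> card (f \<inter> g) \<le> 1"
    and cH: "card H = i" and i: "i \<le> m0"
    and Y: "\<And>a b. {a, b} \<in> open_pairs n H \<Longrightarrow> \<bar>real (card (Yset l n H a b)) - Y_hat l n (tt i)\<bar> \<le> eta i"
  shows "\<bar>real (card (available l n H)) - Q_hat l n (tt i)\<bar> \<le> eta i * (pp i * N\<^sup>2)"
proof -
  interpret triple_state l n H by unfold_locales (rule H)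
  let ?O = "open_pairs n H" and ?yh = "Y_hat l n (tt i)"
  let ?E = "real (card ?O)"
  have p: "0 < pp i" using p_pos[OF i] .
  have pN: "pp i * N\<^sup>2 = N\<^sup>2 - 6 * real i" using N_pos by (simp add: traj_p_def algebra_simps)
  have E: "?E = (pp i * N\<^sup>2 - N) / 2"
  proof -
    have "real (card ?O + 3 * card H) = real (n choose 2)" using card_open_pairs[OF H lin] by simp
    moreover have "real (n choose 2) = N * (N - 1) / 2"
      using n_pos by (simp add: choose_two real_of_nat_div of_nat_diff)
    ultimately show ?thesis unfolding pN using cH by (simp add: power2_eq_square field_simps)
  qed
  have each: "\<bar>real (card {f \<in> Q. d \<subseteq> f}) - ?yh\<bar> \<le> eta i" if d: "d \<in> ?O" for d
  proof -
    obtain a b where ab: "d = {a, b}" "a \<noteq> b" using d by (auto simp: open_pairs_def nsets_def card_2_iff)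
    then show ?thesis using card_through_pair[of a b] Y[of a b] d by simp
  qed
  have "\<bar>3 * real (card Q) - ?E * ?yh\<bar> = \<bar>\<Sum>d\<in>?O. real (card {f \<in> Q. d \<subseteq> f}) - ?yh\<bar>"
    using arg_cong[OF sum_open_pairs, of real] by (simp add: sum_subtractf)
  also have "\<dots> \<le> (\<Sum>d\<in>?O. \<bar>real (card {f \<in> Q. d \<subseteq> f}) - ?yh\<bar>)" by (rule sum_abs)
  also have "\<dots> \<le> (\<Sum>d\<in>?O. eta i)" by (rule sum_mono[OF each])
  finally have a: "\<bar>3 * real (card Q) - ?E * ?yh\<bar> \<le> ?E * eta i" by simp
  have eta1: "1 \<le> eta i" using eta_bounds(1)[OF i] u_pos one_le_power[of u 90] by linarith
  have "?E * eta i \<le> pp i * N\<^sup>2 / 2 * eta i" using eta1 N_pos unfolding E by (intro mult_right_mono) auto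
  then have b: "?E * eta i \<le> eta i * (pp i * N\<^sup>2) / 2" by (simp add: mult_ac)
  note yb = Y_hat_bounds[OF tt_bounds(1,2)[OF i], of l n]
  have qh: "Q_hat l n (tt i) = pp i * N\<^sup>2 * ?yh / 6"
    by (simp add: Q_hat_def Y_hat_def power2_eq_square power3_eq_cube)
  \<comment> \<open>The number of open pairs falls short of p n^2 / 2 by n / 2. This accounts for n
    Y / 2, which fits beside the summed deviations of the |Y|.\<close>
  have c: "3 * Q_hat l n (tt i) - ?E * ?yh = N * ?yh / 2" 
  proof -
    have "3 * (X * y / 6) - (X - N) / 2 * y = N * y / 2" for X y :: real by (simp add: field_simps)
    then show ?thesis unfolding qh E .
  qed
  have "N * ?yh \<le> N * (pp i ^ 2 * N)" using yb by (intro mult_left_mono) auto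
  also have "\<dots> = pp i * (pp i * N\<^sup>2)" by (simp add: power2_eq_square)
  also have "\<dots> \<le> eta i * (pp i * N\<^sup>2)" using eta1 pp_le1[of i] p by (intro mult_right_mono) auto
  finally have d: "N * ?yh \<le> eta i * (pp i * N\<^sup>2)" .
  have d0: "0 \<le> N * ?yh" using yb by simp
  show ?thesis using a b c d d0 by linarith
qed

text \<open>The extension bound is made part of the good event, since the step estimates rely on
  it.\<close>

definition good :: "nat set list \<Rightarrow> bool" where
  "good es \<longleftrightarrow> set es \<subseteq> [{1..n}]\<^bsup>3\<^esup> \<and> length es \<le> m0 \<and> tracks l n (9 / 10) (real A) es (length es) \<and> ext_ok n L u (set es)"

lemma good_tracked:
  assumes len: "length es = i" and g: "good es"
  shows "tracked_state l n L A m0 u K0 (set es) i"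
proof -
  have im: "i \<le> m0" using g len by (simp add: good_def)
  have hg: "hypergraph_at es i = set es" using len by (simp add: hypergraph_at_def)
  have tr: "tracks l n (9 / 10) (real A) es i" and ex: "ext_ok n L u (set es)" using g len by (auto simp: good_def)
  note T = tr[unfolded tracks_iff[OF im] hg]
  have sub: "set es \<subseteq> [{1..n}]\<^bsup>3\<^esup>" using g by (simp add: good_def)
  show ?thesis by unfold_locales (use T ex im sub in blast)+
qed

text \<open>The tracked object is alive while the pair is open; a covered pair never becomes open
  again.\<close>

lemma prob_Y_fail:
  assumes ab: "{a, b} \<in> [{1..n}]\<^bsup>2\<^esup>" and i: "i \<le> m0" and sg: "\<bar>\<sigma>\<bar> = 1"
  shows "measure_pmf.prob (process_steps l n i)
      {es. survives good i es \<and> {a, b} \<in> open_pairs n (set es) \<and>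
        \<sigma> * (real (card (Yset l n (set es) a b)) - N ^ 1 * phiY l (tt i)) - err 1 i \<ge> 0} \<le> exp (- u)"
proof (rule prob_tracking_one_sided[OF sg order_refl _ tayY])
  show "1 \<le> l" using l4 by simp
  show "{a, b} \<in> open_pairs n (set es)" if "{a, b} \<in> open_pairs n (set (es @ [g]))" for es g
    using that by (auto simp: open_pairs_def)
  show "\<bar>real (card (Yset l n {} a b)) - N ^ 1 * phiY l 0\<bar> \<le> K0 * N ^ (1 - 1)"
  proof -
    have ab': "a \<noteq> b" "a \<in> {1..n}" "b \<in> {1..n}" using ab by (auto simp: nsets_def card_2_iff doubleton_eq_iff)
    have "Yset l n {} a b = {1..n} - {a, b}"
      unfolding Yset_def available_empty using ab' by (auto simp: nsets_def)
    then have "card (Yset l n {} a b) = n - 2" using ab' by (simp add: card_Diff_subset)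
    moreover have "n \<ge> 2" using n_ge l4 by simp
    moreover have "phiY l 0 = 1"
    proof -
      have "cF F * (6 * 0) ^ (num_triples F - 1) = 0" if "F \<in> Ffam l" for F
        using num_triples_ge[OF that] by simp
      then have "(\<Sum>F\<in>Ffam l. cF F * (6 * 0) ^ (num_triples F - 1)) = 0" by (intro sum.neutral) blast
      then have "traj_q l 0 = 1" unfolding traj_q_alt by simp
      then show ?thesis by (simp add: phiY_def traj_p_def)
    qed
    moreover have "2 \<le> K0"
    proof -
      have "0 \<le> 3 * real l * pair_const l" by (simp add: pair_const_def)
      then show ?thesis using K0_step by linarith
    qed
    ultimately show ?thesis by (simp add: of_nat_diff)
  qed
  fix i es assume im: "i < m0" and es: "es \<in> set_pmf (process_steps l n i)" and sv: "survives good i es" "good es"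
    and op: "{a, b} \<in> open_pairs n (set es)"
  interpret tracked_state l n L A m0 u K0 "set es" i
    by (rule good_tracked[OF survives_length[OF sv(1)] sv(2)])
  show "\<exists>\<delta>. (\<forall>g\<in>available l n (set es). ({a, b} \<in> open_pairs n (set (es @ [g])) \<longrightarrow>
        real (card (Yset l n (insert g (set es)) a b)) = real (card (Yset l n (set es) a b)) + \<delta> g) \<and>
        \<bar>\<delta> g\<bar> \<le> K0 * N ^ (1 - 1) * u) \<and>
      \<bar>(\<Sum>g\<in>available l n (set es). \<delta> g) / real (card (available l n (set es))) - dY l (tt i) * N ^ 1 / N\<^sup>2\<bar>
        \<le> K0 * (err 1 i / (pp i * N\<^sup>2)) \<and>
      (\<Sum>g\<in>available l n (set es). \<bar>\<delta> g\<bar>) \<le> K0 * (N ^ 1 / N\<^sup>2) * real (card (available l n (set es)))"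
  proof -
    have ins: "set (es @ [g]) = insert g (set es)" for g by simp
    show ?thesis unfolding ins dY_def by (rule Y_step[OF op])
  qed
qed (use i in auto)

lemma prob_W_fail:
  assumes f: "f \<in> [{1..n}]\<^bsup>3\<^esup>" and F: "F \<in> Ffam l" and k: "k \<le> num_triples F - 2" and i: "i \<le> m0"
    and sg: "\<bar>\<sigma>\<bar> = 1" and m: "m = num_triples F - 1 - k"
  shows "measure_pmf.prob (process_steps l n i)
      {es. survives good i es \<and> f \<in> available l n (set es) \<and>
        \<sigma> * (real (card (Wset l n (set es) f F k)) - N ^ m * phiW l F k (tt i)) - err m i \<ge> 0} \<le> exp (- u)"
proof (rule prob_tracking_one_sided[OF sg _ _ tayW[OF F k]])
  have E: "4 \<le> num_triples F" "num_triples F + 2 \<le> l" using num_triples_ge[OF F] by auto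
  show "1 \<le> m" "m \<le> l" using m k E by auto
  show "f \<in> available l n (set es)" if "f \<in> available l n (set (es @ [g]))" for es g
  proof -
    have "set es \<subseteq> set (es @ [g])" by auto
    then show ?thesis using that unfolding available_def by blast
  qed
  show "\<bar>real (card (Wset l n {} f F k)) - N ^ m * phiW l F k 0\<bar> \<le> K0 * N ^ (m - 1)"
  proof (cases "k = 0")
    case True
    have "Wset l n {} f F k = {F' \<in> copies n F. f \<in> F'}"
    proof -
      have "F' \<inter> available l n {} = F' \<and> card F' = num_triples F" if "F' \<in> copies n F" for F'
        using that is_copy_conf(2)[OF F] unfolding copies_def available_empty by blast
      then show ?thesis unfolding Wset_def using True by auto
    qed
    moreover have "N ^ m * phiW l F k 0 = 6 * real (num_triples F) / real (card (hg_aut F)) * N ^ (num_triples F - 1)"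
    proof -
      have "cF G * (6 * 0) ^ (num_triples G - 1) = 0" if "G \<in> Ffam l" for G
        using num_triples_ge[OF that] by simp
      then have "(\<Sum>F\<in>Ffam l. cF F * (6 * 0) ^ (num_triples F - 1)) = 0" by (intro sum.neutral) blast
      then have "traj_q l 0 = 1" unfolding traj_q_alt by simp
      then show ?thesis using True m by (simp add: phiW_def traj_p_def cF_def)
    qed
    moreover have "num_triples F - 2 = m - 1" using m True by simp
    moreover have "6 * real l ^ 3 * N ^ (m - 1) \<le> K0 * N ^ (m - 1)" using K0_init by (intro mult_right_mono) auto
    ultimately show ?thesis using copies_through_edge_estimate[OF F f n_ge] by simp
  next
    case False
    \<comment> \<open>At the start no copy has a triple in the empty hypergraph, and the trajectory
      carries the factor (6t)^k.\<close>
    have "Wset l n {} f F k = {}" unfolding Wset_def using False by auto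
    then show ?thesis using False K0 by (simp add: phiW_def zero_power)
  qed
  fix i es assume im: "i < m0" and es: "es \<in> set_pmf (process_steps l n i)" and sv: "survives good i es" "good es"
    and fa: "f \<in> available l n (set es)"
  interpret tracked_state l n L A m0 u K0 "set es" i
    by (rule good_tracked[OF survives_length[OF sv(1)] sv(2)])
  show "\<exists>\<delta>. (\<forall>g\<in>available l n (set es). (f \<in> available l n (set (es @ [g])) \<longrightarrow>
        real (card (Wset l n (insert g (set es)) f F k)) = real (card (Wset l n (set es) f F k)) + \<delta> g) \<and>
        \<bar>\<delta> g\<bar> \<le> K0 * N ^ (m - 1) * u) \<and>
      \<bar>(\<Sum>g\<in>available l n (set es). \<delta> g) / real (card (available l n (set es))) - dW l F k (tt i) * N ^ m / N\<^sup>2\<bar>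
        \<le> K0 * (err m i / (pp i * N\<^sup>2)) \<and>
      (\<Sum>g\<in>available l n (set es). \<bar>\<delta> g\<bar>) \<le> K0 * (N ^ m / N\<^sup>2) * real (card (available l n (set es)))"
  proof -
    have ins: "set (es @ [g]) = insert g (set es)" for g by simp
    show ?thesis unfolding ins dW_def m[symmetric] by (rule W_step[OF F k fa m])
  qed
qed (use i in auto)

text \<open>Failures of Q do not appear: \<open>Q_from_Y\<close> derives its estimate from that of
  Y, and \<open>card_Q_ge\<close> then gives positivity.\<close>

lemma not_good_cases:
  assumes es: "es \<in> set_pmf (process_steps l n i)" and i: "i \<le> m0" and sv: "survives good i es" and ng: "\<not> good es"
    and ex: "ext_ok n L u (set es)"
  shows "(\<exists>a b \<sigma>. {a, b} \<in> [{1..n}]\<^bsup>2\<^esup> \<and> \<sigma> \<in> {1, -1} \<and> {a, b} \<in> open_pairs n (set es) \<and>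
        \<sigma> * (real (card (Yset l n (set es) a b)) - N ^ 1 * phiY l (tt i)) - err 1 i \<ge> 0) \<or>
    (\<exists>f F k \<sigma>. f \<in> [{1..n}]\<^bsup>3\<^esup> \<and> F \<in> Ffam l \<and> k \<le> num_triples F - 2 \<and> \<sigma> \<in> {1, -1} \<and> f \<in> available l n (set es) \<and>
        \<sigma> * (real (card (Wset l n (set es) f F k)) - N ^ (num_triples F - 1 - k) * phiW l F k (tt i))
          - err (num_triples F - 1 - k) i \<ge> 0)"
proof (rule ccontr)
  assume "\<not> ?thesis"
  then have nY: "\<And>a b \<sigma>. {a, b} \<in> [{1..n}]\<^bsup>2\<^esup> \<Longrightarrow> \<sigma> \<in> {1, -1} \<Longrightarrow> {a, b} \<in> open_pairs n (set es) \<Longrightarrow>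
        \<not> \<sigma> * (real (card (Yset l n (set es) a b)) - N ^ 1 * phiY l (tt i)) - err 1 i \<ge> 0"
    and nW: "\<And>f F k \<sigma>. f \<in> [{1..n}]\<^bsup>3\<^esup> \<Longrightarrow> F \<in> Ffam l \<Longrightarrow> k \<le> num_triples F - 2 \<Longrightarrow> \<sigma> \<in> {1, -1} \<Longrightarrow>
        f \<in> available l n (set es) \<Longrightarrow>
        \<not> \<sigma> * (real (card (Wset l n (set es) f F k)) - N ^ (num_triples F - 1 - k) * phiW l F k (tt i))
          - err (num_triples F - 1 - k) i \<ge> 0" by blast+
  have len: "length es = i" using survives_length[OF sv] .
  have hg: "hypergraph_at es i = set es" using len by (simp add: hypergraph_at_def)
  have inv: "distinct es" "set es \<subseteq> [{1..n}]\<^bsup>3\<^esup>" using process_steps_invariant[OF es] by auto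
  have Y: "\<bar>real (card (Yset l n (set es) a b)) - Y_hat l n (tt i)\<bar> \<le> eta i" if o: "{a, b} \<in> open_pairs n (set es)" for a b
  proof -
    have o2: "{a, b} \<in> [{1..n}]\<^bsup>2\<^esup>" using o by (simp add: open_pairs_def)
    show ?thesis using nY[OF o2 _ o, of 1] nY[OF o2 _ o, of "-1"] by (simp add: Y_hat_phi err_def)
  qed
  have W: "\<bar>real (card (Wset l n (set es) f F k)) - W_hat l n F k (tt i)\<bar> \<le> eta i * (pp i ^ 2 * N) ^ (num_triples F - (2 + k))"
    if f: "f \<in> available l n (set es)" and F: "F \<in> Ffam l" and k: "k \<le> num_triples F - 2" for f F k
  proof -
    have f3: "f \<in> [{1..n}]\<^bsup>3\<^esup>" using f by (simp add: available_def)
    have e: "err (num_triples F - 1 - k) i = eta i * (pp i ^ 2 * N) ^ (num_triples F - (2 + k))"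
      by (simp add: err_def)
    show ?thesis using nW[OF f3 F k _ f, of 1] nW[OF f3 F k _ f, of "-1"] unfolding W_hat_phi e by simp
  qed
  have Qt: "\<bar>real (card (available l n (set es))) - Q_hat l n (tt i)\<bar> \<le> eta i * (pp i * N\<^sup>2)"
    using inv len i Y process_steps_linear[OF es] by (intro Q_from_Y) (auto simp: distinct_card)
  interpret tracked_state l n L A m0 u K0 "set es" i
    by unfold_locales (use Qt Y W ex i inv(2) in blast)+
  have "0 < q_min l * (pp i ^ 3 * N ^ 3) / 12" using q_min_pos[of l] p0 N_pos by simp
  then have "0 < card Q" using card_Q_ge by linarith
  then have "tracks l n (9 / 10) (real A) es i" unfolding tracks_iff[OF i] hg using Qt Y W by blast
  then show False using ng ex i len inv(2) by (simp add: good_def)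
qed

lemma prob_UN_le:
  assumes "finite I" "\<And>x. x \<in> I \<Longrightarrow> measure_pmf.prob p (B x) \<le> c"
  shows "measure_pmf.prob p (\<Union>x\<in>I. B x) \<le> real (card I) * c"
proof -
  have "measure_pmf.prob p (\<Union>x\<in>I. B x) \<le> (\<Sum>x\<in>I. measure_pmf.prob p (B x))"
    using assms(1) by (intro measure_pmf.finite_measure_subadditive_finite) simp_all
  also have "\<dots> \<le> (\<Sum>x\<in>I. c)" by (rule sum_mono[OF assms(2)])
  finally show ?thesis by simp
qed

lemma prob_not_good_le:
  assumes i: "i \<le> m0"
  shows "measure_pmf.prob (process_steps l n i) {es. survives good i es \<and> \<not> good es}
    \<le> measure_pmf.prob (process_steps l n i) {es. survives good i es \<and> \<not> ext_ok n L u (set es)}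
      + (2 * N ^ 2 + 2 * N ^ 3 * real (card (Ffam l)) * real (l + 1)) * exp (- u)"
proof -
  let ?p = "process_steps l n i"
  let ?BY = "\<lambda>(a, b, \<sigma>). {es. survives good i es \<and> {a, b} \<in> open_pairs n (set es) \<and>
        \<sigma> * (real (card (Yset l n (set es) a b)) - N ^ 1 * phiY l (tt i)) - err 1 i \<ge> 0}"
  let ?BW = "\<lambda>(f, F, k, \<sigma>). {es. survives good i es \<and> f \<in> available l n (set es) \<and>
        \<sigma> * (real (card (Wset l n (set es) f F k)) - N ^ (num_triples F - 1 - k) * phiW l F k (tt i))
          - err (num_triples F - 1 - k) i \<ge> 0}"
  \<comment> \<open>Index sets for the union bound. Pairs are ordered here, and 1 and -1 stand for
    deviations upwards and downwards.\<close>
  define JY where "JY = {1..n} \<times> {1..n} \<times> {1, -1 :: real}"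
  define JW where "JW = [{1..n}]\<^bsup>3\<^esup> \<times> Ffam l \<times> {..l} \<times> {1, -1 :: real}"
  define IY where "IY = {(a, b, \<sigma>). (a, b, \<sigma>) \<in> JY \<and> {a, b} \<in> [{1..n}]\<^bsup>2\<^esup>}"
  define IW where "IW = {(f, F, k, \<sigma>). (f, F, k, \<sigma>) \<in> JW \<and> k \<le> num_triples F - 2}"
  have finJ: "finite JY" "finite JW" unfolding JY_def JW_def using finite_Ffam by (auto simp: finite_imp_finite_nsets)
  have sub: "IY \<subseteq> JY" "IW \<subseteq> JW" unfolding IY_def IW_def by auto
  have finI: "finite IY" "finite IW" using finJ sub finite_subset by blast+
  have cY: "real (card IY) \<le> 2 * N ^ 2"
  proof -
    have "card IY \<le> card JY" by (rule card_mono[OF finJ(1) sub(1)])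
    also have "\<dots> = n * (n * 2)" unfolding JY_def by (simp add: card_cartesian_product)
    finally have "real (card IY) \<le> real (n * (n * 2))" by (rule of_nat_mono)
    then show ?thesis by (simp add: power2_eq_square)
  qed
  have cW: "real (card IW) \<le> 2 * N ^ 3 * real (card (Ffam l)) * real (l + 1)"
  proof -
    have "card IW \<le> card JW" by (rule card_mono[OF finJ(2) sub(2)])
    also have "\<dots> = (n choose 3) * (card (Ffam l) * (Suc l * 2))" unfolding JW_def by (simp add: card_cartesian_product)
    also have "\<dots> \<le> n ^ 3 * (card (Ffam l) * (Suc l * 2))"
    proof (rule mult_le_mono1)
      show "n choose 3 \<le> n ^ 3" by (cases "3 \<le> n") (auto simp: binomial_le_pow binomial_eq_0)
    qed
    finally have "real (card IW) \<le> real (n ^ 3 * (card (Ffam l) * (Suc l * 2)))" by (rule of_nat_mono)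
    then show ?thesis by (simp add: algebra_simps)
  qed
  have pY: "measure_pmf.prob ?p (?BY x) \<le> exp (- u)" if x: "x \<in> IY" for x
  proof -
    obtain a b \<sigma> where x': "x = (a, b, \<sigma>)" by (cases x)
    have "{a, b} \<in> [{1..n}]\<^bsup>2\<^esup>" "\<bar>\<sigma>\<bar> = 1" using x unfolding x' IY_def JY_def by auto
    then show ?thesis unfolding x' prod.case using i by (intro prob_Y_fail)
  qed
  have pW: "measure_pmf.prob ?p (?BW x) \<le> exp (- u)" if x: "x \<in> IW" for x
  proof -
    obtain f F k \<sigma> where x': "x = (f, F, k, \<sigma>)" by (cases x)
    have "f \<in> [{1..n}]\<^bsup>3\<^esup>" "F \<in> Ffam l" "k \<le> num_triples F - 2" "\<bar>\<sigma>\<bar> = 1"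
      using x unfolding x' IW_def JW_def by auto
    then show ?thesis unfolding x' prod.case using i by (intro prob_W_fail) auto
  qed
  let ?X = "{es. survives good i es \<and> \<not> ext_ok n L u (set es)}"
  have cover: "{es. survives good i es \<and> \<not> good es} \<inter> set_pmf ?p
      \<subseteq> ?X \<union> ((\<Union>x\<in>IY. ?BY x) \<union> (\<Union>x\<in>IW. ?BW x))"
  proof
    fix es assume a: "es \<in> {es. survives good i es \<and> \<not> good es} \<inter> set_pmf ?p"
    then have es: "es \<in> set_pmf ?p" and sv: "survives good i es" and ng: "\<not> good es" by auto
    show "es \<in> ?X \<union> ((\<Union>x\<in>IY. ?BY x) \<union> (\<Union>x\<in>IW. ?BW x))"
    proof (cases "ext_ok n L u (set es)")
      case False
      then show ?thesis using sv by blast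
    next
      case True
      from not_good_cases[OF es i sv ng True] show ?thesis
      proof
        assume "\<exists>a b \<sigma>. {a, b} \<in> [{1..n}]\<^bsup>2\<^esup> \<and> \<sigma> \<in> {1, -1} \<and> {a, b} \<in> open_pairs n (set es) \<and>
          \<sigma> * (real (card (Yset l n (set es) a b)) - N ^ 1 * phiY l (tt i)) - err 1 i \<ge> 0"
        then obtain a b \<sigma> where h: "{a, b} \<in> [{1..n}]\<^bsup>2\<^esup>" "\<sigma> \<in> {1, -1}" "{a, b} \<in> open_pairs n (set es)"
          "\<sigma> * (real (card (Yset l n (set es) a b)) - N ^ 1 * phiY l (tt i)) - err 1 i \<ge> 0" by blast
        have "a \<in> {1..n}" "b \<in> {1..n}" using h(1) by (auto simp: nsets_def)
        then have "(a, b, \<sigma>) \<in> IY" using h unfolding IY_def JY_def by blast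
        moreover have "es \<in> ?BY (a, b, \<sigma>)" using h sv by simp
        ultimately show ?thesis by blast
      next
        assume "\<exists>f F k \<sigma>. f \<in> [{1..n}]\<^bsup>3\<^esup> \<and> F \<in> Ffam l \<and> k \<le> num_triples F - 2 \<and> \<sigma> \<in> {1, -1} \<and> f \<in> available l n (set es) \<and>
          \<sigma> * (real (card (Wset l n (set es) f F k)) - N ^ (num_triples F - 1 - k) * phiW l F k (tt i))
            - err (num_triples F - 1 - k) i \<ge> 0"
        then obtain f F k \<sigma> where h: "f \<in> [{1..n}]\<^bsup>3\<^esup>" "F \<in> Ffam l" "k \<le> num_triples F - 2" "\<sigma> \<in> {1, -1}"
          "f \<in> available l n (set es)"
          "\<sigma> * (real (card (Wset l n (set es) f F k)) - N ^ (num_triples F - 1 - k) * phiW l F k (tt i))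
            - err (num_triples F - 1 - k) i \<ge> 0" by blast
        have "k \<le> l" using h(3) num_triples_ge[OF h(2)] by arith
        then have "(f, F, k, \<sigma>) \<in> IW" using h unfolding IW_def JW_def by blast
        moreover have "es \<in> ?BW (f, F, k, \<sigma>)" using h sv by simp
        ultimately show ?thesis by blast
      qed
    qed
  qed
  have "measure_pmf.prob ?p {es. survives good i es \<and> \<not> good es}
      = measure_pmf.prob ?p ({es. survives good i es \<and> \<not> good es} \<inter> set_pmf ?p)"
    by (simp only: measure_Int_set_pmf)
  also have "\<dots> \<le> measure_pmf.prob ?p (?X \<union> ((\<Union>x\<in>IY. ?BY x) \<union> (\<Union>x\<in>IW. ?BW x)))"
    by (rule measure_pmf.finite_measure_mono[OF cover]) simp
  also have "\<dots> \<le> measure_pmf.prob ?p ?X + measure_pmf.prob ?p ((\<Union>x\<in>IY. ?BY x) \<union> (\<Union>x\<in>IW. ?BW x))"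
    by (rule measure_Un_le) simp_all
  also have "measure_pmf.prob ?p ((\<Union>x\<in>IY. ?BY x) \<union> (\<Union>x\<in>IW. ?BW x))
      \<le> measure_pmf.prob ?p (\<Union>x\<in>IY. ?BY x) + measure_pmf.prob ?p (\<Union>x\<in>IW. ?BW x)"
    by (rule measure_Un_le) simp_all
  also have "\<dots> \<le> real (card IY) * exp (- u) + real (card IW) * exp (- u)"
    by (rule add_mono[OF prob_UN_le[OF finI(1) pY] prob_UN_le[OF finI(2) pW]])
  also have "\<dots> \<le> 2 * N ^ 2 * exp (- u) + 2 * N ^ 3 * real (card (Ffam l)) * real (l + 1) * exp (- u)"
    using cY cW by (intro add_mono mult_right_mono) auto
  also have "\<dots> = (2 * N ^ 2 + 2 * N ^ 3 * real (card (Ffam l)) * real (l + 1)) * exp (- u)"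
    by (simp only: distrib_right)
  finally show ?thesis by simp
qed

text \<open>Here w bounds p^-3 and is a far smaller power of n than u, because 12 w / q_min takes
  the role of v in \<open>prob_not_ext_ok_le\<close>, where its 2^L-th power has to stay below
  u.\<close>

lemma good_card_available:
  assumes w: "\<And>i. i \<le> m0 \<Longrightarrow> 1 \<le> w * pp i ^ 3" and w0: "w > 0"
    and g: "good es"
  shows "q_min l * N ^ 3 / (12 * w) \<le> real (card (available l n (set es)))"
proof -
  interpret tracked_state l n L A m0 u K0 "set es" "length es"
    by (rule good_tracked[OF refl g])
  have "1 / w \<le> pp (length es) ^ 3" using w[OF im] w0 by (simp add: pos_divide_le_eq mult.commute)
  then have "q_min l * ((1 / w) * N ^ 3) / 12 \<le> q_min l * (pp (length es) ^ 3 * N ^ 3) / 12"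
    using q_min_pos[of l] by (intro divide_right_mono mult_left_mono mult_right_mono) auto
  then show ?thesis using card_Q_ge by (simp add: mult_ac)
qed

text \<open>The order M of the moments stays free, so that it can be chosen after \<tau>.\<close>

lemma prob_tracks_ge:
  assumes w: "\<And>i. i \<le> m0 \<Longrightarrow> 1 \<le> w * pp i ^ 3" and w0: "w > 0"
    and v: "1 \<le> 12 * w / q_min l" "12 * w / q_min l \<le> N" and m0c: "m0 \<le> n choose 3"
  shows "1 - real (m0 + 1) * (real (L + 1) * N ^ L * (real (L + 1) * (ext_const L M * (12 * w / q_min l) ^ (2 ^ L) / u) ^ M)
        + (2 * N ^ 2 + 2 * N ^ 3 * real (card (Ffam l)) * real (l + 1)) * exp (- u))
    \<le> measure_pmf.prob (triple_process l n) {es. \<forall>i\<le>m0. tracks l n (9 / 10) (real A) es i}"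
proof -
  let ?c = "real (L + 1) * N ^ L * (real (L + 1) * (ext_const L M * (12 * w / q_min l) ^ (2 ^ L) / u) ^ M)
        + (2 * N ^ 2 + 2 * N ^ 3 * real (card (Ffam l)) * real (l + 1)) * exp (- u)"
  let ?kQ = "q_min l * N ^ 3 / (12 * w)"
  have kQ0: "?kQ > 0" using q_min_pos[of l] N_pos w0 by simp
  have each: "measure_pmf.prob (process_steps l n i) {es. survives good i es \<and> \<not> good es} \<le> ?c"
    if i: "i \<le> m0" for i
  proof -
    have "real i \<le> real (n ^ 2)" using i m0_le by (intro of_nat_mono) simp
    then have "real i / ?kQ \<le> N ^ 2 / ?kQ" using kQ0 by (intro divide_right_mono) auto
    also have "\<dots> = 12 * w / q_min l / N"
      using N_pos w0 q_min_pos[of l] by (simp add: field_simps power2_eq_square power3_eq_cube)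
    finally have iv: "real i / ?kQ \<le> 12 * w / q_min l / N" .
    have "measure_pmf.prob (process_steps l n i) {es. survives good i es \<and> \<not> ext_ok n L u (set es)}
        \<le> real (L + 1) * N ^ L * (real (L + 1) * (ext_const L M * (12 * w / q_min l) ^ (2 ^ L) / u) ^ M)"
      using n_pos by (intro prob_not_ext_ok_le[OF _ kQ0 good_card_available[OF w w0] v iv u_pos(1)]) auto
    then show ?thesis using prob_not_good_le[OF i] by linarith
  qed
  have ne: "available l n (set es) \<noteq> {}" if "good es" for es
    using good_card_available[OF w w0 that] kQ0 by auto
  have sub: "{es. \<forall>i\<le>m0. length (take i es) = i \<and> good (take i es)}
      \<subseteq> {es. \<forall>i\<le>m0. tracks l n (9 / 10) (real A) es i}"
  proof (intro subsetI CollectI allI impI)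
    fix es i assume a: "es \<in> {es. \<forall>i\<le>m0. length (take i es) = i \<and> good (take i es)}" and i: "i \<le> m0"
    have "length (take i es) = i" "good (take i es)" using a i by blast+
    then have "tracks l n (9 / 10) (real A) (take i es) i" unfolding good_def by simp
    moreover have "hypergraph_at (take i es) i = hypergraph_at es i" by (simp add: hypergraph_at_def)
    ultimately show "tracks l n (9 / 10) (real A) es i" by (simp add: tracks_def)
  qed
  have "(\<Sum>i\<le>m0. measure_pmf.prob (process_steps l n i) {es. survives good i es \<and> \<not> good es}) \<le> (\<Sum>i\<le>m0. ?c)"
    by (rule sum_mono) (use each in simp)
  also have "\<dots> = real (m0 + 1) * ?c" by simp
  finally have "1 - real (m0 + 1) * ?c
      \<le> 1 - (\<Sum>i\<le>m0. measure_pmf.prob (process_steps l n i) {es. survives good i es \<and> \<not> good es})" by linarith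
  also have "\<dots> \<le> measure_pmf.prob (triple_process l n) {es. \<forall>i\<le>m0. length (take i es) = i \<and> good (take i es)}"
    by (rule prob_triple_process_good[OF m0c ne])
  also have "\<dots> \<le> measure_pmf.prob (triple_process l n) {es. \<forall>i\<le>m0. tracks l n (9 / 10) (real A) es i}"
    by (rule measure_pmf.finite_measure_mono[OF sub]) simp
  finally show ?thesis .
qed

end

section \<open>Choice of the parameters\<close>

lemma C2_taylor_uniform:
  assumes "finite S" "\<And>x. x \<in> S \<Longrightarrow> C2 (f x)"
  obtains B where "B \<ge> 0" "\<And>x s t d. x \<in> S \<Longrightarrow> 0 \<le> t \<Longrightarrow> t < s \<Longrightarrow> s \<le> 1 \<Longrightarrow>
    (f x has_real_derivative d) (at t) \<Longrightarrow>
    \<bar>f x s - f x t - d * (s - t)\<bar> \<le> B * (s - t)\<^sup>2 \<and> \<bar>f x s - f x t\<bar> \<le> B * (s - t)"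
proof -
  have "\<forall>x\<in>S. \<exists>B\<ge>0. \<forall>s t d. 0 \<le> t \<longrightarrow> t < s \<longrightarrow> s \<le> 1 \<longrightarrow> (f x has_real_derivative d) (at t) \<longrightarrow>
    \<bar>f x s - f x t - d * (s - t)\<bar> \<le> B * (s - t)\<^sup>2 \<and> \<bar>f x s - f x t\<bar> \<le> B * (s - t)"
    using C2_taylor[OF assms(2)] by metis
  then obtain b where b: "\<And>x. x \<in> S \<Longrightarrow> b x \<ge> 0"
    and tb: "\<And>x s t d. x \<in> S \<Longrightarrow> 0 \<le> t \<Longrightarrow> t < s \<Longrightarrow> s \<le> 1 \<Longrightarrow> (f x has_real_derivative d) (at t) \<Longrightarrow>
      \<bar>f x s - f x t - d * (s - t)\<bar> \<le> b x * (s - t)\<^sup>2 \<and> \<bar>f x s - f x t\<bar> \<le> b x * (s - t)"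
    by metis
  show ?thesis
  proof (rule that[of "sum b S"])
    show "0 \<le> sum b S" using b by (rule sum_nonneg)
    fix x s t d assume x: "x \<in> S" and st: "0 \<le> t" "t < s" "s \<le> 1" and d: "(f x has_real_derivative d) (at t)"
    have "b x \<le> sum b S" using x b assms(1) by (intro member_le_sum) auto
    then have "b x * (s - t)\<^sup>2 \<le> sum b S * (s - t)\<^sup>2" "b x * (s - t) \<le> sum b S * (s - t)"
      using st by (auto intro!: mult_right_mono)
    then show "\<bar>f x s - f x t - d * (s - t)\<bar> \<le> sum b S * (s - t)\<^sup>2 \<and> \<bar>f x s - f x t\<bar> \<le> sum b S * (s - t)"
      using tb[OF x st d] by linarith
  qed
qed

lemma powr_eventually_ge:
  fixes a C :: real
  assumes "a > 0" shows "eventually (\<lambda>n::nat. C \<le> real n powr a) at_top"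
proof -
  have "filterlim (\<lambda>x::real. x powr a) at_top at_top" using assms by real_asymp
  then have "filterlim (\<lambda>n::nat. real n powr a) at_top at_top"
    by (rule filterlim_compose[OF _ filterlim_real_sequentially])
  then show ?thesis by (simp add: filterlim_at_top)
qed

lemma poly_exp_small:
  fixes a C \<tau> :: real
  shows "eventually (\<lambda>n::nat. C * (real n powr a * exp (- (real n powr (1 / 100)))) \<le> real n powr (- \<tau>)) at_top"
proof -
  have "((\<lambda>x::real. C * (x powr (a + \<tau>) * exp (- (x powr (1 / 100))))) \<longlongrightarrow> C * 0) at_top"
    by (intro tendsto_mult tendsto_const) real_asymp
  then have "((\<lambda>n::nat. C * (real n powr (a + \<tau>) * exp (- (real n powr (1 / 100))))) \<longlongrightarrow> C * 0) at_top"
    by (rule filterlim_compose[OF _ filterlim_real_sequentially])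
  then have "eventually (\<lambda>n::nat. C * (real n powr (a + \<tau>) * exp (- (real n powr (1 / 100)))) < 1) at_top"
    by (rule order_tendstoD) simp
  then show ?thesis using eventually_gt_at_top[of 0]
  proof eventually_elim
    case (elim n)
    have "C * (real n powr a * exp (- (real n powr (1 / 100))))
        = C * (real n powr (a + \<tau>) * exp (- (real n powr (1 / 100)))) * real n powr (- \<tau>)"
      using elim(2) by (simp add: powr_add powr_minus)
    also have "\<dots> \<le> 1 * real n powr (- \<tau>)" using elim(1) by (intro mult_right_mono) auto
    finally show ?case by simp
  qed
qed

lemma powr_pow:
  fixes x a :: real
  assumes "0 < x" shows "(x powr a) ^ k = x powr (a * real k)"
  using assms powr_realpow[of "x powr a" k] by (simp add: powr_powr)

text \<open>Rounding up costs at most 6/n^2 in p, which is at most half of n^-\<beta> since \<beta>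
  \<le> 1 and n \<ge> 12.\<close>

lemma m_zero_bounds:
  assumes b: "0 < \<beta>" "\<beta> \<le> 1" and n: "n \<ge> 12"
  shows "m_zero \<beta> n \<le> n ^ 2"
    and "i \<le> m_zero \<beta> n \<Longrightarrow> real n powr (- \<beta>) / 2 \<le> traj_p (real i / real n ^ 2)"
proof -
  let ?N = "real n" and ?x = "real n powr (- \<beta>)"
  have N: "?N \<ge> 12" using n by simp
  have x1: "?x \<le> 1" using powr_mono[of "- \<beta>" 0 ?N] b N by simp
  have x2: "1 / ?N \<le> ?x" using powr_mono[of "-1" "- \<beta>" ?N] b N by (simp add: powr_minus divide_inverse)
  let ?y = "(1 - ?x) * ?N ^ 2 / 6"
  have y0: "0 \<le> ?y" using x1 by simp
  have m: "real (m_zero \<beta> n) \<le> ?y + 1"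
    unfolding m_zero_def using y0 of_int_ceiling_le_add_one[of ?y] by (simp add: of_nat_nat)
  have "?y \<le> ?N ^ 2 / 6" using x1 by (simp add: mult_left_le_one_le)
  moreover have "12 * 12 \<le> ?N ^ 2" unfolding power2_eq_square using N by (intro mult_mono) auto
  ultimately have "real (m_zero \<beta> n) \<le> ?N ^ 2" using m by linarith
  then have "real (m_zero \<beta> n) \<le> real (n ^ 2)" by simp
  then show "m_zero \<beta> n \<le> n ^ 2" by (simp only: of_nat_le_iff)
  assume i: "i \<le> m_zero \<beta> n"
  have "real i \<le> ?y + 1" using i m by (meson of_nat_mono order_trans)
  then have "6 * (real i / ?N ^ 2) \<le> 6 * ((?y + 1) / ?N ^ 2)" by (intro mult_left_mono divide_right_mono) auto
  also have "\<dots> = (1 - ?x) + 6 / ?N ^ 2" using N by (simp add: field_simps)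
  finally have a: "?x - 6 / ?N ^ 2 \<le> traj_p (real i / ?N ^ 2)" unfolding traj_p_def by linarith
  have "2 * (6 / ?N ^ 2) \<le> 1 / ?N"
    using N by (simp add: field_simps power2_eq_square)
  then show "?x / 2 \<le> traj_p (real i / ?N ^ 2)" using a x2 by linarith
qed

text \<open>\<alpha>, \<beta> and A are fixed before \<tau>; only the order of the moments and the
  threshold for n depend on \<tau>.\<close>

theorem theorem2p4:
  fixes l :: nat
  assumes "l \<ge> 4"
  shows "\<exists>\<alpha> \<beta> A :: real. 0 < \<alpha> \<and> \<alpha> < 1 \<and> 0 < \<beta> \<and> \<beta> < 1 \<and> 0 < A \<and>
    (\<forall>\<tau>>0. \<exists>n0>0. \<forall>n\<ge>n0.
       1 - real n powr (-\<tau>) > 0 \<and>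
       measure_pmf.prob (triple_process l n) {es. \<forall>i\<le>m_zero \<beta> n. tracks l n \<alpha> A es i}
         \<ge> 1 - real n powr (-\<tau>))"
proof -
  obtain BY where BY: "BY \<ge> 0" "\<And>s t d. 0 \<le> t \<Longrightarrow> t < s \<Longrightarrow> s \<le> 1 \<Longrightarrow> (phiY l has_real_derivative d) (at t) \<Longrightarrow>
    \<bar>phiY l s - phiY l t - d * (s - t)\<bar> \<le> BY * (s - t)\<^sup>2 \<and> \<bar>phiY l s - phiY l t\<bar> \<le> BY * (s - t)"
    using C2_taylor[OF C2_phiY[of l]] by blast
  obtain BW where BW: "BW \<ge> 0" "\<And>x s t d. x \<in> Ffam l \<times> {..l} \<Longrightarrow> 0 \<le> t \<Longrightarrow> t < s \<Longrightarrow> s \<le> 1 \<Longrightarrow>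
    ((\<lambda>x. phiW l (fst x) (snd x)) x has_real_derivative d) (at t) \<Longrightarrow>
    \<bar>(\<lambda>x. phiW l (fst x) (snd x)) x s - (\<lambda>x. phiW l (fst x) (snd x)) x t - d * (s - t)\<bar> \<le> BW * (s - t)\<^sup>2 \<and>
    \<bar>(\<lambda>x. phiW l (fst x) (snd x)) x s - (\<lambda>x. phiW l (fst x) (snd x)) x t\<bar> \<le> BW * (s - t)"
    using C2_taylor_uniform[of "Ffam l \<times> {..l}" "\<lambda>x. phiW l (fst x) (snd x)"] finite_Ffam C2_phiW by blast
  define q where "q = q_min l"
  have q: "0 < q" "q \<le> 1" unfolding q_def using q_min_pos[of l] by (auto simp: q_min_def sum_nonneg cF_nonneg)
  define Kd where "Kd = drift_const l * (36 / q_min l + 72 / (q_min l)\<^sup>2)"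
  have Kd: "0 \<le> Kd" unfolding Kd_def using drift_const_ge(4)[of l] q_min_pos[of l] by simp
  have pc: "0 \<le> pair_const l" by (simp add: pair_const_def)
  define K0 where "K0 = 1 + BY + BW + Kd + (3 + 3 * real l * pair_const l) + 6 * real l ^ 3"
  have lp: "0 \<le> 3 * real l * pair_const l" "0 \<le> 6 * real l ^ 3" using pc by auto
  have K0: "1 \<le> K0" "BY \<le> K0" "BW \<le> K0" "Kd \<le> K0" "3 + 3 * real l * pair_const l \<le> K0" "6 * real l ^ 3 \<le> K0"
    unfolding K0_def using BY(1) BW(1) Kd lp by linarith+
  define L where "L = 2 * l + 6"
  define D where "D = (2::nat) ^ L"
  have D1: "1 \<le> real D" by (simp add: D_def)
  obtain a :: nat where a: "K0 \<le> real a" using real_nat_ceiling_ge by blast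
  \<comment> \<open>2 l covers the powers of p inside the allowances, and the rest outruns the
    feedback constant K0.\<close>
  define A where "A = 2 * l + a"
  have A: "2 * l \<le> A" "2 * K0 \<le> 6 * (real A - 2 * real l)" "0 < A"
  proof -
    have eq: "real A - 2 * real l = real a" by (simp add: A_def)
    show "2 * K0 \<le> 6 * (real A - 2 * real l)" unfolding eq using a K0(1) by linarith
  qed (use assms in \<open>auto simp: A_def\<close>)
  \<comment> \<open>With p at least n^-\<beta> / 2 this gives p^(A+3) at least about n^(-1/1000),
    well above 1/u = n^(-1/100), and p^3 at least about n^(-1/(1000 D)), well above 1/w for the w
    chosen below.\<close>
  define \<beta> where "\<beta> = 1 / (1000 * real D * real (A + 3))"
  have den: "1000 \<le> 1000 * real D * real (A + 3)"
    using mult_mono[of 1 "real D" 1 "real (A + 3)"] D1 by simp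
  have b: "0 < \<beta>" "\<beta> < 1" "\<beta> \<le> 1" unfolding \<beta>_def using den by (auto simp: divide_less_eq divide_le_eq)
  have bA: "\<beta> * real (A + 3) \<le> 1 / 1000"
  proof -
    have "\<beta> * real (A + 3) = 1 / (1000 * real D)" unfolding \<beta>_def by simp
    also have "\<dots> \<le> 1 / 1000" using D1 by (intro divide_left_mono) auto
    finally show ?thesis .
  qed
  have b3: "\<beta> * 3 \<le> 1 / (1000 * real D)"
  proof -
    have "\<beta> * 3 \<le> \<beta> * real (A + 3)" using b by (intro mult_left_mono) auto
    also have "\<dots> = 1 / (1000 * real D)" unfolding \<beta>_def by simp
    finally show ?thesis .
  qed
  have main: "eventually (\<lambda>n::nat. 1 - real n powr (-\<tau>) > 0 \<and>
       measure_pmf.prob (triple_process l n) {es. \<forall>i\<le>m_zero \<beta> n. tracks l n (9 / 10) (real A) es i}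
         \<ge> 1 - real n powr (-\<tau>)) at_top" if tau: "\<tau> > 0" for \<tau> :: real
  proof -
    \<comment> \<open>Each moment gains a factor n^(-1/200); M of them have to beat n^(L+2) from the
      union bounds and leave n^-\<tau> with room for the constants.\<close>
    define M where "M = nat \<lceil>200 * (\<tau> + real L + 6)\<rceil>"
    have M: "\<tau> + real L + 6 \<le> real M / 200"
      using real_nat_ceiling_ge[of "200 * (\<tau> + real L + 6)"] unfolding M_def by simp
    define C1 where "C1 = ext_const L M * (12 / q) ^ D"
    define Cext where "Cext = 4 * (real (L + 1) * real (L + 1) * C1 ^ M)"
    define C3 where "C3 = 2 + 2 * real (card (Ffam l)) * real (l + 1)"
    define umin where "umin = 2 * K0 + 6 * real A + (4 + pair_const l + real l * pair_const l + real l * (64 + 2 * real l * pair_const l)) + 12 / q + 4"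
    have "eventually (\<lambda>n::nat. umin \<le> real n powr (1 / 100)) at_top" by (rule powr_eventually_ge) simp
    moreover have "eventually (\<lambda>n::nat. 2 ^ (A + 3) \<le> real n powr (9 / 1000)) at_top" by (rule powr_eventually_ge) simp
    moreover have "eventually (\<lambda>n::nat. 8 \<le> real n powr (4 / (1000 * real D))) at_top"
      by (rule powr_eventually_ge) (use D1 in simp)
    moreover have "eventually (\<lambda>n::nat. 12 / q \<le> real n powr (1 / 2)) at_top" by (rule powr_eventually_ge) simp
    moreover have "eventually (\<lambda>n::nat. Cext \<le> real n powr 1) at_top" by (rule powr_eventually_ge) simp
    moreover have "eventually (\<lambda>n::nat. (4 * C3) * (real n powr 5 * exp (- (real n powr (1 / 100)))) \<le> real n powr (- \<tau>)) at_top"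
      by (rule poly_exp_small)
    \<comment> \<open>From 27 on, (n/3)^3 is at least n^2, so that \<open>m_zero\<close> does not
      exceed n choose 3.\<close>
    moreover have "eventually (\<lambda>n::nat. n \<ge> 27 + l) at_top" by (rule eventually_ge_at_top)
    ultimately show ?thesis
    proof eventually_elim
      case (elim n)
      note e1 = elim(1) and e2 = elim(2) and e3 = elim(3) and e4 = elim(4) and e5 = elim(5) and e6 = elim(6)
      have n27: "27 \<le> n" "l \<le> n" "12 \<le> n" "0 < n" using elim(7) by auto
      let ?N = "real n"
      define u where "u = ?N powr (1 / 100)"
      \<comment> \<open>The exponent makes w^(2^L) equal to n^(1/200), the square root of u; this is
        the factor gained by each moment.\<close>
      define w where "w = ?N powr (1 / (200 * real D))"
      define m0 where "m0 = m_zero \<beta> n"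
      have N1: "1 \<le> ?N" "0 < ?N" using n27 by auto
      have u0: "0 < u" unfolding u_def using N1 by simp
      have w0: "0 < w" unfolding w_def using N1 by simp
      note mz = m_zero_bounds[OF b(1,3) n27(3)]
      have uN: "u ^ 100 = ?N"
      proof -
        have "u ^ 100 = (?N powr (1 / 100)) powr (real 100)" unfolding u_def using N1 by (intro powr_realpow[symmetric]) simp
        then show ?thesis using N1 by (simp add: powr_powr)
      qed
      have hp: "0 < ?N powr (-\<beta>) / 2" using N1 by simp
      have p_pos: "0 < traj_p (real i / ?N ^ 2)" if "i \<le> m0" for i
        using mz(2)[of i] that hp unfolding m0_def by linarith
      have bpow: "(?N powr (-\<beta>) / 2) ^ k = ?N powr (- (\<beta> * real k)) / 2 ^ k" for k
      proof -
        have "(?N powr (-\<beta>)) ^ k = ?N powr (-\<beta> * real k)" by (rule powr_pow[OF N1(2)])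
        then show ?thesis by (simp add: power_divide)
      qed
      have p_u: "1 \<le> u * traj_p (real i / ?N ^ 2) ^ (A + 3)" if i: "i \<le> m0" for i
      proof -
        have "1 \<le> ?N powr (9 / 1000) / 2 ^ (A + 3)" using e2 by simp
        also have "?N powr (9 / 1000) \<le> ?N powr (1 / 100 + - (\<beta> * real (A + 3)))"
          using bA N1 by (intro powr_mono) auto
        then have "?N powr (9 / 1000) / 2 ^ (A + 3) \<le> ?N powr (1 / 100 + - (\<beta> * real (A + 3))) / 2 ^ (A + 3)"
          by (intro divide_right_mono) auto
        also have "\<dots> = u * (?N powr (-\<beta>) / 2) ^ (A + 3)" unfolding bpow u_def powr_add by simp
        also have "\<dots> \<le> u * traj_p (real i / ?N ^ 2) ^ (A + 3)"
          using mz(2)[of i] i u0 hp unfolding m0_def by (intro mult_left_mono power_mono) auto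
        finally show ?thesis .
      qed
      have p_w: "1 \<le> w * traj_p (real i / ?N ^ 2) ^ 3" if i: "i \<le> m0" for i
      proof -
        have "1 \<le> ?N powr (4 / (1000 * real D)) / 2 ^ 3" using e3 by simp
        also have "?N powr (4 / (1000 * real D)) \<le> ?N powr (1 / (200 * real D) + - (\<beta> * real 3))"
        proof (rule powr_mono)
          have "1 / (200 * real D) = 5 / (1000 * real D)" by simp
          moreover have "4 / (1000 * real D) + 1 / (1000 * real D) = 5 / (1000 * real D)" by (simp flip: add_divide_distrib)
          ultimately show "4 / (1000 * real D) \<le> 1 / (200 * real D) + - (\<beta> * real 3)" using b3 by simp
        qed (use N1 in simp)
        then have "?N powr (4 / (1000 * real D)) / 2 ^ 3 \<le> ?N powr (1 / (200 * real D) + - (\<beta> * real 3)) / 2 ^ 3"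
          by (intro divide_right_mono) auto
        also have "\<dots> = w * (?N powr (-\<beta>) / 2) ^ 3" unfolding bpow w_def powr_add by simp
        also have "\<dots> \<le> w * traj_p (real i / ?N ^ 2) ^ 3"
          using mz(2)[of i] i w0 hp unfolding m0_def by (intro mult_left_mono power_mono) auto
        finally show ?thesis .
      qed
      have ups: "0 \<le> 2 * K0 + 6 * real A" "0 \<le> 4 + pair_const l + real l * pair_const l + real l * (64 + 2 * real l * pair_const l)" "0 \<le> 12 / q"
        using K0(1) pc q by auto
      have ub: "2 * K0 + 6 * real A \<le> u" "4 \<le> u" "4 + pair_const l + real l * pair_const l + real l * (64 + 2 * real l * pair_const l) \<le> u" "12 / q \<le> u"
        using e1 ups unfolding umin_def u_def by linarith+
      interpret run_final l n L A m0 u K0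
      proof unfold_locales
        show "4 \<le> l" by (rule assms)
        show "L = 2 * l + 6" by (rule L_def)
        show "0 < n" by (rule n27(4))
        show "u ^ 100 = real n" by (rule uN)
        show "2 * l \<le> A" "2 * K0 \<le> 6 * (real A - 2 * real l)" by (rule A)+
        show "1 \<le> K0" by (rule K0)
        show "2 * K0 + 6 * real A \<le> u" "4 \<le> u" by (rule ub)+
        show "m0 \<le> n ^ 2" unfolding m0_def by (rule mz(1))
        show "drift_const l * (36 / q_min l + 72 / (q_min l)\<^sup>2) \<le> K0" using K0(4) unfolding Kd_def .
        show "3 + 3 * real l * pair_const l \<le> K0" by (rule K0(5))
        show "4 + pair_const l + real l * pair_const l + real l * (64 + 2 * real l * pair_const l) \<le> u" by (rule ub)
        show "12 \<le> q_min l * u" using ub(4) q unfolding q_def by (simp add: divide_le_eq mult.commute)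
        show "6 * real l ^ 3 \<le> K0" by (rule K0(6))
        show "l \<le> n" by (rule n27(2))
      next
        fix i assume "i \<le> m0"
        then show "0 < traj_p (real i / real n ^ 2)" "1 \<le> u * traj_p (real i / real n ^ 2) ^ (A + 3)"
          using p_pos p_u by auto
      next
        fix s t :: real assume st: "0 \<le> t" "t < s" "s \<le> 1"
        have "BY * (s - t)\<^sup>2 \<le> K0 * (s - t)\<^sup>2" "BY * (s - t) \<le> K0 * (s - t)"
          using K0(2) st by (auto intro!: mult_right_mono)
        then show "\<bar>phiY l s - phiY l t - dY l t * (s - t)\<bar> \<le> K0 * (s - t)\<^sup>2 \<and> \<bar>phiY l s - phiY l t\<bar> \<le> K0 * (s - t)"
          using BY(2)[OF st phiY_deriv] unfolding dY_def by linarith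
      next
        fix F k and s t :: real assume F: "F \<in> Ffam l" and k: "k \<le> num_triples F - 2" and st: "0 \<le> t" "t < s" "s \<le> 1"
        have "(F, k) \<in> Ffam l \<times> {..l}" using F k num_triples_ge[OF F] by auto
        note tb = BW(2)[OF this st, unfolded fst_conv snd_conv, OF phiW_deriv[OF refl]]
        have "BW * (s - t)\<^sup>2 \<le> K0 * (s - t)\<^sup>2" "BW * (s - t) \<le> K0 * (s - t)"
          using K0(3) st by (auto intro!: mult_right_mono)
        then show "\<bar>phiW l F k s - phiW l F k t - dW l F k t * (s - t)\<bar> \<le> K0 * (s - t)\<^sup>2 \<and> \<bar>phiW l F k s - phiW l F k t\<bar> \<le> K0 * (s - t)"
          using tb unfolding dW_def by linarith
      qed
      have w1: "1 \<le> w" unfolding w_def using N1 D1 by (intro ge_one_powr_ge_zero) auto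
      have v1: "1 \<le> 12 * w / q_min l"
        using w1 q unfolding q_def by (simp add: le_divide_eq)
      have v2: "12 * w / q_min l \<le> ?N"
      proof -
        have wN: "w \<le> ?N powr (1 / 2)" unfolding w_def
        proof (rule powr_mono)
          show "1 / (200 * real D) \<le> 1 / 2" using D1 by (intro divide_left_mono) auto
        qed (use N1 in simp)
        have "12 * w / q_min l = 12 / q * w" unfolding q_def by simp
        also have "\<dots> \<le> ?N powr (1 / 2) * ?N powr (1 / 2)" using e4 wN q w0 by (intro mult_mono) auto
        also have "\<dots> = ?N" using N1 by (simp flip: powr_add)
        finally show ?thesis .
      qed
      have m0c: "m0 \<le> n choose 3"
      proof -
        have "real n ^ 2 \<le> (real n / 3) ^ 3"
          using n27(1) by (simp add: power_divide power2_eq_square power3_eq_cube)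
        also have "\<dots> \<le> real (n choose 3)"
          using binomial_ge_n_over_k_pow_k[of 3 n, where 'a = real] n27 by simp
        finally have "real (n ^ 2) \<le> real (n choose 3)" by simp
        then have "n ^ 2 \<le> n choose 3" by (simp only: of_nat_le_iff)
        then show ?thesis using mz(1) unfolding m0_def by linarith
      qed
      have wD: "w ^ D = ?N powr (1 / 200)"
      proof -
        have "w ^ D = w powr real D" using w0 by (rule powr_realpow[symmetric])
        also have "\<dots> = ?N powr (1 / (200 * real D) * real D)" unfolding w_def by (rule powr_powr)
        also have "1 / (200 * real D) * real D = 1 / 200" using D1 by simp
        finally show ?thesis .
      qed
      have ext_eq: "ext_const L M * (12 * w / q_min l) ^ (2 ^ L) / u = C1 * ?N powr (- (1 / 200))"
      proof -
        have "(12 * w / q_min l) ^ D = (12 / q) ^ D * w ^ D" unfolding q_def by (simp flip: power_mult_distrib)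
        then have "(12 * w / q_min l) ^ D / u = (12 / q) ^ D * (?N powr (1 / 200) / ?N powr (1 / 100))"
          unfolding wD u_def by simp
        also have "?N powr (1 / 200) / ?N powr (1 / 100) = ?N powr (- (1 / 200))" by (simp flip: powr_diff)
        finally show ?thesis unfolding C1_def D_def[symmetric] by (simp only: times_divide_eq_right[symmetric] mult.assoc)
      qed
      have C10: "0 \<le> C1" unfolding C1_def ext_const_def using q by simp
      let ?X1 = "real (L + 1) * ?N ^ L * (real (L + 1) * (ext_const L M * (12 * w / q_min l) ^ (2 ^ L) / u) ^ M)"
      let ?X2 = "(2 * ?N ^ 2 + 2 * ?N ^ 3 * real (card (Ffam l)) * real (l + 1)) * exp (- u)"
      have m1: "real (m0 + 1) \<le> 2 * ?N powr 2"
      proof -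
        have "real m0 \<le> real (n ^ 2)" using mz(1) unfolding m0_def by (rule of_nat_mono)
        then have "real m0 \<le> ?N ^ 2" by (simp only: of_nat_power)
        moreover have "1 \<le> ?N ^ 2" using N1 by simp
        moreover have "?N powr 2 = ?N ^ 2" using N1 by simp
        moreover have "real (m0 + 1) = real m0 + 1" by simp
        ultimately show ?thesis by linarith
      qed
      have x1: "2 * ?N powr 2 * ?X1 \<le> ?N powr (-\<tau>) / 2"
      proof -
        have "(C1 * ?N powr (- (1 / 200))) ^ M = C1 ^ M * ?N powr (- (real M / 200))"
        proof -
          have "(?N powr (- (1 / 200))) ^ M = ?N powr (- (1 / 200) * real M)" by (rule powr_pow[OF N1(2)])
          then show ?thesis by (simp add: power_mult_distrib)
        qed
        moreover have "?N ^ L = ?N powr real L" using N1 by (simp add: powr_realpow)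
        ultimately have "2 * ?N powr 2 * ?X1 = 2 * (real (L + 1) * real (L + 1) * C1 ^ M) * (?N powr 2 * ?N powr real L * ?N powr (- (real M / 200)))"
          unfolding ext_eq by simp
        also have "?N powr 2 * ?N powr real L * ?N powr (- (real M / 200)) = ?N powr (2 + real L + - (real M / 200))"
          by (simp only: powr_add)
        also have "2 * (real (L + 1) * real (L + 1) * C1 ^ M) * \<dots> \<le> 2 * (real (L + 1) * real (L + 1) * C1 ^ M) * ?N powr (-\<tau> - 1)"
          using M C10 N1 by (intro mult_left_mono powr_mono) auto
        also have "\<dots> = Cext * ?N powr (-\<tau> - 1) / 2" unfolding Cext_def by simp
        also have "\<dots> \<le> ?N powr 1 * ?N powr (-\<tau> - 1) / 2" using e5 by (intro divide_right_mono mult_right_mono) auto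
        also have "?N powr 1 * ?N powr (-\<tau> - 1) = ?N powr (-\<tau>)"
          unfolding powr_add[symmetric] by (rule arg_cong[where f = "\<lambda>a. ?N powr a"]) simp
        finally show ?thesis .
      qed
      have x2: "2 * ?N powr 2 * ?X2 \<le> ?N powr (-\<tau>) / 2"
      proof -
        have "2 * ?N ^ 2 \<le> 2 * ?N ^ 3" using N1 power_increasing[of 2 3 ?N] by simp
        then have "2 * ?N ^ 2 + 2 * ?N ^ 3 * real (card (Ffam l)) * real (l + 1) \<le> C3 * ?N ^ 3"
          unfolding C3_def by (simp add: algebra_simps)
        also have "\<dots> = C3 * ?N powr 3" using N1 powr_realpow[of ?N 3] by simp
        finally have "?X2 \<le> C3 * ?N powr 3 * exp (- u)" by (intro mult_right_mono) auto
        then have "2 * ?N powr 2 * ?X2 \<le> 2 * ?N powr 2 * (C3 * ?N powr 3 * exp (- u))" by (intro mult_left_mono) auto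
        also have "\<dots> = (2 * C3) * ((?N powr 2 * ?N powr 3) * exp (- u))" by simp
        also have "?N powr 2 * ?N powr 3 = ?N powr 5"
          unfolding powr_add[symmetric] by (rule arg_cong[where f = "\<lambda>a. ?N powr a"]) simp
        also have "(2 * C3) * (?N powr 5 * exp (- u)) = (4 * C3) * (?N powr 5 * exp (- u)) / 2" by simp
        also have "\<dots> \<le> ?N powr (-\<tau>) / 2" using e6 unfolding u_def by (intro divide_right_mono) auto
        finally show ?thesis .
      qed
      have X0: "0 \<le> ?X1 + ?X2" unfolding ext_eq using C10 by (intro add_nonneg_nonneg mult_nonneg_nonneg zero_le_power) auto
      have "real (m0 + 1) * (?X1 + ?X2) \<le> 2 * ?N powr 2 * (?X1 + ?X2)" using m1 X0 by (rule mult_right_mono)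
      also have "\<dots> = 2 * ?N powr 2 * ?X1 + 2 * ?N powr 2 * ?X2" by (rule distrib_left)
      also have "\<dots> \<le> ?N powr (-\<tau>)" using x1 x2 by linarith
      finally have tot: "real (m0 + 1) * (?X1 + ?X2) \<le> ?N powr (-\<tau>)" .
      have "1 - real (m0 + 1) * (?X1 + ?X2)
          \<le> measure_pmf.prob (triple_process l n) {es. \<forall>i\<le>m0. tracks l n (9 / 10) (real A) es i}"
        by (rule prob_tracks_ge[OF p_w w0 v1 v2 m0c])
      then have "1 - ?N powr (-\<tau>) \<le> measure_pmf.prob (triple_process l n) {es. \<forall>i\<le>m0. tracks l n (9 / 10) (real A) es i}"
        using tot by linarith
      moreover have "?N powr (-\<tau>) < 1"
        using powr_less_mono[of "-\<tau>" 0 ?N] tau n27 by simp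
      ultimately show ?case unfolding m0_def by simp
    qed
  qed
  show ?thesis
  proof (rule exI[of _ "9 / 10"], rule exI[of _ \<beta>], rule exI[of _ "real A"], intro conjI allI impI)
    fix \<tau> :: real assume "\<tau> > 0"
    from main[OF this] obtain n1 where n1: "\<And>n. n \<ge> n1 \<Longrightarrow> 1 - real n powr (-\<tau>) > 0 \<and>
       measure_pmf.prob (triple_process l n) {es. \<forall>i\<le>m_zero \<beta> n. tracks l n (9 / 10) (real A) es i}
         \<ge> 1 - real n powr (-\<tau>)" unfolding eventually_at_top_linorder by blast
    show "\<exists>n0>0. \<forall>n\<ge>n0. 1 - real n powr (-\<tau>) > 0 \<and>
       measure_pmf.prob (triple_process l n) {es. \<forall>i\<le>m_zero \<beta> n. tracks l n (9 / 10) (real A) es i}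
         \<ge> 1 - real n powr (-\<tau>)"
      by (rule exI[of _ "Suc n1"]) (use n1 in auto)
  qed (use b A in auto)
qed

end
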